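(* Let $\beta_1,\beta_2,\beta_3\in(0,1]$, $L_1,L_2,L_3\in(0,\infty)$ and $\beta_\wedge=\min(\beta_1,\beta_2,\beta_3)$. Suppose that $\|a\|_\infty<\infty$, that $c\le\bar r_S(x_S)\le C$ for all $x_S\in\mathbb R^S$ and $S\in\mathbb S$, where $0<c\le C<\infty$, and that: (A1) for all $x,x'\in\mathbb R^d$ with $\|x-x'\|_\infty\le 1$, $|a(x)-a(x')|\le L_1\|x-x'\|_\infty^{\beta_1}$; (A2) for all $S\in\mathbb S$ and $x_S,x_S'\in\mathbb R^S$ with $\|x_S-x_S'\|_\infty\le 1$, the total variation distance between the conditional distributions of $X_{S^c}$ given $X_S=x_S$ and given $X_S=x_S'$ is at most $L_2\|x_S-x_S'\|_\infty^{\beta_2}$; (A3) for all $S\in\mathbb S$ and $x_S,x_S'\in\mathbb R^S$ with $\|x_S-x_S'\|_\infty\le 1$, $|\bar r_S(x_S)-\bar r_S(x_S')|\le L_3\|x_S-x_S'\|_\infty^{\beta_3}$. Suppose further that $|n\lambda_S/n_S-1|\le 1/n$ for all $S\in\mathbb S$. Let $\lambda_{\max}=\max_{S\in\mathbb S}\lambda_S$, $\lambda_{\min}=\min_{S\in\mathbb S}\lambda_S$, $\kappa=|\mathbb S|(1+C\lambda_{\max})$, $A=28(C/c+2^d)$, $B=16\max(\|a\|_\infty^2,1)\max\{(C/c)^2,(L_1+L_2+L_3)^2,8^d\}$ and $D=200|\mathbb S|^2(C/c)(1+\lambda_{\min}^{-1})B$. Let $\hat\theta$ be the cross-fitting estimator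 defined in the context, with step size $\eta=|\mathbb S|^{-1}$. When $h\in[T(M/n)^{1/d},1]$ we have $$n\mathbb E\{(\hat\theta-\theta)^2\}-\mathcal L(\alpha_{\mathbb S}^* )\le A^MD\Bigl\{\frac{MT^d}{nh^d}+h^{2\beta_\wedge}+\mathbb P(\|X\|_\infty\ge T)\Bigr\}^{1/2}+4\kappa\{\mathrm{Var}\,a(X)\}\exp(-M/\kappa),$$ where $\alpha_{\mathbb S}^*$ is the minimiser of $\mathcal L$ over $H_{\mathbb S}$. In particular, if all problem parameters are held fixed, then $$\mathbb E\{(\hat\theta-\theta)^2\}=\frac1n\mathcal L(\alpha_{\mathbb S}^* )+o(1/n)\qquad(n\to\infty)$$ whenever $h,T,M$ (depending on $n$) satisfy $A^{2M}\{MT^d/(nh^d)+h^{2\beta_\wedge}+\mathbb P(\|X\|_\infty\ge T)\}\to 0$ and $T,M\to\infty$.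
   Context: Setting. Let $d\ge 2$, $[d]=\{1,\dots,d\}$, let $f$ be a probability density on $\mathbb R^d$ and $X\sim f$. For $x\in\mathbb R^d$, $S\subseteq[d]$ write $x_S=(x_j:j\in S)\in\mathbb R^S$, $S^c=[d]\setminus S$, and $f_S$ for the density of $X_S$. Let $\mathbb S\subseteq 2^{[d]}\setminus\{[d]\}$ be a nonempty collection, and for $S\in\mathbb S$ let $r_S:\mathbb R^S\to(0,\infty)$ be a known measurable function with normalised version $\bar r_S=r_S/\int r_Sf_S$. Functions of $x_S$ are also regarded as functions of $x$. Let $a:\mathbb R^d\to\mathbb R$ be a known measurable function, $\|a\|_\infty=\sup_x|a(x)|$, and $\theta=\int af=\mathbb E\{a(X)\}$. Data. For sample sizes $n$ and $n_S\ge 1$ ($S\in\mathbb S$; $n_S/n\to\lambda_S\in(0,\infty)$ as $n\to\infty$) we observe mutually independent samples: $X_1,\dots,X_n$ i.i.d. with density $f$; and, for each $S\in\mathbb S$, $X_{S,1},\dots,X_{S,n_S}$ for which only the coordinates in $S$ are observed, with $(X_{S,i})_S$ i.i.d. with density $\bar r_Sf_S$. Functions of $x_S$ may be evaluated at $X_{S,i}$. Objective. $L^2=\{\alpha:\mathbb R^d\to\mathbb R:\int\alpha^2f<\infty\}$, $H_S=\{\alpha_S\in L^2:\alpha_S(x)\equiv\alpha_S(x_S),\int\alpha_Sf=0\}$, $H_{\mathbb S}=\prod_{S\in\mathbb S}H_S$, and for $\alpha_{\mathbb S}\in H_{\mathbb S}$ $$\mathcal L(\alpha_{\mathbb S})=\mathrm{Var}\Bigl(a(X)-\sum_{S\in\mathbb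 S}\alpha_S(X_S)\Bigr)+\sum_{S\in\mathbb S}\mathbb E\Bigl[\frac{\alpha_S(X_S)^2}{\lambda_S\bar r_S(X_S)}\Bigr],$$ which has a unique minimiser over $H_{\mathbb S}$. Cross-fitting estimator. Let $M\in\mathbb N$ with $n\ge 2M$, $h>0$ a bandwidth, $T\ge 1$ and $\eta=|\mathbb S|^{-1}$. Let $\mathcal D_1=\{X_1,\dots,X_{\lceil n/2\rceil}\}$, $\mathcal D_2=\{X_{\lceil n/2\rceil+1},\dots,X_n\}$, and split each $\mathcal D_\ell$ into $M$ disjoint pieces $\mathcal D_{\ell,1},\dots,\mathcal D_{\ell,M}$ of sizes as equal as possible. Let $K_h^S(u_S)=(2h)^{-|S|}\mathbf 1\{\|u_S\|_\infty\le h\}$, $B_T=\{x\in\mathbb R^d:\|x\|_\infty\le T\}$, $\hat r_{S,(\ell)}=|\mathcal D_\ell|^{-1}\sum_{x\in\mathcal D_\ell}r_S(x)$. For fixed $\ell\in\{1,2\}$ put $\hat r_S^{(m)}=|\mathcal D_{\ell,m}|^{-1}\sum_{y\in\mathcal D_{\ell,m}}r_S(y)$, $\hat f_S^{(m)}(x_S)=|\mathcal D_{\ell,m}|^{-1}\sum_{y\in\mathcal D_{\ell,m}}K_h^S(x_S-y_S)$ and $\hat w_S^{(m)}(x_S)=\lambda_Sr_S(x_S)/\{\hat r_S^{(m)}+\lambda_Sr_S(x_S)\}$. Set $\hat\alpha_{S,(\ell)}^{(0)}\equiv 0$ and, for $m=1,\dots,M$, $S\in\mathbb S$, $\|x_S\|_\infty\le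 T$, $$\hat\alpha_{S,(\ell)}^{(m)}(x_S)=(1-\eta)\hat\alpha_{S,(\ell)}^{(m-1)}(x_S)+\eta\,\hat w_S^{(m)}(x_S)\Bigl[\frac1{|\mathcal D_{\ell,m}|}\sum_{y\in\mathcal D_{\ell,m}}g_S(y)\mathbf 1_{B_T}(y)\frac{K_h^S(x_S-y_S)}{\hat f_S^{(m)}(x_S)}-\frac{\sum_{y\in\mathcal D_{\ell,m}}\hat w_S^{(m)}(y)g_S(y)\mathbf 1_{B_T}(y)}{\sum_{y\in\mathcal D_{\ell,m}}\hat w_S^{(m)}(y)}\Bigr],$$ where $g_S(y)=a(y)-\sum_{S'\in\mathbb S\setminus\{S\}}\hat\alpha_{S',(\ell)}^{(m-1)}(y)$ and $0/0=0$; set $\hat\alpha_{S,(\ell)}^{(m)}(x_S)=0$ if $\|x_S\|_\infty>T$. Then $$\hat\theta_{(\ell)}^{(M)}=\frac1{|\mathcal D_{3-\ell}|}\sum_{x\in\mathcal D_{3-\ell}}\Bigl\{a(x)-\sum_{S\in\mathbb S}\hat\alpha_{S,(\ell)}^{(M)}(x)\Bigr\}+\sum_{S\in\mathbb S}\frac1{n_S}\sum_{j=1}^{n_S}\frac{\hat\alpha_{S,(\ell)}^{(M)}(X_{S,j})\,\hat r_{S,(3-\ell)}}{r_S(X_{S,j})},$$ and $\hat\theta=(|\mathcal D_2|\hat\theta_{(1)}^{(M)}+|\mathcal D_1|\hat\theta_{(2)}^{(M)})/n$. *)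

theory Defs
  imports "HOL-Probability.Probability" "HOL-Library.Landau_Symbols"
begin

text \<open>
  The index set \<open>[d]\<close> is the universe of a finite type \<open>'d\<close>. A point of \<open>\<real>\<^sup>S\<close> is a function
  \<open>'d \<Rightarrow> real\<close> that is \<open>undefined\<close> outside \<open>S\<close>, so that \<open>\<real>\<^sup>d\<close> is the case \<open>S = UNIV\<close>
  (all functions), and \<open>x\<^sub>S\<close> is \<open>restrict x S\<close>. A function \<open>g\<close> of \<open>x\<^sub>S\<close>, regarded as a function
  of \<open>x\<close>, is \<open>\<lambda>x. g (restrict x S)\<close>. This way complete and incomplete observations have the
  same type, as joint independence requires.
\<close>

abbreviation subspace_of :: "'d::finite set \<Rightarrow> ('d \<Rightarrow> real) set" where
  "subspace_of S \<equiv> S \<rightarrow>\<^sub>E UNIV"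

abbreviation leb :: "'d::finite set \<Rightarrow> ('d \<Rightarrow> real) measure" where
  "leb S \<equiv> PiM S (\<lambda>_. lborel)"

text \<open>The inserted 0 only matters for \<open>S = {}\<close>.\<close>

definition supnorm :: "'d::finite set \<Rightarrow> ('d \<Rightarrow> real) \<Rightarrow> real" where
  "supnorm S u = Max (insert 0 ((\<lambda>j. \<bar>u j\<bar>) ` S))"

definition supdist :: "'d::finite set \<Rightarrow> ('d \<Rightarrow> real) \<Rightarrow> ('d \<Rightarrow> real) \<Rightarrow> real" where
  "supdist S u v = supnorm S (\<lambda>j. u j - v j)"

definition is_prob_density :: "(('d::finite \<Rightarrow> real) \<Rightarrow> real) \<Rightarrow> bool" where
  "is_prob_density f \<longleftrightarrow> f \<in> borel_measurable (leb UNIV) \<and> (\<forall>x. 0 \<le> f x) \<and>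
     (\<integral>\<^sup>+x. ennreal (f x) \<partial>leb UNIV) = 1"

definition law :: "(('d::finite \<Rightarrow> real) \<Rightarrow> real) \<Rightarrow> ('d \<Rightarrow> real) measure" where
  "law f = density (leb UNIV) (\<lambda>x. ennreal (f x))"

definition marginal :: "(('d::finite \<Rightarrow> real) \<Rightarrow> real) \<Rightarrow> 'd set \<Rightarrow> ('d \<Rightarrow> real) \<Rightarrow> real" where
  "marginal f S u = (LINT v|leb (-S). f (merge S (-S) (u, v)))"

text \<open>If \<open>r\<^sub>S f\<^sub>S\<close> is not integrable the quotient is \<open>0\<close>, which is excluded by any positive
  lower bound on \<open>rbar\<close>.\<close>

definition rbar ::
  "(('d::finite \<Rightarrow> real) \<Rightarrow> real) \<Rightarrow> ('d set \<Rightarrow> ('d \<Rightarrow> real) \<Rightarrow> real) \<Rightarrow> 'd set \<Rightarrow> ('d \<Rightarrow> real) \<Rightarrow> real"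
where
  "rbar f r S u = r S u / (LINT v|leb S. r S v * marginal f S v)"

text \<open>\<open>k\<close> is a version of the regular conditional distribution of \<open>X\<close> restricted to \<open>-S\<close> given
  \<open>X\<close> restricted to \<open>S\<close>.\<close>

definition cond_distribution ::
  "(('d::finite \<Rightarrow> real) \<Rightarrow> real) \<Rightarrow> 'd set \<Rightarrow> (('d \<Rightarrow> real) \<Rightarrow> ('d \<Rightarrow> real) measure) \<Rightarrow> bool"
where
  "cond_distribution f S k \<longleftrightarrow>
     k \<in> leb S \<rightarrow>\<^sub>M prob_algebra (leb (-S)) \<and>
     (\<forall>A\<in>sets (leb S). \<forall>B\<in>sets (leb (-S)).
        emeasure (law f) {x. restrict x S \<in> A \<and> restrict x (-S) \<in> B} =
        (\<integral>\<^sup>+u\<in>A. emeasure (k u) B \<partial>distr (law f) (leb S) (\<lambda>x. restrict x S)))"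

definition tv_dist :: "'a measure \<Rightarrow> 'a measure \<Rightarrow> real" where
  "tv_dist \<mu> \<nu> = (SUP A\<in>sets \<mu>. \<bar>measure \<mu> A - measure \<nu> A\<bar>)"

definition H_space :: "(('d::finite \<Rightarrow> real) \<Rightarrow> real) \<Rightarrow> 'd set \<Rightarrow> (('d \<Rightarrow> real) \<Rightarrow> real) set" where
  "H_space f S = {\<alpha> \<in> borel_measurable (leb S).
     integrable (law f) (\<lambda>x. (\<alpha> (restrict x S))\<^sup>2) \<and>
     (LINT x|law f. \<alpha> (restrict x S)) = 0}"

definition H_prod ::
  "(('d::finite \<Rightarrow> real) \<Rightarrow> real) \<Rightarrow> 'd set set \<Rightarrow> ('d set \<Rightarrow> ('d \<Rightarrow> real) \<Rightarrow> real) set"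
where
  "H_prod f SS = (\<Pi>\<^sub>E S\<in>SS. H_space f S)"

definition objective ::
  "(('d::finite \<Rightarrow> real) \<Rightarrow> real) \<Rightarrow> (('d \<Rightarrow> real) \<Rightarrow> real) \<Rightarrow> ('d set \<Rightarrow> ('d \<Rightarrow> real) \<Rightarrow> real) \<Rightarrow>
   'd set set \<Rightarrow> ('d set \<Rightarrow> real) \<Rightarrow> ('d set \<Rightarrow> ('d \<Rightarrow> real) \<Rightarrow> real) \<Rightarrow> real"
where
  "objective f a r SS lam \<alpha> =
     prob_space.variance (law f) (\<lambda>x. a x - (\<Sum>S\<in>SS. \<alpha> S (restrict x S))) +
     (\<Sum>S\<in>SS. prob_space.expectation (law f)
        (\<lambda>x. (\<alpha> S (restrict x S))\<^sup>2 / (lam S * rbar f r S (restrict x S))))"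

text \<open>The observed data: \<open>X i\<close> for \<open>i = 1..n\<close> and \<open>Y S j\<close> for \<open>S \<in> SS\<close>, \<open>j = 1..ns S\<close>, the latter
  with values in \<open>\<real>\<^sup>S\<close>, all mutually independent.\<close>

definition sample_model ::
  "(('d::finite \<Rightarrow> real) \<Rightarrow> real) \<Rightarrow> ('d set \<Rightarrow> ('d \<Rightarrow> real) \<Rightarrow> real) \<Rightarrow> 'd set set \<Rightarrow>
   nat \<Rightarrow> ('d set \<Rightarrow> nat) \<Rightarrow> 'w measure \<Rightarrow>
   (nat \<Rightarrow> 'w \<Rightarrow> ('d \<Rightarrow> real)) \<Rightarrow> ('d set \<Rightarrow> nat \<Rightarrow> 'w \<Rightarrow> ('d \<Rightarrow> real)) \<Rightarrow> bool"
where
  "sample_model f r SS n ns P X Y \<longleftrightarrow>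
     prob_space P \<and>
     (\<forall>i\<in>{1..n}. distributed P (leb UNIV) (X i) (\<lambda>x. ennreal (f x))) \<and>
     (\<forall>S\<in>SS. \<forall>j\<in>{1..ns S}.
        distributed P (leb S) (Y S j) (\<lambda>u. ennreal (rbar f r S u * marginal f S u))) \<and>
     prob_space.indep_vars P
       (case_sum (\<lambda>_. leb UNIV) (\<lambda>(S, j). leb S))
       (case_sum X (\<lambda>(S, j). Y S j))
       ({1..n} <+> (SIGMA S:SS. {1..ns S}))"

text \<open>The halves \<open>D\<^sub>1\<close>, \<open>D\<^sub>2\<close> of the complete sample and their pieces are represented by the sets
  of indices of the observations they contain.\<close>

definition half :: "nat \<Rightarrow> nat \<Rightarrow> nat set" where
  "half n l = (if l = 1 then {1..nat \<lceil>real n / 2\<rceil>} else {nat \<lceil>real n / 2\<rceil> + 1..n})"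

definition balanced_split :: "nat \<Rightarrow> nat \<Rightarrow> (nat \<Rightarrow> nat \<Rightarrow> nat set) \<Rightarrow> bool" where
  "balanced_split n M I \<longleftrightarrow> (\<forall>l\<in>{1, 2}.
     disjoint_family_on (I l) {1..M} \<and>
     (\<Union>m\<in>{1..M}. I l m) = half n l \<and>
     (\<forall>m\<in>{1..M}. \<forall>m'\<in>{1..M}. card (I l m) \<le> card (I l m') + 1))"

text \<open>In the estimators below \<open>x\<close> and \<open>y\<close> are realised values of the two kinds of data and \<open>J\<close>
  is a set of indices of complete observations.\<close>

definition kern :: "real \<Rightarrow> 'd::finite set \<Rightarrow> ('d \<Rightarrow> real) \<Rightarrow> real" where
  "kern h S u = (if supnorm S u \<le> h then 1 / (2 * h) ^ card S else 0)"

definition r_hat ::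
  "('d::finite set \<Rightarrow> ('d \<Rightarrow> real) \<Rightarrow> real) \<Rightarrow> (nat \<Rightarrow> ('d \<Rightarrow> real)) \<Rightarrow> nat set \<Rightarrow> 'd set \<Rightarrow> real"
where
  "r_hat r x J S = (\<Sum>i\<in>J. r S (restrict (x i) S)) / card J"

definition f_hat ::
  "real \<Rightarrow> (nat \<Rightarrow> ('d::finite \<Rightarrow> real)) \<Rightarrow> nat set \<Rightarrow> 'd set \<Rightarrow> ('d \<Rightarrow> real) \<Rightarrow> real"
where
  "f_hat h x J S u = (\<Sum>i\<in>J. kern h S (\<lambda>j. u j - x i j)) / card J"

definition w_hat ::
  "('d::finite set \<Rightarrow> ('d \<Rightarrow> real) \<Rightarrow> real) \<Rightarrow> ('d set \<Rightarrow> real) \<Rightarrow>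
   (nat \<Rightarrow> ('d \<Rightarrow> real)) \<Rightarrow> nat set \<Rightarrow> 'd set \<Rightarrow> ('d \<Rightarrow> real) \<Rightarrow> real"
where
  "w_hat r lam x J S u = lam S * r S u / (r_hat r x J S + lam S * r S u)"

definition residual ::
  "'d::finite set set \<Rightarrow> (('d \<Rightarrow> real) \<Rightarrow> real) \<Rightarrow> ('d set \<Rightarrow> ('d \<Rightarrow> real) \<Rightarrow> real) \<Rightarrow>
   'd set \<Rightarrow> ('d \<Rightarrow> real) \<Rightarrow> real"
where
  "residual SS a \<alpha> S z = a z - (\<Sum>S'\<in>SS - {S}. \<alpha> S' (restrict z S'))"

text \<open>\<open>J m\<close> is the piece used in step \<open>m\<close>; the convention \<open>0/0 = 0\<close> is that of HOL.\<close>

primrec alpha_hat ::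
  "'d::finite set set \<Rightarrow> (('d \<Rightarrow> real) \<Rightarrow> real) \<Rightarrow> ('d set \<Rightarrow> ('d \<Rightarrow> real) \<Rightarrow> real) \<Rightarrow>
   ('d set \<Rightarrow> real) \<Rightarrow> real \<Rightarrow> real \<Rightarrow> (nat \<Rightarrow> ('d \<Rightarrow> real)) \<Rightarrow> (nat \<Rightarrow> nat set) \<Rightarrow>
   nat \<Rightarrow> 'd set \<Rightarrow> ('d \<Rightarrow> real) \<Rightarrow> real"
where
  "alpha_hat SS a r lam h T x J 0 = (\<lambda>S u. 0)"
| "alpha_hat SS a r lam h T x J (Suc m) = (\<lambda>S u.
     let \<alpha> = alpha_hat SS a r lam h T x J m;
         K = J (Suc m);
         \<eta> = 1 / real (card SS);
         w = w_hat r lam x K S;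
         g = (\<lambda>z. residual SS a \<alpha> S z * indicator {z. supnorm UNIV z \<le> T} z)
     in if supnorm S u \<le> T
        then (1 - \<eta>) * \<alpha> S u + \<eta> * w u *
          ((\<Sum>i\<in>K. g (x i) * (kern h S (\<lambda>j. u j - x i j) / f_hat h x K S u)) / card K
           - (\<Sum>i\<in>K. w (restrict (x i) S) * g (x i)) / (\<Sum>i\<in>K. w (restrict (x i) S)))
        else 0)"

text \<open>Here \<open>\<alpha>\<close> is fitted on half \<open>l\<close> and evaluated on half \<open>3 - l\<close>.\<close>

definition theta_half ::
  "'d::finite set set \<Rightarrow> (('d \<Rightarrow> real) \<Rightarrow> real) \<Rightarrow> ('d set \<Rightarrow> ('d \<Rightarrow> real) \<Rightarrow> real) \<Rightarrow>
   ('d set \<Rightarrow> real) \<Rightarrow> nat \<Rightarrow> ('d set \<Rightarrow> nat) \<Rightarrow> nat \<Rightarrow> real \<Rightarrow> real \<Rightarrow> (nat \<Rightarrow> nat \<Rightarrow> nat set) \<Rightarrow>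
   (nat \<Rightarrow> ('d \<Rightarrow> real)) \<Rightarrow> ('d set \<Rightarrow> nat \<Rightarrow> ('d \<Rightarrow> real)) \<Rightarrow> nat \<Rightarrow> real"
where
  "theta_half SS a r lam n ns M h T I x y l =
     (let \<alpha> = alpha_hat SS a r lam h T x (I l) M; E = half n (3 - l) in
      (\<Sum>i\<in>E. a (x i) - (\<Sum>S\<in>SS. \<alpha> S (restrict (x i) S))) / card E +
      (\<Sum>S\<in>SS. (\<Sum>j\<in>{1..ns S}. \<alpha> S (y S j) * r_hat r x E S / r S (y S j)) / ns S))"

definition theta_hat ::
  "'d::finite set set \<Rightarrow> (('d \<Rightarrow> real) \<Rightarrow> real) \<Rightarrow> ('d set \<Rightarrow> ('d \<Rightarrow> real) \<Rightarrow> real) \<Rightarrow>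
   ('d set \<Rightarrow> real) \<Rightarrow> nat \<Rightarrow> ('d set \<Rightarrow> nat) \<Rightarrow> nat \<Rightarrow> real \<Rightarrow> real \<Rightarrow> (nat \<Rightarrow> nat \<Rightarrow> nat set) \<Rightarrow>
   (nat \<Rightarrow> ('d \<Rightarrow> real)) \<Rightarrow> ('d set \<Rightarrow> nat \<Rightarrow> ('d \<Rightarrow> real)) \<Rightarrow> real"
where
  "theta_hat SS a r lam n ns M h T I x y =
     (card (half n 2) * theta_half SS a r lam n ns M h T I x y 1 +
      card (half n 1) * theta_half SS a r lam n ns M h T I x y 2) / n"

definition mse ::
  "(('d::finite \<Rightarrow> real) \<Rightarrow> real) \<Rightarrow> 'd set set \<Rightarrow> (('d \<Rightarrow> real) \<Rightarrow> real) \<Rightarrow>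
   ('d set \<Rightarrow> ('d \<Rightarrow> real) \<Rightarrow> real) \<Rightarrow> ('d set \<Rightarrow> real) \<Rightarrow> nat \<Rightarrow> ('d set \<Rightarrow> nat) \<Rightarrow> nat \<Rightarrow>
   real \<Rightarrow> real \<Rightarrow> (nat \<Rightarrow> nat \<Rightarrow> nat set) \<Rightarrow> 'w measure \<Rightarrow>
   (nat \<Rightarrow> 'w \<Rightarrow> ('d \<Rightarrow> real)) \<Rightarrow> ('d set \<Rightarrow> nat \<Rightarrow> 'w \<Rightarrow> ('d \<Rightarrow> real)) \<Rightarrow> real"
where
  "mse f SS a r lam n ns M h T I P X Y =
     prob_space.expectation P (\<lambda>\<omega>.
       (theta_hat SS a r lam n ns M h T I (\<lambda>i. X i \<omega>) (\<lambda>S j. Y S j \<omega>)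
        - prob_space.expectation (law f) a)\<^sup>2)"

end

theory Submission
  imports Defs
begin

text \<open>
  The objective is the limiting value of \<open>n\<close> times the mean squared error of the estimator that uses a
  fixed \<open>\<alpha>\<close>. With infinitely many data the fitting iteration is an averaged block coordinate descent
  for this convex quadratic functional: each block update is an exact minimisation, and comparing
  the decrease of one step with the distance to the optimum gives a contraction by \<open>1 - 1 / \<kappa>\<close>.

  A step of the actual fit differs from the population step by a local average of i.i.d. data. Freezing
  the earlier pieces, the error inherited from the previous fit is multiplied by a constant, by Stone's
  inequality for local averages: each observation carries bounded expected weight. The new
  error consists of a truncation term, a bias controlled by the Hoelder conditions (which the
  population iterates inherit) and a variance controlled by the covering number of the cube. Iterating
  gives an error of order \<open>A ^ M\<close> times the rate.

  Because each half is evaluated on data independent of the fit, the scaled estimation error is a sum of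
  independent centred variables, built from the population iterate, plus a remainder whose second
  moment is bounded by that of the fitting error. The mixed term is split by Young's inequality,
  which turns the rate into its square root.
\<close>

text \<open>The obstacle is that \<open>f\<close> has no lower bound: a ball may have arbitrarily
  small mass, so the error of a local average cannot be bounded at a single point. It is bounded
  only after averaging the point over \<open>law f\<close>, where the integral of 1 / P(ball) is at
  most the number of cells of diameter \<open>h\<close> that cover the region in question. The
  orthants around an observation give the power of 2 in Stone's inequality; a grid on the cube gives
  \<open>(3 * T / h) ^ card S\<close> for the variance. Each step uses a piece of its own because
  the previous fit enters the new average: on a fresh piece it can be held fixed, and the data that
  remain are i.i.d. Constants: put y = C/c + 2^d. A step multiplies the inherited squared error by
  at most 2 + 18 y. The crude bounds on the population iterates grow like 3^m and the new squared
  error like \<open>9 ^ m * (C / c) ^ m\<close>; the choice A = 28 y dominates this growth and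
  leaves the share 10 y - 2 for the new error of each step.\<close>

lemma supnorm_le_iff: "0 \<le> t \<Longrightarrow> supnorm S u \<le> t \<longleftrightarrow> (\<forall>j\<in>S. \<bar>u j\<bar> \<le> t)"
  by (simp add: supnorm_def)

lemma supnorm_nonneg: "0 \<le> supnorm S u"
  by (simp add: supnorm_def)

lemma abs_le_supnorm: "j \<in> S \<Longrightarrow> \<bar>u j\<bar> \<le> supnorm S u"
  by (simp add: supnorm_def)

lemma supnorm_cong: "(\<And>j. j \<in> S \<Longrightarrow> u j = v j) \<Longrightarrow> supnorm S u = supnorm S v"
  by (simp add: supnorm_def)

lemma supnorm_restrict [simp]: "supnorm S (restrict u S) = supnorm S u"
  by (rule supnorm_cong) simp

lemma supnorm_mono: "S \<subseteq> S' \<Longrightarrow> supnorm S u \<le> supnorm S' u"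
  using supnorm_le_iff[OF supnorm_nonneg[of S' u], of S u] abs_le_supnorm[of _ S' u] by blast

lemma supdist_nonneg: "0 \<le> supdist S u v"
  by (simp add: supdist_def supnorm_nonneg)

lemma supdist_le_iff: "0 \<le> t \<Longrightarrow> supdist S u v \<le> t \<longleftrightarrow> (\<forall>j\<in>S. \<bar>u j - v j\<bar> \<le> t)"
  by (simp add: supdist_def supnorm_le_iff)

lemma supdist_cong:
  "(\<And>j. j \<in> S \<Longrightarrow> u j = u' j) \<Longrightarrow> (\<And>j. j \<in> S \<Longrightarrow> v j = v' j) \<Longrightarrow> supdist S u v = supdist S u' v'"
  unfolding supdist_def by (rule supnorm_cong) simp

lemma supdist_restrict [simp]:
  "supdist S (restrict u S) v = supdist S u v" "supdist S u (restrict v S) = supdist S u v"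
  by (rule supdist_cong; simp)+

lemma borel_measurable_supnorm [measurable (raw)]:
  assumes "\<And>j. j \<in> S \<Longrightarrow> (\<lambda>x. f x j) \<in> borel_measurable M"
  shows "(\<lambda>x. supnorm S (f x)) \<in> borel_measurable M"
proof -
  \<comment> \<open>The index \<open>None\<close> turns the inserted 0 into one more member of a
    finite family, the form that \<open>borel_measurable_Max\<close> expects.\<close>
  have "insert 0 ((\<lambda>j. \<bar>f x j\<bar>) ` S) =
      (\<lambda>i. case i of None \<Rightarrow> 0 | Some j \<Rightarrow> \<bar>f x j\<bar>) ` insert None (Some ` S)" for x
    by (simp add: image_image)
  moreover have "(\<lambda>x. Max ((\<lambda>i. case i of None \<Rightarrow> 0 | Some j \<Rightarrow> \<bar>f x j\<bar>) ` insert None (Some ` S)))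
      \<in> borel_measurable M"
    using assms by (intro borel_measurable_Max) (auto split: option.split)
  ultimately show ?thesis by (simp add: supnorm_def)
qed

lemma measurable_leb_component [measurable (raw)]:
  assumes "f \<in> M \<rightarrow>\<^sub>M leb S" "j \<in> S"
  shows "(\<lambda>x. f x j) \<in> borel_measurable M"
  using measurable_compose[OF assms(1) measurable_component_singleton[OF assms(2)]] by simp

lemma measurable_leb_restrict [measurable (raw)]:
  assumes "f \<in> M \<rightarrow>\<^sub>M leb S'" "S \<subseteq> S'"
  shows "(\<lambda>x. restrict (f x) S) \<in> M \<rightarrow>\<^sub>M leb S"
  using measurable_compose[OF assms(1) measurable_restrict_subset[OF assms(2)]] by simp

lemma space_leb_UNIV [simp]: "space (leb UNIV) = UNIV"
  by (simp add: space_PiM)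

section \<open>The law of X and total variation distance\<close>

lemma prob_law:
  assumes "is_prob_density f" shows "prob_space (law f)"
proof (rule prob_spaceI)
  have f: "(\<lambda>x. ennreal (f x)) \<in> borel_measurable (leb UNIV)"
    using assms by (auto simp: is_prob_density_def)
  have "emeasure (law f) (space (law f)) = (\<integral>\<^sup>+x. ennreal (f x) \<partial>leb UNIV)"
    unfolding law_def space_density emeasure_density[OF f sets.top]
    by (rule nn_integral_cong) (simp only: indicator_simps mult_1_right)
  then show "emeasure (law f) (space (law f)) = 1"
    using assms by (simp only: is_prob_density_def)
qed

lemma sets_law [measurable_cong, simp]: "sets (law f) = sets (leb UNIV)"
  and space_law [simp]: "space (law f) = UNIV"
  by (auto simp: law_def)

lemma measurable_restrict_law [measurable]: "(\<lambda>x. restrict x S) \<in> law f \<rightarrow>\<^sub>M leb S"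
  using measurable_leb_restrict[of "\<lambda>x. x" "law f" UNIV S] by (simp add: measurable_ident_sets)

text \<open>Layer-cake argument for functions with values in \<open>[0,1]\<close>.\<close>

lemma nn_integral_le_tv_dist:
  assumes "prob_space \<mu>" "prob_space \<nu>" and sets: "sets \<nu> = sets \<mu>"
    and [measurable]: "\<phi> \<in> borel_measurable \<mu>"
    and \<phi>: "\<And>x. 0 \<le> \<phi> x" "\<And>x. \<phi> x \<le> 1"
  shows "(\<integral>\<^sup>+x. ennreal (\<phi> x) \<partial>\<mu>) \<le> (\<integral>\<^sup>+x. ennreal (\<phi> x) \<partial>\<nu>) + ennreal (tv_dist \<mu> \<nu>)"
proof -
  interpret \<mu>: prob_space \<mu> by fact
  interpret \<nu>: prob_space \<nu> by fact
  note [measurable_cong] = sets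
  have space: "space \<nu> = space \<mu>" using sets by (rule sets_eq_imp_space_eq)
  have layer: "(\<integral>\<^sup>+x. ennreal (\<phi> x) \<partial>\<rho>) =
      (\<integral>\<^sup>+t. indicator {0..1} t * emeasure \<rho> {x\<in>space \<rho>. t < \<phi> x} \<partial>lborel)"
    if "prob_space \<rho>" and [measurable_cong]: "sets \<rho> = sets \<mu>" for \<rho>
  proof -
    interpret \<rho>: prob_space \<rho> by fact
    interpret pair_sigma_finite \<rho> lborel ..
    have "ennreal (\<phi> x) = (\<integral>\<^sup>+t. indicator {0..1} t * indicator {x. t < \<phi> x} x \<partial>lborel)" for x
    proof -
      have "(\<integral>\<^sup>+t. indicator {0..1} t * indicator {x. t < \<phi> x} x \<partial>lborel) =
          (\<integral>\<^sup>+t. indicator {0..<\<phi> x} t \<partial>lborel)"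
        using \<phi>[of x] by (intro nn_integral_cong) (auto split: split_indicator)
      then show ?thesis using \<phi>[of x] by simp
    qed
    then have "(\<integral>\<^sup>+x. ennreal (\<phi> x) \<partial>\<rho>) =
        (\<integral>\<^sup>+x. \<integral>\<^sup>+t. indicator {0..1} t * indicator {x. t < \<phi> x} x \<partial>lborel \<partial>\<rho>)" by simp
    also have "\<dots> = (\<integral>\<^sup>+t. \<integral>\<^sup>+x. indicator {0..1} t * indicator {x. t < \<phi> x} x \<partial>\<rho> \<partial>lborel)"
      by (rule Fubini'[symmetric]) measurable
    also have "\<dots> = (\<integral>\<^sup>+t. indicator {0..1} t * emeasure \<rho> {x\<in>space \<rho>. t < \<phi> x} \<partial>lborel)"
    proof (rule nn_integral_cong)
      fix t :: real
      have "(\<integral>\<^sup>+x. indicator {0..1} t * indicator {x. t < \<phi> x} x \<partial>\<rho>) =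
          (\<integral>\<^sup>+x. indicator {0..1} t * indicator {x\<in>space \<rho>. t < \<phi> x} x \<partial>\<rho>)"
        by (intro nn_integral_cong) (auto split: split_indicator)
      also have "\<dots> = indicator {0..1} t * emeasure \<rho> {x\<in>space \<rho>. t < \<phi> x}"
        by (subst nn_integral_cmult_indicator) auto
      finally show "(\<integral>\<^sup>+x. indicator {0..1} t * indicator {x. t < \<phi> x} x \<partial>\<rho>) =
          indicator {0..1} t * emeasure \<rho> {x\<in>space \<rho>. t < \<phi> x}" .
    qed
    finally show ?thesis .
  qed
  \<comment> \<open>The supremum is taken in the reals, so the family must be shown to be bounded
    before a single event can be compared with it.\<close>
  have tv: "emeasure \<mu> A \<le> emeasure \<nu> A + ennreal (tv_dist \<mu> \<nu>)" if "A \<in> sets \<mu>" for A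
  proof -
    have "bdd_above ((\<lambda>A. \<bar>measure \<mu> A - measure \<nu> A\<bar>) ` sets \<mu>)"
    proof (rule bdd_aboveI2)
      fix A show "\<bar>measure \<mu> A - measure \<nu> A\<bar> \<le> 2"
        using \<mu>.prob_le_1[of A] \<nu>.prob_le_1[of A] measure_nonneg[of \<mu> A] measure_nonneg[of \<nu> A] by linarith
    qed
    then have "\<bar>measure \<mu> A - measure \<nu> A\<bar> \<le> tv_dist \<mu> \<nu>"
      unfolding tv_dist_def using that by (intro cSUP_upper2) auto
    then have "measure \<mu> A \<le> measure \<nu> A + tv_dist \<mu> \<nu>" "0 \<le> tv_dist \<mu> \<nu>" by linarith+
    then show ?thesis
      by (simp add: \<mu>.emeasure_eq_measure \<nu>.emeasure_eq_measure flip: ennreal_plus)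
  qed
  \<comment> \<open>The level only ranges over the unit interval, so the excess of each level set is
    counted with total weight 1.\<close>
  have "(\<integral>\<^sup>+x. ennreal (\<phi> x) \<partial>\<mu>) \<le> (\<integral>\<^sup>+t. indicator {0..1} t * emeasure \<nu> {x\<in>space \<nu>. t < \<phi> x} +
      ennreal (tv_dist \<mu> \<nu>) * indicator {0..1} t \<partial>lborel)"
    unfolding layer[OF \<open>prob_space \<mu>\<close> refl] using tv
    by (intro nn_integral_mono) (auto simp: space split: split_indicator)
  also have "\<dots> = (\<integral>\<^sup>+t. indicator {0..1} t * emeasure \<nu> {x\<in>space \<nu>. t < \<phi> x} \<partial>lborel) + ennreal (tv_dist \<mu> \<nu>)"
    by (subst nn_integral_add) (auto simp: nn_integral_cmult_indicator)
  finally show ?thesis by (simp add: layer[OF \<open>prob_space \<nu>\<close> sets])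
qed

text \<open>The empty event contributes the value 0 to a supremum over a bounded family.\<close>

lemma tv_dist_nonneg:
  assumes "prob_space \<mu>" "prob_space \<nu>" shows "0 \<le> tv_dist \<mu> \<nu>"
proof -
  interpret \<mu>: prob_space \<mu> by fact
  interpret \<nu>: prob_space \<nu> by fact
  have "bdd_above ((\<lambda>A. \<bar>measure \<mu> A - measure \<nu> A\<bar>) ` sets \<mu>)"
  proof (rule bdd_aboveI2)
    fix A show "\<bar>measure \<mu> A - measure \<nu> A\<bar> \<le> 2"
      using \<mu>.prob_le_1[of A] \<nu>.prob_le_1[of A] measure_nonneg[of \<mu> A] measure_nonneg[of \<nu> A] by linarith
  qed
  then show ?thesis unfolding tv_dist_def by (intro cSUP_upper2[where x="{}"]) auto
qed

text \<open>The affine map from [-K, K] onto [0, 1] reduces the claim to the layer-cake comparison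
  and costs the factor \<open>2 * K\<close>. The opposite sign follows by applying the one-sided
  bound to the negated function.\<close>

lemma integral_diff_le_tv_dist:
  assumes \<mu>: "prob_space \<mu>" and \<nu>: "prob_space \<nu>" and sets: "sets \<nu> = sets \<mu>"
    and \<phi>[measurable]: "\<phi> \<in> borel_measurable \<mu>" and b: "\<And>x. \<bar>\<phi> x\<bar> \<le> K"
  shows "\<bar>(\<integral>x. \<phi> x \<partial>\<mu>) - (\<integral>x. \<phi> x \<partial>\<nu>)\<bar> \<le> 2 * K * tv_dist \<mu> \<nu>"
proof -
  interpret \<mu>: prob_space \<mu> by fact
  interpret \<nu>: prob_space \<nu> by fact
  note [measurable_cong] = sets
  have K0: "0 \<le> K" using b[of undefined] by linarith
  have one: "(\<integral>x. \<phi> x \<partial>\<mu>) - (\<integral>x. \<phi> x \<partial>\<nu>) \<le> 2 * K * tv_dist \<mu> \<nu>"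
    if \<phi>[measurable]: "\<phi> \<in> borel_measurable \<mu>" and b: "\<And>x. \<bar>\<phi> x\<bar> \<le> K" for \<phi>
  \<comment> \<open>The rescaling divides by \<open>2 * K\<close>, so the zero function is treated
    apart.\<close>
  proof (cases "K = 0")
    case True then have "\<phi> x = 0" for x using b[of x] by simp
    then show ?thesis using True by simp
  next
    case False
    then have K: "0 < K" using K0 by simp
    define \<psi> where "\<psi> x = (\<phi> x + K) / (2 * K)" for x
    have \<psi>: "0 \<le> \<psi> x" "\<psi> x \<le> 1" for x
      using b[of x] K unfolding \<psi>_def by (auto simp: field_simps abs_le_iff)
    have [measurable]: "\<psi> \<in> borel_measurable \<mu>" unfolding \<psi>_def by measurable
    have i1: "integrable \<mu> \<phi>" "integrable \<mu> \<psi>"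
      by (rule \<mu>.integrable_const_bound[of _ K], use b in auto)
         (rule \<mu>.integrable_const_bound[of _ 1], use \<psi> in auto)
    have i2: "integrable \<nu> \<phi>" "integrable \<nu> \<psi>"
      by (rule \<nu>.integrable_const_bound[of _ K], use b in auto)
         (rule \<nu>.integrable_const_bound[of _ 1], use \<psi> in auto)
    have "ennreal (\<integral>x. \<psi> x \<partial>\<mu>) \<le> ennreal (\<integral>x. \<psi> x \<partial>\<nu>) + ennreal (tv_dist \<mu> \<nu>)"
      using nn_integral_le_tv_dist[OF \<mu> \<nu> sets, of \<psi>]
      by (simp add: nn_integral_eq_integral i1 i2 \<psi>)
    then have "(\<integral>x. \<psi> x \<partial>\<mu>) \<le> (\<integral>x. \<psi> x \<partial>\<nu>) + tv_dist \<mu> \<nu>"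
      using tv_dist_nonneg[OF \<mu> \<nu>] \<psi> by (simp add: integral_nonneg flip: ennreal_plus)
    moreover have "(\<integral>x. \<psi> x \<partial>\<mu>) = ((\<integral>x. \<phi> x \<partial>\<mu>) + K) / (2 * K)" unfolding \<psi>_def
      using i1 by (simp add: \<mu>.prob_space)
    moreover have "(\<integral>x. \<psi> x \<partial>\<nu>) = ((\<integral>x. \<phi> x \<partial>\<nu>) + K) / (2 * K)" unfolding \<psi>_def
      using i2 by (simp add: \<nu>.prob_space)
    ultimately have "((\<integral>x. \<phi> x \<partial>\<mu>) + K) / (2 * K) - ((\<integral>x. \<phi> x \<partial>\<nu>) + K) / (2 * K) \<le> tv_dist \<mu> \<nu>"
      by simp
    then have "((\<integral>x. \<phi> x \<partial>\<mu>) - (\<integral>x. \<phi> x \<partial>\<nu>)) / (2 * K) \<le> tv_dist \<mu> \<nu>"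
      by (simp add: diff_divide_distrib add_divide_distrib)
    then show ?thesis using K by (simp add: pos_divide_le_eq mult.commute)
  qed
  show ?thesis using one[OF \<phi> b] one[of "\<lambda>x. - \<phi> x"] b by (auto simp: abs_le_iff)
qed

section \<open>Binomial means and the law of a count\<close>

text \<open>The mean of \<open>\<phi>\<close> at a binomial variable, computed by conditioning on
  one trial at a time. The failure probability is an argument of its own, which avoids truncated
  subtraction in \<open>ennreal\<close>.\<close>

primrec binom_mean :: "ennreal \<Rightarrow> ennreal \<Rightarrow> nat \<Rightarrow> (nat \<Rightarrow> ennreal) \<Rightarrow> ennreal" where
  "binom_mean p p' 0 \<phi> = \<phi> 0"
| "binom_mean p p' (Suc m) \<phi> = p * binom_mean p p' m (\<lambda>k. \<phi> (Suc k)) + p' * binom_mean p p' m \<phi>"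

lemma binom_mean_add:
  "binom_mean p p' m (\<lambda>k. \<phi> k + \<psi> k) = binom_mean p p' m \<phi> + binom_mean p p' m \<psi>"
  by (induction m arbitrary: \<phi> \<psi>) (auto simp: algebra_simps)

lemma binom_mean_mono: "(\<And>k. \<phi> k \<le> \<psi> k) \<Longrightarrow> binom_mean p p' m \<phi> \<le> binom_mean p p' m \<psi>"
  by (induction m arbitrary: \<phi> \<psi>) (auto intro!: add_mono mult_left_mono)

lemma binom_mean_const: "p + p' = 1 \<Longrightarrow> binom_mean p p' m (\<lambda>_. x) = x"
  by (induction m) (auto simp flip: distrib_right)

text \<open>Size biasing: writing N as a sum of indicators of success, each trial contributes its
  success probability times the mean of \<phi> at one plus the number of successes among the other
  trials.\<close>

lemma binom_mean_size_bias:
  "binom_mean p p' (Suc m) (\<lambda>k. of_nat k * \<phi> k) = of_nat (Suc m) * p * binom_mean p p' m (\<lambda>k. \<phi> (Suc k))"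
proof (induction m arbitrary: \<phi>)
  case (Suc m)
  have "binom_mean p p' (Suc (Suc m)) (\<lambda>k. of_nat k * \<phi> k) =
      p * binom_mean p p' (Suc m) (\<lambda>k. \<phi> (Suc k) + of_nat k * \<phi> (Suc k)) +
      p' * binom_mean p p' (Suc m) (\<lambda>k. of_nat k * \<phi> k)"
    by (subst binom_mean.simps(2)) (simp add: algebra_simps del: binom_mean.simps(2))
  also have "\<dots> = p * binom_mean p p' (Suc m) (\<lambda>k. \<phi> (Suc k)) +
      (p * (of_nat (Suc m) * p * binom_mean p p' m (\<lambda>k. \<phi> (Suc (Suc k)))) +
       p' * (of_nat (Suc m) * p * binom_mean p p' m (\<lambda>k. \<phi> (Suc k))))"
    unfolding binom_mean_add Suc.IH Suc.IH[of "\<lambda>k. \<phi> (Suc k)"] by (simp add: algebra_simps)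
  also have "\<dots> = of_nat (Suc (Suc m)) * p * binom_mean p p' (Suc m) (\<lambda>k. \<phi> (Suc k))"
    by (simp add: algebra_simps)
  finally show ?case .
qed (simp add: algebra_simps)

text \<open>Size biasing with \<open>\<phi> k = 1 / k\<close>: the product of k and 1 / k is 1
  except at k = 0, where it is 0, so its mean is at most 1. In effect the mean of 1 / (1 + N) for m
  trials is at most the inverse of (m + 1) p.\<close>

lemma binom_mean_inverse_Suc:
  assumes "p + p' = 1"
  shows "of_nat (Suc m) * p * binom_mean p p' m (\<lambda>k. ennreal (1 / real (Suc k))) \<le> 1"
proof -
  have "of_nat (Suc m) * p * binom_mean p p' m (\<lambda>k. ennreal (1 / real (Suc k))) =
      binom_mean p p' (Suc m) (\<lambda>k. of_nat k * ennreal (1 / real k))"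
    using binom_mean_size_bias[of p p' m "\<lambda>k. ennreal (1 / real k)"] by simp
  also have "\<dots> \<le> binom_mean p p' (Suc m) (\<lambda>k. 1)"
  proof (rule binom_mean_mono)
    fix k :: nat
    have "of_nat k * ennreal (1 / real k) = ennreal (real k * (1 / real k))"
      unfolding ennreal_of_nat_eq_real_of_nat by (rule ennreal_mult[symmetric]) auto
    also have "\<dots> \<le> 1" by (cases "k = 0") auto
    finally show "of_nat k * ennreal (1 / real k) \<le> 1" .
  qed
  also have "\<dots> = 1" by (rule binom_mean_const[OF assms])
  finally show ?thesis .
qed

text \<open>The number of sample points that fall into an event is binomial. The induction
  integrates out one observation, which is the recursion of \<open>binom_mean\<close>.\<close>

lemma nn_integral_PiM_card:
  fixes K :: "nat set"
  assumes "prob_space \<mu>" "finite K" and [measurable]: "{y\<in>space \<mu>. P y} \<in> sets \<mu>"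
  shows "(\<integral>\<^sup>+y. \<phi> (card {j\<in>K. P (y j)}) \<partial>PiM K (\<lambda>_. \<mu>)) =
    binom_mean (emeasure \<mu> {y\<in>space \<mu>. P y}) (emeasure \<mu> {y\<in>space \<mu>. \<not> P y}) (card K) \<phi>"
  using \<open>finite K\<close>
proof (induction K arbitrary: \<phi> rule: finite_induct)
  case empty
  interpret product_prob_space "\<lambda>_. \<mu>" by (simp add: assms(1) product_prob_spaceI)
  show ?case using nn_integral_empty[of "\<lambda>y. \<phi> 0"] by simp
next
  case (insert i K)
  interpret prob_space \<mu> by fact
  interpret product_prob_space "\<lambda>_. \<mu>" by (simp add: assms(1) product_prob_spaceI)
  have meas: "(\<lambda>y. \<phi> (card {j\<in>K'. P (y j)})) \<in> borel_measurable (PiM K' (\<lambda>_. \<mu>))" if "finite K'"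
    for K' :: "nat set" and \<phi> :: "nat \<Rightarrow> ennreal"
  proof -
    have "(\<lambda>y. card {j\<in>K'. P (y j)}) \<in> PiM K' (\<lambda>_. \<mu>) \<rightarrow>\<^sub>M count_space UNIV"
    proof (rule measurable_card[where S="\<lambda>y. {j\<in>K'. P (y j)}"])
      fix i
      show "{y\<in>space (PiM K' (\<lambda>_. \<mu>)). i \<in> {j\<in>K'. P (y j)}} \<in> sets (PiM K' (\<lambda>_. \<mu>))"
      proof (cases "i \<in> K'")
        case True
        have "{y\<in>space (PiM K' (\<lambda>_. \<mu>)). i \<in> {j\<in>K'. P (y j)}} =
            (\<lambda>y. y i) -` {y\<in>space \<mu>. P y} \<inter> space (PiM K' (\<lambda>_. \<mu>))"
          using True by (auto simp: space_PiM)
        then show ?thesis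
          using measurable_sets[OF measurable_component_singleton[OF True, of "\<lambda>_. \<mu>"] assms(3)] by simp
      qed simp
    qed
    then show ?thesis by (rule measurable_compose) simp
  qed
  have card: "card {j\<in>insert i K. P ((x(i := y)) j)} = (if P y then Suc (card {j\<in>K. P (x j)}) else card {j\<in>K. P (x j)})" for x y
  proof -
    have "{j\<in>insert i K. P ((x(i := y)) j)} = (if P y then insert i {j\<in>K. P (x j)} else {j\<in>K. P (x j)})"
      using insert.hyps by auto
    then show ?thesis using insert.hyps by auto
  qed
  have "(\<integral>\<^sup>+y. \<phi> (card {j\<in>insert i K. P (y j)}) \<partial>PiM (insert i K) (\<lambda>_. \<mu>)) =
      (\<integral>\<^sup>+x. \<integral>\<^sup>+y. (if P y then \<phi> (Suc (card {j\<in>K. P (x j)})) else \<phi> (card {j\<in>K. P (x j)})) \<partial>\<mu> \<partial>PiM K (\<lambda>_. \<mu>))"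
    by (subst product_nn_integral_insert[OF insert.hyps meas]) (use insert.hyps card in \<open>auto intro!: nn_integral_cong\<close>)
  also have "\<dots> = (\<integral>\<^sup>+x. emeasure \<mu> {y\<in>space \<mu>. P y} * \<phi> (Suc (card {j\<in>K. P (x j)})) +
      emeasure \<mu> {y\<in>space \<mu>. \<not> P y} * \<phi> (card {j\<in>K. P (x j)}) \<partial>PiM K (\<lambda>_. \<mu>))"
  proof (rule nn_integral_cong)
    fix x
    have "(\<integral>\<^sup>+y. (if P y then \<phi> (Suc (card {j\<in>K. P (x j)})) else \<phi> (card {j\<in>K. P (x j)})) \<partial>\<mu>) =
      (\<integral>\<^sup>+y. \<phi> (Suc (card {j\<in>K. P (x j)})) * indicator {y\<in>space \<mu>. P y} y +
         \<phi> (card {j\<in>K. P (x j)}) * indicator {y\<in>space \<mu>. \<not> P y} y \<partial>\<mu>)"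
      by (intro nn_integral_cong) (auto split: split_indicator)
    also have "\<dots> = \<phi> (Suc (card {j\<in>K. P (x j)})) * emeasure \<mu> {y\<in>space \<mu>. P y} +
      \<phi> (card {j\<in>K. P (x j)}) * emeasure \<mu> {y\<in>space \<mu>. \<not> P y}"
      by (subst nn_integral_add) (auto simp: nn_integral_cmult_indicator)
    also have "\<dots> = emeasure \<mu> {y\<in>space \<mu>. P y} * \<phi> (Suc (card {j\<in>K. P (x j)})) +
      emeasure \<mu> {y\<in>space \<mu>. \<not> P y} * \<phi> (card {j\<in>K. P (x j)})"
      by (simp only: mult.commute)
    finally show "(\<integral>\<^sup>+y. (if P y then \<phi> (Suc (card {j\<in>K. P (x j)})) else \<phi> (card {j\<in>K. P (x j)})) \<partial>\<mu>) = \<dots>" .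
  qed
  also have "\<dots> = binom_mean (emeasure \<mu> {y\<in>space \<mu>. P y}) (emeasure \<mu> {y\<in>space \<mu>. \<not> P y}) (card (insert i K)) \<phi>"
    using insert.hyps meas[OF insert.hyps(1), of \<phi>] meas[OF insert.hyps(1), of "\<lambda>k. \<phi> (Suc k)"]
    by (simp add: nn_integral_add nn_integral_cmult insert.IH insert.IH[of "\<lambda>k. \<phi> (Suc k)"])
  finally show ?case .
qed

section \<open>Second moments, orthogonality and independence\<close>

lemma integrable_mult_of_square_integrable:
  fixes f g :: "'a \<Rightarrow> real"
  assumes [measurable]: "f \<in> borel_measurable M" "g \<in> borel_measurable M"
    and "integrable M (\<lambda>x. (f x)\<^sup>2)" "integrable M (\<lambda>x. (g x)\<^sup>2)"
  shows "integrable M (\<lambda>x. f x * g x)"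
proof (rule Bochner_Integration.integrable_bound[OF Bochner_Integration.integrable_add[OF assms(3,4)]])
  have "\<bar>u * v\<bar> \<le> u\<^sup>2 + v\<^sup>2" for u v :: real
    using sum_squares_bound[of "\<bar>u\<bar>" "\<bar>v\<bar>"] mult_nonneg_nonneg[of "\<bar>u\<bar>" "\<bar>v\<bar>"]
    unfolding abs_mult power2_abs by linarith
  then show "AE x in M. norm (f x * g x) \<le> norm ((f x)\<^sup>2 + (g x)\<^sup>2)" by auto
qed auto

lemma (in prob_space) integrable_of_square_integrable:
  fixes f :: "'a \<Rightarrow> real"
  assumes "f \<in> borel_measurable M" "integrable M (\<lambda>x. (f x)\<^sup>2)"
  shows "integrable M f"
  using integrable_mult_of_square_integrable[of f M "\<lambda>_. 1"] assms by simp

text \<open>Stated for uncorrelated rather than independent summands: the kernel-weighted terms of a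
  local average share their weights, so orthogonality is all they offer.\<close>

lemma integral_sum_square_orthogonal:
  fixes Z :: "'i \<Rightarrow> 'a \<Rightarrow> real"
  assumes "finite I"
    and [measurable]: "\<And>i. i \<in> I \<Longrightarrow> Z i \<in> borel_measurable M"
    and sq: "\<And>i. i \<in> I \<Longrightarrow> integrable M (\<lambda>x. (Z i x)\<^sup>2)"
    and orth: "\<And>i j. i \<in> I \<Longrightarrow> j \<in> I \<Longrightarrow> i \<noteq> j \<Longrightarrow> (\<integral>x. Z i x * Z j x \<partial>M) = 0"
  shows "integrable M (\<lambda>x. (\<Sum>i\<in>I. Z i x)\<^sup>2)"
    and "(\<integral>x. (\<Sum>i\<in>I. Z i x)\<^sup>2 \<partial>M) = (\<Sum>i\<in>I. \<integral>x. (Z i x)\<^sup>2 \<partial>M)"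
proof -
  have int: "integrable M (\<lambda>x. Z i x * Z j x)" if "i \<in> I" "j \<in> I" for i j
    using that sq by (intro integrable_mult_of_square_integrable) auto
  have eq: "(\<Sum>i\<in>I. Z i x)\<^sup>2 = (\<Sum>i\<in>I. \<Sum>j\<in>I. Z i x * Z j x)" for x
    by (simp add: power2_eq_square sum_product)
  show "integrable M (\<lambda>x. (\<Sum>i\<in>I. Z i x)\<^sup>2)" unfolding eq using int by auto
  have "(\<integral>x. (\<Sum>i\<in>I. Z i x)\<^sup>2 \<partial>M) = (\<Sum>i\<in>I. \<Sum>j\<in>I. \<integral>x. Z i x * Z j x \<partial>M)"
    unfolding eq using int by (subst Bochner_Integration.integral_sum) (auto intro!: sum.cong Bochner_Integration.integral_sum)
  also have "\<dots> = (\<Sum>i\<in>I. \<Sum>j\<in>I. if j = i then \<integral>x. (Z i x)\<^sup>2 \<partial>M else 0)"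
    using orth by (intro sum.cong) (auto simp: power2_eq_square)
  also have "\<dots> = (\<Sum>i\<in>I. \<integral>x. (Z i x)\<^sup>2 \<partial>M)"
    using assms(1) by (simp add: sum.delta)
  finally show "(\<integral>x. (\<Sum>i\<in>I. Z i x)\<^sup>2 \<partial>M) = (\<Sum>i\<in>I. \<integral>x. (Z i x)\<^sup>2 \<partial>M)" .
qed

lemma (in prob_space) expectation_sum_square_indep:
  fixes \<psi> :: "'i \<Rightarrow> 'b \<Rightarrow> real"
  assumes "finite I" and indep: "indep_vars M' V I"
    and \<psi>: "\<And>i. i \<in> I \<Longrightarrow> \<psi> i \<in> borel_measurable (M' i)"
    and sq: "\<And>i. i \<in> I \<Longrightarrow> integrable M (\<lambda>x. (\<psi> i (V i x))\<^sup>2)"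
    and mean: "\<And>i. i \<in> I \<Longrightarrow> expectation (\<lambda>x. \<psi> i (V i x)) = 0"
  shows "integrable M (\<lambda>x. (\<Sum>i\<in>I. \<psi> i (V i x))\<^sup>2)"
    and "expectation (\<lambda>x. (\<Sum>i\<in>I. \<psi> i (V i x))\<^sup>2) = (\<Sum>i\<in>I. expectation (\<lambda>x. (\<psi> i (V i x))\<^sup>2))"
proof -
  have V: "V i \<in> M \<rightarrow>\<^sub>M M' i" if "i \<in> I" for i using indep that by (auto simp: indep_vars_def)
  have meas: "(\<lambda>x. \<psi> i (V i x)) \<in> borel_measurable M" if "i \<in> I" for i
    using measurable_compose[OF V \<psi>] that by simp
  have int: "integrable M (\<lambda>x. \<psi> i (V i x))" if "i \<in> I" for i
    by (rule integrable_of_square_integrable[OF meas[OF that] sq[OF that]])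
  have orth: "expectation (\<lambda>x. \<psi> i (V i x) * \<psi> j (V j x)) = 0" if "i \<in> I" "j \<in> I" "i \<noteq> j" for i j
  proof -
    have "indep_vars (\<lambda>_. borel) (\<lambda>i x. \<psi> i (V i x)) {i, j}"
      using that \<psi> by (intro indep_vars_compose2[OF indep_vars_subset[OF indep]]) auto
    then have "expectation (\<lambda>x. \<Prod>l\<in>{i, j}. \<psi> l (V l x)) = (\<Prod>l\<in>{i, j}. expectation (\<lambda>x. \<psi> l (V l x)))"
      using that by (intro indep_vars_lebesgue_integral) (auto intro!: int)
    then show ?thesis using that mean by simp
  qed
  show "integrable M (\<lambda>x. (\<Sum>i\<in>I. \<psi> i (V i x))\<^sup>2)"
    by (rule integral_sum_square_orthogonal(1)[OF assms(1) meas sq orth])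
  show "expectation (\<lambda>x. (\<Sum>i\<in>I. \<psi> i (V i x))\<^sup>2) = (\<Sum>i\<in>I. expectation (\<lambda>x. (\<psi> i (V i x))\<^sup>2))"
    by (rule integral_sum_square_orthogonal(2)[OF assms(1) meas sq orth])
qed

text \<open>The tool for freezing part of the data: the inner integral runs over a second copy of
  the outcome, so it can be estimated for each value of \<open>U\<close> as if that value were a
  constant.\<close>

lemma (in prob_space) nn_integral_indep_var:
  assumes indep: "indep_var MU U MV V" and \<Phi>: "case_prod \<Phi> \<in> borel_measurable (MU \<Otimes>\<^sub>M MV)"
  shows "(\<integral>\<^sup>+\<omega>. \<Phi> (U \<omega>) (V \<omega>) \<partial>M) = (\<integral>\<^sup>+\<omega>. \<integral>\<^sup>+\<omega>'. \<Phi> (U \<omega>) (V \<omega>') \<partial>M \<partial>M)"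
proof -
  have U[measurable]: "U \<in> M \<rightarrow>\<^sub>M MU" and V[measurable]: "V \<in> M \<rightarrow>\<^sub>M MV"
    and eq: "distr M MU U \<Otimes>\<^sub>M distr M MV V = distr M (MU \<Otimes>\<^sub>M MV) (\<lambda>x. (U x, V x))"
    using indep unfolding indep_var_distribution_eq by auto
  note \<Phi>[measurable]
  interpret V: prob_space "distr M MV V" by (rule prob_space_distr) fact
  have "(\<integral>\<^sup>+\<omega>. \<Phi> (U \<omega>) (V \<omega>) \<partial>M) = (\<integral>\<^sup>+z. case_prod \<Phi> z \<partial>distr M (MU \<Otimes>\<^sub>M MV) (\<lambda>x. (U x, V x)))"
    by (subst nn_integral_distr) auto
  also have "\<dots> = (\<integral>\<^sup>+u. \<integral>\<^sup>+v. \<Phi> u v \<partial>distr M MV V \<partial>distr M MU U)"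
    unfolding eq[symmetric] by (subst V.nn_integral_fst[symmetric]) auto
  also have "\<dots> = (\<integral>\<^sup>+u. \<integral>\<^sup>+\<omega>'. \<Phi> u (V \<omega>') \<partial>M \<partial>distr M MU U)"
    by (intro nn_integral_cong nn_integral_distr) auto
  also have "\<dots> = (\<integral>\<^sup>+\<omega>. \<integral>\<^sup>+\<omega>'. \<Phi> (U \<omega>) (V \<omega>') \<partial>M \<partial>M)"
    by (subst nn_integral_distr) auto
  finally show ?thesis .
qed

subsection \<open>Marginals and conditional distributions\<close>

lemma space_subspace [simp]: "space (leb S) = subspace_of S"
  by (simp add: space_PiM)

lemma restrict_subspace [simp]: "restrict x S \<in> subspace_of S"
  by simp

lemma merge_restrict_compl [simp]: "merge S (-S) (restrict x S, restrict x (-S)) = x"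
  by (auto simp: merge_def)

lemma restrict_merge_compl [simp]: "restrict (merge S (-S) (u, v)) S = restrict u S"
  by (simp add: restrict_def merge_def fun_eq_iff)

lemma restrict_id_subspace: "u \<in> subspace_of S \<Longrightarrow> restrict u S = u"
  by (auto simp: PiE_def extensional_restrict)

lemma measurable_merge_compl [measurable]: "merge S (-S) \<in> leb S \<Otimes>\<^sub>M leb (-S) \<rightarrow>\<^sub>M leb UNIV"
  using measurable_merge[of S "-S" "\<lambda>_. lborel"] by simp

text \<open>Folding the product measure yields an inner integral in \<open>ennreal\<close>, whereas
  \<open>marginal\<close> is a Bochner integral and equals 0 where the section is not integrable.
  The two agree almost everywhere because the total mass is finite.\<close>

lemma nn_integral_law_restrict:
  assumes f: "is_prob_density f" and [measurable]: "\<phi> \<in> borel_measurable (leb S)"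
  shows "(\<integral>\<^sup>+x. \<phi> (restrict x S) \<partial>law f) = (\<integral>\<^sup>+u. \<phi> u * ennreal (marginal f S u) \<partial>leb S)"
    and "marginal f S \<in> borel_measurable (leb S)"
proof -
  interpret product_sigma_finite "\<lambda>_::'a. lborel :: real measure" ..
  interpret mS: sigma_finite_measure "leb (-S)" by (intro sigma_finite) simp
  have [measurable]: "f \<in> borel_measurable (leb UNIV)" and f0: "\<And>x. 0 \<le> f x"
    and f1: "(\<integral>\<^sup>+x. ennreal (f x) \<partial>leb UNIV) = 1"
    using f by (auto simp: is_prob_density_def)
  have meas: "(\<lambda>(u, v). f (merge S (-S) (u, v))) \<in> borel_measurable (leb S \<Otimes>\<^sub>M leb (-S))"
    by (simp add: split_beta')
  have fold: "integral\<^sup>N (leb UNIV) g = (\<integral>\<^sup>+u. \<integral>\<^sup>+v. g (merge S (-S) (u, v)) \<partial>leb (-S) \<partial>leb S)"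
    if "g \<in> borel_measurable (leb UNIV)" for g
    using product_nn_integral_fold[of S "-S" g] that by simp
  define F where "F u = (\<integral>\<^sup>+v. ennreal (f (merge S (-S) (u, v))) \<partial>leb (-S))" for u
  have F[measurable]: "F \<in> borel_measurable (leb S)"
    unfolding F_def by (intro mS.borel_measurable_nn_integral) (simp add: split_beta')
  show m: "marginal f S \<in> borel_measurable (leb S)"
    unfolding marginal_def[abs_def] by (intro mS.borel_measurable_lebesgue_integral meas)
  have "(\<integral>\<^sup>+u. F u \<partial>leb S) = 1" using fold[of "\<lambda>x. ennreal (f x)"] f1 by (simp add: F_def)
  then have "AE u in leb S. F u \<noteq> \<infinity>" by (intro nn_integral_noteq_infinite) auto
  then have AE: "AE u in leb S. F u = ennreal (marginal f S u)"
  proof (rule AE_mp, intro AE_I2 impI)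
    fix u assume u: "u \<in> space (leb S)" "F u \<noteq> \<infinity>"
    have mv: "(\<lambda>v. f (merge S (-S) (u, v))) \<in> borel_measurable (leb (-S))"
      using measurable_compose[OF measurable_Pair1'[OF u(1), of "leb (-S)"] meas] by simp
    then have "integrable (leb (-S)) (\<lambda>v. f (merge S (-S) (u, v)))"
      using u(2) f0 by (intro integrableI_nonneg) (auto simp: F_def less_top)
    then show "F u = ennreal (marginal f S u)"
      unfolding F_def marginal_def using f0 by (intro nn_integral_eq_integral) auto
  qed
  have "(\<integral>\<^sup>+x. \<phi> (restrict x S) \<partial>law f) = (\<integral>\<^sup>+x. ennreal (f x) * \<phi> (restrict x S) \<partial>leb UNIV)"
    unfolding law_def by (subst nn_integral_density) measurable
  also have "\<dots> = (\<integral>\<^sup>+u. \<integral>\<^sup>+v. ennreal (f (merge S (-S) (u, v))) * \<phi> (restrict u S) \<partial>leb (-S) \<partial>leb S)"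
    by (subst fold) auto
  also have "\<dots> = (\<integral>\<^sup>+u. \<phi> u * F u \<partial>leb S)"
  proof (rule nn_integral_cong)
    fix u assume u: "u \<in> space (leb S)"
    have mv: "(\<lambda>v. f (merge S (-S) (u, v))) \<in> borel_measurable (leb (-S))"
      using measurable_compose[OF measurable_Pair1'[OF u, of "leb (-S)"] meas] by simp
    show "(\<integral>\<^sup>+v. ennreal (f (merge S (-S) (u, v))) * \<phi> (restrict u S) \<partial>leb (-S)) = \<phi> u * F u"
      using u mv by (subst nn_integral_multc) (auto simp: F_def restrict_id_subspace mult.commute)
  qed
  also have "\<dots> = (\<integral>\<^sup>+u. \<phi> u * ennreal (marginal f S u) \<partial>leb S)"
    using AE by (intro nn_integral_cong_AE) auto
  finally show "(\<integral>\<^sup>+x. \<phi> (restrict x S) \<partial>law f) = (\<integral>\<^sup>+u. \<phi> u * ennreal (marginal f S u) \<partial>leb S)" .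
qed

lemma marginal_nonneg: "is_prob_density f \<Longrightarrow> 0 \<le> marginal f S u"
  unfolding marginal_def is_prob_density_def by (intro Bochner_Integration.integral_nonneg) auto

text \<open>One exponent serves all three smoothness conditions. As they only concern distances up
  to 1, conditions with different exponents imply those with the smallest of them. \<open>na\<close>
  stands for any bound on |a|.\<close>

locale missing_data =
  fixes f a :: "('d::finite \<Rightarrow> real) \<Rightarrow> real" and SS :: "'d set set"
    and r :: "'d set \<Rightarrow> ('d \<Rightarrow> real) \<Rightarrow> real" and lam :: "'d set \<Rightarrow> real"
    and k :: "'d set \<Rightarrow> ('d \<Rightarrow> real) \<Rightarrow> ('d \<Rightarrow> real) measure"
    and \<beta> L1 L2 L3 c C na :: real
  assumes f: "is_prob_density f" and SS: "SS \<noteq> {}"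
    and r_meas [measurable]: "S \<in> SS \<Longrightarrow> r S \<in> borel_measurable (leb S)"
    and r_pos: "S \<in> SS \<Longrightarrow> u \<in> subspace_of S \<Longrightarrow> 0 < r S u"
    and lam_pos: "S \<in> SS \<Longrightarrow> 0 < lam S"
    and a_meas [measurable]: "a \<in> borel_measurable (leb UNIV)"
    and a_bound: "\<bar>a x\<bar> \<le> na"
    and \<beta>: "0 < \<beta>" "\<beta> \<le> 1" and L: "0 < L1" "0 < L2" "0 < L3"
    and c: "0 < c"
    and rbar_bounds: "S \<in> SS \<Longrightarrow> u \<in> subspace_of S \<Longrightarrow> c \<le> rbar f r S u \<and> rbar f r S u \<le> C"
    and a_hoelder: "supdist UNIV x x' \<le> 1 \<Longrightarrow> \<bar>a x - a x'\<bar> \<le> L1 * supdist UNIV x x' powr \<beta>"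
    and k: "S \<in> SS \<Longrightarrow> cond_distribution f S (k S)"
    and k_hoelder: "S \<in> SS \<Longrightarrow> u \<in> subspace_of S \<Longrightarrow> u' \<in> subspace_of S \<Longrightarrow>
      supdist S u u' \<le> 1 \<Longrightarrow> tv_dist (k S u) (k S u') \<le> L2 * supdist S u u' powr \<beta>"
    and rbar_hoelder: "S \<in> SS \<Longrightarrow> u \<in> subspace_of S \<Longrightarrow> u' \<in> subspace_of S \<Longrightarrow>
      supdist S u u' \<le> 1 \<Longrightarrow> \<bar>rbar f r S u - rbar f r S u'\<bar> \<le> L3 * supdist S u u' powr \<beta>"
begin

sublocale prob_space "law f"
  by (rule prob_law) (rule f)

lemma finite_SS [simp]: "finite SS" by simp

lemma card_SS: "1 \<le> real (card SS)"
  using SS by (simp add: Suc_le_eq card_gt_0_iff)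

lemma na_nonneg: "0 \<le> na"
  using a_bound[of undefined] by linarith

abbreviation rb :: "'d set \<Rightarrow> ('d \<Rightarrow> real) \<Rightarrow> real" where "rb \<equiv> rbar f r"

definition R :: "'d set \<Rightarrow> real" where "R S = (LINT v|leb S. r S v * marginal f S v)"

lemma rb_eq: "rb S u = r S u / R S"
  by (simp add: rbar_def R_def)

lemma rb_measurable [measurable]: "S \<in> SS \<Longrightarrow> rb S \<in> borel_measurable (leb S)"
  unfolding rbar_def[abs_def] by simp

lemma rb_pos: "S \<in> SS \<Longrightarrow> u \<in> subspace_of S \<Longrightarrow> 0 < rb S u"
  using rbar_bounds[of S u] c by auto

text \<open>Forced by the lower bound on \<open>rbar\<close>: a value \<open>R S \<le> 0\<close>, in
  particular the value 0 of a non-integrable product, would make the quotient nonpositive.\<close>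

lemma R_pos: assumes "S \<in> SS" shows "0 < R S"
proof -
  have "0 < r S (restrict undefined S) / R S"
    using rb_pos[OF assms restrict_subspace] by (simp add: rb_eq)
  then show ?thesis using r_pos[OF assms restrict_subspace[of undefined S]]
    by (simp add: zero_less_divide_iff)
qed

lemma r_eq: "S \<in> SS \<Longrightarrow> r S u = R S * rb S u"
  using R_pos[of S] by (simp add: rb_eq)

lemma integrable_bounded:
  assumes "g \<in> borel_measurable (leb UNIV)" "\<And>x. \<bar>g x\<bar> \<le> (K::real)"
  shows "integrable (law f) g"
  using assms by (intro integrable_const_bound[of _ K]) auto

lemma measurable_restrict_arg [measurable (raw)]:
  "\<phi> \<in> leb S \<rightarrow>\<^sub>M M \<Longrightarrow> (\<lambda>x. \<phi> (restrict x S)) \<in> leb UNIV \<rightarrow>\<^sub>M M"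
  by (rule measurable_compose[OF measurable_restrict_subset[OF subset_UNIV]])

lemma integrable_rb: "S \<in> SS \<Longrightarrow> integrable (law f) (\<lambda>x. rb S (restrict x S))"
  using rbar_bounds[OF _ restrict_subspace] rb_pos[OF _ restrict_subspace]
  by (intro integrable_bounded[of _ C]) (auto simp: abs_of_pos)

lemma expectation_rb: assumes S: "S \<in> SS" shows "(\<integral>x. rb S (restrict x S) \<partial>law f) = 1"
proof -
  note [measurable] = nn_integral_law_restrict(2)[OF f, of "\<lambda>_. 0" S]
  \<comment> \<open>A non-integrable function has Bochner integral 0, so the positivity of
    \<open>R S\<close> yields integrability.\<close>
  have int: "integrable (leb S) (\<lambda>v. r S v * marginal f S v)"
    using R_pos[OF S] not_integrable_integral_eq unfolding R_def by force
  have "(\<integral>\<^sup>+x. ennreal (r S (restrict x S)) \<partial>law f) = (\<integral>\<^sup>+v. ennreal (r S v * marginal f S v) \<partial>leb S)"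
    using S r_pos[OF S]
    by (subst nn_integral_law_restrict[OF f]) (auto intro!: nn_integral_cong simp: ennreal_mult' less_imp_le)
  also have "\<dots> = ennreal (R S)"
    unfolding R_def using r_pos[OF S] marginal_nonneg[OF f]
    by (intro nn_integral_eq_integral[OF int] AE_I2) (auto simp: less_imp_le)
  finally have *: "(\<integral>\<^sup>+x. ennreal (r S (restrict x S)) \<partial>law f) = ennreal (R S)" .
  have "(\<integral>x. r S (restrict x S) \<partial>law f) = R S"
    using S R_pos[OF S] r_pos[OF S] * by (intro integral_eq_nn_integral[THEN trans]) (auto simp: less_imp_le)
  then show ?thesis using R_pos[OF S] by (simp add: rb_eq)
qed

text \<open>Uniform bounds on a function of mean 1 must enclose 1.\<close>

lemma c_C: "c \<le> 1" "1 \<le> C"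
proof -
  obtain S where S: "S \<in> SS" using SS by auto
  have "(\<integral>x. c \<partial>law f) \<le> (\<integral>x. rb S (restrict x S) \<partial>law f)"
    using rbar_bounds[OF S restrict_subspace] by (intro integral_mono integrable_rb[OF S] integrable_const) simp
  moreover have "(\<integral>x. rb S (restrict x S) \<partial>law f) \<le> (\<integral>x. C \<partial>law f)"
    using rbar_bounds[OF S restrict_subspace] by (intro integral_mono integrable_rb[OF S] integrable_const) simp
  ultimately show "c \<le> 1" "1 \<le> C" using expectation_rb[OF S] prob_space by simp_all
qed

text \<open>Moves integrals over an incomplete observation to \<open>law f\<close>, at the price of
  the density ratio \<open>rb\<close>.\<close>

lemma nn_integral_obs:
  assumes S: "S \<in> SS" and [measurable]: "\<phi> \<in> borel_measurable (leb S)"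
  shows "(\<integral>\<^sup>+u. \<phi> u \<partial>density (leb S) (\<lambda>u. ennreal (rb S u * marginal f S u))) =
    (\<integral>\<^sup>+x. ennreal (rb S (restrict x S)) * \<phi> (restrict x S) \<partial>law f)"
proof -
  note [measurable] = nn_integral_law_restrict(2)[OF f, of "\<lambda>_. 0" S]
  have "(\<integral>\<^sup>+u. \<phi> u \<partial>density (leb S) (\<lambda>u. ennreal (rb S u * marginal f S u))) =
     (\<integral>\<^sup>+u. ennreal (rb S u) * \<phi> u * ennreal (marginal f S u) \<partial>leb S)"
    using S rb_pos[OF S] by (subst nn_integral_density)
      (auto intro!: nn_integral_cong simp: ennreal_mult marginal_nonneg[OF f] less_imp_le mult_ac)
  also have "\<dots> = (\<integral>\<^sup>+x. ennreal (rb S (restrict x S)) * \<phi> (restrict x S) \<partial>law f)"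
    using S by (subst nn_integral_law_restrict(1)[OF f]) auto
  finally show ?thesis .
qed

text \<open>The conditional law of the complete vector given its coordinates in \<open>S\<close>.
  Unlike \<open>k S u\<close> it lives on the space of complete vectors, so it can be composed with
  \<open>law f\<close> by \<open>bind\<close>.\<close>

definition ker :: "'d set \<Rightarrow> ('d \<Rightarrow> real) \<Rightarrow> ('d \<Rightarrow> real) measure" where
  "ker S u = distr (k S u) (leb UNIV) (\<lambda>v. merge S (-S) (u, v))"

lemma k_prob:
  assumes "S \<in> SS" "u \<in> subspace_of S"
  shows "prob_space (k S u)" "sets (k S u) = sets (leb (-S))"
proof -
  have "k S u \<in> space (prob_algebra (leb (-S)))"
    using k[OF assms(1)] assms(2) by (intro measurable_space[of "k S" "leb S"]) (auto simp: cond_distribution_def)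
  then show "prob_space (k S u)" "sets (k S u) = sets (leb (-S))" by (auto simp: space_prob_algebra)
qed

lemma merge_measurable:
  assumes "S \<in> SS" "u \<in> subspace_of S"
  shows "(\<lambda>v. merge S (-S) (u, v)) \<in> k S u \<rightarrow>\<^sub>M leb UNIV"
  unfolding measurable_cong_sets[OF k_prob(2)[OF assms] refl]
  using assms by (intro measurable_compose[OF measurable_Pair1' measurable_merge_compl]) auto

lemma ker_measurable [measurable]:
  assumes S: "S \<in> SS" shows "ker S \<in> leb S \<rightarrow>\<^sub>M subprob_algebra (leb UNIV)"
  unfolding ker_def[abs_def]
  using k[OF S] by (intro measurable_distr2[where M="leb (-S)"]) (auto simp: cond_distribution_def intro: measurable_prob_algebraD)

lemma ker_restrict_measurable [measurable]:
  "S \<in> SS \<Longrightarrow> (\<lambda>x. ker S (restrict x S)) \<in> law f \<rightarrow>\<^sub>M subprob_algebra (leb UNIV)"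
  using measurable_compose[OF measurable_restrict_law ker_measurable] .

lemma ker_prob: "S \<in> SS \<Longrightarrow> u \<in> subspace_of S \<Longrightarrow> prob_space (ker S u)"
  unfolding ker_def by (intro prob_space.prob_space_distr k_prob merge_measurable)

text \<open>Both sides are finite measures on a product space, so boxes suffice. A box splits into
  its part in \<open>S\<close>, which becomes an indicator, and its complementary part, for which
  the rectangle identity of \<open>cond_distribution\<close> applies.\<close>

lemma bind_ker: assumes S: "S \<in> SS"
  shows "law f \<bind> (\<lambda>x. ker S (restrict x S)) = law f" (is "?B = _")
proof -
  have sets: "sets ?B = sets (leb UNIV)"
    by (rule sets_bind) (auto intro!: subprob_measurableD(2)[OF ker_restrict_measurable[OF S]])
  interpret B: prob_space ?B
    by (rule prob_space_bind[where S="leb UNIV"]) (auto intro!: AE_I2 ker_prob S ker_restrict_measurable)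
  show ?thesis
  proof (rule measure_eqI_PiM_finite[where I=UNIV and M="\<lambda>_. lborel" and A="\<lambda>_. UNIV"])
    fix A :: "'d \<Rightarrow> real set" assume A: "\<And>i. i \<in> UNIV \<Longrightarrow> A i \<in> sets lborel"
    have A1[measurable]: "Pi\<^sub>E S A \<in> sets (leb S)" and A2[measurable]: "Pi\<^sub>E (-S) A \<in> sets (leb (-S))"
      and A3[measurable]: "Pi\<^sub>E UNIV A \<in> sets (leb UNIV)"
      using A by (auto intro!: sets_PiM_I_finite)
    have box: "merge S (-S) (restrict x S, v) \<in> Pi\<^sub>E UNIV A \<longleftrightarrow> restrict x S \<in> Pi\<^sub>E S A \<and> v \<in> Pi\<^sub>E (-S) A"
      if "v \<in> subspace_of (-S)" for x v
      using that by (auto simp: PiE_iff merge_def extensional_def split: if_splits)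
    have "emeasure ?B (Pi\<^sub>E UNIV A) = (\<integral>\<^sup>+x. emeasure (ker S (restrict x S)) (Pi\<^sub>E UNIV A) \<partial>law f)"
      by (rule emeasure_bind[OF _ ker_restrict_measurable[OF S] A3]) simp
    also have "\<dots> = (\<integral>\<^sup>+x. emeasure (k S (restrict x S)) (Pi\<^sub>E (-S) A) * indicator (Pi\<^sub>E S A) (restrict x S) \<partial>law f)"
    proof (rule nn_integral_cong)
      fix x
      note kp = k_prob[OF S restrict_subspace[of x]]
      have sp: "space (k S (restrict x S)) = subspace_of (-S)" using sets_eq_imp_space_eq[OF kp(2)] by simp
      have "emeasure (ker S (restrict x S)) (Pi\<^sub>E UNIV A) =
          emeasure (k S (restrict x S)) ((\<lambda>v. merge S (-S) (restrict x S, v)) -` Pi\<^sub>E UNIV A \<inter> space (k S (restrict x S)))"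
        unfolding ker_def by (rule emeasure_distr[OF merge_measurable[OF S restrict_subspace] A3])
      also have "(\<lambda>v. merge S (-S) (restrict x S, v)) -` Pi\<^sub>E UNIV A \<inter> space (k S (restrict x S)) =
          (if restrict x S \<in> Pi\<^sub>E S A then Pi\<^sub>E (-S) A else {})"
        unfolding sp using box[of _ x] by (auto simp: PiE_iff simp del: restrict_PiE_iff)
      finally show "emeasure (ker S (restrict x S)) (Pi\<^sub>E UNIV A) =
          emeasure (k S (restrict x S)) (Pi\<^sub>E (-S) A) * indicator (Pi\<^sub>E S A) (restrict x S)"
        by (cases "restrict x S \<in> Pi\<^sub>E S A";
            simp only: if_True if_False indicator_simps emeasure_empty mult_1_right mult_zero_right not_False_eq_True)
    qed
    also have "\<dots> = (\<integral>\<^sup>+u\<in>Pi\<^sub>E S A. emeasure (k S u) (Pi\<^sub>E (-S) A) \<partial>distr (law f) (leb S) (\<lambda>x. restrict x S))"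
    proof -
      have [measurable]: "k S \<in> leb S \<rightarrow>\<^sub>M subprob_algebra (leb (-S))"
        using k[OF S] by (auto simp: cond_distribution_def intro: measurable_prob_algebraD)
      show ?thesis by (subst nn_integral_distr) auto
    qed
    also have "\<dots> = emeasure (law f) {x. restrict x S \<in> Pi\<^sub>E S A \<and> restrict x (-S) \<in> Pi\<^sub>E (-S) A}"
      by (rule k[OF S, unfolded cond_distribution_def, THEN conjunct2, rule_format, OF A1 A2, symmetric])
    also have "{x. restrict x S \<in> Pi\<^sub>E S A \<and> restrict x (-S) \<in> Pi\<^sub>E (-S) A} = Pi\<^sub>E UNIV A"
      by (auto simp: PiE_iff restrict_def extensional_def)
    finally show "emeasure ?B (Pi\<^sub>E UNIV A) = emeasure (law f) (Pi\<^sub>E UNIV A)" .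
  next
    have "(\<Pi>\<^sub>E i\<in>(UNIV :: 'd set). UNIV) \<in> prod_algebra UNIV (\<lambda>_. lborel :: real measure)"
      by (rule prod_algebraI_finite) auto
    then show "range (\<lambda>_. UNIV :: ('d \<Rightarrow> real) set) \<subseteq> prod_algebra UNIV (\<lambda>_. lborel)" by auto
  next
    show "emeasure ?B UNIV \<noteq> \<infinity>" using B.emeasure_finite[of UNIV] by simp
  qed (use sets in \<open>simp_all add: space_PiM\<close>)
qed

text \<open>A version of the conditional expectation of \<open>g\<close> given the coordinates in
  \<open>S\<close>, fixed at every \<open>u\<close> and not merely almost everywhere: the Hoelder
  comparisons between two points need this.\<close>

definition cmean :: "'d set \<Rightarrow> (('d \<Rightarrow> real) \<Rightarrow> real) \<Rightarrow> ('d \<Rightarrow> real) \<Rightarrow> real" where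
  "cmean S g u = (\<integral>v. g (merge S (-S) (u, v)) \<partial>k S u)"

lemma cmean_eq_ker:
  assumes "S \<in> SS" "u \<in> subspace_of S" "g \<in> borel_measurable (leb UNIV)"
  shows "cmean S g u = (\<integral>x. g x \<partial>ker S u)"
  unfolding ker_def cmean_def using assms by (subst integral_distr[OF merge_measurable]) auto

lemma cmean_measurable [measurable]:
  assumes "S \<in> SS" "g \<in> borel_measurable (leb UNIV)"
  shows "cmean S g \<in> borel_measurable (leb S)"
  using measurable_compose[OF ker_measurable[OF assms(1)] integral_measurable_subprob_algebra[OF assms(2)]]
  by (subst measurable_cong[OF cmean_eq_ker]) (use assms in auto)

lemma cmean_bound:
  assumes "S \<in> SS" "u \<in> subspace_of S" "g \<in> borel_measurable (leb UNIV)" "\<And>x. \<bar>g x\<bar> \<le> K"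
  shows "\<bar>cmean S g u\<bar> \<le> K"
proof -
  interpret kS: prob_space "k S u" by (rule k_prob) fact+
  have m: "(\<lambda>v. g (merge S (-S) (u, v))) \<in> borel_measurable (k S u)"
    using measurable_compose[OF merge_measurable[OF assms(1,2)] assms(3)] .
  have "\<bar>cmean S g u\<bar> \<le> (\<integral>v. \<bar>g (merge S (-S) (u, v))\<bar> \<partial>k S u)"
    unfolding cmean_def by (rule integral_abs_bound)
  also have "\<dots> \<le> (\<integral>v. K \<partial>k S u)"
    using assms(4) order_trans[OF abs_ge_zero assms(4)] m by (intro integral_mono kS.integrable_const_bound[of _ K]) auto
  finally show ?thesis by (simp add: kS.prob_space)
qed

text \<open>The tower property: \<open>law f\<close> is resampled through \<open>ker\<close>, which
  leaves the coordinates in \<open>S\<close> unchanged, so the factor \<open>\<phi>\<close> comes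
  out of the inner integral.\<close>

lemma cmean_orthogonal_bounded:
  assumes S: "S \<in> SS" and g[measurable]: "g \<in> borel_measurable (leb UNIV)" and gK: "\<And>x. \<bar>g x\<bar> \<le> K"
    and \<phi>[measurable]: "\<phi> \<in> borel_measurable (leb S)" and \<phi>K: "\<And>u. u \<in> subspace_of S \<Longrightarrow> \<bar>\<phi> u\<bar> \<le> K'"
  shows "(\<integral>x. \<phi> (restrict x S) * g x \<partial>law f) = (\<integral>x. \<phi> (restrict x S) * cmean S g (restrict x S) \<partial>law f)"
proof -
  have "(\<integral>x. \<phi> (restrict x S) * g x \<partial>law f) =
      (\<integral>x. \<phi> (restrict x S) * g x \<partial>(law f \<bind> (\<lambda>x. ker S (restrict x S))))"
    by (simp add: bind_ker[OF S])
  also have "\<dots> = (\<integral>x. \<integral>y. \<phi> (restrict y S) * g y \<partial>ker S (restrict x S) \<partial>law f)"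
  proof (rule integral_bind[where K="leb UNIV" and B="K' * K" and B'=1])
    show "\<bar>\<phi> (restrict x S) * g x\<bar> \<le> K' * K" for x
      unfolding abs_mult using \<phi>K[OF restrict_subspace[of x]] gK[of x]
      by (intro mult_mono) (auto intro: order_trans[OF abs_ge_zero])
    show "AE x in law f. emeasure (ker S (restrict x S)) (space (ker S (restrict x S))) \<le> ennreal 1"
      using prob_space.emeasure_space_1[OF ker_prob[OF S restrict_subspace]] by simp
  qed (use S in \<open>auto intro: finite_measure_axioms\<close>)
  also have "\<dots> = (\<integral>x. \<phi> (restrict x S) * cmean S g (restrict x S) \<partial>law f)"
  proof (rule Bochner_Integration.integral_cong[OF refl])
    fix x
    have "(\<integral>y. \<phi> (restrict y S) * g y \<partial>ker S (restrict x S)) =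
        (\<integral>v. \<phi> (restrict x S) * g (merge S (-S) (restrict x S, v)) \<partial>k S (restrict x S))"
      unfolding ker_def by (subst integral_distr[OF merge_measurable[OF S restrict_subspace]]) auto
    then show "(\<integral>y. \<phi> (restrict y S) * g y \<partial>ker S (restrict x S)) = \<phi> (restrict x S) * cmean S g (restrict x S)"
      by (simp add: cmean_def)
  qed
  finally show ?thesis .
qed

text \<open>Square-integrable test functions are reached by truncation.\<close>

lemma cmean_orthogonal:
  assumes S: "S \<in> SS" and g[measurable]: "g \<in> borel_measurable (leb UNIV)" and gK: "\<And>x. \<bar>g x\<bar> \<le> K"
    and \<phi>[measurable]: "\<phi> \<in> borel_measurable (leb S)" and \<phi>i: "integrable (law f) (\<lambda>x. \<phi> (restrict x S))"
  shows "(\<integral>x. \<phi> (restrict x S) * (g x - cmean S g (restrict x S)) \<partial>law f) = 0"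
proof -
  note [measurable] = cmean_measurable[OF S g]
  define \<phi>n where "\<phi>n n u = max (- real n) (min (real n) (\<phi> u))" for n u
  have [measurable]: "\<phi>n n \<in> borel_measurable (leb S)" for n unfolding \<phi>n_def by measurable
  have b: "\<bar>g x - cmean S g (restrict x S)\<bar> \<le> 2 * K" for x
    using gK[of x] cmean_bound[OF S restrict_subspace g gK, of x] by linarith
  have zero: "(\<integral>x. \<phi>n n (restrict x S) * (g x - cmean S g (restrict x S)) \<partial>law f) = 0" for n
  proof -
    have \<phi>nb: "\<bar>\<phi>n n u\<bar> \<le> real n" for u unfolding \<phi>n_def by auto
    have K: "0 \<le> K" using gK[of undefined] by linarith
    have "integrable (law f) (\<lambda>x. \<phi>n n (restrict x S) * g x)"
      by (rule integrable_bounded[of _ "real n * K"]) (auto simp: abs_mult intro!: mult_mono \<phi>nb gK)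
    moreover have "integrable (law f) (\<lambda>x. \<phi>n n (restrict x S) * cmean S g (restrict x S))"
      by (rule integrable_bounded[of _ "real n * K"])
        (auto simp: abs_mult intro!: mult_mono \<phi>nb cmean_bound S gK)
    ultimately show ?thesis
      using cmean_orthogonal_bounded[OF S g gK, of "\<phi>n n" "real n"] \<phi>nb by (simp add: right_diff_distrib)
  qed
  have "(\<lambda>n. \<integral>x. \<phi>n n (restrict x S) * (g x - cmean S g (restrict x S)) \<partial>law f) \<longlonglongrightarrow>
      (\<integral>x. \<phi> (restrict x S) * (g x - cmean S g (restrict x S)) \<partial>law f)"
  proof (rule integral_dominated_convergence[where w="\<lambda>x. \<bar>\<phi> (restrict x S)\<bar> * (2 * K)"])
    show "AE x in law f. (\<lambda>n. \<phi>n n (restrict x S) * (g x - cmean S g (restrict x S))) \<longlonglongrightarrow>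
        \<phi> (restrict x S) * (g x - cmean S g (restrict x S))"
    proof (intro AE_I2 tendsto_mult_right tendsto_eventually)
      fix x
      obtain N :: nat where N: "\<bar>\<phi> (restrict x S)\<bar> \<le> real N" using real_arch_simple by blast
      show "\<forall>\<^sub>F n in sequentially. \<phi>n n (restrict x S) = \<phi> (restrict x S)"
        using eventually_ge_at_top[of N] by eventually_elim (use N in \<open>auto simp: \<phi>n_def\<close>)
    qed
    show "AE x in law f. norm (\<phi>n n (restrict x S) * (g x - cmean S g (restrict x S))) \<le> \<bar>\<phi> (restrict x S)\<bar> * (2 * K)" for n
      using b by (auto simp: abs_mult \<phi>n_def intro!: mult_mono)
  qed (use \<phi>i in auto)
  then show ?thesis by (simp add: zero LIMSEQ_const_iff)
qed

end

subsection \<open>Block coordinate descent for the objective\<close>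

lemma abs_le_imp_square_le: "\<bar>x\<bar> \<le> K \<Longrightarrow> x\<^sup>2 \<le> (K::real)\<^sup>2"
  using power_mono[of "\<bar>x\<bar>" K 2] by simp

lemma integrable_times_bounded:
  fixes p q :: "'a \<Rightarrow> real"
  assumes "integrable M p" "q \<in> borel_measurable M" "\<And>x. x \<in> space M \<Longrightarrow> \<bar>q x\<bar> \<le> K"
  shows "integrable M (\<lambda>x. p x * q x)"
proof (rule Bochner_Integration.integrable_bound)
  show "integrable M (\<lambda>x. p x * K)" using assms(1) by simp
  show "AE x in M. norm (p x * q x) \<le> norm (p x * K)"
  proof (rule AE_I2)
    fix x assume "x \<in> space M"
    then have "\<bar>q x\<bar> \<le> \<bar>K\<bar>" using assms(3)[of x] by linarith
    then have "\<bar>p x\<bar> * \<bar>q x\<bar> \<le> \<bar>p x\<bar> * \<bar>K\<bar>" by (intro mult_left_mono) auto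
    then show "norm (p x * q x) \<le> norm (p x * K)" by (simp only: real_norm_def abs_mult)
  qed
qed (use assms in auto)

context missing_data
begin

text \<open>The limit of \<open>w_hat\<close> after cancelling \<open>R S\<close>. In block
  \<open>S\<close> the objective has second-order coefficient 1 + \<open>iv S\<close>, and this
  weight is its reciprocal.\<close>

definition wt :: "'d set \<Rightarrow> ('d \<Rightarrow> real) \<Rightarrow> real" where
  "wt S u = lam S * rb S u / (1 + lam S * rb S u)"

text \<open>The Lagrange multiplier of the centring constraint: minimising the mean of (g -
  \<alpha>)^2 + iv \<alpha>^2 over centred functions \<alpha> of the coordinates in \<open>S\<close>
  gives \<open>wt S\<close> times the conditional mean of g minus a constant, and centring
  determines that constant.\<close>

definition wmean :: "'d set \<Rightarrow> (('d \<Rightarrow> real) \<Rightarrow> real) \<Rightarrow> real" where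
  "wmean S g = expectation (\<lambda>x. wt S (restrict x S) * g x) / expectation (\<lambda>x. wt S (restrict x S))"

text \<open>The infinite-sample version of \<open>alpha_hat\<close>, without truncation to the cube.\<close>

primrec pop :: "nat \<Rightarrow> 'd set \<Rightarrow> ('d \<Rightarrow> real) \<Rightarrow> real" where
  "pop 0 = (\<lambda>S u. 0)"
| "pop (Suc m) = (\<lambda>S u. (1 - 1 / real (card SS)) * pop m S u + 1 / real (card SS) * wt S u *
      (cmean S (residual SS a (pop m) S) u - wmean S (residual SS a (pop m) S)))"

text \<open>The weight of the penalty term of the objective, which is the price of estimating the
  mean of a block from the incomplete sample.\<close>

definition iv :: "'d set \<Rightarrow> ('d \<Rightarrow> real) \<Rightarrow> real" where "iv S u = 1 / (lam S * rb S u)"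

lemma lam_rb_pos: "S \<in> SS \<Longrightarrow> u \<in> subspace_of S \<Longrightarrow> 0 < lam S * rb S u"
  using lam_pos rb_pos by simp

lemma wt_measurable [measurable]: "S \<in> SS \<Longrightarrow> wt S \<in> borel_measurable (leb S)"
  unfolding wt_def[abs_def] by simp

lemma iv_measurable [measurable]: "S \<in> SS \<Longrightarrow> iv S \<in> borel_measurable (leb S)"
  unfolding iv_def[abs_def] by simp

lemma wt_bounds: assumes "S \<in> SS" "u \<in> subspace_of S" shows "0 < wt S u" "wt S u \<le> 1"
  using lam_rb_pos[OF assms] by (auto simp: wt_def)

lemma iv_bounds: assumes "S \<in> SS" "u \<in> subspace_of S" shows "0 < iv S u" "iv S u \<le> 1 / (lam S * c)"
  using lam_rb_pos[OF assms] lam_pos[OF assms(1)] rbar_bounds[OF assms] c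
  by (auto simp: iv_def intro!: divide_left_mono)

lemma inverse_wt: assumes "S \<in> SS" "u \<in> subspace_of S" shows "1 / wt S u = 1 + iv S u"
  using lam_rb_pos[OF assms] lam_pos[OF assms(1)] rb_pos[OF assms] by (simp add: wt_def iv_def add_divide_distrib)

lemma wt_ge:
  assumes "S \<in> SS" "u \<in> subspace_of S" shows "lam S * c / (1 + lam S * C) \<le> wt S u"
proof -
  have "0 < lam S * rb S u" "lam S * c \<le> lam S * rb S u" "lam S * rb S u \<le> lam S * C"
    using lam_rb_pos[OF assms] lam_pos[OF assms(1)] rbar_bounds[OF assms] by auto
  then show ?thesis unfolding wt_def by (intro frac_le) linarith+
qed

lemma integrable_wt: "S \<in> SS \<Longrightarrow> integrable (law f) (\<lambda>x. wt S (restrict x S))"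
  using wt_bounds[OF _ restrict_subspace] by (intro integrable_bounded[of _ 1]) (auto simp: abs_of_pos)

lemma expectation_wt_pos: assumes S: "S \<in> SS" shows "0 < expectation (\<lambda>x. wt S (restrict x S))"
proof -
  have "(\<integral>x. lam S * c / (1 + lam S * C) \<partial>law f) \<le> expectation (\<lambda>x. wt S (restrict x S))"
    using wt_ge[OF S restrict_subspace] by (intro integral_mono integrable_wt[OF S] integrable_const) simp
  moreover have "0 < lam S * c / (1 + lam S * C)"
    using lam_pos[OF S] c c_C by (auto intro!: divide_pos_pos add_pos_pos mult_pos_pos)
  ultimately show ?thesis using prob_space by simp
qed

lemma wmean_bound:
  assumes S: "S \<in> SS" and g[measurable]: "g \<in> borel_measurable (leb UNIV)" and gK: "\<And>x. \<bar>g x\<bar> \<le> K"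
  shows "\<bar>wmean S g\<bar> \<le> K"
proof -
  have w: "0 < wt S (restrict x S)" for x by (rule wt_bounds(1)[OF S restrict_subspace])
  have int: "integrable (law f) (\<lambda>x. wt S (restrict x S) * \<bar>g x\<bar>)"
    by (rule integrable_times_bounded[OF integrable_wt[OF S], where K=K]) (use gK in auto)
  have "\<bar>expectation (\<lambda>x. wt S (restrict x S) * g x)\<bar> \<le> expectation (\<lambda>x. \<bar>wt S (restrict x S) * g x\<bar>)"
    by (rule integral_abs_bound)
  also have "\<dots> = expectation (\<lambda>x. wt S (restrict x S) * \<bar>g x\<bar>)" using w by (simp add: abs_mult abs_of_pos)
  also have "\<dots> \<le> expectation (\<lambda>x. wt S (restrict x S) * K)"
    using w gK by (intro integral_mono int integrable_mult_left integrable_wt[OF S] mult_left_mono) (auto simp: less_imp_le)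
  also have "\<dots> = expectation (\<lambda>x. wt S (restrict x S)) * K" by simp
  finally show ?thesis using expectation_wt_pos[OF S] unfolding wmean_def
    by (simp add: abs_of_pos pos_divide_le_eq mult.commute)
qed

lemma residual_measurable:
  assumes "\<And>S. S \<in> SS \<Longrightarrow> \<alpha> S \<in> borel_measurable (leb S)"
  shows "residual SS a \<alpha> S \<in> borel_measurable (leb UNIV)"
  unfolding residual_def[abs_def] using assms by measurable

lemma residual_bound:
  assumes "S \<in> SS" "\<And>S u. S \<in> SS \<Longrightarrow> u \<in> subspace_of S \<Longrightarrow> \<bar>\<alpha> S u\<bar> \<le> K"
  shows "\<bar>residual SS a \<alpha> S x\<bar> \<le> na + (real (card SS) - 1) * K"
proof -
  have "\<bar>\<Sum>S'\<in>SS - {S}. \<alpha> S' (restrict x S')\<bar> \<le> (\<Sum>S'\<in>SS - {S}. K)"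
    using assms by (intro order_trans[OF sum_abs] sum_mono) auto
  also have "\<dots> = (real (card SS) - 1) * K"
    using assms(1) card_SS by (simp add: of_nat_diff)
  finally show ?thesis using a_bound[of x] unfolding residual_def by linarith
qed

lemma pop_measurable [measurable]: "S \<in> SS \<Longrightarrow> pop m S \<in> borel_measurable (leb S)"
proof (induction m arbitrary: S)
  case (Suc m)
  note [measurable] = cmean_measurable[OF Suc.prems residual_measurable[OF Suc.IH]] Suc.IH[OF Suc.prems]
  show ?case using Suc.prems by simp
qed simp

lemma pop_residual_measurable [measurable]: "residual SS a (pop m) S \<in> borel_measurable (leb UNIV)"
  by (rule residual_measurable) (rule pop_measurable)

text \<open>The two bounds support each other. A step adds at most
  \<open>2 * na * 3 ^ m / card SS\<close> to a block, and 3^m - 1 + 2 * 3^m = 3^(m+1) - 1; adding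
  \<open>na\<close> to the contributions of the other blocks gives the bound on the residual.
  Bounded residuals are what all later uses of \<open>cmean\<close> and \<open>wmean\<close> rely
  on.\<close>

lemma pop_bound:
  "S \<in> SS \<Longrightarrow> u \<in> subspace_of S \<Longrightarrow> \<bar>pop m S u\<bar> \<le> na * (3 ^ m - 1) / real (card SS)"
  "S \<in> SS \<Longrightarrow> \<bar>residual SS a (pop m) S x\<bar> \<le> na * 3 ^ m"
proof (induction m arbitrary: S u x)
  case 0
  { case 1 show ?case by simp }
  { case 2 show ?case using a_bound by (simp add: residual_def) }
next
  case (Suc m)
  let ?N = "real (card SS)" and ?g = "residual SS a (pop m)"
  have N: "1 \<le> ?N" by (rule card_SS)
  have step: "\<bar>pop (Suc m) S u\<bar> \<le> na * (3 ^ Suc m - 1) / ?N" if S: "S \<in> SS" and u: "u \<in> subspace_of S" for S u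
  proof -
    have g: "\<bar>?g S x\<bar> \<le> na * 3 ^ m" for x using Suc.IH(2)[OF S] .
    have d: "\<bar>cmean S (?g S) u - wmean S (?g S)\<bar> \<le> 2 * (na * 3 ^ m)"
      using cmean_bound[OF S u pop_residual_measurable g] wmean_bound[OF S pop_residual_measurable g] by linarith
    have wd: "\<bar>wt S u * (cmean S (?g S) u - wmean S (?g S))\<bar> \<le> 1 * (2 * (na * 3 ^ m))"
      unfolding abs_mult using d wt_bounds[OF S u] by (intro mult_mono) auto
    have p: "\<bar>pop m S u\<bar> \<le> na * (3 ^ m - 1) / ?N" using Suc.IH(1)[OF S u] .
    have "\<bar>pop (Suc m) S u\<bar> \<le> (1 - 1 / ?N) * \<bar>pop m S u\<bar> + 1 / ?N * \<bar>wt S u * (cmean S (?g S) u - wmean S (?g S))\<bar>"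
    proof -
      have "\<bar>pop (Suc m) S u\<bar> \<le> \<bar>(1 - 1 / ?N) * pop m S u\<bar> + \<bar>1 / ?N * (wt S u * (cmean S (?g S) u - wmean S (?g S)))\<bar>"
        unfolding pop.simps mult.assoc by (rule abs_triangle_ineq)
      then show ?thesis using N by (simp add: abs_mult)
    qed
    also have "\<dots> \<le> 1 * (na * (3 ^ m - 1) / ?N) + 1 / ?N * (1 * (2 * (na * 3 ^ m)))"
      using N p wd na_nonneg by (intro add_mono mult_mono) auto
    also have "\<dots> = na * (3 ^ Suc m - 1) / ?N"
      by (simp add: add_divide_distrib[symmetric] algebra_simps)
    finally show ?thesis .
  qed
  { case 1 then show ?case by (rule step) }
  { case 2
    have "\<bar>residual SS a (pop (Suc m)) S u\<bar> \<le> na + (?N - 1) * (na * (3 ^ Suc m - 1) / ?N)"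
      using 2 step by (rule residual_bound)
    also have "\<dots> \<le> na + ?N * (na * (3 ^ Suc m - 1) / ?N)"
    proof -
      have "(1::real) \<le> 3 ^ Suc m" by (rule one_le_power) simp
      then have "0 \<le> na * (3 ^ Suc m - 1) / ?N" using na_nonneg N by auto
      then show ?thesis by (intro add_left_mono mult_right_mono) auto
    qed
    also have "\<dots> = na * 3 ^ Suc m"
      using N by (subst times_divide_eq_right, subst nonzero_mult_div_cancel_left) (auto simp: right_diff_distrib)
    finally show ?case . }
qed

definition rho :: "nat \<Rightarrow> 'd set \<Rightarrow> ('d \<Rightarrow> real) \<Rightarrow> real" where
  "rho m S u = wt S u * (cmean S (residual SS a (pop m) S) u - wmean S (residual SS a (pop m) S)) - pop m S u"

lemma pop_Suc: "pop (Suc m) S u = pop m S u + rho m S u / real (card SS)"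
  by (simp add: rho_def algebra_simps add_divide_distrib diff_divide_distrib)

lemma rho_measurable [measurable]: "S \<in> SS \<Longrightarrow> rho m S \<in> borel_measurable (leb S)"
  unfolding rho_def[abs_def] using cmean_measurable[of S "residual SS a (pop m) S"] by simp

lemma rho_bound:
  assumes S: "S \<in> SS" and u: "u \<in> subspace_of S"
  shows "\<bar>rho m S u\<bar> \<le> 3 * (na * 3 ^ m)"
proof -
  have g: "\<bar>residual SS a (pop m) S x\<bar> \<le> na * 3 ^ m" for x using pop_bound(2)[OF S] .
  have d: "\<bar>cmean S (residual SS a (pop m) S) u - wmean S (residual SS a (pop m) S)\<bar> \<le> 2 * (na * 3 ^ m)"
    using cmean_bound[OF S u pop_residual_measurable g] wmean_bound[OF S pop_residual_measurable g] by linarith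
  have wd: "\<bar>wt S u * (cmean S (residual SS a (pop m) S) u - wmean S (residual SS a (pop m) S))\<bar> \<le> 1 * (2 * (na * 3 ^ m))"
    unfolding abs_mult using d wt_bounds[OF S u] by (intro mult_mono) auto
  have "na * (3 ^ m - 1) / real (card SS) \<le> na * (3 ^ m - 1) / 1"
    using card_SS na_nonneg by (intro divide_left_mono) (auto intro!: mult_nonneg_nonneg)
  also have "\<dots> \<le> na * 3 ^ m" using na_nonneg by (simp add: algebra_simps)
  finally show ?thesis using wd pop_bound(1)[OF S u, of m] unfolding rho_def by linarith
qed

lemma H_spaceD:
  assumes "\<alpha> \<in> H_space f S"
  shows "\<alpha> \<in> borel_measurable (leb S)" "integrable (law f) (\<lambda>x. (\<alpha> (restrict x S))\<^sup>2)"
    "integrable (law f) (\<lambda>x. \<alpha> (restrict x S))" "expectation (\<lambda>x. \<alpha> (restrict x S)) = 0"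
proof -
  show m[measurable]: "\<alpha> \<in> borel_measurable (leb S)" using assms by (auto simp: H_space_def)
  show sq: "integrable (law f) (\<lambda>x. (\<alpha> (restrict x S))\<^sup>2)"
    and "expectation (\<lambda>x. \<alpha> (restrict x S)) = 0" using assms by (auto simp: H_space_def)
  show "integrable (law f) (\<lambda>x. \<alpha> (restrict x S))"
    by (rule integrable_of_square_integrable[OF _ sq]) measurable
qed

lemma H_space_bounded:
  assumes "S \<in> SS" "\<alpha> \<in> borel_measurable (leb S)" "\<And>u. u \<in> subspace_of S \<Longrightarrow> \<bar>\<alpha> u\<bar> \<le> K"
    "expectation (\<lambda>x. \<alpha> (restrict x S)) = 0"
  shows "\<alpha> \<in> H_space f S"
proof -
  have "integrable (law f) (\<lambda>x. (\<alpha> (restrict x S))\<^sup>2)"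
    using assms(1,2) abs_le_imp_square_le[OF assms(3)[OF restrict_subspace]]
    by (intro integrable_bounded[of _ "K\<^sup>2"]) simp_all
  then show ?thesis using assms by (simp add: H_space_def)
qed

text \<open>Subtracting \<open>wmean\<close> keeps every block centred: under the weight
  \<open>wt S\<close> the conditional mean may be exchanged for the residual itself, whose weighted
  mean is \<open>wmean\<close> times the mean weight.\<close>

lemma pop_H_space: "S \<in> SS \<Longrightarrow> pop m S \<in> H_space f S"
  and rho_H_space: "S \<in> SS \<Longrightarrow> rho m S \<in> H_space f S"
proof -
  have rho0: "expectation (\<lambda>x. rho m S (restrict x S)) = 0"
    if S: "S \<in> SS" and pop0: "expectation (\<lambda>x. pop m S (restrict x S)) = 0" for m S
  proof -
    let ?g = "residual SS a (pop m) S"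
    note [measurable] = cmean_measurable[OF S pop_residual_measurable[of m S]] wt_measurable[OF S]
    have gb: "\<bar>?g x\<bar> \<le> na * 3 ^ m" for x using pop_bound(2)[OF S] .
    have i1: "integrable (law f) (\<lambda>x. wt S (restrict x S) * ?g x)"
      by (rule integrable_times_bounded[OF integrable_wt[OF S], where K="na * 3 ^ m"]) (use gb in auto)
    have i2: "integrable (law f) (\<lambda>x. wt S (restrict x S) * cmean S ?g (restrict x S))"
      by (rule integrable_times_bounded[OF integrable_wt[OF S], where K="na * 3 ^ m"])
        (use cmean_bound[OF S restrict_subspace pop_residual_measurable gb] in auto)
    have i3: "integrable (law f) (\<lambda>x. pop m S (restrict x S))"
      by (rule integrable_bounded[OF _ pop_bound(1)[OF S restrict_subspace]]) (use S in auto)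
    have "expectation (\<lambda>x. wt S (restrict x S) * (?g x - cmean S ?g (restrict x S))) = 0"
      by (rule cmean_orthogonal[OF S pop_residual_measurable gb wt_measurable[OF S] integrable_wt[OF S]])
    then have "expectation (\<lambda>x. wt S (restrict x S) * cmean S ?g (restrict x S)) =
        expectation (\<lambda>x. wt S (restrict x S) * ?g x)"
      using i1 i2 by (simp add: right_diff_distrib)
    also have "\<dots> = wmean S ?g * expectation (\<lambda>x. wt S (restrict x S))"
      using expectation_wt_pos[OF S] by (simp add: wmean_def)
    finally show ?thesis
      unfolding rho_def using i2 i3 integrable_wt[OF S] pop0 by (simp add: right_diff_distrib)
  qed
  have pop0: "S \<in> SS \<Longrightarrow> expectation (\<lambda>x. pop m S (restrict x S)) = 0" for m S
  proof (induction m)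
    case (Suc m)
    have "integrable (law f) (\<lambda>x. pop m S (restrict x S))"
      by (rule integrable_bounded[OF _ pop_bound(1)[OF Suc.prems restrict_subspace]]) (use Suc.prems in auto)
    moreover have "integrable (law f) (\<lambda>x. rho m S (restrict x S))"
      by (rule integrable_bounded[OF _ rho_bound[OF Suc.prems restrict_subspace]]) (use Suc.prems in auto)
    ultimately have "expectation (\<lambda>x. pop (Suc m) S (restrict x S)) =
        expectation (\<lambda>x. pop m S (restrict x S)) + expectation (\<lambda>x. rho m S (restrict x S)) / real (card SS)"
      unfolding pop_Suc by simp
    then show ?case
      by (simp only: Suc.IH[OF Suc.prems] rho0[OF Suc.prems Suc.IH[OF Suc.prems]] add_0 div_0)
  qed simp
  show "pop m S \<in> H_space f S" if "S \<in> SS" using that pop0[OF that] pop_bound(1)[OF that]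
    by (intro H_space_bounded) auto
  show "rho m S \<in> H_space f S" if "S \<in> SS" using that rho0[OF that pop0[OF that]] rho_bound[OF that]
    by (intro H_space_bounded) auto
qed

abbreviation obj :: "('d set \<Rightarrow> ('d \<Rightarrow> real) \<Rightarrow> real) \<Rightarrow> real" where "obj \<equiv> objective f a r SS lam"

text \<open>The mean of \<open>a\<close> is removed here, so that for centred blocks the second
  moment of this function is the variance in the objective.\<close>

definition centred :: "('d set \<Rightarrow> ('d \<Rightarrow> real) \<Rightarrow> real) \<Rightarrow> ('d \<Rightarrow> real) \<Rightarrow> real" where
  "centred \<alpha> x = a x - expectation a - (\<Sum>S\<in>SS. \<alpha> S (restrict x S))"

lemma integrable_a: "integrable (law f) a"
  by (rule integrable_bounded[OF a_meas a_bound])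

lemma obj_eq:
  assumes "\<And>S. S \<in> SS \<Longrightarrow> \<alpha> S \<in> H_space f S"
  shows "obj \<alpha> = expectation (\<lambda>x. (centred \<alpha> x)\<^sup>2) + (\<Sum>S\<in>SS. expectation (\<lambda>x. (\<alpha> S (restrict x S))\<^sup>2 * iv S (restrict x S)))"
proof -
  have "expectation (\<lambda>x. a x - (\<Sum>S\<in>SS. \<alpha> S (restrict x S))) = expectation a"
    using integrable_a H_spaceD[OF assms] by (simp add: Bochner_Integration.integral_sum)
  then show ?thesis by (simp add: objective_def centred_def iv_def algebra_simps)
qed

lemma integrable_iv: "S \<in> SS \<Longrightarrow> integrable (law f) p \<Longrightarrow> integrable (law f) (\<lambda>x. p x * iv S (restrict x S))"
  using iv_bounds[OF _ restrict_subspace, of S]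
  by (intro integrable_times_bounded[where K="1 / (lam S * c)"]) (auto simp: abs_of_pos)

lemma centred_square_integrable:
  assumes "\<And>S. S \<in> SS \<Longrightarrow> \<alpha> S \<in> H_space f S"
  shows "integrable (law f) (\<lambda>x. (centred \<alpha> x)\<^sup>2)" "centred \<alpha> \<in> borel_measurable (leb UNIV)"
proof -
  note [measurable] = H_spaceD(1)[OF assms]
  have [measurable]: "(\<lambda>x. \<Sum>S\<in>SS. \<alpha> S (restrict x S)) \<in> borel_measurable (leb UNIV)" by measurable
  show "centred \<alpha> \<in> borel_measurable (leb UNIV)" unfolding centred_def[abs_def] by measurable
  have i1: "integrable (law f) (\<lambda>x. (a x - expectation a)\<^sup>2)"
  proof (rule integrable_bounded)
    fix x
    have "\<bar>a x - expectation a\<bar> \<le> na + \<bar>expectation a\<bar>" using a_bound[of x] by linarith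
    then show "\<bar>(a x - expectation a)\<^sup>2\<bar> \<le> (na + \<bar>expectation a\<bar>)\<^sup>2" using abs_le_imp_square_le by simp
  qed simp
  have pr: "integrable (law f) (\<lambda>x. \<alpha> S (restrict x S) * \<alpha> S' (restrict x S'))" if "S \<in> SS" "S' \<in> SS" for S S'
    using that H_spaceD(1,2)[OF assms] by (intro integrable_mult_of_square_integrable) auto
  have i2: "integrable (law f) (\<lambda>x. (\<Sum>S\<in>SS. \<alpha> S (restrict x S))\<^sup>2)"
    unfolding power2_eq_square sum_product using pr by auto
  have i3: "integrable (law f) (\<lambda>x. (a x - expectation a) * (\<Sum>S\<in>SS. \<alpha> S (restrict x S)))"
    by (rule integrable_mult_of_square_integrable[OF _ _ i1 i2]) auto
  have "(centred \<alpha> x)\<^sup>2 = (a x - expectation a)\<^sup>2 + (\<Sum>S\<in>SS. \<alpha> S (restrict x S))\<^sup>2 - 2 * ((a x - expectation a) * (\<Sum>S\<in>SS. \<alpha> S (restrict x S)))" for x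
    by (simp add: centred_def power2_diff)
  then show "integrable (law f) (\<lambda>x. (centred \<alpha> x)\<^sup>2)" using i1 i2 i3 by simp
qed

text \<open>Expansion of the quadratic functional around a bounded point; \<open>\<rho>\<close> is the direction of the exact blockwise update.\<close>

lemma obj_perturb:
  assumes \<alpha>: "\<And>S. S \<in> SS \<Longrightarrow> \<alpha> S \<in> H_space f S" and d: "\<And>S. S \<in> SS \<Longrightarrow> d S \<in> H_space f S"
    and \<alpha>K: "\<And>S u. S \<in> SS \<Longrightarrow> u \<in> subspace_of S \<Longrightarrow> \<bar>\<alpha> S u\<bar> \<le> K"
    and \<rho>: "\<And>S u. \<rho> S u = wt S u * (cmean S (residual SS a \<alpha> S) u - wmean S (residual SS a \<alpha> S)) - \<alpha> S u"
  shows "obj (\<lambda>S u. \<alpha> S u + d S u) = obj \<alpha>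
     - 2 * (\<Sum>S\<in>SS. expectation (\<lambda>x. d S (restrict x S) * \<rho> S (restrict x S) * (1 + iv S (restrict x S))))
     + expectation (\<lambda>x. (\<Sum>S\<in>SS. d S (restrict x S))\<^sup>2)
     + (\<Sum>S\<in>SS. expectation (\<lambda>x. (d S (restrict x S))\<^sup>2 * iv S (restrict x S)))"
proof -
  let ?E = expectation and ?D = "\<lambda>x. \<Sum>S\<in>SS. d S (restrict x S)"
  note [measurable] = H_spaceD(1)[OF \<alpha>] H_spaceD(1)[OF d]
  have [measurable]: "?D \<in> borel_measurable (leb UNIV)" by measurable
  have ad: "integrable (law f) (\<lambda>x. \<alpha> S (restrict x S) * d S (restrict x S))" if "S \<in> SS" for S
    using that H_spaceD(1,2)[OF \<alpha>] H_spaceD(1,2)[OF d] by (intro integrable_mult_of_square_integrable) auto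
  have dd: "integrable (law f) (\<lambda>x. d S (restrict x S) * d S' (restrict x S'))" if "S \<in> SS" "S' \<in> SS" for S S'
    using that H_spaceD(1,2)[OF d] by (intro integrable_mult_of_square_integrable) auto
  have DD: "integrable (law f) (\<lambda>x. (?D x)\<^sup>2)"
    unfolding power2_eq_square sum_product using dd by auto
  have cd: "integrable (law f) (\<lambda>x. centred \<alpha> x * d S (restrict x S))" if "S \<in> SS" for S
    using centred_square_integrable[OF \<alpha>] H_spaceD(2)[OF d[OF that]] that
    by (intro integrable_mult_of_square_integrable) auto
  have sumH: "(\<lambda>u. \<alpha> S u + d S u) \<in> H_space f S" if "S \<in> SS" for S
  proof -
    have "integrable (law f) (\<lambda>x. (\<alpha> S (restrict x S) + d S (restrict x S))\<^sup>2)"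
      unfolding power2_sum using H_spaceD(2)[OF \<alpha>[OF that]] H_spaceD(2)[OF d[OF that]] ad[OF that]
      by (auto simp: mult.assoc)
    then show ?thesis
      using that H_spaceD[OF \<alpha>[OF that]] H_spaceD[OF d[OF that]] by (simp add: H_space_def)
  qed
  \<comment> \<open>The left side is minus one half of the derivative of the objective in direction
    \<open>d S\<close>. It turns out to be the inner product of \<open>d S\<close> and
    \<open>\<rho> S\<close> with weight 1 + \<open>iv S\<close>.\<close>
  have key: "?E (\<lambda>x. centred \<alpha> x * d S (restrict x S)) - ?E (\<lambda>x. \<alpha> S (restrict x S) * d S (restrict x S) * iv S (restrict x S))
      = ?E (\<lambda>x. d S (restrict x S) * \<rho> S (restrict x S) * (1 + iv S (restrict x S)))" if S: "S \<in> SS" for S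
  proof -
    let ?g = "residual SS a \<alpha> S" and ?d = "\<lambda>x. d S (restrict x S)" and ?a = "\<lambda>x. \<alpha> S (restrict x S)"
    have gm[measurable]: "?g \<in> borel_measurable (leb UNIV)" by (rule residual_measurable) (rule H_spaceD(1)[OF \<alpha>])
    have gb: "\<bar>?g x\<bar> \<le> na + (real (card SS) - 1) * K" for x by (rule residual_bound[OF S \<alpha>K])
    note [measurable] = cmean_measurable[OF S gm] d[OF S, THEN H_spaceD(1)]
    note di = H_spaceD(3)[OF d[OF S]] and d0 = H_spaceD(4)[OF d[OF S]]
    have i1: "integrable (law f) (\<lambda>x. ?d x * ?g x)" by (rule integrable_times_bounded[OF di]) (use gb in auto)
    have i2: "integrable (law f) (\<lambda>x. ?d x * cmean S ?g (restrict x S))"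
      by (rule integrable_times_bounded[OF di]) (use cmean_bound[OF S restrict_subspace gm gb] in auto)
    have i3: "integrable (law f) (\<lambda>x. ?d x * ?a x)" using ad[OF S] by (simp add: mult.commute)
    have i4: "integrable (law f) (\<lambda>x. ?d x * ?a x * iv S (restrict x S))" by (rule integrable_iv[OF S i3])
    \<comment> \<open>The direction is only square integrable, so orthogonality is needed for
      unbounded test functions; the boundedness of \<open>\<alpha>\<close> supplies the bounded
      residual that it asks for.\<close>
    have orth: "?E (\<lambda>x. ?d x * ?g x) = ?E (\<lambda>x. ?d x * cmean S ?g (restrict x S))"
      using cmean_orthogonal[OF S gm gb, of "d S"] i1 i2 di by (simp add: right_diff_distrib)
    have ce: "centred \<alpha> x = ?g x - ?a x - ?E a" for x
      using S by (simp add: centred_def residual_def sum.remove[of SS S])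
    have "?E (\<lambda>x. centred \<alpha> x * ?d x) = ?E (\<lambda>x. ?d x * ?g x - ?d x * ?a x - ?d x * ?E a)"
      unfolding ce by (simp add: algebra_simps)
    also have "\<dots> = ?E (\<lambda>x. ?d x * cmean S ?g (restrict x S)) - ?E (\<lambda>x. ?d x * ?a x)"
      using i1 i3 di d0 orth by simp
    finally have 1: "?E (\<lambda>x. centred \<alpha> x * ?d x) = \<dots>" .
    \<comment> \<open>The weight cancels against 1 + \<open>iv S\<close>. The constant
      \<open>wmean\<close> disappears under the integral because \<open>d S\<close> is
      centred.\<close>
    have pw: "?d x * \<rho> S (restrict x S) * (1 + iv S (restrict x S)) =
        ?d x * cmean S ?g (restrict x S) - ?d x * wmean S ?g - ?d x * ?a x - ?d x * ?a x * iv S (restrict x S)" for x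
    proof -
      have "wt S (restrict x S) * (1 + iv S (restrict x S)) = 1"
        using inverse_wt[OF S restrict_subspace, of x] wt_bounds(1)[OF S restrict_subspace, of x]
        by (simp add: field_simps)
      note W = this
      have eq: "?d x * \<rho> S (restrict x S) * (1 + iv S (restrict x S)) =
        ?d x * ((wt S (restrict x S) * (1 + iv S (restrict x S))) * (cmean S ?g (restrict x S) - wmean S ?g) - ?a x * (1 + iv S (restrict x S)))"
        unfolding \<rho> by (simp add: algebra_simps)
      show ?thesis unfolding eq W by (simp add: algebra_simps)
    qed
    have "?E (\<lambda>x. ?d x * \<rho> S (restrict x S) * (1 + iv S (restrict x S))) =
       ?E (\<lambda>x. ?d x * cmean S ?g (restrict x S)) - ?E (\<lambda>x. ?d x * ?a x) - ?E (\<lambda>x. ?d x * ?a x * iv S (restrict x S))"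
      unfolding pw using i2 i3 i4 di d0 by simp
    then show ?thesis using 1 by (simp add: mult.commute[of "?a _"])
  qed
  have e1: "?E (\<lambda>x. (centred (\<lambda>S u. \<alpha> S u + d S u) x)\<^sup>2) =
      ?E (\<lambda>x. (centred \<alpha> x)\<^sup>2) - 2 * (\<Sum>S\<in>SS. ?E (\<lambda>x. centred \<alpha> x * d S (restrict x S))) + ?E (\<lambda>x. (?D x)\<^sup>2)"
  proof -
    have "(centred (\<lambda>S u. \<alpha> S u + d S u) x)\<^sup>2 = (centred \<alpha> x)\<^sup>2 - 2 * (\<Sum>S\<in>SS. centred \<alpha> x * d S (restrict x S)) + (?D x)\<^sup>2" for x
      unfolding sum_distrib_left[symmetric] by (simp add: centred_def sum.distrib power2_eq_square algebra_simps)
    then show ?thesis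
      using centred_square_integrable(1)[OF \<alpha>] DD cd
      by (simp add: Bochner_Integration.integral_sum)
  qed
  have e2: "?E (\<lambda>x. (\<alpha> S (restrict x S) + d S (restrict x S))\<^sup>2 * iv S (restrict x S)) =
      ?E (\<lambda>x. (\<alpha> S (restrict x S))\<^sup>2 * iv S (restrict x S))
      + 2 * ?E (\<lambda>x. \<alpha> S (restrict x S) * d S (restrict x S) * iv S (restrict x S))
      + ?E (\<lambda>x. (d S (restrict x S))\<^sup>2 * iv S (restrict x S))" if S: "S \<in> SS" for S
  proof -
    note i = integrable_iv[OF S H_spaceD(2)[OF \<alpha>[OF S]]] integrable_iv[OF S H_spaceD(2)[OF d[OF S]]] integrable_iv[OF S ad[OF S]]
    have "(\<alpha> S (restrict x S) + d S (restrict x S))\<^sup>2 * iv S (restrict x S) =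
      (\<alpha> S (restrict x S))\<^sup>2 * iv S (restrict x S) + 2 * (\<alpha> S (restrict x S) * d S (restrict x S) * iv S (restrict x S))
      + (d S (restrict x S))\<^sup>2 * iv S (restrict x S)" for x
      by (simp add: power2_sum algebra_simps)
    then show ?thesis using i by simp
  qed
  have "obj (\<lambda>S u. \<alpha> S u + d S u) = ?E (\<lambda>x. (centred (\<lambda>S u. \<alpha> S u + d S u) x)\<^sup>2) +
      (\<Sum>S\<in>SS. ?E (\<lambda>x. (\<alpha> S (restrict x S) + d S (restrict x S))\<^sup>2 * iv S (restrict x S)))"
    by (rule obj_eq[OF sumH])
  also have "(\<Sum>S\<in>SS. ?E (\<lambda>x. (\<alpha> S (restrict x S) + d S (restrict x S))\<^sup>2 * iv S (restrict x S))) =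
      (\<Sum>S\<in>SS. ?E (\<lambda>x. (\<alpha> S (restrict x S))\<^sup>2 * iv S (restrict x S)))
      + 2 * (\<Sum>S\<in>SS. ?E (\<lambda>x. \<alpha> S (restrict x S) * d S (restrict x S) * iv S (restrict x S)))
      + (\<Sum>S\<in>SS. ?E (\<lambda>x. (d S (restrict x S))\<^sup>2 * iv S (restrict x S)))"
    unfolding sum_distrib_left sum.distrib[symmetric] by (rule sum.cong[OF refl e2])
  also have "(\<Sum>S\<in>SS. ?E (\<lambda>x. \<alpha> S (restrict x S) * d S (restrict x S) * iv S (restrict x S))) =
      (\<Sum>S\<in>SS. ?E (\<lambda>x. centred \<alpha> x * d S (restrict x S))) -
      (\<Sum>S\<in>SS. ?E (\<lambda>x. d S (restrict x S) * \<rho> S (restrict x S) * (1 + iv S (restrict x S))))"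
    unfolding sum_subtractf[symmetric] by (intro sum.cong refl) (use key in \<open>simp add: algebra_simps\<close>)
  moreover have "obj \<alpha> = ?E (\<lambda>x. (centred \<alpha> x)\<^sup>2) + (\<Sum>S\<in>SS. ?E (\<lambda>x. (\<alpha> S (restrict x S))\<^sup>2 * iv S (restrict x S)))"
    by (rule obj_eq) (rule \<alpha>)
  ultimately show ?thesis unfolding e1 by linarith
qed

text \<open>The squared length of the update in the norm in which one block of \<open>obj\<close> is exactly quadratic.\<close>

definition gain :: "nat \<Rightarrow> real" where
  "gain m = (\<Sum>S\<in>SS. expectation (\<lambda>x. (rho m S (restrict x S))\<^sup>2 * (1 + iv S (restrict x S))))"

lemma gain_nonneg: "0 \<le> gain m"
  unfolding gain_def using iv_bounds(1)[OF _ restrict_subspace]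
  by (intro sum_nonneg Bochner_Integration.integral_nonneg) (simp add: less_imp_le)

lemma rho_square_integrable:
  "S \<in> SS \<Longrightarrow> integrable (law f) (\<lambda>x. (rho m S (restrict x S))\<^sup>2)"
  "S \<in> SS \<Longrightarrow> integrable (law f) (\<lambda>x. (rho m S (restrict x S))\<^sup>2 * iv S (restrict x S))"
  using H_spaceD(2)[OF rho_H_space] integrable_iv by auto

text \<open>Write N for \<open>card SS\<close>. With the direction \<open>rho\<close> / N the linear
  term is -2 gain / N. Cauchy-Schwarz over the N blocks bounds the coupling term, and 1 / N^2 \<le>
  1 / N bounds the penalty term; together they cost at most gain / N. This is the reason for the
  step size 1 / N.\<close>

lemma obj_pop_descent: "obj (pop (Suc m)) \<le> obj (pop m) - gain m / real (card SS)"
proof -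
  let ?N = "real (card SS)" and ?E = expectation
  have N: "1 \<le> ?N" by (rule card_SS)
  define d where "d S u = rho m S u / ?N" for S u
  have d: "d S \<in> H_space f S" if "S \<in> SS" for S
    using H_spaceD[OF rho_H_space[OF that, of m]] that by (simp add: H_space_def d_def[abs_def] power_divide)
  have eq: "obj (pop (Suc m)) = obj (pop m)
     - 2 * (\<Sum>S\<in>SS. ?E (\<lambda>x. d S (restrict x S) * rho m S (restrict x S) * (1 + iv S (restrict x S))))
     + ?E (\<lambda>x. (\<Sum>S\<in>SS. d S (restrict x S))\<^sup>2)
     + (\<Sum>S\<in>SS. ?E (\<lambda>x. (d S (restrict x S))\<^sup>2 * iv S (restrict x S)))"
  proof -
    have "pop (Suc m) = (\<lambda>S u. pop m S u + d S u)" by (intro ext) (simp only: pop_Suc d_def)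
    then show ?thesis
      using obj_perturb[of "pop m" d "na * (3 ^ m - 1) / ?N" "rho m", OF pop_H_space d pop_bound(1) rho_def]
      by simp
  qed
  have 1: "(\<Sum>S\<in>SS. ?E (\<lambda>x. d S (restrict x S) * rho m S (restrict x S) * (1 + iv S (restrict x S)))) = gain m / ?N"
    unfolding gain_def sum_divide_distrib d_def
  proof (rule sum.cong[OF refl])
    fix S
    have "(\<lambda>x. rho m S (restrict x S) / ?N * rho m S (restrict x S) * (1 + iv S (restrict x S))) =
      (\<lambda>x. (rho m S (restrict x S))\<^sup>2 * (1 + iv S (restrict x S)) / ?N)"
      by (auto simp: power2_eq_square)
    then show "?E (\<lambda>x. rho m S (restrict x S) / ?N * rho m S (restrict x S) * (1 + iv S (restrict x S))) =
      ?E (\<lambda>x. (rho m S (restrict x S))\<^sup>2 * (1 + iv S (restrict x S))) / ?N" by simp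
  qed
  have 2: "?E (\<lambda>x. (\<Sum>S\<in>SS. d S (restrict x S))\<^sup>2) \<le> ?E (\<lambda>x. (\<Sum>S\<in>SS. (rho m S (restrict x S))\<^sup>2 / ?N))"
  proof (rule integral_mono)
    show "integrable (law f) (\<lambda>x. (\<Sum>S\<in>SS. (rho m S (restrict x S))\<^sup>2 / ?N))"
      using rho_square_integrable(1) by auto
    have "integrable (law f) (\<lambda>x. d S (restrict x S) * d S' (restrict x S'))" if "S \<in> SS" "S' \<in> SS" for S S'
      using that H_spaceD(1,2)[OF d] by (intro integrable_mult_of_square_integrable) auto
    then show "integrable (law f) (\<lambda>x. (\<Sum>S\<in>SS. d S (restrict x S))\<^sup>2)"
      unfolding power2_eq_square sum_product by auto
    fix x
    have "(\<Sum>S\<in>SS. d S (restrict x S))\<^sup>2 \<le> (\<Sum>S\<in>SS. (d S (restrict x S))\<^sup>2) * ?N"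
      by (rule sum_squared_le_sum_of_squares)
    also have "\<dots> = (\<Sum>S\<in>SS. (rho m S (restrict x S))\<^sup>2 / ?N)"
      unfolding sum_distrib_right d_def using N by (intro sum.cong) (auto simp: power_divide power2_eq_square)
    finally show "(\<Sum>S\<in>SS. d S (restrict x S))\<^sup>2 \<le> (\<Sum>S\<in>SS. (rho m S (restrict x S))\<^sup>2 / ?N)" .
  qed
  have 3: "(\<Sum>S\<in>SS. ?E (\<lambda>x. (d S (restrict x S))\<^sup>2 * iv S (restrict x S))) \<le>
      (\<Sum>S\<in>SS. ?E (\<lambda>x. (rho m S (restrict x S))\<^sup>2 * iv S (restrict x S) / ?N))"
  proof (intro sum_mono integral_mono)
    fix S x assume S: "S \<in> SS"
    show "integrable (law f) (\<lambda>x. (d S (restrict x S))\<^sup>2 * iv S (restrict x S))"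
      by (rule integrable_iv[OF S H_spaceD(2)[OF d[OF S]]])
    show "integrable (law f) (\<lambda>x. (rho m S (restrict x S))\<^sup>2 * iv S (restrict x S) / ?N)"
      using rho_square_integrable(2)[OF S] by simp
    have "0 \<le> (rho m S (restrict x S))\<^sup>2 * iv S (restrict x S) / ?N"
      using iv_bounds(1)[OF S restrict_subspace] by (simp add: less_imp_le)
    then have "(rho m S (restrict x S))\<^sup>2 * iv S (restrict x S) / ?N / ?N \<le> (rho m S (restrict x S))\<^sup>2 * iv S (restrict x S) / ?N / 1"
      using N by (intro divide_left_mono) auto
    then show "(d S (restrict x S))\<^sup>2 * iv S (restrict x S) \<le> (rho m S (restrict x S))\<^sup>2 * iv S (restrict x S) / ?N"
      by (simp add: d_def power_divide power2_eq_square)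
  qed
  have 4: "?E (\<lambda>x. (\<Sum>S\<in>SS. (rho m S (restrict x S))\<^sup>2 / ?N)) +
      (\<Sum>S\<in>SS. ?E (\<lambda>x. (rho m S (restrict x S))\<^sup>2 * iv S (restrict x S) / ?N)) = gain m / ?N"
    using rho_square_integrable
    by (simp add: gain_def Bochner_Integration.integral_sum sum.distrib sum_divide_distrib add_divide_distrib distrib_left)
  show ?thesis using 1 2 3 4 unfolding eq by linarith
qed

lemma obj_pop_le: "obj (pop m) \<le> variance a"
proof (induction m)
  case 0
  have "obj (pop 0) = variance a" by (simp add: objective_def)
  then show ?case by simp
next
  case (Suc m)
  have "0 \<le> gain m / real (card SS)" using gain_nonneg by simp
  then show ?case using Suc obj_pop_descent[of m] by linarith
qed

lemma obj_nonneg: assumes "\<And>S. S \<in> SS \<Longrightarrow> \<alpha> S \<in> H_space f S" shows "0 \<le> obj \<alpha>"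
proof -
  have "obj \<alpha> = expectation (\<lambda>x. (centred \<alpha> x)\<^sup>2) + (\<Sum>S\<in>SS. expectation (\<lambda>x. (\<alpha> S (restrict x S))\<^sup>2 * iv S (restrict x S)))"
    by (rule obj_eq) (rule assms)
  also have "0 \<le> \<dots>" using iv_bounds(1)[OF _ restrict_subspace]
    by (intro add_nonneg_nonneg sum_nonneg Bochner_Integration.integral_nonneg) (auto simp: less_imp_le)
  finally show ?thesis .
qed

text \<open>The coupling square is nonnegative and is dropped. What remains separates into blocks
  and points: with b = 1 / iv, the expression 2 d \<rho> (1 + iv) - d^2 iv is largest at d = (1 + b)
  \<rho>, with maximum (1 + b) (1 + iv) \<rho>^2, and b = lam rb is at most
  \<open>C * lmax\<close>.\<close>

lemma obj_ge:
  assumes \<alpha>: "\<And>S. S \<in> SS \<Longrightarrow> \<alpha> S \<in> H_space f S" and lmax: "\<And>S. S \<in> SS \<Longrightarrow> lam S \<le> lmax"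
  shows "obj (pop m) - (1 + C * lmax) * gain m \<le> obj \<alpha>"
proof -
  let ?E = expectation
  let ?q = "1 + C * lmax"
  define d where "d S u = \<alpha> S u - pop m S u" for S u
  have d: "d S \<in> H_space f S" if S: "S \<in> SS" for S
  proof -
    note i = H_spaceD[OF \<alpha>[OF S]] and i' = H_spaceD[OF pop_H_space[OF S, of m]]
    have "integrable (law f) (\<lambda>x. \<alpha> S (restrict x S) * pop m S (restrict x S))"
      using i i' S by (intro integrable_mult_of_square_integrable) auto
    then have "integrable (law f) (\<lambda>x. (d S (restrict x S))\<^sup>2)"
      unfolding d_def power2_diff using i(2) i'(2) by (auto simp: mult.assoc)
    moreover have "?E (\<lambda>x. d S (restrict x S)) = ?E (\<lambda>x. \<alpha> S (restrict x S)) - ?E (\<lambda>x. pop m S (restrict x S))"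
      unfolding d_def using i(3) i'(3) by simp
    moreover have "d S \<in> borel_measurable (leb S)" unfolding d_def[abs_def] using i(1) i'(1) by simp
    ultimately show ?thesis unfolding H_space_def using i(4) i'(4) by simp
  qed
  have eq: "obj \<alpha> = obj (pop m)
     - 2 * (\<Sum>S\<in>SS. ?E (\<lambda>x. d S (restrict x S) * rho m S (restrict x S) * (1 + iv S (restrict x S))))
     + ?E (\<lambda>x. (\<Sum>S\<in>SS. d S (restrict x S))\<^sup>2)
     + (\<Sum>S\<in>SS. ?E (\<lambda>x. (d S (restrict x S))\<^sup>2 * iv S (restrict x S)))"
    using obj_perturb[of "pop m" d "na * (3 ^ m - 1) / real (card SS)" "rho m", OF pop_H_space d pop_bound(1) rho_def]
    by (simp add: d_def)
  have key: "2 * ?E (\<lambda>x. d S (restrict x S) * rho m S (restrict x S) * (1 + iv S (restrict x S)))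
      - ?E (\<lambda>x. (d S (restrict x S))\<^sup>2 * iv S (restrict x S))
      \<le> ?q * ?E (\<lambda>x. (rho m S (restrict x S))\<^sup>2 * (1 + iv S (restrict x S)))" if S: "S \<in> SS" for S
  proof -
    have dr: "integrable (law f) (\<lambda>x. d S (restrict x S) * rho m S (restrict x S))"
      using H_spaceD(1,2)[OF d[OF S]] H_spaceD(1,2)[OF rho_H_space[OF S, of m]] S by (intro integrable_mult_of_square_integrable) auto
    have i1: "integrable (law f) (\<lambda>x. d S (restrict x S) * rho m S (restrict x S) * (1 + iv S (restrict x S)))"
      using dr integrable_iv[OF S dr] by (simp add: distrib_left)
    have i2: "integrable (law f) (\<lambda>x. (d S (restrict x S))\<^sup>2 * iv S (restrict x S))"
      by (rule integrable_iv[OF S H_spaceD(2)[OF d[OF S]]])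
    have i3: "integrable (law f) (\<lambda>x. (rho m S (restrict x S))\<^sup>2 * (1 + iv S (restrict x S)))"
      using rho_square_integrable[OF S] by (simp add: distrib_left)
    have "?E (\<lambda>x. 2 * (d S (restrict x S) * rho m S (restrict x S) * (1 + iv S (restrict x S)))
        - (d S (restrict x S))\<^sup>2 * iv S (restrict x S)) \<le> ?E (\<lambda>x. ?q * ((rho m S (restrict x S))\<^sup>2 * (1 + iv S (restrict x S))))"
    proof (rule integral_mono)
      show "integrable (law f) (\<lambda>x. 2 * (d S (restrict x S) * rho m S (restrict x S) * (1 + iv S (restrict x S)))
        - (d S (restrict x S))\<^sup>2 * iv S (restrict x S))" using i1 i2 by simp
      show "integrable (law f) (\<lambda>x. ?q * ((rho m S (restrict x S))\<^sup>2 * (1 + iv S (restrict x S))))" using i3 by simp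
      fix x
      let ?d = "d S (restrict x S)" and ?r = "rho m S (restrict x S)" and ?i = "iv S (restrict x S)"
        and ?b = "lam S * rb S (restrict x S)"
      have b: "0 < ?b" by (rule lam_rb_pos[OF S restrict_subspace])
      have "?b \<le> C * lmax"
        using rbar_bounds[OF S restrict_subspace, of x] lmax[OF S] lam_pos[OF S] c_C
        by (subst mult.commute) (auto intro!: mult_mono)
      then have bq: "1 + ?b \<le> ?q" by simp
      have i: "?b * ?i = 1" "0 < ?i" using b by (auto simp: iv_def)
      have "0 \<le> ?i * (?d - (1 + ?b) * ?r)\<^sup>2" using i by simp
      also have "\<dots> = ?d\<^sup>2 * ?i - 2 * (?d * ?r * (?i + ?b * ?i)) + (?i + ?b * ?i) * (1 + ?b) * ?r\<^sup>2"
        by (simp add: power2_eq_square algebra_simps)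
      finally have "2 * (?d * ?r * (1 + ?i)) - ?d\<^sup>2 * ?i \<le> (1 + ?b) * (?r\<^sup>2 * (1 + ?i))"
        unfolding i(1) by (simp add: algebra_simps)
      also have "\<dots> \<le> ?q * (?r\<^sup>2 * (1 + ?i))" using bq i by (intro mult_right_mono) auto
      finally show "2 * (?d * ?r * (1 + ?i)) - ?d\<^sup>2 * ?i \<le> ?q * (?r\<^sup>2 * (1 + ?i))" .
    qed
    then show ?thesis using i1 i2 by simp
  qed
  have "2 * (\<Sum>S\<in>SS. ?E (\<lambda>x. d S (restrict x S) * rho m S (restrict x S) * (1 + iv S (restrict x S))))
      - (\<Sum>S\<in>SS. ?E (\<lambda>x. (d S (restrict x S))\<^sup>2 * iv S (restrict x S))) \<le> ?q * gain m"
    unfolding gain_def sum_distrib_left sum_subtractf[symmetric] by (rule sum_mono) (rule key)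
  moreover have "0 \<le> ?E (\<lambda>x. (\<Sum>S\<in>SS. d S (restrict x S))\<^sup>2)"
    by (rule Bochner_Integration.integral_nonneg) simp
  ultimately show ?thesis unfolding eq by linarith
qed

text \<open>The gap is at most (1 + C lmax) times the gain, while a step lowers the objective by at
  least gain / \<open>card SS\<close>: each step removes a share 1 / \<kappa> of the gap. The
  initial gap is at most the variance of \<open>a\<close>, since the objective is
  nonnegative.\<close>

lemma obj_pop_gap:
  assumes \<alpha>: "\<And>S. S \<in> SS \<Longrightarrow> \<alpha> S \<in> H_space f S" and lmax: "\<And>S. S \<in> SS \<Longrightarrow> lam S \<le> lmax"
    and \<kappa>: "\<kappa> = real (card SS) * (1 + C * lmax)"
  shows "obj (pop m) - obj \<alpha> \<le> variance a * exp (- real m / \<kappa>)"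
proof -
  obtain S where "S \<in> SS" using SS by auto
  then have "0 < lmax" using lam_pos lmax by force
  then have q: "1 \<le> 1 + C * lmax" using c_C by simp
  then have \<kappa>1: "1 \<le> \<kappa>" unfolding \<kappa> using mult_mono[OF card_SS q] by simp
  have "obj (pop m) - obj \<alpha> \<le> variance a * (1 - 1 / \<kappa>) ^ m"
  proof (induction m)
    case 0 then show ?case using obj_pop_le[of 0] obj_nonneg[OF \<alpha>] by simp
  next
    case (Suc m)
    have "obj (pop m) - obj \<alpha> \<le> (1 + C * lmax) * gain m" using obj_ge[OF \<alpha> lmax, of m] by simp
    then have "(obj (pop m) - obj \<alpha>) / \<kappa> \<le> ((1 + C * lmax) * gain m) / \<kappa>"
      using \<kappa>1 by (intro divide_right_mono) auto
    also have "\<dots> = gain m / real (card SS)" unfolding \<kappa> using q by simp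
    finally have "obj (pop (Suc m)) - obj \<alpha> \<le> (obj (pop m) - obj \<alpha>) * (1 - 1 / \<kappa>)"
      using obj_pop_descent[of m] by (simp add: right_diff_distrib)
    also have "\<dots> \<le> variance a * (1 - 1 / \<kappa>) ^ m * (1 - 1 / \<kappa>)"
      using Suc \<kappa>1 by (intro mult_right_mono) auto
    finally show ?case by (simp add: mult_ac)
  qed
  also have "\<dots> \<le> variance a * exp (- 1 / \<kappa>) ^ m"
    using exp_ge_add_one_self[of "- 1 / \<kappa>"] \<kappa>1
    by (intro mult_left_mono power_mono Bochner_Integration.integral_nonneg) auto
  also have "\<dots> = variance a * exp (- real m / \<kappa>)" by (simp flip: exp_of_nat_mult)
  finally show ?thesis .
qed

end

subsection \<open>Local averages and smoothness of the population iterates\<close>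

text \<open>The unobserved coordinates agree, so no block sees a larger distance than the one
  between \<open>u\<close> and \<open>u'\<close>.\<close>

lemma supdist_merge: "supdist S' (merge S (-S) (u, v)) (merge S (-S) (u', v)) \<le> supdist S u u'"
proof -
  have "\<bar>u j - u' j\<bar> \<le> supdist S u u'" if "j \<in> S" for j
    using supdist_le_iff[OF supdist_nonneg, of S u u' S u u'] that by auto
  then show ?thesis
    by (subst supdist_le_iff[OF supdist_nonneg]) (auto simp: merge_def supdist_nonneg)
qed

lemma borel_measurable_supdist [measurable (raw)]:
  assumes "\<And>j. j \<in> S \<Longrightarrow> (\<lambda>x. f x j) \<in> borel_measurable M" "\<And>j. j \<in> S \<Longrightarrow> (\<lambda>x. g x j) \<in> borel_measurable M"
  shows "(\<lambda>x. supdist S (f x) (g x)) \<in> borel_measurable M"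
  unfolding supdist_def using assms by (intro borel_measurable_supnorm borel_measurable_diff)

text \<open>The bound is relative to x, hence invariant under scaling of both arguments;
  \<open>lam S\<close> will cancel from it.\<close>

lemma wt_diff_le:
  assumes "0 < x" "0 < (y::real)" shows "\<bar>x / (1 + x) - y / (1 + y)\<bar> \<le> \<bar>x - y\<bar> / x"
proof -
  have "x / (1 + x) - y / (1 + y) = (x - y) / ((1 + x) * (1 + y))"
    using assms by (simp add: field_simps)
  then have "\<bar>x / (1 + x) - y / (1 + y)\<bar> = \<bar>x - y\<bar> / ((1 + x) * (1 + y))"
    using assms by (simp add: abs_mult)
  also have "\<dots> \<le> \<bar>x - y\<bar> / x"
  proof (rule divide_left_mono)
    show "x \<le> (1 + x) * (1 + y)" using assms by (simp add: algebra_simps)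
  qed (use assms in \<open>auto intro!: mult_pos_pos\<close>)
  finally show ?thesis .
qed

definition cnt :: "'d::finite set \<Rightarrow> real \<Rightarrow> nat set \<Rightarrow> ('d \<Rightarrow> real) \<Rightarrow> (nat \<Rightarrow> 'd \<Rightarrow> real) \<Rightarrow> real" where
  "cnt S h K x y = (\<Sum>j\<in>K. if supdist S x (y j) \<le> h then 1 else 0)"

text \<open>The Nadaraya-Watson weights of the box kernel. If no observation lies within distance
  \<open>h\<close>, all of them are 0, in agreement with the convention 0/0 = 0 of the
  estimator.\<close>

definition W :: "'d::finite set \<Rightarrow> real \<Rightarrow> nat set \<Rightarrow> ('d \<Rightarrow> real) \<Rightarrow> (nat \<Rightarrow> 'd \<Rightarrow> real) \<Rightarrow> nat \<Rightarrow> real" where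
  "W S h K x y i = (if supdist S x (y i) \<le> h then 1 / cnt S h K x y else 0)"

lemma cnt_card: "finite K \<Longrightarrow> cnt S h K x y = real (card {j\<in>K. supdist S x (y j) \<le> h})"
  by (simp add: cnt_def sum.If_cases Int_def)

lemma cnt_nonneg: "0 \<le> cnt S h K x y"
  by (auto simp: cnt_def intro: sum_nonneg)

lemma W_nonneg: "0 \<le> W S h K x y i"
  by (simp add: W_def cnt_nonneg)

lemma sum_W: "(\<Sum>i\<in>K. W S h K x y i) = (if cnt S h K x y = 0 then 0 else 1)"
proof -
  have "(\<Sum>i\<in>K. W S h K x y i) = (\<Sum>i\<in>K. (if supdist S x (y i) \<le> h then 1 else 0) / cnt S h K x y)"
    unfolding W_def by (intro sum.cong) auto
  also have "\<dots> = cnt S h K x y / cnt S h K x y" by (simp add: cnt_def flip: sum_divide_distrib)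
  finally show ?thesis by simp
qed

lemma cnt_cases: "finite K \<Longrightarrow> cnt S h K x y = 0 \<or> 1 \<le> cnt S h K x y"
  by (auto simp: cnt_card Suc_le_eq card_gt_0_iff)

lemma W_le_1: assumes "finite K" shows "W S h K x y i \<le> 1"
  using cnt_cases[OF assms, of S h x y] by (auto simp: W_def)

text \<open>For a nonempty ball the sum is 1 / \<open>cnt\<close>. It is traded for 2 / (1 +
  \<open>cnt\<close>), which also makes sense for an empty ball and whose mean is controlled by size
  biasing.\<close>

lemma sum_W_square:
  assumes "finite K" shows "(\<Sum>i\<in>K. (W S h K x y i)\<^sup>2) \<le> 2 * (1 / (1 + cnt S h K x y))"
proof (cases "cnt S h K x y = 0")
  case True
  then have "W S h K x y i = 0" for i by (simp add: W_def)
  then show ?thesis using True by simp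
next
  case False
  then have c: "1 \<le> cnt S h K x y" using cnt_cases[OF assms] by auto
  have "(\<Sum>i\<in>K. (W S h K x y i)\<^sup>2) = (\<Sum>i\<in>K. W S h K x y i * (1 / cnt S h K x y))"
    by (intro sum.cong) (auto simp: W_def power2_eq_square)
  also have "\<dots> = 1 / cnt S h K x y" using False by (simp add: sum_W flip: sum_divide_distrib)
  also have "\<dots> \<le> 2 * (1 / (1 + cnt S h K x y))" using c by (simp add: field_simps)
  finally show ?thesis .
qed

text \<open>The weights are nonnegative and sum to at most one.\<close>

lemma sum_W_Jensen: "(\<Sum>i\<in>K. W S h K x y i * (b i::real))\<^sup>2 \<le> (\<Sum>i\<in>K. W S h K x y i * (b i)\<^sup>2)"
proof -
  have "(\<Sum>i\<in>K. W S h K x y i * b i)\<^sup>2 = (\<Sum>i\<in>K. sqrt (W S h K x y i) * (sqrt (W S h K x y i) * b i))\<^sup>2"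
    by (simp add: W_nonneg flip: mult.assoc)
  also have "\<dots> \<le> (\<Sum>i\<in>K. (sqrt (W S h K x y i))\<^sup>2) * (\<Sum>i\<in>K. (sqrt (W S h K x y i) * b i)\<^sup>2)"
    by (rule Cauchy_Schwarz_ineq_sum)
  also have "\<dots> = (\<Sum>i\<in>K. W S h K x y i) * (\<Sum>i\<in>K. W S h K x y i * (b i)\<^sup>2)"
    by (simp add: W_nonneg power_mult_distrib)
  also have "\<dots> \<le> 1 * (\<Sum>i\<in>K. W S h K x y i * (b i)\<^sup>2)"
    by (intro mult_right_mono) (auto simp: sum_W W_nonneg intro!: sum_nonneg)
  finally show ?thesis by simp
qed

lemma measurable_cnt:
  assumes "\<And>j. j \<in> K \<Longrightarrow> (\<lambda>\<omega>. supdist S (xx \<omega>) (Y \<omega> j)) \<in> borel_measurable M"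
  shows "(\<lambda>\<omega>. cnt S h K (xx \<omega>) (Y \<omega>)) \<in> borel_measurable M"
  unfolding cnt_def using assms by measurable

lemma measurable_W:
  assumes "\<And>j. j \<in> K \<Longrightarrow> (\<lambda>\<omega>. supdist S (xx \<omega>) (Y \<omega> j)) \<in> borel_measurable M" and "i \<in> K"
  shows "(\<lambda>\<omega>. W S h K (xx \<omega>) (Y \<omega>) i) \<in> borel_measurable M"
proof -
  note [measurable] = measurable_cnt[OF assms(1)] assms(1)[OF assms(2)]
  show ?thesis unfolding W_def by measurable
qed

text \<open>Fubini with observation \<open>i\<close> innermost. This is how mixed terms of two
  observations are shown to vanish.\<close>

lemma integral_PiM_zero:
  fixes F :: "(nat \<Rightarrow> 'a) \<Rightarrow> real"
  assumes "prob_space \<mu>" "finite K" "i \<in> K" "integrable (PiM K (\<lambda>_. \<mu>)) F"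
    and "\<And>y. (\<integral>z. F (y(i := z)) \<partial>\<mu>) = 0"
  shows "(\<integral>y. F y \<partial>PiM K (\<lambda>_. \<mu>)) = 0"
proof -
  interpret product_prob_space "\<lambda>_. \<mu>" by (simp add: assms(1) product_prob_spaceI)
  have K: "insert i (K - {i}) = K" using assms by auto
  have "integral\<^sup>L (PiM (insert i (K - {i})) (\<lambda>_. \<mu>)) F = (\<integral>y. \<integral>z. F (y(i := z)) \<partial>\<mu> \<partial>PiM (K - {i}) (\<lambda>_. \<mu>))"
    using assms(2-4) by (intro product_integral_insert) (auto simp: insert_absorb)
  then show ?thesis by (simp add: assms(5) insert_absorb[OF assms(3)])
qed

lemma nn_integral_PiM_component:
  assumes "prob_space \<mu>" "finite K" "i \<in> (K::nat set)" and [measurable]: "D \<in> borel_measurable \<mu>"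
  shows "(\<integral>\<^sup>+y. D (y i) \<partial>PiM K (\<lambda>_. \<mu>)) = (\<integral>\<^sup>+z. D z \<partial>\<mu>)"
proof -
  interpret product_prob_space "\<lambda>_. \<mu>" by (simp add: assms(1) product_prob_spaceI)
  interpret Q: prob_space "PiM (K - {i}) (\<lambda>_. \<mu>)" by (rule prob_space_PiM) (rule assms)
  have K: "insert i (K - {i}) = K" using assms by auto
  have "(\<integral>\<^sup>+y. D (y i) \<partial>PiM (insert i (K - {i})) (\<lambda>_. \<mu>)) =
      (\<integral>\<^sup>+y. \<integral>\<^sup>+z. D ((y(i := z)) i) \<partial>\<mu> \<partial>PiM (K - {i}) (\<lambda>_. \<mu>))"
    using assms by (intro product_nn_integral_insert) (auto simp: insert_absorb)
  then show ?thesis by (simp add: insert_absorb[OF assms(3)] Q.emeasure_space_1)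
qed

text \<open>The value \<open>inverse 0 = \<top>\<close> makes the case p = 0 trivial, so balls of
  mass zero need no exceptional set in the covering arguments.\<close>

lemma ennreal_le_inverse: "x * p \<le> 1 \<Longrightarrow> p \<noteq> \<top> \<Longrightarrow> x \<le> inverse (p::ennreal)"
proof (cases "p = 0")
  case False
  assume a: "x * p \<le> 1" "p \<noteq> \<top>"
  have "x = x * (p * inverse p)" using False a(2) by (simp add: less_top flip: divide_ennreal_def)
  also have "\<dots> = (x * p) * inverse p" by (simp add: mult.assoc)
  also have "\<dots> \<le> 1 * inverse p" using a(1) by (intro mult_right_mono) auto
  finally show ?thesis by simp
qed simp

lemma ennreal_inverse_times_le: "inverse p * p \<le> (1::ennreal)"
proof (cases "p = 0 \<or> p = \<top>")
  case False
  then have "p * inverse p = 1" by (simp add: less_top flip: divide_ennreal_def)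
  then show ?thesis by (simp add: mult.commute)
qed auto

lemma ennreal_inverse_antimono: "p \<le> q \<Longrightarrow> p \<noteq> \<top> \<Longrightarrow> inverse q \<le> inverse (p::ennreal)"
  using ennreal_inverse_times_le[of q] mult_left_mono[of p q "inverse q"]
  by (intro ennreal_le_inverse) (auto intro: order_trans)

context missing_data
begin

text \<open>\<open>Lam m\<close> is a Hoelder constant of the conditional means of the residuals of \<open>pop m\<close>.\<close>

definition lip :: real where "lip = 2 * max na 1 * (L1 + L2 + L3) * (C / c)"

definition Lam :: "nat \<Rightarrow> real" where "Lam m = L1 + 2 * (na * 3 ^ m) * L2 + (3 ^ m - 1) * lip"

lemma lip_pos: "0 < lip"
  unfolding lip_def using L c c_C by (auto intro!: mult_pos_pos divide_pos_pos)

text \<open>Moving the point changes the integrand by at most \<open>G\<close> and the conditional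
  law by its total variation distance; a function bounded by \<open>K\<close> turns the latter into
  the second term.\<close>

lemma cmean_hoelder:
  assumes S: "S \<in> SS" and u: "u \<in> subspace_of S" and u': "u' \<in> subspace_of S"
    and g: "g \<in> borel_measurable (leb UNIV)" and gK: "\<And>x. \<bar>g x\<bar> \<le> K"
    and G: "\<And>v. \<bar>g (merge S (-S) (u, v)) - g (merge S (-S) (u', v))\<bar> \<le> G"
  shows "\<bar>cmean S g u - cmean S g u'\<bar> \<le> G + 2 * K * tv_dist (k S u) (k S u')"
proof -
  interpret k1: prob_space "k S u" by (rule k_prob(1)[OF S u])
  have m: "(\<lambda>v. g (merge S (-S) (w, v))) \<in> borel_measurable (k S u)" if "w \<in> subspace_of S" for w
    using measurable_compose[OF merge_measurable[OF S that] g] k_prob(2)[OF S that] k_prob(2)[OF S u]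
    by (simp cong: measurable_cong_sets)
  have i: "integrable (k S u) (\<lambda>v. g (merge S (-S) (w, v)))" if "w \<in> subspace_of S" for w
    using m[OF that] gK by (intro k1.integrable_const_bound[of _ K]) auto
  have "\<bar>\<integral>v. g (merge S (-S) (u, v)) - g (merge S (-S) (u', v)) \<partial>k S u\<bar> \<le> (\<integral>v. G \<partial>k S u)"
    using G i[OF u] i[OF u'] by (intro order_trans[OF integral_abs_bound] integral_mono) auto
  then have 1: "\<bar>(\<integral>v. g (merge S (-S) (u, v)) \<partial>k S u) - (\<integral>v. g (merge S (-S) (u', v)) \<partial>k S u)\<bar> \<le> G"
    using i[OF u] i[OF u'] by (simp add: k1.prob_space)
  have 2: "\<bar>(\<integral>v. g (merge S (-S) (u', v)) \<partial>k S u) - (\<integral>v. g (merge S (-S) (u', v)) \<partial>k S u')\<bar> \<le> 2 * K * tv_dist (k S u) (k S u')"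
    using k_prob(2)[OF S u] k_prob(2)[OF S u'] gK m[OF u']
    by (intro integral_diff_le_tv_dist k_prob(1)[OF S]) (auto simp: u u')
  show ?thesis unfolding cmean_def using 1 2 by linarith
qed

text \<open>In the relative bound on the weight \<open>lam S\<close> cancels, and the remaining
  denominator is at least \<open>c\<close>.\<close>

lemma wt_hoelder:
  assumes S: "S \<in> SS" and u: "u \<in> subspace_of S" and u': "u' \<in> subspace_of S" and "supdist S u u' \<le> 1"
  shows "\<bar>wt S u - wt S u'\<bar> \<le> L3 / c * supdist S u u' powr \<beta>"
proof -
  have "\<bar>wt S u - wt S u'\<bar> \<le> \<bar>lam S * rb S u - lam S * rb S u'\<bar> / (lam S * rb S u)"
    unfolding wt_def by (rule wt_diff_le) (use lam_rb_pos[OF S] u u' in auto)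
  also have "\<dots> = \<bar>rb S u - rb S u'\<bar> / rb S u"
    using lam_pos[OF S] by (simp add: abs_mult flip: right_diff_distrib)
  also have "\<dots> \<le> \<bar>rb S u - rb S u'\<bar> / c"
    using rbar_bounds[OF S u] c by (intro divide_left_mono) auto
  also have "\<dots> \<le> (L3 * supdist S u u' powr \<beta>) / c"
    using rbar_hoelder[OF assms] c by (intro divide_right_mono) auto
  finally show ?thesis by simp
qed

text \<open>The two constants feed each other: the conditional mean of a residual inherits the
  constants of the other blocks, and multiplication by the weight adds that of \<open>wt\<close>.
  \<open>lip\<close> is chosen so that the direct contributions of \<open>L1\<close>,
  \<open>L2\<close> and \<open>L3\<close> at step m are together at most \<open>3 ^ m * lip\<close>;
  then 3^m - 1 plus 2 * 3^m - 1 stays below 3^(m+1) - 1 and the recursion closes.\<close>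

lemma pop_hoelder:
  "S \<in> SS \<Longrightarrow> u \<in> subspace_of S \<Longrightarrow> u' \<in> subspace_of S \<Longrightarrow> supdist S u u' \<le> 1 \<Longrightarrow>
    \<bar>pop m S u - pop m S u'\<bar> \<le> (3 ^ m - 1) * lip / real (card SS) * supdist S u u' powr \<beta>"
  "S \<in> SS \<Longrightarrow> u \<in> subspace_of S \<Longrightarrow> u' \<in> subspace_of S \<Longrightarrow> supdist S u u' \<le> 1 \<Longrightarrow>
    \<bar>cmean S (residual SS a (pop m) S) u - cmean S (residual SS a (pop m) S) u'\<bar> \<le> Lam m * supdist S u u' powr \<beta>"
proof -
  let ?N = "real (card SS)"
  have N: "1 \<le> ?N" by (rule card_SS)
  \<comment> \<open>Kept as an implication from the block constants at \<open>m\<close>, so that the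
    same argument serves inside the induction and for the second claim.\<close>
  have cm: "\<bar>cmean S (residual SS a (pop m) S) u - cmean S (residual SS a (pop m) S) u'\<bar> \<le> Lam m * supdist S u u' powr \<beta>"
    if H: "\<forall>S\<in>SS. \<forall>u\<in>subspace_of S. \<forall>u'\<in>subspace_of S. supdist S u u' \<le> 1 \<longrightarrow>
    \<bar>pop m S u - pop m S u'\<bar> \<le> (3 ^ m - 1) * lip / ?N * supdist S u u' powr \<beta>"
      and S: "S \<in> SS" and u: "u \<in> subspace_of S" and u': "u' \<in> subspace_of S" and s1: "supdist S u u' \<le> 1"
    for m S u u'
  proof -
    let ?s = "supdist S u u' powr \<beta>"
    have m1: "(1::real) \<le> 3 ^ m" by (rule one_le_power) simp
    have mono: "supdist S' (merge S (-S) (u, v)) (merge S (-S) (u', v)) powr \<beta> \<le> ?s" for S' v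
      using \<beta> by (intro powr_mono2 supdist_merge supdist_nonneg) auto
    have pt: "\<bar>residual SS a (pop m) S (merge S (-S) (u, v)) - residual SS a (pop m) S (merge S (-S) (u', v))\<bar>
        \<le> L1 * ?s + (3 ^ m - 1) * lip * ?s" (is "\<bar>?r - ?r'\<bar> \<le> _") for v
    proof -
      let ?x = "merge S (-S) (u, v)" and ?x' = "merge S (-S) (u', v)"
      have "\<bar>a ?x - a ?x'\<bar> \<le> L1 * supdist UNIV ?x ?x' powr \<beta>"
        using supdist_merge[of UNIV S u v u'] s1 by (intro a_hoelder) auto
      also have "\<dots> \<le> L1 * ?s" using L mono[of UNIV v] by (intro mult_left_mono) auto
      finally have 1: "\<bar>a ?x - a ?x'\<bar> \<le> L1 * ?s" .
      have "\<bar>(\<Sum>S'\<in>SS - {S}. pop m S' (restrict ?x S')) - (\<Sum>S'\<in>SS - {S}. pop m S' (restrict ?x' S'))\<bar>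
          \<le> (\<Sum>S'\<in>SS - {S}. (3 ^ m - 1) * lip / ?N * ?s)"
        unfolding sum_subtractf[symmetric]
      proof (intro order_trans[OF sum_abs] sum_mono)
        fix S' assume S': "S' \<in> SS - {S}"
        have "\<bar>pop m S' (restrict ?x S') - pop m S' (restrict ?x' S')\<bar> \<le>
            (3 ^ m - 1) * lip / ?N * supdist S' (restrict ?x S') (restrict ?x' S') powr \<beta>"
          using S' supdist_merge[of S' S u v u'] s1
          by (intro H[THEN bspec, THEN bspec, THEN bspec, THEN mp]) auto
        also have "\<dots> \<le> (3 ^ m - 1) * lip / ?N * ?s"
          using lip_pos m1 N mono[of S' v] by (intro mult_left_mono) auto
        finally show "\<bar>pop m S' (restrict ?x S') - pop m S' (restrict ?x' S')\<bar> \<le> (3 ^ m - 1) * lip / ?N * ?s" .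
      qed
      also have "\<dots> = (?N - 1) / ?N * ((3 ^ m - 1) * lip * ?s)"
        using S N by (simp add: of_nat_diff)
      also have "\<dots> \<le> 1 * ((3 ^ m - 1) * lip * ?s)"
        using N lip_pos m1 by (intro mult_right_mono) auto
      finally show ?thesis using 1 unfolding residual_def by linarith
    qed
    have "\<bar>cmean S (residual SS a (pop m) S) u - cmean S (residual SS a (pop m) S) u'\<bar>
        \<le> (L1 * ?s + (3 ^ m - 1) * lip * ?s) + 2 * (na * 3 ^ m) * tv_dist (k S u) (k S u')"
      by (rule cmean_hoelder[OF S u u' pop_residual_measurable pop_bound(2)[OF S] pt])
    also have "\<dots> \<le> (L1 * ?s + (3 ^ m - 1) * lip * ?s) + 2 * (na * 3 ^ m) * (L2 * ?s)"
      using k_hoelder[OF S u u' s1] na_nonneg by (intro add_left_mono mult_left_mono) auto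
    also have "\<dots> = Lam m * ?s" by (simp add: Lam_def algebra_simps)
    finally show ?thesis .
  qed
  have pp: "\<bar>pop m S u - pop m S u'\<bar> \<le> (3 ^ m - 1) * lip / ?N * supdist S u u' powr \<beta>"
    if "S \<in> SS" "u \<in> subspace_of S" "u' \<in> subspace_of S" "supdist S u u' \<le> 1" for m S u u'
    using that
  proof (induction m arbitrary: S u u')
    case (Suc m)
    note S = Suc.prems(1) and u = Suc.prems(2) and u' = Suc.prems(3)
    let ?s = "supdist S u u' powr \<beta>" and ?G = "cmean S (residual SS a (pop m) S)" and ?M = "wmean S (residual SS a (pop m) S)"
    have m1: "(1::real) \<le> 3 ^ m" by (rule one_le_power) simp
    have G: "\<bar>?G u - ?G u'\<bar> \<le> Lam m * ?s"
      by (rule cm[OF _ Suc.prems]) (blast intro: Suc.IH)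
    have b: "\<bar>?G u' - ?M\<bar> \<le> 2 * (na * 3 ^ m)"
      using cmean_bound[OF S u' pop_residual_measurable pop_bound(2)[OF S]]
        wmean_bound[OF S pop_residual_measurable pop_bound(2)[OF S]] by (smt (verit))
    have w: "\<bar>wt S u\<bar> \<le> 1" using wt_bounds[OF S u] by auto
    have "\<bar>wt S u * (?G u - ?G u') + (wt S u - wt S u') * (?G u' - ?M)\<bar> \<le>
        \<bar>wt S u\<bar> * \<bar>?G u - ?G u'\<bar> + \<bar>wt S u - wt S u'\<bar> * \<bar>?G u' - ?M\<bar>"
      by (rule order_trans[OF abs_triangle_ineq]) (simp add: abs_mult)
    also have "\<dots> \<le> 1 * (Lam m * ?s) + (L3 / c * ?s) * (2 * (na * 3 ^ m))"
      using w G wt_hoelder[OF Suc.prems] b L c na_nonneg by (intro add_mono mult_mono) auto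
    also have "\<dots> = (Lam m + L3 / c * (2 * (na * 3 ^ m))) * ?s" by (simp add: algebra_simps)
    also have "\<dots> \<le> ((3 ^ m - 1) * lip + 3 ^ m * lip) * ?s"
    proof (intro mult_right_mono)
      have q: "1 \<le> C / c" using c c_C by simp
      \<comment> \<open>The three parts of \<open>lip\<close> absorb \<open>L3 / c\<close>,
        \<open>L1\<close> and \<open>L2\<close> in turn. The maximum with 1 is there for
        \<open>L1\<close>, whose contribution carries no factor \<open>na\<close>.\<close>
      have "L3 / c \<le> L3 * (C / c)" using L c c_C by (simp add: field_simps)
      then have "L3 / c * (2 * (na * 3 ^ m)) \<le> (L3 * (C / c)) * (2 * (max na 1 * 3 ^ m))"
        using L c c_C na_nonneg by (intro mult_mono) auto
      moreover have "L1 * 1 \<le> (L1 * (C / c)) * (2 * (max na 1 * 3 ^ m))"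
      proof (intro mult_mono)
        show "L1 \<le> L1 * (C / c)" using mult_left_mono[OF q, of L1] L by simp
        have "1 * 1 \<le> max na 1 * 3 ^ m" using m1 by (intro mult_mono) (auto simp: le_max_iff_disj)
        then show "1 \<le> 2 * (max na 1 * 3 ^ m)" by simp
      qed (use L q c c_C in auto)
      moreover have "2 * (na * 3 ^ m) * L2 \<le> 2 * (max na 1 * 3 ^ m) * (L2 * (C / c))"
        using mult_left_mono[OF q, of L2] L na_nonneg q by (intro mult_mono) auto
      ultimately show "Lam m + L3 / c * (2 * (na * 3 ^ m)) \<le> (3 ^ m - 1) * lip + 3 ^ m * lip"
        unfolding Lam_def lip_def by (simp add: algebra_simps)
    qed simp
    finally have 1: "\<bar>wt S u * (?G u - ?G u') + (wt S u - wt S u') * (?G u' - ?M)\<bar> \<le> (2 * 3 ^ m - 1) * lip * ?s"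
      by (simp add: algebra_simps)
    have 2: "\<bar>pop m S u - pop m S u'\<bar> \<le> (3 ^ m - 1) * lip / ?N * ?s" by (rule Suc.IH[OF Suc.prems])
    have eq: "pop (Suc m) S u - pop (Suc m) S u' = (1 - 1 / ?N) * (pop m S u - pop m S u') +
        1 / ?N * (wt S u * (?G u - ?G u') + (wt S u - wt S u') * (?G u' - ?M))"
      by (simp add: algebra_simps diff_divide_distrib add_divide_distrib)
    have "\<bar>pop (Suc m) S u - pop (Suc m) S u'\<bar> \<le> (1 - 1 / ?N) * \<bar>pop m S u - pop m S u'\<bar> +
        1 / ?N * \<bar>wt S u * (?G u - ?G u') + (wt S u - wt S u') * (?G u' - ?M)\<bar>"
      unfolding eq using N by (intro order_trans[OF abs_triangle_ineq]) (simp add: abs_mult)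
    also have "\<dots> \<le> 1 * ((3 ^ m - 1) * lip / ?N * ?s) + 1 / ?N * ((2 * 3 ^ m - 1) * lip * ?s)"
    proof (rule add_mono)
      show "(1 - 1 / ?N) * \<bar>pop m S u - pop m S u'\<bar> \<le> 1 * ((3 ^ m - 1) * lip / ?N * ?s)"
        by (rule mult_mono[OF _ 2]) (use N in simp_all)
      show "1 / ?N * \<bar>wt S u * (?G u - ?G u') + (wt S u - wt S u') * (?G u' - ?M)\<bar> \<le> 1 / ?N * ((2 * 3 ^ m - 1) * lip * ?s)"
        by (rule mult_left_mono[OF 1]) simp
    qed
    also have "\<dots> = (3 ^ Suc m - 2) * lip / ?N * ?s"
    proof -
      have "1 * ((p - 1) * l / n * s) + 1 / n * ((2 * p - 1) * l * s) = (3 * p - 2) * l / n * s" for p l n s :: real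
        by (cases "n = 0") (auto simp: field_simps)
      then show ?thesis by (simp only: power_Suc)
    qed
    also have "\<dots> \<le> (3 ^ Suc m - 1) * lip / ?N * ?s"
      using lip_pos N by (intro mult_right_mono divide_right_mono) auto
    finally show ?case .
  qed simp
  show "S \<in> SS \<Longrightarrow> u \<in> subspace_of S \<Longrightarrow> u' \<in> subspace_of S \<Longrightarrow> supdist S u u' \<le> 1 \<Longrightarrow>
    \<bar>pop m S u - pop m S u'\<bar> \<le> (3 ^ m - 1) * lip / ?N * supdist S u u' powr \<beta>" by (rule pp)
  show "S \<in> SS \<Longrightarrow> u \<in> subspace_of S \<Longrightarrow> u' \<in> subspace_of S \<Longrightarrow> supdist S u u' \<le> 1 \<Longrightarrow>
    \<bar>cmean S (residual SS a (pop m) S) u - cmean S (residual SS a (pop m) S) u'\<bar> \<le> Lam m * supdist S u u' powr \<beta>"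
    by (rule cm) (blast intro: pp)
qed

lemma Lam_nonneg: "0 \<le> Lam m"
  unfolding Lam_def using L na_nonneg lip_pos one_le_power[of "3::real" m]
  by (intro add_nonneg_nonneg mult_nonneg_nonneg) auto

text \<open>The factor \<open>C / c\<close> enters \<open>Lam m\<close> only for \<open>m \<ge> 1\<close>, so it is absorbed by the growth in \<open>m\<close>.\<close>

lemma Lam_square_le: "(Lam m)\<^sup>2 \<le> 16 * max (na\<^sup>2) 1 * (L1 + L2 + L3)\<^sup>2 * 9 ^ m * (C / c) ^ Suc m"
proof -
  let ?x = "max na 1" and ?L = "L1 + L2 + L3" and ?q = "C / c"
  have q: "1 \<le> ?q" using c c_C by simp
  have m1: "(1::real) \<le> 3 ^ m" by (rule one_le_power) simp
  have x2: "?x\<^sup>2 = max (na\<^sup>2) 1" using na_nonneg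
    by (cases "na \<le> 1") (auto simp: max_def power2_eq_square dest: mult_mono intro: order_antisym simp: mult_le_one abs_square_le_1[unfolded power2_eq_square])
  \<comment> \<open>Switches the \<open>lip\<close> part off at m = 0. There (1 + C/c)^2 would
    require two powers of C/c, and only one is available.\<close>
  define e where "e = (if m = 0 then 0 else ?q)"
  have "1 * 1 \<le> max na 1 * 3 ^ m" using m1 by (intro mult_mono) (auto simp: le_max_iff_disj)
  then have "1 \<le> 2 * (max na 1 * 3 ^ m)" by simp
  then have "L1 * 1 + 2 * (na * 3 ^ m) * L2 \<le> L1 * (2 * (?x * 3 ^ m)) + 2 * (?x * 3 ^ m) * (L2 + L3)"
    using L m1 na_nonneg by (intro add_mono mult_mono) auto
  moreover have "(3 ^ m - 1) * lip \<le> 3 ^ m * (2 * ?x * ?L * e)"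
  proof (cases "m = 0")
    case False
    then have "2 * ?x * ?L * e = lip" by (simp add: e_def lip_def)
    moreover have "(3 ^ m - 1) * lip \<le> 3 ^ m * lip" using lip_pos by (intro mult_right_mono) auto
    ultimately show ?thesis by (simp only:)
  qed (simp add: e_def)
  ultimately have le: "Lam m \<le> 2 * ?x * ?L * 3 ^ m * (1 + e)"
    unfolding Lam_def by (simp add: algebra_simps)
  have e: "(1 + e)\<^sup>2 \<le> 4 * ?q ^ Suc m"
  proof (cases "m = 0")
    case True then show ?thesis using q by (simp add: e_def)
  next
    case False
    have "(1 + ?q)\<^sup>2 \<le> (2 * ?q)\<^sup>2" using q by (intro power_mono) auto
    also have "\<dots> = 4 * ?q ^ 2" by (simp add: power2_eq_square)
    also have "\<dots> \<le> 4 * ?q ^ Suc m" using False q by (intro mult_left_mono power_increasing) auto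
    finally show ?thesis using False by (simp add: e_def)
  qed
  have "(Lam m)\<^sup>2 \<le> (2 * ?x * ?L * 3 ^ m * (1 + e))\<^sup>2"
    using le Lam_nonneg by (intro power_mono) auto
  also have "\<dots> = 4 * ?x\<^sup>2 * ?L\<^sup>2 * 9 ^ m * (1 + e)\<^sup>2"
  proof -
    have "(3 ^ m)\<^sup>2 = (9::real) ^ m" by (simp add: power2_eq_square flip: power_mult_distrib)
    then show ?thesis by (simp add: power_mult_distrib)
  qed
  also have "\<dots> \<le> 4 * ?x\<^sup>2 * ?L\<^sup>2 * 9 ^ m * (4 * ?q ^ Suc m)"
    using e by (intro mult_left_mono) auto
  finally show ?thesis by (simp add: x2 mult_ac)
qed

end

section \<open>Covering arguments and the mean of kernel weights\<close>

context missing_data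
begin

definition pball :: "'d set \<Rightarrow> real \<Rightarrow> ('d \<Rightarrow> real) \<Rightarrow> ennreal" where
  "pball S h x = emeasure (law f) {y. supdist S x y \<le> h}"

lemma ball_sets [measurable]: "{y. supdist S x y \<le> h} \<in> sets (leb UNIV)"
proof -
  have "{y\<in>space (leb UNIV). supdist S x y \<le> h} \<in> sets (leb UNIV)" by measurable
  then show ?thesis by simp
qed

lemma pball_measurable [measurable]: "pball S h \<in> borel_measurable (leb UNIV)"
proof -
  let ?Q = "{z\<in>space (leb UNIV \<Otimes>\<^sub>M law f). supdist S (fst z) (snd z) \<le> h}"
  have "?Q \<in> sets (leb UNIV \<Otimes>\<^sub>M law f)" by measurable
  then have "(\<lambda>x. emeasure (law f) (Pair x -` ?Q)) \<in> borel_measurable (leb UNIV)"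
    by (rule measurable_emeasure_Pair)
  moreover have "Pair x -` ?Q = {y. supdist S x y \<le> h}" for x by (auto simp: space_pair_measure)
  ultimately show ?thesis by (simp add: pball_def[abs_def])
qed

lemma pball_finite: "pball S h x \<noteq> \<top>"
  unfolding pball_def by simp

text \<open>A cell of diameter at most \<open>h\<close> lies in the ball around each of its points,
  so on the cell the integrand is at most the inverse of the mass of the cell. Integrating that over
  the cell gives at most 1, also when its mass is 0.\<close>

lemma covering:
  assumes "finite Ix" and Q: "\<And>l. l \<in> Ix \<Longrightarrow> Q l \<in> sets (leb UNIV)"
    and small: "\<And>l x x'. l \<in> Ix \<Longrightarrow> x \<in> Q l \<Longrightarrow> x' \<in> Q l \<Longrightarrow> supdist S x x' \<le> h"
    and E: "E \<subseteq> (\<Union>l\<in>Ix. Q l)"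
  shows "(\<integral>\<^sup>+x. indicator E x * inverse (pball S h x) \<partial>law f) \<le> of_nat (card Ix)"
proof -
  have "(\<integral>\<^sup>+x. indicator E x * inverse (pball S h x) \<partial>law f) \<le>
      (\<integral>\<^sup>+x. (\<Sum>l\<in>Ix. inverse (emeasure (law f) (Q l)) * indicator (Q l) x) \<partial>law f)"
  proof (rule nn_integral_mono)
    fix x
    show "indicator E x * inverse (pball S h x) \<le> (\<Sum>l\<in>Ix. inverse (emeasure (law f) (Q l)) * indicator (Q l) x)"
    proof (cases "x \<in> E")
      case True
      then obtain l where l: "l \<in> Ix" "x \<in> Q l" using E by auto
      have "emeasure (law f) (Q l) \<le> pball S h x"
        unfolding pball_def using small[OF l(1,2)] by (intro emeasure_mono) auto
      then have "inverse (pball S h x) \<le> inverse (emeasure (law f) (Q l)) * indicator (Q l) x"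
        using l by (simp add: ennreal_inverse_antimono)
      also have "\<dots> \<le> (\<Sum>l\<in>Ix. inverse (emeasure (law f) (Q l)) * indicator (Q l) x)"
        using l assms(1) by (intro member_le_sum) auto
      finally show ?thesis using True by simp
    qed simp
  qed
  also have "\<dots> = (\<Sum>l\<in>Ix. inverse (emeasure (law f) (Q l)) * emeasure (law f) (Q l))"
    using Q by (subst nn_integral_sum) (auto simp: nn_integral_cmult_indicator)
  also have "\<dots> \<le> (\<Sum>l\<in>Ix. 1)"
    by (intro sum_mono ennreal_inverse_times_le)
  finally show ?thesis by simp
qed

text \<open>The ball is cut into the orthants at its centre \<open>y\<close>: two points within
  \<open>h\<close> of \<open>y\<close> on the same side of it in each coordinate are within
  \<open>h\<close> of each other. This is where the power of 2 in \<open>A\<close>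
  originates.\<close>

lemma covering_ball:
  assumes h: "0 \<le> h"
  shows "(\<integral>\<^sup>+x. indicator {x. supdist S x y \<le> h} x * inverse (pball S h x) \<partial>law f) \<le> 2 ^ card S"
proof -
  let ?Q = "\<lambda>\<sigma>. {x. supdist S x y \<le> h \<and> (\<forall>j\<in>S. y j \<le> x j \<longleftrightarrow> j \<in> \<sigma>)}"
  have "(\<integral>\<^sup>+x. indicator {x. supdist S x y \<le> h} x * inverse (pball S h x) \<partial>law f) \<le> of_nat (card (Pow S))"
  proof (rule covering[where Q="?Q"])
    show "?Q \<sigma> \<in> sets (leb UNIV)" for \<sigma>
    proof -
      have "{x\<in>space (leb UNIV). supdist S x y \<le> h \<and> (\<forall>j\<in>S. y j \<le> x j \<longleftrightarrow> j \<in> \<sigma>)} \<in> sets (leb UNIV)"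
        by measurable
      then show ?thesis by simp
    qed
    show "supdist S x x' \<le> h" if "x \<in> ?Q \<sigma>" "x' \<in> ?Q \<sigma>" for \<sigma> x x'
    proof (subst supdist_le_iff[OF h], rule ballI)
      fix j assume j: "j \<in> S"
      have "\<bar>x j - y j\<bar> \<le> h" "\<bar>x' j - y j\<bar> \<le> h" "y j \<le> x j \<longleftrightarrow> y j \<le> x' j"
        using that j by (auto simp: supdist_le_iff[OF h])
      then show "\<bar>x j - x' j\<bar> \<le> h" by linarith
    qed
    show "{x. supdist S x y \<le> h} \<subseteq> (\<Union>\<sigma>\<in>Pow S. ?Q \<sigma>)"
    proof
      fix x assume "x \<in> {x. supdist S x y \<le> h}"
      then have "x \<in> ?Q {j\<in>S. y j \<le> x j}" by simp
      then show "x \<in> (\<Union>\<sigma>\<in>Pow S. ?Q \<sigma>)" by (intro UN_I[where a="{j\<in>S. y j \<le> x j}"]) auto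
    qed
  qed (rule finite_Pow_iff[THEN iffD2], simp)
  then show ?thesis by (simp add: card_Pow)
qed

text \<open>A half-open grid of mesh \<open>h\<close> on the cube. Each coordinate needs at most 2 T
  / h + 1 cells, and \<open>h \<le> T\<close> turns this into 3 T / h.\<close>

lemma covering_cube:
  assumes h: "0 < h" "h \<le> T"
  shows "(\<integral>\<^sup>+x. indicator {x. supnorm S x \<le> T} x * inverse (pball S h x) \<partial>law f) \<le> ennreal ((3 * T / h) ^ card S)"
proof -
  define m where "m = nat \<lfloor>2 * T / h\<rfloor>"
  let ?Q = "\<lambda>z. {x. \<forall>j\<in>S. real (z j) * h \<le> x j + T \<and> x j + T < (real (z j) + 1) * h}"
  let ?I = "\<Pi>\<^sub>E j\<in>S. {0..m}"
  have "(\<integral>\<^sup>+x. indicator {x. supnorm S x \<le> T} x * inverse (pball S h x) \<partial>law f) \<le> of_nat (card ?I)"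
  proof (rule covering[where Q="?Q"])
    show "finite ?I" by (intro finite_PiE) auto
    show "?Q z \<in> sets (leb UNIV)" for z
    proof -
      have "{x\<in>space (leb UNIV). \<forall>j\<in>S. real (z j) * h \<le> x j + T \<and> x j + T < (real (z j) + 1) * h} \<in> sets (leb UNIV)"
        by measurable
      then show ?thesis by simp
    qed
    show "supdist S x x' \<le> h" if "x \<in> ?Q z" "x' \<in> ?Q z" for z x x'
    proof (subst supdist_le_iff, goal_cases)
      case 2
      show ?case
      proof
        fix j assume "j \<in> S"
        then have "real (z j) * h \<le> x j + T" "x j + T < (real (z j) + 1) * h"
           "real (z j) * h \<le> x' j + T" "x' j + T < (real (z j) + 1) * h" using that by auto
        then show "\<bar>x j - x' j\<bar> \<le> h" by (simp add: algebra_simps abs_le_iff)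
      qed
    qed (use h in simp)
    show "{x. supnorm S x \<le> T} \<subseteq> (\<Union>z\<in>?I. ?Q z)"
    proof
      fix x assume "x \<in> {x. supnorm S x \<le> T}"
      then have x: "\<bar>x j\<bar> \<le> T" if "j \<in> S" for j using abs_le_supnorm[OF that, of x] by auto
      define z where "z = (\<lambda>j\<in>S. nat \<lfloor>(x j + T) / h\<rfloor>)"
      have "z \<in> ?I"
      proof (rule PiE_I)
        fix j assume j: "j \<in> S"
        have "(x j + T) / h \<le> 2 * T / h" using x[OF j] h by (intro divide_right_mono) auto
        then show "z j \<in> {0..m}" using j by (auto simp: z_def m_def intro!: nat_mono floor_mono)
      qed (simp add: z_def)
      moreover have "x \<in> ?Q z"
      proof (intro CollectI ballI)
        fix j assume j: "j \<in> S"
        have "0 \<le> (x j + T) / h" using x[OF j] h by auto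
        then have "real (z j) \<le> (x j + T) / h" "(x j + T) / h < real (z j) + 1"
          using j by (auto simp: z_def)
        then show "real (z j) * h \<le> x j + T \<and> x j + T < (real (z j) + 1) * h"
          using h by (simp add: pos_le_divide_eq pos_divide_less_eq)
      qed
      ultimately show "x \<in> (\<Union>z\<in>?I. ?Q z)" by (rule UN_I[where a=z])
    qed
  qed
  also have "of_nat (card ?I) = ennreal (real (m + 1) ^ card S)"
    by (simp add: card_PiE ennreal_of_nat_eq_real_of_nat add.commute)
  also have "\<dots> \<le> ennreal ((3 * T / h) ^ card S)"
  proof (intro ennreal_leI power_mono)
    have "real m \<le> 2 * T / h" unfolding m_def using h by (simp add: of_nat_nat)
    moreover have "1 \<le> T / h" using h by simp
    ultimately show "real (m + 1) \<le> 3 * T / h" by simp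
  qed simp
  finally show ?thesis .
qed

lemma ball_compl: "emeasure (law f) {y. supdist S x y \<le> h} + emeasure (law f) {y. \<not> supdist S x y \<le> h} = 1"
proof -
  have "{y. \<not> supdist S x y \<le> h} \<in> sets (leb UNIV)"
    using sets.compl_sets[OF ball_sets[of S x h]] by (simp add: Compl_eq_Diff_UNIV[symmetric] Collect_neg_eq)
  then have "emeasure (law f) {y. supdist S x y \<le> h} + emeasure (law f) {y. \<not> supdist S x y \<le> h} =
      emeasure (law f) ({y. supdist S x y \<le> h} \<union> {y. \<not> supdist S x y \<le> h})"
    by (intro plus_emeasure) auto
  also have "{y. supdist S x y \<le> h} \<union> {y. \<not> supdist S x y \<le> h} = UNIV" by auto
  finally show ?thesis using emeasure_space_1 by simp
qed

text \<open>\<open>cnt\<close> is binomial with success probability \<open>pball S h x\<close>, so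
  this is the size-bias bound divided by that probability.\<close>

lemma nn_integral_inverse_cnt:
  assumes "finite K"
  shows "of_nat (Suc (card K)) * (\<integral>\<^sup>+y. ennreal (1 / (1 + cnt S h K x y)) \<partial>PiM K (\<lambda>_. law f)) \<le> inverse (pball S h x)"
proof (rule ennreal_le_inverse)
  have "(\<integral>\<^sup>+y. ennreal (1 / (1 + cnt S h K x y)) \<partial>PiM K (\<lambda>_. law f)) =
      (\<integral>\<^sup>+y. (\<lambda>k. ennreal (1 / real (Suc k))) (card {j\<in>K. supdist S x (y j) \<le> h}) \<partial>PiM K (\<lambda>_. law f))"
    by (intro nn_integral_cong) (simp add: cnt_card[OF assms] add.commute)
  also have "\<dots> = binom_mean (emeasure (law f) {y\<in>space (law f). supdist S x y \<le> h})
      (emeasure (law f) {y\<in>space (law f). \<not> supdist S x y \<le> h}) (card K) (\<lambda>k. ennreal (1 / real (Suc k)))"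
    by (rule nn_integral_PiM_card[OF prob_space_axioms assms]) simp
  finally show "of_nat (Suc (card K)) * (\<integral>\<^sup>+y. ennreal (1 / (1 + cnt S h K x y)) \<partial>PiM K (\<lambda>_. law f)) * pball S h x \<le> 1"
    using binom_mean_inverse_Suc[OF ball_compl[of S x h], of "card K"] by (simp add: pball_def mult_ac)
qed (rule pball_finite)

text \<open>The key estimate behind Stone's theorem, before integration over \<open>x\<close>.\<close>

lemma nn_integral_weighted_sum:
  assumes K: "finite K" and D[measurable]: "D \<in> borel_measurable (leb UNIV)"
  shows "(\<integral>\<^sup>+y. (\<Sum>i\<in>K. ennreal (W S h K x y i) * D (y i)) \<partial>PiM K (\<lambda>_. law f)) \<le>
    (\<integral>\<^sup>+z. D z * indicator {z. supdist S x z \<le> h} z \<partial>law f) * inverse (pball S h x)"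
proof -
  interpret PP: product_prob_space "\<lambda>_. law f" by (intro product_prob_spaceI prob_space_axioms)
  let ?I = "\<integral>\<^sup>+z. D z * indicator {z. supdist S x z \<le> h} z \<partial>law f"
  have comp: "(\<lambda>y. y j) \<in> PiM K' (\<lambda>_. law f) \<rightarrow>\<^sub>M leb UNIV" if "j \<in> K'" for j K'
    using measurable_component_singleton[OF that, of "\<lambda>_. law f"] by (simp cong: measurable_cong_sets)
  have sd: "(\<lambda>y. supdist S x (y j)) \<in> borel_measurable (PiM K' (\<lambda>_. law f))" if "j \<in> K'" for j K'
    by (intro borel_measurable_supdist borel_measurable_const measurable_leb_component[OF comp[OF that] UNIV_I])
  have Wm: "(\<lambda>y. W S h K x y i) \<in> borel_measurable (PiM K (\<lambda>_. law f))" if "i \<in> K" for i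
    by (rule measurable_W[OF sd that])
  \<comment> \<open>Observation \<open>i\<close> is integrated out first: once it lies in the ball,
    its weight is 1 / (1 + count of the others), which is independent of it. Size biasing with
    \<open>card K\<close> - 1 trials then supplies exactly the factor \<open>card K\<close>.\<close>
  have each: "of_nat (card K) * (\<integral>\<^sup>+y. ennreal (W S h K x y i) * D (y i) \<partial>PiM K (\<lambda>_. law f)) \<le> ?I * inverse (pball S h x)"
    if i: "i \<in> K" for i
  proof -
    let ?K = "K - {i}"
    have ins: "insert i ?K = K" using i by auto
    have "(\<integral>\<^sup>+y. ennreal (W S h K x y i) * D (y i) \<partial>PiM (insert i ?K) (\<lambda>_. law f)) =
        (\<integral>\<^sup>+y. \<integral>\<^sup>+z. ennreal (W S h K x (y(i := z)) i) * D ((y(i := z)) i) \<partial>law f \<partial>PiM ?K (\<lambda>_. law f))"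
    proof (rule PP.product_nn_integral_insert)
      show "(\<lambda>y. ennreal (W S h K x y i) * D (y i)) \<in> borel_measurable (PiM (insert i ?K) (\<lambda>_. law f))"
        unfolding ins using Wm[OF i] measurable_compose[OF comp[OF i] D] by measurable
    qed (use K in auto)
    also have "\<dots> = (\<integral>\<^sup>+y. ?I * ennreal (1 / (1 + cnt S h ?K x y)) \<partial>PiM ?K (\<lambda>_. law f))"
    proof (rule nn_integral_cong)
      fix y
      have c: "cnt S h K x (y(i := z)) = 1 + cnt S h ?K x y" if "supdist S x z \<le> h" for z
      proof -
        have "cnt S h (insert i ?K) x (y(i := z)) = 1 + cnt S h ?K x (y(i := z))"
          unfolding cnt_def using K that by (subst sum.insert) auto
        also have "cnt S h ?K x (y(i := z)) = cnt S h ?K x y"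
          unfolding cnt_def by (intro sum.cong) auto
        finally show ?thesis by (simp only: ins)
      qed
      have "(\<integral>\<^sup>+z. ennreal (W S h K x (y(i := z)) i) * D ((y(i := z)) i) \<partial>law f) =
          (\<integral>\<^sup>+z. (D z * indicator {z. supdist S x z \<le> h} z) * ennreal (1 / (1 + cnt S h ?K x y)) \<partial>law f)"
        by (intro nn_integral_cong) (auto simp: W_def c mult.commute split: split_indicator)
      then show "(\<integral>\<^sup>+z. ennreal (W S h K x (y(i := z)) i) * D ((y(i := z)) i) \<partial>law f) = ?I * ennreal (1 / (1 + cnt S h ?K x y))"
        by (simp add: nn_integral_multc)
    qed
    also have "\<dots> = ?I * (\<integral>\<^sup>+y. ennreal (1 / (1 + cnt S h ?K x y)) \<partial>PiM ?K (\<lambda>_. law f))"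
    proof (rule nn_integral_cmult)
      have "(\<lambda>y. cnt S h ?K x y) \<in> borel_measurable (PiM ?K (\<lambda>_. law f))"
        by (rule measurable_cnt) (rule sd)
      then show "(\<lambda>y. ennreal (1 / (1 + cnt S h ?K x y))) \<in> borel_measurable (PiM ?K (\<lambda>_. law f))"
        by measurable
    qed
    finally have "of_nat (card K) * (\<integral>\<^sup>+y. ennreal (W S h K x y i) * D (y i) \<partial>PiM K (\<lambda>_. law f)) =
        ?I * (of_nat (Suc (card ?K)) * (\<integral>\<^sup>+y. ennreal (1 / (1 + cnt S h ?K x y)) \<partial>PiM ?K (\<lambda>_. law f)))"
      using card.remove[OF K i] by (simp only: ins mult.left_commute)
    also have "\<dots> \<le> ?I * inverse (pball S h x)"
      using K by (intro mult_left_mono nn_integral_inverse_cnt) auto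
    finally show ?thesis .
  qed
  show ?thesis
  proof (cases "K = {}")
    case False
    then have q: "0 < card K" using K by (simp add: card_gt_0_iff)
    define J where "J i = (\<integral>\<^sup>+y. ennreal (W S h K x y i) * D (y i) \<partial>PiM K (\<lambda>_. law f))" for i
    have "(\<integral>\<^sup>+y. (\<Sum>i\<in>K. ennreal (W S h K x y i) * D (y i)) \<partial>PiM K (\<lambda>_. law f)) = (\<Sum>i\<in>K. J i)"
      unfolding J_def
      by (rule nn_integral_sum) (use Wm measurable_compose[OF comp D] in measurable)
    moreover have "(\<Sum>i\<in>K. J i) \<le> ?I * inverse (pball S h x)"
    proof -
      \<comment> \<open>The factor \<open>card K\<close> is positive and finite, so it can be
        cancelled in \<open>ennreal\<close>.\<close>
      have "of_nat (card K) * (\<Sum>i\<in>K. J i) \<le> (\<Sum>i\<in>K. ?I * inverse (pball S h x))"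
        unfolding sum_distrib_left J_def by (intro sum_mono each)
      also have "\<dots> = of_nat (card K) * (?I * inverse (pball S h x))" by simp
      finally show ?thesis using q
        by (subst (asm) ennreal_mult_le_mult_iff) (auto simp: of_nat_less_top less_imp_neq)
    qed
    ultimately show ?thesis by simp
  qed simp
qed

end

subsection \<open>The error of the fit\<close>

text \<open>Cauchy-Schwarz with the square roots of the weights; if the weights sum to 0, both
  quotients are 0.\<close>

lemma weighted_mean_Jensen:
  fixes v b :: "'i \<Rightarrow> real"
  assumes "\<And>i. i \<in> K \<Longrightarrow> 0 \<le> v i"
  shows "((\<Sum>i\<in>K. v i * b i) / (\<Sum>i\<in>K. v i))\<^sup>2 \<le> (\<Sum>i\<in>K. v i * (b i)\<^sup>2) / (\<Sum>i\<in>K. v i)"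
proof -
  have V: "0 \<le> (\<Sum>i\<in>K. v i)" by (intro sum_nonneg assms)
  have "(\<Sum>i\<in>K. v i * b i) = (\<Sum>i\<in>K. sqrt (v i) * (sqrt (v i) * b i))"
    by (intro sum.cong) (auto simp: assms simp flip: mult.assoc)
  then have "(\<Sum>i\<in>K. v i * b i)\<^sup>2 \<le> (\<Sum>i\<in>K. (sqrt (v i))\<^sup>2) * (\<Sum>i\<in>K. (sqrt (v i) * b i)\<^sup>2)"
    by (simp only: Cauchy_Schwarz_ineq_sum)
  also have "\<dots> = (\<Sum>i\<in>K. v i) * (\<Sum>i\<in>K. v i * (b i)\<^sup>2)"
    by (intro arg_cong2[of _ _ _ _ "(*)"] sum.cong) (auto simp: assms power_mult_distrib)
  finally have "(\<Sum>i\<in>K. v i * b i)\<^sup>2 / (\<Sum>i\<in>K. v i)\<^sup>2 \<le> (\<Sum>i\<in>K. v i) * (\<Sum>i\<in>K. v i * (b i)\<^sup>2) / (\<Sum>i\<in>K. v i)\<^sup>2"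
    by (intro divide_right_mono) auto
  then show ?thesis by (cases "(\<Sum>i\<in>K. v i) = 0") (simp_all add: power_divide power2_eq_square)
qed

lemma square_sum3_le: "(x + y + z)\<^sup>2 \<le> 3 * (x\<^sup>2 + y\<^sup>2 + (z::real)\<^sup>2)"
proof -
  have "0 \<le> (x - y)\<^sup>2 + (y - z)\<^sup>2 + (x - z)\<^sup>2" by simp
  then show ?thesis by (simp add: power2_eq_square algebra_simps)
qed

lemma le3_mono:
  "x \<le> 3 * (p + q + e) \<Longrightarrow> p \<le> p' \<Longrightarrow> q \<le> q' \<Longrightarrow> e \<le> e' \<Longrightarrow> x \<le> 3 * (p' + q' + (e'::real))"
  by (auto simp: algebra_simps)

lemma le3_combine:
  "z \<le> 3 * (P + Q + R) \<Longrightarrow> P \<le> 3 * (p1 + p2 + p3) \<Longrightarrow> Q \<le> 3 * (s + R + t) \<Longrightarrow>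
    z \<le> 9 * (p1 + p2 + p3 + s + t) + 12 * (R::real)"
  by (auto simp: algebra_simps)

lemma square_sum2_le: "(x + y)\<^sup>2 \<le> 2 * (x\<^sup>2 + (y::real)\<^sup>2)"
  using zero_le_power2[of "x - y"] by (simp add: power2_eq_square algebra_simps)

text \<open>One round of \<open>alpha_hat\<close> with the previous fit as a free argument, so that
  this fit can be frozen while the new piece is random.\<close>

definition fit_step ::
  "'d::finite set set \<Rightarrow> (('d \<Rightarrow> real) \<Rightarrow> real) \<Rightarrow> ('d set \<Rightarrow> ('d \<Rightarrow> real) \<Rightarrow> real) \<Rightarrow>
   ('d set \<Rightarrow> real) \<Rightarrow> real \<Rightarrow> real \<Rightarrow> (nat \<Rightarrow> ('d \<Rightarrow> real)) \<Rightarrow> nat set \<Rightarrow>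
   ('d set \<Rightarrow> ('d \<Rightarrow> real) \<Rightarrow> real) \<Rightarrow> 'd set \<Rightarrow> ('d \<Rightarrow> real) \<Rightarrow> real" where
  "fit_step SS a r lam h T x K \<alpha> S u =
    (let g = (\<lambda>z. residual SS a \<alpha> S z * indicator {z. supnorm UNIV z \<le> T} z); w = w_hat r lam x K S
     in if supnorm S u \<le> T
        then (1 - 1 / real (card SS)) * \<alpha> S u + 1 / real (card SS) * w u *
          ((\<Sum>i\<in>K. g (x i) * (kern h S (\<lambda>j. u j - x i j) / f_hat h x K S u)) / card K
           - (\<Sum>i\<in>K. w (restrict (x i) S) * g (x i)) / (\<Sum>i\<in>K. w (restrict (x i) S)))
        else 0)"

lemma alpha_hat_Suc:
  "alpha_hat SS a r lam h T x J (Suc m) = fit_step SS a r lam h T x (J (Suc m)) (alpha_hat SS a r lam h T x J m)"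
  by (intro ext) (simp add: fit_step_def Let_def)

lemma fit_step_cong:
  "(\<And>i. i \<in> K \<Longrightarrow> x i = x' i) \<Longrightarrow> fit_step SS a r lam h T x K \<alpha> = fit_step SS a r lam h T x' K \<alpha>"
  by (intro ext) (simp add: fit_step_def Let_def w_hat_def r_hat_def f_hat_def cong: sum.cong)

text \<open>A fit reads no data beyond its own pieces; this turns independence of pieces into
  independence of fits.\<close>

lemma alpha_hat_cong:
  "(\<And>l i. l \<in> {1..m} \<Longrightarrow> i \<in> J l \<Longrightarrow> x i = x' i) \<Longrightarrow>
    alpha_hat SS a r lam h T x J m = alpha_hat SS a r lam h T x' J m"
proof (induction m)
  case (Suc m)
  have "alpha_hat SS a r lam h T x J m = alpha_hat SS a r lam h T x' J m"
    by (rule Suc.IH) (rule Suc.prems, auto)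
  then show ?case unfolding alpha_hat_Suc using Suc.prems by (auto intro!: fit_step_cong)
qed simp

text \<open>The normalising power of 2 h and the sample size cancel between the kernel and
  \<open>f_hat\<close>, which leaves the plain weights \<open>W\<close>.\<close>

lemma local_average_eq:
  assumes "finite K" "K \<noteq> {}" "0 < h"
  shows "(\<Sum>i\<in>K. g (y i) * (kern h S (\<lambda>j. restrict x S j - y i j) / f_hat h y K S (restrict x S))) / card K =
    (\<Sum>i\<in>K. W S h K x y i * g (y i))"
proof -
  have kern: "kern h S (\<lambda>j. restrict x S j - y i j) = (if supdist S x (y i) \<le> h then 1 else 0) * (1 / (2 * h) ^ card S)" for i
  proof -
    have "supnorm S (\<lambda>j. restrict x S j - y i j) = supdist S x (y i)"
      unfolding supdist_def by (rule supnorm_cong) simp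
    then show ?thesis by (simp add: kern_def)
  qed
  have fh: "f_hat h y K S (restrict x S) = cnt S h K x y * (1 / (2 * h) ^ card S) / card K"
    unfolding f_hat_def kern cnt_def sum_distrib_right[symmetric] ..
  have q: "0 < real (card K)" using assms by (simp add: card_gt_0_iff)
  have "g (y i) * (kern h S (\<lambda>j. restrict x S j - y i j) / f_hat h y K S (restrict x S)) / card K = W S h K x y i * g (y i)" for i
    unfolding fh kern using q assms(3) by (simp add: W_def)
  then show ?thesis by (simp add: sum_divide_distrib)
qed

context missing_data
begin

text \<open>The unknown normalisation \<open>R S\<close> cancels, so the estimated weight differs
  from \<open>wt\<close> through one scalar only, the sample mean of \<open>rb\<close>, which
  replaces 1.\<close>

lemma w_hat_eq:
  assumes "S \<in> SS"
  shows "w_hat r lam y K S u = lam S * rb S u / ((\<Sum>i\<in>K. rb S (restrict (y i) S)) / card K + lam S * rb S u)"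
proof -
  have "r_hat r y K S = R S * ((\<Sum>i\<in>K. rb S (restrict (y i) S)) / card K)"
    unfolding r_hat_def using assms by (simp add: r_eq sum_distrib_left)
  moreover have "lam S * r S u = R S * (lam S * rb S u)" using assms by (simp add: r_eq)
  ultimately show ?thesis
    unfolding w_hat_def using R_pos[OF assms] by (simp only: distrib_left[symmetric] mult_divide_mult_cancel_left_if) simp
qed

text \<open>The error of the update is split into that of the local average, that of the weighted
  mean, and that of the weight in front. The local average in turn has an inherited part \<delta>, a
  centred noise \<epsilon> and a bias; the weighted mean has an inherited part, a part due to
  estimated weights, and the sampling error X. Everything is pointwise and deterministic.\<close>

lemma fit_step_error:
  fixes y :: "nat \<Rightarrow> 'd \<Rightarrow> real" and K :: "nat set" and m :: nat and \<alpha> :: "'d set \<Rightarrow> ('d \<Rightarrow> real) \<Rightarrow> real"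
  assumes S: "S \<in> SS" and K: "finite K" "K \<noteq> {}" and h: "0 < h" "h \<le> 1" and x: "supnorm S x \<le> T"
  defines "g \<equiv> residual SS a (pop m) S" and "b \<equiv> na * 3 ^ m" and "q \<equiv> C / c"
  defines "\<delta> \<equiv> (\<lambda>z. residual SS a \<alpha> S z * indicator {z. supnorm UNIV z \<le> T} z - g z)"
  defines "\<epsilon> \<equiv> (\<lambda>z. g z - cmean S g (restrict z S))"
  defines "\<rho> \<equiv> (\<Sum>i\<in>K. rb S (restrict (y i) S)) / card K"
  defines "X \<equiv> (\<Sum>i\<in>K. wt S (restrict (y i) S) * (g (y i) - wmean S g)) / (\<Sum>i\<in>K. wt S (restrict (y i) S))"
  shows "(fit_step SS a r lam h T y K \<alpha> S (restrict x S) - pop (Suc m) S (restrict x S))\<^sup>2 \<le>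
    2 * (\<alpha> S (restrict x S) - pop m S (restrict x S))\<^sup>2 +
    18 / (real (card SS))\<^sup>2 * ((\<Sum>i\<in>K. W S h K x y i * (\<delta> (y i))\<^sup>2) + (\<Sum>i\<in>K. W S h K x y i * \<epsilon> (y i))\<^sup>2
       + ((Lam m)\<^sup>2 * h powr (2 * \<beta>) + b\<^sup>2 * (1 / (1 + cnt S h K x y)))
       + q * ((\<Sum>i\<in>K. (\<delta> (y i))\<^sup>2) / card K) + X\<^sup>2)
    + 96 / (real (card SS))\<^sup>2 * b\<^sup>2 * (\<rho> - 1)\<^sup>2"
proof -
  let ?N = "real (card SS)" and ?G = "\<lambda>z. cmean S g (restrict z S)" and ?W = "W S h K x y"
  let ?u = "restrict x S" and ?c0 = "wmean S g"
  have N: "1 \<le> ?N" by (rule card_SS)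
  have q1: "1 \<le> q" using c c_C by (simp add: q_def)
  have k0: "0 < real (card K)" using K by (simp add: card_gt_0_iff)
  have gb: "\<bar>g z\<bar> \<le> b" for z unfolding g_def b_def by (rule pop_bound(2)[OF S])
  have gm: "g \<in> borel_measurable (leb UNIV)" unfolding g_def by (rule pop_residual_measurable)
  have Gb: "\<bar>?G z\<bar> \<le> b" for z by (rule cmean_bound[OF S restrict_subspace gm gb])
  have c0b: "\<bar>?c0\<bar> \<le> b" by (rule wmean_bound[OF S gm gb])
  have b0: "0 \<le> b" using gb[of undefined] by linarith
  define t where "t i = lam S * rb S (restrict (y i) S)" for i
  have t0: "0 < t i" for i unfolding t_def by (rule lam_rb_pos[OF S restrict_subspace])
  have \<rho>0: "0 < \<rho>" unfolding \<rho>_def using K rb_pos[OF S restrict_subspace] by (intro divide_pos_pos sum_pos k0) auto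
  define v where "v i = t i / (\<rho> + t i)" for i
  have v0: "0 < v i" for i unfolding v_def using t0[of i] \<rho>0 by simp
  have vhat: "w_hat r lam y K S (restrict (y i) S) = v i" for i
    unfolding w_hat_eq[OF S] v_def t_def \<rho>_def ..
  have wt: "wt S (restrict (y i) S) = t i / (1 + t i)" for i unfolding wt_def t_def ..
  define w where "w i = t i / (1 + t i)" for i
  have w0: "0 < w i" for i unfolding w_def using t0[of i] by simp
  have V0: "0 < (\<Sum>i\<in>K. v i)" and W0: "0 < (\<Sum>i\<in>K. w i)" using K v0 w0 by (auto intro!: sum_pos)
  \<comment> \<open>A relative bound: the error is proportional to the estimated weight itself, so
    it can be summed over the observations and divided by the sum of these weights.\<close>
  have rel: "\<bar>s / (\<rho> + s) - s / (1 + s)\<bar> \<le> s / (\<rho> + s) * \<bar>\<rho> - 1\<bar>" if "0 < s" for s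
  proof -
    have "s / (\<rho> + s) - s / (1 + s) = s / (\<rho> + s) * ((1 - \<rho>) / (1 + s))"
      using that \<rho>0 by (simp add: field_simps)
    then have "\<bar>s / (\<rho> + s) - s / (1 + s)\<bar> = s / (\<rho> + s) * (\<bar>\<rho> - 1\<bar> / (1 + s))"
      using that \<rho>0 by (simp add: abs_mult abs_minus_commute)
    also have "\<dots> \<le> s / (\<rho> + s) * \<bar>\<rho> - 1\<bar>"
      using that \<rho>0 divide_left_mono[of 1 "1 + s" "\<bar>\<rho> - 1\<bar>"] by (intro mult_left_mono) auto
    finally show ?thesis .
  qed
  define wh where "wh = lam S * rb S ?u / (\<rho> + lam S * rb S ?u)"
  have s0: "0 < lam S * rb S ?u" by (rule lam_rb_pos[OF S restrict_subspace])
  have wh: "0 \<le> wh" "wh \<le> 1" unfolding wh_def using s0 \<rho>0 by auto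
  have whd: "\<bar>wh - wt S ?u\<bar> \<le> \<bar>\<rho> - 1\<bar>"
  proof -
    have "\<bar>wh - wt S ?u\<bar> \<le> wh * \<bar>\<rho> - 1\<bar>" unfolding wh_def wt_def by (rule rel[OF s0])
    also have "\<dots> \<le> 1 * \<bar>\<rho> - 1\<bar>" using wh by (intro mult_right_mono) auto
    finally show ?thesis by simp
  qed
  define Gh where "Gh = (\<Sum>i\<in>K. ?W i * (g (y i) + \<delta> (y i)))"
  define ch where "ch = (\<Sum>i\<in>K. v i * (g (y i) + \<delta> (y i))) / (\<Sum>i\<in>K. v i)"
  have gd: "residual SS a \<alpha> S z * indicator {z. supnorm UNIV z \<le> T} z = g z + \<delta> z" for z
    by (simp add: \<delta>_def)
  have fit: "fit_step SS a r lam h T y K \<alpha> S ?u = (1 - 1 / ?N) * \<alpha> S ?u + 1 / ?N * wh * (Gh - ch)"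
    using x local_average_eq[OF K h(1), of "\<lambda>z. g z + \<delta> z" y S x]
    by (simp add: fit_step_def Let_def gd Gh_def ch_def vhat)
       (simp add: w_hat_eq[OF S] wh_def \<rho>_def)

  have 1: "(Gh - ?G x)\<^sup>2 \<le> 3 * ((\<Sum>i\<in>K. ?W i * (\<delta> (y i))\<^sup>2) + (\<Sum>i\<in>K. ?W i * \<epsilon> (y i))\<^sup>2
       + ((Lam m)\<^sup>2 * h powr (2 * \<beta>) + b\<^sup>2 * (1 / (1 + cnt S h K x y))))"
  proof -
    \<comment> \<open>Smoothing bias plus the defect of the total weight; the second summand
      vanishes unless the ball is empty.\<close>
    define E where "E = (\<Sum>i\<in>K. ?W i * (?G (y i) - ?G x)) + ((\<Sum>i\<in>K. ?W i) - 1) * ?G x"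
    have "Gh - ?G x = (\<Sum>i\<in>K. ?W i * \<delta> (y i)) + (\<Sum>i\<in>K. ?W i * \<epsilon> (y i)) + E"
      unfolding Gh_def \<epsilon>_def E_def by (simp add: algebra_simps sum.distrib sum_subtractf sum_distrib_left)
    then have "(Gh - ?G x)\<^sup>2 \<le> 3 * ((\<Sum>i\<in>K. ?W i * \<delta> (y i))\<^sup>2 + (\<Sum>i\<in>K. ?W i * \<epsilon> (y i))\<^sup>2 + E\<^sup>2)"
      using square_sum3_le by simp
    moreover have "(\<Sum>i\<in>K. ?W i * \<delta> (y i))\<^sup>2 \<le> (\<Sum>i\<in>K. ?W i * (\<delta> (y i))\<^sup>2)" by (rule sum_W_Jensen)
    moreover have "E\<^sup>2 \<le> (Lam m)\<^sup>2 * h powr (2 * \<beta>) + b\<^sup>2 * (1 / (1 + cnt S h K x y))"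
    \<comment> \<open>Without neighbours the local average is 0 and the error is at most
      \<open>b\<close>; then 1 / (1 + \<open>cnt\<close>) equals 1 and pays for it.\<close>
    proof (cases "cnt S h K x y = 0")
      case True
      then have "?W i = 0" for i by (simp add: W_def)
      then have "E\<^sup>2 = (?G x)\<^sup>2" by (simp add: E_def)
      also have "\<dots> \<le> b\<^sup>2" by (rule abs_le_imp_square_le[OF Gb])
      finally show ?thesis using True by (simp add: add_increasing)
    next
      case False
      then have E: "E = (\<Sum>i\<in>K. ?W i * (?G (y i) - ?G x))" by (simp add: E_def sum_W)
      have "\<bar>E\<bar> \<le> (\<Sum>i\<in>K. ?W i * (Lam m * h powr \<beta>))"
        unfolding E
      proof (intro order_trans[OF sum_abs] sum_mono)
        fix i
        show "\<bar>?W i * (?G (y i) - ?G x)\<bar> \<le> ?W i * (Lam m * h powr \<beta>)"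
        proof (cases "supdist S x (y i) \<le> h")
          case True
          have "\<bar>?G x - ?G (y i)\<bar> \<le> Lam m * supdist S ?u (restrict (y i) S) powr \<beta>"
            unfolding g_def using True h by (intro pop_hoelder(2)[OF S]) auto
          also have "\<dots> \<le> Lam m * h powr \<beta>"
            using True \<beta> Lam_nonneg by (intro mult_left_mono powr_mono2) (auto simp: supdist_nonneg)
          finally show ?thesis
            unfolding abs_mult abs_of_nonneg[OF W_nonneg] abs_minus_commute[of "?G x"]
            by (intro mult_left_mono) (auto simp: W_nonneg)
        qed (simp add: W_def)
      qed
      also have "\<dots> = Lam m * h powr \<beta>" using False by (simp add: sum_W flip: sum_distrib_right)
      finally have "E\<^sup>2 \<le> (Lam m * h powr \<beta>)\<^sup>2" by (rule abs_le_imp_square_le)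
      also have "\<dots> = (Lam m)\<^sup>2 * h powr (2 * \<beta>)"
        using h by (simp add: power_mult_distrib powr_power mult.commute)
      also have "\<dots> \<le> (Lam m)\<^sup>2 * h powr (2 * \<beta>) + b\<^sup>2 * (1 / (1 + cnt S h K x y))"
        using cnt_nonneg[of S h K x y] by simp
      finally show ?thesis .
    qed
    ultimately show ?thesis by (rule le3_mono[OF _ _ order_refl])
  qed

  have 2: "(ch - ?c0)\<^sup>2 \<le> 3 * (q * ((\<Sum>i\<in>K. (\<delta> (y i))\<^sup>2) / card K) + 4 * b\<^sup>2 * (\<rho> - 1)\<^sup>2 + X\<^sup>2)"
  proof -
    define ct where "ct = (\<Sum>i\<in>K. w i * g (y i)) / (\<Sum>i\<in>K. w i)"
    have Xeq: "X = ct - ?c0"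
      unfolding X_def ct_def wt w_def[symmetric] using W0
      by (simp add: right_diff_distrib sum_subtractf diff_divide_distrib flip: sum_distrib_right)
    have ctb: "\<bar>ct\<bar> \<le> b"
    proof -
      have "\<bar>\<Sum>i\<in>K. w i * g (y i)\<bar> \<le> (\<Sum>i\<in>K. w i * b)"
        using gb w0 by (intro order_trans[OF sum_abs] sum_mono) (auto simp: abs_mult abs_of_pos)
      then show ?thesis unfolding ct_def using W0
        by (simp add: abs_of_pos pos_divide_le_eq mult.commute flip: sum_distrib_left)
    qed
    define A1 where "A1 = (\<Sum>i\<in>K. v i * \<delta> (y i)) / (\<Sum>i\<in>K. v i)"
    define A2 where "A2 = (\<Sum>i\<in>K. v i * (g (y i) - ct)) / (\<Sum>i\<in>K. v i)"
    have split: "ch - ?c0 = A1 + A2 + X"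
      unfolding Xeq ch_def A1_def A2_def using V0
      by (simp add: distrib_left right_diff_distrib sum.distrib sum_subtractf add_divide_distrib diff_divide_distrib flip: sum_distrib_right)
    have "A1\<^sup>2 \<le> (\<Sum>i\<in>K. v i * (\<delta> (y i))\<^sup>2) / (\<Sum>i\<in>K. v i)"
      unfolding A1_def by (rule weighted_mean_Jensen) (simp add: less_imp_le[OF v0])
    also have "\<dots> \<le> q * ((\<Sum>i\<in>K. (\<delta> (y i))\<^sup>2) / card K)"
    proof -
      \<comment> \<open>All weights are within the factor \<open>q\<close> of each other, whatever
        \<open>lam S\<close> and \<rho> are, so the weighted mean of squares is at most
        \<open>q\<close> times the plain mean. This is the source of C/c in
        \<open>A\<close>.\<close>
      have tq: "t i \<le> q * t j" for i j
      proof -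
        have "rb S (restrict (y i) S) \<le> q * rb S (restrict (y j) S)"
        proof -
          have "rb S (restrict (y i) S) \<le> q * c" unfolding q_def using rbar_bounds[OF S restrict_subspace] c by simp
          also have "\<dots> \<le> q * rb S (restrict (y j) S)"
            using rbar_bounds[OF S restrict_subspace] q1 by (intro mult_left_mono) auto
          finally show ?thesis .
        qed
        from mult_left_mono[OF this less_imp_le[OF lam_pos[OF S]]]
        show ?thesis unfolding t_def by (simp only: mult.left_commute)
      qed
      have vq: "v i \<le> q * v j" for i j
      proof -
        have "t i * (\<rho> + t j) \<le> q * t j * (\<rho> + t i)"
        proof -
          have "t i * \<rho> \<le> q * t j * \<rho>" using tq[of i j] \<rho>0 by (intro mult_right_mono) auto
          moreover have "1 * (t i * t j) \<le> q * (t i * t j)" using q1 t0[of i] t0[of j] by (intro mult_right_mono) auto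
          ultimately show ?thesis by (simp add: algebra_simps)
        qed
        then show ?thesis unfolding v_def using t0[of i] t0[of j] \<rho>0 by (simp add: pos_divide_le_eq pos_le_divide_eq mult_ac)
      qed
      have vV: "real (card K) * v i \<le> q * (\<Sum>j\<in>K. v j)" for i
      proof -
        have "(\<Sum>j\<in>K. v i) \<le> (\<Sum>j\<in>K. q * v j)" by (intro sum_mono vq)
        then show ?thesis by (simp add: sum_distrib_left)
      qed
      have "real (card K) * (\<Sum>i\<in>K. v i * (\<delta> (y i))\<^sup>2) \<le> q * (\<Sum>j\<in>K. v j) * (\<Sum>i\<in>K. (\<delta> (y i))\<^sup>2)"
      proof -
        have "real (card K) * (\<Sum>i\<in>K. v i * (\<delta> (y i))\<^sup>2) = (\<Sum>i\<in>K. real (card K) * v i * (\<delta> (y i))\<^sup>2)"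
          by (simp only: sum_distrib_left mult.assoc)
        also have "\<dots> \<le> (\<Sum>i\<in>K. q * (\<Sum>j\<in>K. v j) * (\<delta> (y i))\<^sup>2)"
          by (intro sum_mono mult_right_mono vV zero_le_power2)
        also have "\<dots> = q * (\<Sum>j\<in>K. v j) * (\<Sum>i\<in>K. (\<delta> (y i))\<^sup>2)"
          by (simp only: sum_distrib_left)
        finally show ?thesis .
      qed
      then show ?thesis using V0 k0 by (simp add: pos_divide_le_eq pos_le_divide_eq mult_ac)
    qed
    finally have a1: "A1\<^sup>2 \<le> q * ((\<Sum>i\<in>K. (\<delta> (y i))\<^sup>2) / card K)" .
    \<comment> \<open>\<open>ct\<close> is the mean under the limiting weights \<open>w\<close>, so
      centring at it makes the sum with those weights vanish and only the differences v - w
      remain.\<close>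
    have "(\<Sum>i\<in>K. w i * (g (y i) - ct)) = (\<Sum>i\<in>K. w i * g (y i)) - (\<Sum>i\<in>K. w i) * ct"
      by (simp only: right_diff_distrib sum_subtractf sum_distrib_right)
    also have "\<dots> = 0" using W0 by (simp add: ct_def)
    finally have "(\<Sum>i\<in>K. w i * (g (y i) - ct)) = 0" .
    then have A2': "A2 = (\<Sum>i\<in>K. (v i - w i) * (g (y i) - ct)) / (\<Sum>i\<in>K. v i)"
      unfolding A2_def by (simp add: left_diff_distrib sum_subtractf)
    have "\<bar>\<Sum>i\<in>K. (v i - w i) * (g (y i) - ct)\<bar> \<le> (\<Sum>i\<in>K. (v i * \<bar>\<rho> - 1\<bar>) * (2 * b))"
    proof (intro order_trans[OF sum_abs] sum_mono)
      fix i
      have "\<bar>v i - w i\<bar> \<le> v i * \<bar>\<rho> - 1\<bar>" unfolding v_def w_def by (rule rel[OF t0])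
      moreover have "\<bar>g (y i) - ct\<bar> \<le> 2 * b" using gb[of "y i"] ctb by linarith
      ultimately show "\<bar>(v i - w i) * (g (y i) - ct)\<bar> \<le> (v i * \<bar>\<rho> - 1\<bar>) * (2 * b)"
        unfolding abs_mult using v0[of i] by (intro mult_mono) auto
    qed
    also have "\<dots> = (2 * b * \<bar>\<rho> - 1\<bar>) * (\<Sum>i\<in>K. v i)"
      unfolding sum_distrib_left by (intro sum.cong) (auto simp: mult_ac)
    finally have "\<bar>A2\<bar> \<le> 2 * b * \<bar>\<rho> - 1\<bar>"
      unfolding A2' using V0 by (simp add: abs_of_pos pos_divide_le_eq)
    then have a2: "A2\<^sup>2 \<le> 4 * b\<^sup>2 * (\<rho> - 1)\<^sup>2"
      using abs_le_imp_square_le[of A2 "2 * b * \<bar>\<rho> - 1\<bar>"] by (simp add: power_mult_distrib)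
    have "(ch - ?c0)\<^sup>2 \<le> 3 * (A1\<^sup>2 + A2\<^sup>2 + X\<^sup>2)" unfolding split by (rule square_sum3_le)
    from le3_mono[OF this a1 a2 order_refl] show ?thesis .
  qed

  have 3: "((wh - wt S ?u) * (?G x - ?c0))\<^sup>2 \<le> 4 * b\<^sup>2 * (\<rho> - 1)\<^sup>2"
  proof -
    have "\<bar>?G x - ?c0\<bar> \<le> 2 * b" using Gb[of x] c0b by linarith
    then have "\<bar>(wh - wt S ?u) * (?G x - ?c0)\<bar> \<le> \<bar>\<rho> - 1\<bar> * (2 * b)"
      unfolding abs_mult using whd by (intro mult_mono) auto
    from abs_le_imp_square_le[OF this] show ?thesis by (simp add: power_mult_distrib mult_ac)
  qed

  \<comment> \<open>Two nested uses of \<open>square_sum3_le\<close> give the factor 9. The ratio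
    error enters both directly and through the weighted mean, in all 3 * 4 + 9 * 4 = 48 times; the
    final factor 2 yields 18 and 96.\<close>
  define Z where "Z = wh * (Gh - ch) - wt S ?u * (?G x - ?c0)"
  have "Z = wh * (Gh - ?G x) + wh * (?c0 - ch) + (wh - wt S ?u) * (?G x - ?c0)"
    unfolding Z_def by (simp add: algebra_simps)
  then have "Z\<^sup>2 \<le> 3 * ((wh * (Gh - ?G x))\<^sup>2 + (wh * (?c0 - ch))\<^sup>2 + ((wh - wt S ?u) * (?G x - ?c0))\<^sup>2)"
    using square_sum3_le by simp
  moreover have "(wh * s)\<^sup>2 \<le> s\<^sup>2" for s
    unfolding power_mult_distrib using mult_right_mono[of "wh\<^sup>2" 1 "s\<^sup>2"] wh by (simp add: power_le_one)
  ultimately have "Z\<^sup>2 \<le> 3 * ((Gh - ?G x)\<^sup>2 + (?c0 - ch)\<^sup>2 + 4 * b\<^sup>2 * (\<rho> - 1)\<^sup>2)"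
    using le3_mono 3 by blast
  then have Z: "Z\<^sup>2 \<le> 9 * ((\<Sum>i\<in>K. ?W i * (\<delta> (y i))\<^sup>2) + (\<Sum>i\<in>K. ?W i * \<epsilon> (y i))\<^sup>2
       + ((Lam m)\<^sup>2 * h powr (2 * \<beta>) + b\<^sup>2 * (1 / (1 + cnt S h K x y)))
       + q * ((\<Sum>i\<in>K. (\<delta> (y i))\<^sup>2) / card K) + X\<^sup>2) + 12 * (4 * b\<^sup>2 * (\<rho> - 1)\<^sup>2)"
    unfolding power2_commute[of ?c0 ch] using 1 2 by (rule le3_combine)
  have "fit_step SS a r lam h T y K \<alpha> S ?u - pop (Suc m) S ?u = (1 - 1 / ?N) * (\<alpha> S ?u - pop m S ?u) + Z / ?N"
    unfolding fit Z_def pop.simps g_def[symmetric] by (simp add: algebra_simps diff_divide_distrib add_divide_distrib)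
  then have "(fit_step SS a r lam h T y K \<alpha> S ?u - pop (Suc m) S ?u)\<^sup>2 \<le>
      2 * (((1 - 1 / ?N) * (\<alpha> S ?u - pop m S ?u))\<^sup>2 + (Z / ?N)\<^sup>2)"
    using square_sum2_le by simp
  also have "\<dots> \<le> 2 * ((\<alpha> S ?u - pop m S ?u)\<^sup>2 + Z\<^sup>2 / ?N\<^sup>2)"
  proof -
    have "(1 - 1 / ?N)\<^sup>2 \<le> 1" using N by (intro power_le_one) auto
    then have "((1 - 1 / ?N) * (\<alpha> S ?u - pop m S ?u))\<^sup>2 \<le> 1 * (\<alpha> S ?u - pop m S ?u)\<^sup>2"
      unfolding power_mult_distrib by (intro mult_right_mono) auto
    then show ?thesis by (simp add: power_divide)
  qed
  also have "\<dots> \<le> 2 * ((\<alpha> S ?u - pop m S ?u)\<^sup>2 +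
      (9 * ((\<Sum>i\<in>K. ?W i * (\<delta> (y i))\<^sup>2) + (\<Sum>i\<in>K. ?W i * \<epsilon> (y i))\<^sup>2
       + ((Lam m)\<^sup>2 * h powr (2 * \<beta>) + b\<^sup>2 * (1 / (1 + cnt S h K x y)))
       + q * ((\<Sum>i\<in>K. (\<delta> (y i))\<^sup>2) / card K) + X\<^sup>2) + 48 * b\<^sup>2 * (\<rho> - 1)\<^sup>2) / ?N\<^sup>2)"
    using Z by (intro mult_left_mono add_left_mono divide_right_mono) auto
  finally have "(fit_step SS a r lam h T y K \<alpha> S ?u - pop (Suc m) S ?u)\<^sup>2 \<le> \<dots>" .
  moreover have "2 * (E + (9 * M + 48 * B * s) / n) = 2 * E + 18 / n * M + 96 / n * B * s" for E M B s n :: real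
    by (simp add: add_divide_distrib algebra_simps)
  ultimately show ?thesis by (simp only:)
qed

lemma measurable_kern:
  assumes "\<And>j. j \<in> S \<Longrightarrow> (\<lambda>\<omega>. z \<omega> j) \<in> borel_measurable M"
  shows "(\<lambda>\<omega>. kern h S (z \<omega>)) \<in> borel_measurable M"
proof -
  have [measurable]: "(\<lambda>\<omega>. supnorm S (z \<omega>)) \<in> borel_measurable M" by (rule borel_measurable_supnorm[OF assms])
  show ?thesis unfolding kern_def by measurable
qed

lemma measurable_fit_step:
  assumes S: "S \<in> SS" and x: "\<And>i. i \<in> K \<Longrightarrow> x i \<in> M \<rightarrow>\<^sub>M leb UNIV" and u: "u \<in> M \<rightarrow>\<^sub>M leb S"
    and \<alpha>: "\<And>S' u. S' \<in> SS \<Longrightarrow> u \<in> M \<rightarrow>\<^sub>M leb S' \<Longrightarrow> (\<lambda>\<omega>. \<alpha> \<omega> S' (u \<omega>)) \<in> borel_measurable M"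
  shows "(\<lambda>\<omega>. fit_step SS a r lam h T (\<lambda>i. x i \<omega>) K (\<alpha> \<omega>) S (u \<omega>)) \<in> borel_measurable M"
proof -
  have rest: "(\<lambda>\<omega>. restrict (x i \<omega>) S') \<in> M \<rightarrow>\<^sub>M leb S'" if "i \<in> K" for i S'
    by (rule measurable_leb_restrict[OF x[OF that] subset_UNIV])
  have ru: "(\<lambda>\<omega>. r S (u' \<omega>)) \<in> borel_measurable M" if "u' \<in> M \<rightarrow>\<^sub>M leb S" for u'
    by (rule measurable_compose[OF that r_meas[OF S]])
  have rh: "(\<lambda>\<omega>. r_hat r (\<lambda>i. x i \<omega>) K S) \<in> borel_measurable M"
    unfolding r_hat_def by (intro borel_measurable_divide borel_measurable_sum ru rest borel_measurable_const)
  have wh: "(\<lambda>\<omega>. w_hat r lam (\<lambda>i. x i \<omega>) K S (u' \<omega>)) \<in> borel_measurable M" if "u' \<in> M \<rightarrow>\<^sub>M leb S" for u'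
    unfolding w_hat_def
    by (intro borel_measurable_divide borel_measurable_add borel_measurable_times borel_measurable_const ru[OF that] rh)
  have gh: "(\<lambda>\<omega>. residual SS a (\<alpha> \<omega>) S (x i \<omega>) * indicator {z. supnorm UNIV z \<le> T} (x i \<omega>)) \<in> borel_measurable M" if "i \<in> K" for i
  proof -
    have [measurable]: "(\<lambda>\<omega>. supnorm UNIV (x i \<omega>)) \<in> borel_measurable M"
      by (rule borel_measurable_supnorm) (rule measurable_leb_component[OF x[OF that] UNIV_I])
    have "(\<lambda>\<omega>. residual SS a (\<alpha> \<omega>) S (x i \<omega>)) \<in> borel_measurable M"
      unfolding residual_def
      by (intro borel_measurable_diff borel_measurable_sum measurable_compose[OF x[OF that] a_meas] \<alpha> rest[OF that]) auto
    moreover have "(\<lambda>\<omega>. indicator {z. supnorm UNIV z \<le> T} (x i \<omega>) :: real) \<in> borel_measurable M"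
      unfolding indicator_def mem_Collect_eq by measurable
    ultimately show ?thesis by (rule borel_measurable_times)
  qed
  have kn: "(\<lambda>\<omega>. kern h S (\<lambda>j. u \<omega> j - x i \<omega> j)) \<in> borel_measurable M" if "i \<in> K" for i
    by (intro measurable_kern borel_measurable_diff measurable_leb_component[OF u] measurable_leb_component[OF x[OF that]]) auto
  have fh: "(\<lambda>\<omega>. f_hat h (\<lambda>i. x i \<omega>) K S (u \<omega>)) \<in> borel_measurable M"
    unfolding f_hat_def by (intro borel_measurable_divide borel_measurable_sum kn borel_measurable_const)
  have [measurable]: "(\<lambda>\<omega>. supnorm S (u \<omega>)) \<in> borel_measurable M"
    by (rule borel_measurable_supnorm) (rule measurable_leb_component[OF u])
  define F where "F \<omega> = (1 - 1 / real (card SS)) * \<alpha> \<omega> S (u \<omega>) + 1 / real (card SS) * w_hat r lam (\<lambda>i. x i \<omega>) K S (u \<omega>) *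
          ((\<Sum>i\<in>K. (residual SS a (\<alpha> \<omega>) S (x i \<omega>) * indicator {z. supnorm UNIV z \<le> T} (x i \<omega>)) * (kern h S (\<lambda>j. u \<omega> j - x i \<omega> j) / f_hat h (\<lambda>i. x i \<omega>) K S (u \<omega>))) / card K
           - (\<Sum>i\<in>K. w_hat r lam (\<lambda>i. x i \<omega>) K S (restrict (x i \<omega>) S) * (residual SS a (\<alpha> \<omega>) S (x i \<omega>) * indicator {z. supnorm UNIV z \<le> T} (x i \<omega>))) / (\<Sum>i\<in>K. w_hat r lam (\<lambda>i. x i \<omega>) K S (restrict (x i \<omega>) S)))" for \<omega>
  have [measurable]: "F \<in> borel_measurable M"
    unfolding F_def[abs_def]
    by (intro borel_measurable_diff borel_measurable_add borel_measurable_times borel_measurable_divide borel_measurable_sum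
        borel_measurable_const gh kn fh wh u rest \<alpha> S)
  have "(\<lambda>\<omega>. fit_step SS a r lam h T (\<lambda>i. x i \<omega>) K (\<alpha> \<omega>) S (u \<omega>)) = (\<lambda>\<omega>. if supnorm S (u \<omega>) \<le> T then F \<omega> else 0)"
    by (simp add: fit_step_def F_def fun_eq_iff Let_def)
  then show ?thesis by simp
qed

lemma measurable_alpha_hat:
  assumes x: "\<And>l i. l \<in> {1..m} \<Longrightarrow> i \<in> J l \<Longrightarrow> x i \<in> M \<rightarrow>\<^sub>M leb UNIV" and "S \<in> SS" and "u \<in> M \<rightarrow>\<^sub>M leb S"
  shows "(\<lambda>\<omega>. alpha_hat SS a r lam h T (\<lambda>i. x i \<omega>) J m S (u \<omega>)) \<in> borel_measurable M"
  using assms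
proof (induction m arbitrary: S u)
  case (Suc m)
  have IH: "(\<lambda>\<omega>. alpha_hat SS a r lam h T (\<lambda>i. x i \<omega>) J m S' (u \<omega>)) \<in> borel_measurable M"
    if "S' \<in> SS" "u \<in> M \<rightarrow>\<^sub>M leb S'" for S' u
    by (rule Suc.IH[OF _ that]) (rule Suc.prems(1), auto)
  have "(\<lambda>\<omega>. fit_step SS a r lam h T (\<lambda>i. x i \<omega>) (J (Suc m)) (alpha_hat SS a r lam h T (\<lambda>i. x i \<omega>) J m) S (u \<omega>)) \<in> borel_measurable M"
    by (rule measurable_fit_step[OF Suc.prems(2) _ Suc.prems(3) IH]) (auto intro: Suc.prems(1)[of "Suc m"])
  then show ?case by (simp only: alpha_hat_Suc)
qed simp

end

section \<open>Averages over one fresh piece\<close>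

context missing_data
begin

lemma PiM_component_measurable:
  assumes "j \<in> K" shows "(\<lambda>y. y j) \<in> PiM K (\<lambda>_. law f) \<rightarrow>\<^sub>M leb UNIV"
  using measurable_component_singleton[OF assms, of "\<lambda>_. law f"] by (simp cong: measurable_cong_sets)

lemma prob_PiM: "prob_space (PiM K (\<lambda>_. law f))"
  by (rule prob_space_PiM) (rule prob_space_axioms)

lemma nn_integral_sum_square_PiM:
  assumes K: "finite (K :: nat set)" and \<psi>[measurable]: "\<psi> \<in> borel_measurable (leb UNIV)"
    and b: "\<And>z. \<bar>\<psi> z\<bar> \<le> B" and mean: "expectation \<psi> = 0"
  shows "(\<integral>\<^sup>+y. ennreal ((\<Sum>i\<in>K. \<psi> (y i))\<^sup>2) \<partial>PiM K (\<lambda>_. law f)) = ennreal (real (card K) * expectation (\<lambda>z. (\<psi> z)\<^sup>2))"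
proof -
  interpret Q: prob_space "PiM K (\<lambda>_. law f)" by (rule prob_PiM)
  have m: "(\<lambda>y. \<psi> (y i)) \<in> borel_measurable (PiM K (\<lambda>_. law f))" if "i \<in> K" for i
    by (rule measurable_compose[OF PiM_component_measurable[OF that] \<psi>])
  have B: "0 \<le> B" using b[of undefined] by linarith
  have i2: "integrable (PiM K (\<lambda>_. law f)) (\<lambda>y. \<psi> (y i) * \<psi> (y j))" if "i \<in> K" "j \<in> K" for i j
    using m that b B by (intro Q.integrable_const_bound[of _ "B * B"]) (auto simp: abs_mult intro!: mult_mono)
  have orth: "(\<integral>y. \<psi> (y i) * \<psi> (y j) \<partial>PiM K (\<lambda>_. law f)) = 0" if "i \<in> K" "j \<in> K" "i \<noteq> j" for i j
    using that mean by (intro integral_PiM_zero[OF prob_space_axioms K that(1) i2]) auto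
  have sq: "integrable (PiM K (\<lambda>_. law f)) (\<lambda>y. (\<psi> (y i))\<^sup>2)" if "i \<in> K" for i
    using i2[OF that that] by (simp add: power2_eq_square)
  have S1: "integrable (PiM K (\<lambda>_. law f)) (\<lambda>y. (\<Sum>i\<in>K. \<psi> (y i))\<^sup>2)"
    by (rule integral_sum_square_orthogonal(1)[OF K m sq orth])
  have S2: "(\<integral>y. (\<Sum>i\<in>K. \<psi> (y i))\<^sup>2 \<partial>PiM K (\<lambda>_. law f)) = (\<Sum>i\<in>K. \<integral>y. (\<psi> (y i))\<^sup>2 \<partial>PiM K (\<lambda>_. law f))"
    by (rule integral_sum_square_orthogonal(2)[OF K m sq orth])
  have each: "(\<integral>y. (\<psi> (y i))\<^sup>2 \<partial>PiM K (\<lambda>_. law f)) = expectation (\<lambda>z. (\<psi> z)\<^sup>2)" if i: "i \<in> K" for i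
  proof -
    have "(\<integral>\<^sup>+y. ennreal ((\<psi> (y i))\<^sup>2) \<partial>PiM K (\<lambda>_. law f)) = (\<integral>\<^sup>+z. ennreal ((\<psi> z)\<^sup>2) \<partial>law f)"
      by (rule nn_integral_PiM_component[OF prob_space_axioms K i, of "\<lambda>z. ennreal ((\<psi> z)\<^sup>2)"]) simp
    then show ?thesis using m[OF i] by (simp add: integral_eq_nn_integral)
  qed
  have "(\<integral>\<^sup>+y. ennreal ((\<Sum>i\<in>K. \<psi> (y i))\<^sup>2) \<partial>PiM K (\<lambda>_. law f)) = ennreal (\<integral>y. (\<Sum>i\<in>K. \<psi> (y i))\<^sup>2 \<partial>PiM K (\<lambda>_. law f))"
    by (rule nn_integral_eq_integral[OF S1]) auto
  then show ?thesis unfolding S2 by (simp add: each)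
qed

text \<open>The summands are orthogonal because the weights see an observation only through its
  coordinates in \<open>S\<close>, given which the residual is centred. What is left is the sum of
  squared weights times at most (2 b)^2, and \<open>sum_W_square\<close> contributes the remaining
  factor 2 of the 8.\<close>

lemma nn_integral_sum_W_centred:
  assumes S: "S \<in> SS" and K: "finite (K :: nat set)" and g: "g \<in> borel_measurable (leb UNIV)" and gb: "\<And>x. \<bar>g x\<bar> \<le> b"
  shows "(\<integral>\<^sup>+y. ennreal ((\<Sum>i\<in>K. W S h K x y i * (g (y i) - cmean S g (restrict (y i) S)))\<^sup>2) \<partial>PiM K (\<lambda>_. law f))
    \<le> ennreal (8 * b\<^sup>2) * (\<integral>\<^sup>+y. ennreal (1 / (1 + cnt S h K x y)) \<partial>PiM K (\<lambda>_. law f))"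
proof -
  interpret Q: prob_space "PiM K (\<lambda>_. law f)" by (rule prob_PiM)
  define \<epsilon> where "\<epsilon> z = g z - cmean S g (restrict z S)" for z
  note [measurable] = g cmean_measurable[OF S g]
  have \<epsilon>m[measurable]: "\<epsilon> \<in> borel_measurable (leb UNIV)" unfolding \<epsilon>_def[abs_def] by measurable
  have \<epsilon>b: "\<bar>\<epsilon> z\<bar> \<le> 2 * b" for z
    using gb[of z] cmean_bound[OF S restrict_subspace g gb, of z] unfolding \<epsilon>_def by linarith
  have sd: "(\<lambda>y. supdist S x (y j)) \<in> borel_measurable (PiM K (\<lambda>_. law f))" if "j \<in> K" for j
    by (intro borel_measurable_supdist borel_measurable_const measurable_leb_component[OF PiM_component_measurable[OF that] UNIV_I])
  have Wm: "(\<lambda>y. W S h K x y i) \<in> borel_measurable (PiM K (\<lambda>_. law f))" if "i \<in> K" for i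
    by (rule measurable_W[OF sd that])
  have cm: "(\<lambda>y. cnt S h K x y) \<in> borel_measurable (PiM K (\<lambda>_. law f))" by (rule measurable_cnt) (rule sd)
  define Z where "Z i y = W S h K x y i * \<epsilon> (y i)" for i y
  have Zm: "Z i \<in> borel_measurable (PiM K (\<lambda>_. law f))" if "i \<in> K" for i
    unfolding Z_def[abs_def] by (intro borel_measurable_times Wm that measurable_compose[OF PiM_component_measurable[OF that] \<epsilon>m])
  have Zb: "\<bar>Z i y\<bar> \<le> 2 * b" for i y
  proof -
    have "\<bar>Z i y\<bar> \<le> 1 * (2 * b)" unfolding Z_def abs_mult
      using W_le_1[OF K, of S h x y i] W_nonneg[of S h K x y i] \<epsilon>b by (intro mult_mono) auto
    then show ?thesis by simp
  qed
  have b0: "0 \<le> b" using gb[of undefined] by linarith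
  have i2: "integrable (PiM K (\<lambda>_. law f)) (\<lambda>y. Z i y * Z j y)" if "i \<in> K" "j \<in> K" for i j
  proof (rule Q.integrable_const_bound[of _ "(2 * b) * (2 * b)"])
    show "AE y in PiM K (\<lambda>_. law f). norm (Z i y * Z j y) \<le> (2 * b) * (2 * b)"
      unfolding real_norm_def abs_mult using Zb b0 by (intro AE_I2 mult_mono) auto
  qed (intro borel_measurable_times Zm that)
  have sq: "integrable (PiM K (\<lambda>_. law f)) (\<lambda>y. (Z i y)\<^sup>2)" if "i \<in> K" for i
    using i2[OF that that] by (simp add: power2_eq_square)
  have orth: "(\<integral>y. Z i y * Z j y \<partial>PiM K (\<lambda>_. law f)) = 0" if ij: "i \<in> K" "j \<in> K" "i \<noteq> j" for i j
  proof (rule integral_PiM_zero[OF prob_space_axioms K ij(1) i2[OF ij(1,2)]])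
    fix y
    \<comment> \<open>Every factor other than \<epsilon> at observation \<open>i\<close>, as a
      function of that observation. It depends only on the coordinates in \<open>S\<close>, so it is
      an admissible test function for orthogonality.\<close>
    define \<phi> where "\<phi> u = W S h K x (y(i := u)) i * W S h K x (y(i := u)) j * \<epsilon> (y j)" for u
    have \<phi>r: "\<phi> (restrict z S) = \<phi> z" for z
    proof -
      have "supdist S x ((y(i := restrict z S)) l) = supdist S x ((y(i := z)) l)" for l by simp
      then show ?thesis unfolding \<phi>_def W_def cnt_def by (simp only:)
    qed
    have sd': "(\<lambda>u. supdist S x ((y(i := u)) l)) \<in> borel_measurable (leb S)" for l
      by (cases "l = i") (auto intro!: borel_measurable_supdist measurable_leb_component[OF measurable_ident])
    have \<phi>m: "\<phi> \<in> borel_measurable (leb S)"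
      unfolding \<phi>_def[abs_def]
      by (intro borel_measurable_times borel_measurable_const measurable_W[OF sd' ij(1)] measurable_W[OF sd' ij(2)])
    have \<phi>b: "\<bar>\<phi> u\<bar> \<le> 2 * b" for u
    proof -
      have "\<bar>\<phi> u\<bar> \<le> 1 * 1 * (2 * b)" unfolding \<phi>_def abs_mult
        using W_le_1[OF K] W_nonneg \<epsilon>b by (intro mult_mono) (auto simp: W_nonneg)
      then show ?thesis by simp
    qed
    have \<phi>i: "integrable (law f) (\<lambda>z. \<phi> (restrict z S))"
      by (rule integrable_bounded[OF measurable_restrict_arg[OF \<phi>m] \<phi>b])
    have "(\<integral>z. \<phi> (restrict z S) * (g z - cmean S g (restrict z S)) \<partial>law f) = 0"
      by (rule cmean_orthogonal[OF S g gb \<phi>m \<phi>i])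
    moreover have "Z i (y(i := z)) * Z j (y(i := z)) = \<phi> (restrict z S) * (g z - cmean S g (restrict z S))" for z
      unfolding \<phi>r using ij by (simp add: Z_def \<phi>_def \<epsilon>_def)
    ultimately show "(\<integral>z. Z i (y(i := z)) * Z j (y(i := z)) \<partial>law f) = 0" by simp
  qed
  have S1: "integrable (PiM K (\<lambda>_. law f)) (\<lambda>y. (\<Sum>i\<in>K. Z i y)\<^sup>2)"
    by (rule integral_sum_square_orthogonal(1)[OF K Zm sq orth])
  have S2: "(\<integral>y. (\<Sum>i\<in>K. Z i y)\<^sup>2 \<partial>PiM K (\<lambda>_. law f)) = (\<Sum>i\<in>K. \<integral>y. (Z i y)\<^sup>2 \<partial>PiM K (\<lambda>_. law f))"
    by (rule integral_sum_square_orthogonal(2)[OF K Zm sq orth])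
  have i1: "integrable (PiM K (\<lambda>_. law f)) (\<lambda>y. 1 / (1 + cnt S h K x y))"
  proof (rule Q.integrable_const_bound[of _ 1])
    show "AE y in PiM K (\<lambda>_. law f). norm (1 / (1 + cnt S h K x y)) \<le> 1"
    proof (rule AE_I2)
      fix y show "norm (1 / (1 + cnt S h K x y)) \<le> 1" using cnt_nonneg[of S h K x y] by (simp add: abs_of_pos)
    qed
  qed (use cm in measurable)
  have "(\<Sum>i\<in>K. \<integral>y. (Z i y)\<^sup>2 \<partial>PiM K (\<lambda>_. law f)) = (\<integral>y. (\<Sum>i\<in>K. (Z i y)\<^sup>2) \<partial>PiM K (\<lambda>_. law f))"
    using sq by (simp add: Bochner_Integration.integral_sum)
  also have "\<dots> \<le> (\<integral>y. 8 * b\<^sup>2 * (1 / (1 + cnt S h K x y)) \<partial>PiM K (\<lambda>_. law f))"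
  proof (rule integral_mono)
    show "integrable (PiM K (\<lambda>_. law f)) (\<lambda>y. \<Sum>i\<in>K. (Z i y)\<^sup>2)" using sq by auto
    show "integrable (PiM K (\<lambda>_. law f)) (\<lambda>y. 8 * b\<^sup>2 * (1 / (1 + cnt S h K x y)))" using i1 by (intro integrable_mult_right)
    fix y
    have "(\<Sum>i\<in>K. (Z i y)\<^sup>2) \<le> (\<Sum>i\<in>K. (W S h K x y i)\<^sup>2 * (2 * b)\<^sup>2)"
      unfolding Z_def power_mult_distrib[of "W S h K x y _"]
      by (intro sum_mono mult_left_mono abs_le_imp_square_le \<epsilon>b) auto
    also have "\<dots> = (\<Sum>i\<in>K. (W S h K x y i)\<^sup>2) * (4 * b\<^sup>2)" by (simp add: sum_distrib_right power_mult_distrib)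
    also have "\<dots> \<le> 2 * (1 / (1 + cnt S h K x y)) * (4 * b\<^sup>2)"
      by (intro mult_right_mono sum_W_square K) auto
    finally show "(\<Sum>i\<in>K. (Z i y)\<^sup>2) \<le> 8 * b\<^sup>2 * (1 / (1 + cnt S h K x y))" by (simp add: mult_ac)
  qed
  also have "\<dots> = 8 * b\<^sup>2 * (\<integral>y. 1 / (1 + cnt S h K x y) \<partial>PiM K (\<lambda>_. law f))"
    by (rule Bochner_Integration.integral_mult_right_zero)
  finally have le: "(\<integral>y. (\<Sum>i\<in>K. Z i y)\<^sup>2 \<partial>PiM K (\<lambda>_. law f)) \<le> 8 * b\<^sup>2 * (\<integral>y. 1 / (1 + cnt S h K x y) \<partial>PiM K (\<lambda>_. law f))"
    unfolding S2 .
  have "(\<integral>\<^sup>+y. ennreal ((\<Sum>i\<in>K. Z i y)\<^sup>2) \<partial>PiM K (\<lambda>_. law f)) = ennreal (\<integral>y. (\<Sum>i\<in>K. Z i y)\<^sup>2 \<partial>PiM K (\<lambda>_. law f))"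
    by (rule nn_integral_eq_integral[OF S1]) auto
  also have "\<dots> \<le> ennreal (8 * b\<^sup>2 * (\<integral>y. 1 / (1 + cnt S h K x y) \<partial>PiM K (\<lambda>_. law f)))"
    by (rule ennreal_leI[OF le])
  also have "\<dots> = ennreal (8 * b\<^sup>2) * ennreal (\<integral>y. 1 / (1 + cnt S h K x y) \<partial>PiM K (\<lambda>_. law f))"
    by (rule ennreal_mult') simp
  also have "ennreal (\<integral>y. 1 / (1 + cnt S h K x y) \<partial>PiM K (\<lambda>_. law f)) = (\<integral>\<^sup>+y. ennreal (1 / (1 + cnt S h K x y)) \<partial>PiM K (\<lambda>_. law f))"
    by (rule nn_integral_eq_integral[OF i1, symmetric]) (auto intro!: add_nonneg_nonneg cnt_nonneg)
  finally show ?thesis by (simp add: Z_def \<epsilon>_def)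
qed

text \<open>Size biasing at each point, then the grid covering of the cube.\<close>

lemma nn_integral_inverse_cnt_cube:
  assumes K: "finite (K :: nat set)" "K \<noteq> {}" and h: "0 < h" "h \<le> T"
  shows "(\<integral>\<^sup>+x. indicator {x. supnorm S x \<le> T} x * (\<integral>\<^sup>+y. ennreal (1 / (1 + cnt S h K x y)) \<partial>PiM K (\<lambda>_. law f)) \<partial>law f)
    \<le> ennreal ((3 * T / h) ^ card S / card K)"
proof -
  define J where "J x = (\<integral>\<^sup>+y. ennreal (1 / (1 + cnt S h K x y)) \<partial>PiM K (\<lambda>_. law f))" for x
  have q: "0 < real (card K)" using K by (simp add: card_gt_0_iff)
  have J: "J x \<le> ennreal (1 / card K) * inverse (pball S h x)" for x
  proof -
    have "ennreal (card K) * J x \<le> of_nat (Suc (card K)) * J x"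
      by (intro mult_right_mono) (auto simp: ennreal_of_nat_eq_real_of_nat)
    also have "\<dots> \<le> inverse (pball S h x)" unfolding J_def by (rule nn_integral_inverse_cnt[OF K(1)])
    finally have "ennreal (1 / card K) * (ennreal (card K) * J x) \<le> ennreal (1 / card K) * inverse (pball S h x)"
      by (intro mult_left_mono) auto
    then show ?thesis using q by (simp add: mult.assoc[symmetric] flip: ennreal_mult)
  qed
  have "(\<integral>\<^sup>+x. indicator {x. supnorm S x \<le> T} x * J x \<partial>law f) \<le>
      (\<integral>\<^sup>+x. ennreal (1 / card K) * (indicator {x. supnorm S x \<le> T} x * inverse (pball S h x)) \<partial>law f)"
    using J by (intro nn_integral_mono) (auto split: split_indicator)
  also have "\<dots> = ennreal (1 / card K) * (\<integral>\<^sup>+x. indicator {x. supnorm S x \<le> T} x * inverse (pball S h x) \<partial>law f)"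
  proof (rule nn_integral_cmult)
    have "{x\<in>space (leb UNIV). supnorm S x \<le> T} \<in> sets (leb UNIV)" by measurable
    then show "(\<lambda>x. indicator {x. supnorm S x \<le> T} x * inverse (pball S h x)) \<in> borel_measurable (law f)"
      by simp
  qed
  also have "\<dots> \<le> ennreal (1 / card K) * ennreal ((3 * T / h) ^ card S)"
    by (intro mult_left_mono covering_cube h) auto
  also have "\<dots> = ennreal ((3 * T / h) ^ card S / card K)"
    using h by (subst ennreal_mult[symmetric]) auto
  finally show ?thesis by (simp add: J_def)
qed

text \<open>After Fubini the condition is on \<open>x\<close> near a fixed observation
  \<open>z\<close>, and \<open>covering_ball\<close> bounds the integral of the inverse ball mass
  over such \<open>x\<close> by a constant that does not depend on the density.\<close>

lemma Stone_bound:
  assumes K: "finite (K :: nat set)" and h: "0 \<le> h" and D[measurable]: "D \<in> borel_measurable (leb UNIV)"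
  shows "(\<integral>\<^sup>+x. \<integral>\<^sup>+y. (\<Sum>i\<in>K. ennreal (W S h K x y i) * D (y i)) \<partial>PiM K (\<lambda>_. law f) \<partial>law f) \<le> 2 ^ card S * (\<integral>\<^sup>+z. D z \<partial>law f)"
proof -
  interpret pair_sigma_finite "law f" "law f" ..
  have "(\<integral>\<^sup>+x. \<integral>\<^sup>+y. (\<Sum>i\<in>K. ennreal (W S h K x y i) * D (y i)) \<partial>PiM K (\<lambda>_. law f) \<partial>law f) \<le>
      (\<integral>\<^sup>+x. (\<integral>\<^sup>+z. D z * indicator {z. supdist S x z \<le> h} z \<partial>law f) * inverse (pball S h x) \<partial>law f)"
    by (intro nn_integral_mono nn_integral_weighted_sum K D)
  also have "\<dots> = (\<integral>\<^sup>+x. \<integral>\<^sup>+z. D z * (indicator {x. supdist S x z \<le> h} x * inverse (pball S h x)) \<partial>law f \<partial>law f)"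
  proof (rule nn_integral_cong)
    fix x
    show "(\<integral>\<^sup>+z. D z * indicator {z. supdist S x z \<le> h} z \<partial>law f) * inverse (pball S h x) =
        (\<integral>\<^sup>+z. D z * (indicator {x. supdist S x z \<le> h} x * inverse (pball S h x)) \<partial>law f)"
      by (subst nn_integral_multc[symmetric]) (auto intro!: nn_integral_cong split: split_indicator)
  qed
  also have "\<dots> = (\<integral>\<^sup>+z. \<integral>\<^sup>+x. D z * (indicator {x. supdist S x z \<le> h} x * inverse (pball S h x)) \<partial>law f \<partial>law f)"
  proof (rule Fubini'[symmetric])
    have [measurable]: "{p\<in>space (law f \<Otimes>\<^sub>M law f). supdist S (fst p) (snd p) \<le> h} \<in> sets (law f \<Otimes>\<^sub>M law f)" by measurable
    have eq: "(case p of (x, z) \<Rightarrow> D z * (indicator {x. supdist S x z \<le> h} x * inverse (pball S h x))) =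
      D (snd p) * (indicator {p\<in>space (law f \<Otimes>\<^sub>M law f). supdist S (fst p) (snd p) \<le> h} p * inverse (pball S h (fst p)))" for p
      by (cases p) (auto simp: space_pair_measure split: split_indicator)
    show "(\<lambda>(x, z). D z * (indicator {x. supdist S x z \<le> h} x * inverse (pball S h x))) \<in> borel_measurable (law f \<Otimes>\<^sub>M law f)"
      unfolding eq by measurable
  qed
  also have "\<dots> \<le> (\<integral>\<^sup>+z. D z * 2 ^ card S \<partial>law f)"
  proof (rule nn_integral_mono)
    fix z
    have "(\<integral>\<^sup>+x. D z * (indicator {x. supdist S x z \<le> h} x * inverse (pball S h x)) \<partial>law f) =
        D z * (\<integral>\<^sup>+x. indicator {x. supdist S x z \<le> h} x * inverse (pball S h x) \<partial>law f)"
    proof (rule nn_integral_cmult)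
      have "{x\<in>space (leb UNIV). supdist S x z \<le> h} \<in> sets (leb UNIV)" by measurable
      then show "(\<lambda>x. indicator {x. supdist S x z \<le> h} x * inverse (pball S h x)) \<in> borel_measurable (law f)" by simp
    qed
    also have "\<dots> \<le> D z * 2 ^ card S" by (intro mult_left_mono covering_ball h) auto
    finally show "(\<integral>\<^sup>+x. D z * (indicator {x. supdist S x z \<le> h} x * inverse (pball S h x)) \<partial>law f) \<le> D z * 2 ^ card S" .
  qed
  also have "\<dots> = 2 ^ card S * (\<integral>\<^sup>+z. D z \<partial>law f)" by (simp add: nn_integral_multc mult.commute)
  finally show ?thesis .
qed

text \<open>The numerator is a centred sum by the choice of \<open>wmean\<close>. The denominator is
  at least \<open>card K\<close> times the lower bound \<open>l\<close> of the weights, and no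
  weight exceeds \<open>C / c * l\<close>; thus \<open>l\<close> cancels and the bound is free of
  \<open>lam S\<close>.\<close>

lemma nn_integral_wmean_error:
  assumes S: "S \<in> SS" and K: "finite (K :: nat set)" "K \<noteq> {}" and g: "g \<in> borel_measurable (leb UNIV)" and gb: "\<And>x. \<bar>g x\<bar> \<le> b"
  shows "(\<integral>\<^sup>+y. ennreal (((\<Sum>i\<in>K. wt S (restrict (y i) S) * (g (y i) - wmean S g)) / (\<Sum>i\<in>K. wt S (restrict (y i) S)))\<^sup>2) \<partial>PiM K (\<lambda>_. law f))
    \<le> ennreal (4 * b\<^sup>2 * (C / c)\<^sup>2 / card K)"
proof -
  let ?q = "C / c"
  have q0: "0 < real (card K)" using K by (simp add: card_gt_0_iff)
  have b0: "0 \<le> b" using gb[of undefined] by linarith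
  define l where "l = lam S * c / (1 + lam S * c)"
  have lc: "0 < lam S * c" using lam_pos[OF S] c by simp
  have l0: "0 < l" unfolding l_def using lc by simp
  have wl: "l \<le> wt S u" "wt S u \<le> ?q * l" if u: "u \<in> subspace_of S" for u
  proof -
    define t where "t = lam S * rb S u"
    have t: "lam S * c \<le> t" "t \<le> ?q * (lam S * c)" using rbar_bounds[OF S u] lam_pos[OF S] c by (auto simp: t_def)
    have m: "s / (1 + s) \<le> t / (1 + t)" if "0 < s" "s \<le> t" for s t :: real using that by (simp add: field_simps)
    show "l \<le> wt S u" unfolding l_def wt_def t_def[symmetric] by (rule m[OF lc t(1)])
    have "t / (1 + t) \<le> t / (1 + lam S * c)" using t lc by (intro divide_left_mono) auto
    also have "\<dots> \<le> ?q * (lam S * c) / (1 + lam S * c)" using t lc by (intro divide_right_mono) auto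
    finally show "wt S u \<le> ?q * l" unfolding l_def wt_def t_def[symmetric] by simp
  qed
  define \<psi> where "\<psi> z = wt S (restrict z S) * (g z - wmean S g)" for z
  note [measurable] = g wt_measurable[OF S]
  have \<psi>m: "\<psi> \<in> borel_measurable (leb UNIV)" unfolding \<psi>_def[abs_def] by measurable
  have \<psi>b: "\<bar>\<psi> z\<bar> \<le> ?q * l * (2 * b)" for z
  proof -
    have "\<bar>g z - wmean S g\<bar> \<le> 2 * b" using gb[of z] wmean_bound[OF S g gb] by linarith
    then show ?thesis unfolding \<psi>_def abs_mult using wl[OF restrict_subspace, of z] l0 by (intro mult_mono) auto
  qed
  have mean: "expectation \<psi> = 0"
  proof -
    have i1: "integrable (law f) (\<lambda>z. wt S (restrict z S) * g z)"
      by (rule integrable_times_bounded[OF integrable_wt[OF S]]) (use gb in auto)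
    then have "expectation \<psi> = expectation (\<lambda>z. wt S (restrict z S) * g z) - expectation (\<lambda>z. wt S (restrict z S)) * wmean S g"
      unfolding \<psi>_def[abs_def] using integrable_wt[OF S] by (simp add: right_diff_distrib)
    then show ?thesis using expectation_wt_pos[OF S] by (simp add: wmean_def)
  qed
  have "(\<integral>\<^sup>+y. ennreal (((\<Sum>i\<in>K. \<psi> (y i)) / (\<Sum>i\<in>K. wt S (restrict (y i) S)))\<^sup>2) \<partial>PiM K (\<lambda>_. law f)) \<le>
      (\<integral>\<^sup>+y. ennreal (1 / (card K * l)\<^sup>2) * ennreal ((\<Sum>i\<in>K. \<psi> (y i))\<^sup>2) \<partial>PiM K (\<lambda>_. law f))"
  proof (rule nn_integral_mono)
    fix y
    have "(\<Sum>i\<in>K. l) \<le> (\<Sum>i\<in>K. wt S (restrict (y i) S))" by (intro sum_mono wl) simp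
    then have "(card K * l)\<^sup>2 \<le> (\<Sum>i\<in>K. wt S (restrict (y i) S))\<^sup>2" using l0 by (intro power_mono) auto
    then have "(\<Sum>i\<in>K. \<psi> (y i))\<^sup>2 / (\<Sum>i\<in>K. wt S (restrict (y i) S))\<^sup>2 \<le> (\<Sum>i\<in>K. \<psi> (y i))\<^sup>2 / (card K * l)\<^sup>2"
    proof (rule divide_left_mono)
      have "0 < (card K * l)\<^sup>2" using q0 l0 by simp
      then show "0 < (\<Sum>i\<in>K. wt S (restrict (y i) S))\<^sup>2 * (card K * l)\<^sup>2"
        using \<open>(card K * l)\<^sup>2 \<le> _\<close> by (intro mult_pos_pos) linarith+
    qed simp
    then show "ennreal (((\<Sum>i\<in>K. \<psi> (y i)) / (\<Sum>i\<in>K. wt S (restrict (y i) S)))\<^sup>2) \<le>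
        ennreal (1 / (card K * l)\<^sup>2) * ennreal ((\<Sum>i\<in>K. \<psi> (y i))\<^sup>2)"
      by (subst ennreal_mult[symmetric]) (auto simp: power_divide intro!: ennreal_leI)
  qed
  also have "\<dots> = ennreal (1 / (card K * l)\<^sup>2) * ennreal (card K * expectation (\<lambda>z. (\<psi> z)\<^sup>2))"
  proof -
    have "(\<lambda>y. ennreal ((\<Sum>i\<in>K. \<psi> (y i))\<^sup>2)) \<in> borel_measurable (PiM K (\<lambda>_. law f))"
      by (intro measurable_compose[OF _ measurable_ennreal] borel_measurable_power borel_measurable_sum
        measurable_compose[OF PiM_component_measurable \<psi>m])
    then show ?thesis
      by (subst nn_integral_cmult) (auto simp: nn_integral_sum_square_PiM[OF K(1) \<psi>m \<psi>b mean])
  qed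
  also have "\<dots> = ennreal (expectation (\<lambda>z. (\<psi> z)\<^sup>2) / (card K * l\<^sup>2))"
    using q0 l0 by (subst ennreal_mult[symmetric]) (auto simp: power_mult_distrib power2_eq_square mult_ac intro!: Bochner_Integration.integral_nonneg)
  also have "\<dots> \<le> ennreal ((?q * l * (2 * b))\<^sup>2 / (card K * l\<^sup>2))"
  proof (intro ennreal_leI divide_right_mono)
    have i: "integrable (law f) (\<lambda>z. (\<psi> z)\<^sup>2)"
      by (rule integrable_bounded[of _ "(?q * l * (2 * b))\<^sup>2"]) (use \<psi>m abs_le_imp_square_le[OF \<psi>b] in auto)
    have "expectation (\<lambda>z. (\<psi> z)\<^sup>2) \<le> expectation (\<lambda>z. (?q * l * (2 * b))\<^sup>2)"
      by (rule integral_mono[OF i integrable_const]) (rule abs_le_imp_square_le[OF \<psi>b])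
    then show "expectation (\<lambda>z. (\<psi> z)\<^sup>2) \<le> (?q * l * (2 * b))\<^sup>2" using prob_space by simp
  qed auto
  also have "(?q * l * (2 * b))\<^sup>2 / (card K * l\<^sup>2) = 4 * b\<^sup>2 * ?q\<^sup>2 / card K"
  proof -
    have "(q * l * (2 * b))\<^sup>2 / (s * l\<^sup>2) = 4 * b\<^sup>2 * q\<^sup>2 / s" for q s :: real
      using l0 by (simp add: power_mult_distrib mult_ac)
    then show ?thesis .
  qed
  finally show ?thesis unfolding \<psi>_def .
qed

text \<open>As the mean is 1, the second moment is at most \<open>C\<close> times the mean, so the
  bound is linear in \<open>C\<close>.\<close>

lemma rb_second_moment:
  assumes S: "S \<in> SS"
  shows "expectation (\<lambda>z. (rb S (restrict z S) - 1)\<^sup>2) \<le> C"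
proof -
  have i2: "integrable (law f) (\<lambda>z. (rb S (restrict z S))\<^sup>2)"
    using rbar_bounds[OF S restrict_subspace] rb_pos[OF S restrict_subspace] S
    by (intro integrable_bounded[of _ "C\<^sup>2"]) (auto intro!: abs_le_imp_square_le simp: abs_of_pos)
  have "expectation (\<lambda>z. (rb S (restrict z S) - 1)\<^sup>2) = expectation (\<lambda>z. (rb S (restrict z S))\<^sup>2) - 2 * expectation (\<lambda>z. rb S (restrict z S)) + 1"
    using i2 integrable_rb[OF S] prob_space by (simp add: power2_diff)
  also have "\<dots> \<le> expectation (\<lambda>z. (rb S (restrict z S))\<^sup>2)" using expectation_rb[OF S] by simp
  also have "\<dots> \<le> expectation (\<lambda>z. C * rb S (restrict z S))"
    using i2 integrable_rb[OF S] rbar_bounds[OF S restrict_subspace] rb_pos[OF S restrict_subspace]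
    by (intro integral_mono) (auto simp: power2_eq_square intro!: mult_right_mono less_imp_le)
  also have "\<dots> = C" using expectation_rb[OF S] by simp
  finally show ?thesis .
qed

lemma nn_integral_ratio_error:
  assumes S: "S \<in> SS" and K: "finite (K :: nat set)" "K \<noteq> {}"
  shows "(\<integral>\<^sup>+y. ennreal (((\<Sum>i\<in>K. rb S (restrict (y i) S)) / card K - 1)\<^sup>2) \<partial>PiM K (\<lambda>_. law f)) \<le> ennreal (C / card K)"
proof -
  have q0: "0 < real (card K)" using K by (simp add: card_gt_0_iff)
  define \<psi> where "\<psi> z = rb S (restrict z S) - 1" for z
  note [measurable] = rb_measurable[OF S]
  have \<psi>m: "\<psi> \<in> borel_measurable (leb UNIV)" unfolding \<psi>_def[abs_def] by measurable
  have \<psi>b: "\<bar>\<psi> z\<bar> \<le> C + 1" for z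
    using rbar_bounds[OF S restrict_subspace, of z] rb_pos[OF S restrict_subspace, of z] unfolding \<psi>_def by linarith
  have mean: "expectation \<psi> = 0"
    unfolding \<psi>_def[abs_def] using integrable_rb[OF S] expectation_rb[OF S] prob_space by simp
  have eq: "((\<Sum>i\<in>K. rb S (restrict (y i) S)) / card K - 1)\<^sup>2 = 1 / (card K)\<^sup>2 * (\<Sum>i\<in>K. \<psi> (y i))\<^sup>2" for y :: "nat \<Rightarrow> 'd \<Rightarrow> real"
  proof -
    have "(\<Sum>i\<in>K. rb S (restrict (y i) S)) / card K - 1 = (\<Sum>i\<in>K. \<psi> (y i)) / card K"
      using q0 by (simp add: \<psi>_def sum_subtractf diff_divide_distrib)
    then show ?thesis by (simp add: power_divide)
  qed
  have m: "(\<lambda>y. ennreal ((\<Sum>i\<in>K. \<psi> (y i))\<^sup>2)) \<in> borel_measurable (PiM K (\<lambda>_. law f))"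
    by (intro measurable_compose[OF _ measurable_ennreal] borel_measurable_power borel_measurable_sum
      measurable_compose[OF PiM_component_measurable \<psi>m])
  have "(\<integral>\<^sup>+y. ennreal (((\<Sum>i\<in>K. rb S (restrict (y i) S)) / card K - 1)\<^sup>2) \<partial>PiM K (\<lambda>_. law f)) =
      ennreal (1 / (card K)\<^sup>2) * ennreal (card K * expectation (\<lambda>z. (\<psi> z)\<^sup>2))"
  proof -
    have "(\<integral>\<^sup>+y. ennreal (1 / (card K)\<^sup>2 * (\<Sum>i\<in>K. \<psi> (y i))\<^sup>2) \<partial>PiM K (\<lambda>_. law f)) =
        (\<integral>\<^sup>+y. ennreal (1 / (card K)\<^sup>2) * ennreal ((\<Sum>i\<in>K. \<psi> (y i))\<^sup>2) \<partial>PiM K (\<lambda>_. law f))"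
      by (intro nn_integral_cong ennreal_mult') simp
    also have "\<dots> = ennreal (1 / (card K)\<^sup>2) * (\<integral>\<^sup>+y. ennreal ((\<Sum>i\<in>K. \<psi> (y i))\<^sup>2) \<partial>PiM K (\<lambda>_. law f))"
      by (rule nn_integral_cmult[OF m])
    finally show ?thesis unfolding eq nn_integral_sum_square_PiM[OF K(1) \<psi>m \<psi>b mean] .
  qed
  also have "\<dots> = ennreal (expectation (\<lambda>z. (\<psi> z)\<^sup>2) / card K)"
    using q0 by (subst ennreal_mult[symmetric]) (auto simp: power2_eq_square intro!: Bochner_Integration.integral_nonneg)
  also have "\<dots> \<le> ennreal (C / card K)"
    using rb_second_moment[OF S] by (intro ennreal_leI divide_right_mono) (auto simp: \<psi>_def)
  finally show ?thesis .
qed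

end

section \<open>One fitting step in mean square\<close>

context missing_data
begin

definition tail :: "real \<Rightarrow> real" where "tail T = measure (law f) {x. T \<le> supnorm UNIV x}"

lemma tail_sets: "{x. T \<le> supnorm UNIV x} \<in> sets (leb UNIV)"
proof -
  have "{x\<in>space (leb UNIV). T \<le> supnorm UNIV x} \<in> sets (leb UNIV)" by measurable
  then show ?thesis by simp
qed

lemma supnorm_sets: "{x. supnorm S x \<le> T} \<in> sets (leb UNIV)"
proof -
  have "{x\<in>space (leb UNIV). supnorm S x \<le> T} \<in> sets (leb UNIV)" by measurable
  then show ?thesis by simp
qed

lemma nn_integral_tail: "(\<integral>\<^sup>+x. indicator {x. T \<le> supnorm UNIV x} x \<partial>law f) = ennreal (tail T)"
  unfolding tail_def using tail_sets by (subst nn_integral_indicator) (auto simp: emeasure_eq_measure)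

text \<open>Inside the cube only the fit errors of the other blocks remain, and Cauchy-Schwarz costs
  the number of those blocks. Outside, the truncated residual is 0 and the whole population residual
  is lost, on an event of probability at most \<open>tail T\<close>.\<close>

lemma nn_integral_residual_error:
  fixes \<alpha> :: "'d set \<Rightarrow> ('d \<Rightarrow> real) \<Rightarrow> real"
  assumes S: "S \<in> SS" and \<alpha>: "\<And>S'. S' \<in> SS \<Longrightarrow> \<alpha> S' \<in> borel_measurable (leb S')"
  shows "(\<integral>\<^sup>+z. ennreal ((residual SS a \<alpha> S z * indicator {z. supnorm UNIV z \<le> T} z - residual SS a (pop m) S z)\<^sup>2) \<partial>law f) \<le>
    ennreal (real (card SS) - 1) * (\<Sum>S'\<in>SS - {S}. \<integral>\<^sup>+x. ennreal ((\<alpha> S' (restrict x S') - pop m S' (restrict x S'))\<^sup>2) \<partial>law f)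
    + ennreal ((na * 3 ^ m)\<^sup>2 * tail T)"
proof -
  let ?e = "\<lambda>S' x. (\<alpha> S' (restrict x S') - pop m S' (restrict x S'))\<^sup>2"
  have em: "(\<lambda>x. ennreal (?e S' x)) \<in> borel_measurable (law f)" if "S' \<in> SS" for S'
    using measurable_restrict_arg[OF \<alpha>[OF that]] measurable_restrict_arg[OF pop_measurable[OF that, of m]] by simp
  have N1: "0 \<le> real (card SS) - 1" using card_SS by simp
  have "(\<integral>\<^sup>+z. ennreal ((residual SS a \<alpha> S z * indicator {z. supnorm UNIV z \<le> T} z - residual SS a (pop m) S z)\<^sup>2) \<partial>law f) \<le>
    (\<integral>\<^sup>+z. ennreal (real (card SS) - 1) * (\<Sum>S'\<in>SS - {S}. ennreal (?e S' z))
       + ennreal ((na * 3 ^ m)\<^sup>2) * indicator {x. T \<le> supnorm UNIV x} z \<partial>law f)"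
  proof (rule nn_integral_mono)
    fix z
    show "ennreal ((residual SS a \<alpha> S z * indicator {z. supnorm UNIV z \<le> T} z - residual SS a (pop m) S z)\<^sup>2) \<le>
      ennreal (real (card SS) - 1) * (\<Sum>S'\<in>SS - {S}. ennreal (?e S' z)) + ennreal ((na * 3 ^ m)\<^sup>2) * indicator {x. T \<le> supnorm UNIV x} z"
    proof (cases "supnorm UNIV z \<le> T")
      case True
      have "residual SS a \<alpha> S z * indicator {z. supnorm UNIV z \<le> T} z - residual SS a (pop m) S z =
          - (\<Sum>S'\<in>SS - {S}. \<alpha> S' (restrict z S') - pop m S' (restrict z S'))"
        using True by (simp add: residual_def sum_subtractf)
      then have "(residual SS a \<alpha> S z * indicator {z. supnorm UNIV z \<le> T} z - residual SS a (pop m) S z)\<^sup>2 =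
          (\<Sum>S'\<in>SS - {S}. \<alpha> S' (restrict z S') - pop m S' (restrict z S'))\<^sup>2" by simp
      also have "\<dots> \<le> (\<Sum>S'\<in>SS - {S}. ?e S' z) * real (card (SS - {S}))"
        by (rule sum_squared_le_sum_of_squares)
      also have "\<dots> = (real (card SS) - 1) * (\<Sum>S'\<in>SS - {S}. ?e S' z)"
        using S card_SS by (simp add: of_nat_diff)
      finally have "ennreal ((residual SS a \<alpha> S z * indicator {z. supnorm UNIV z \<le> T} z - residual SS a (pop m) S z)\<^sup>2) \<le>
          ennreal ((real (card SS) - 1) * (\<Sum>S'\<in>SS - {S}. ?e S' z))" by (rule ennreal_leI)
      also have "\<dots> = ennreal (real (card SS) - 1) * (\<Sum>S'\<in>SS - {S}. ennreal (?e S' z))"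
        using N1 by (simp add: ennreal_mult' sum_ennreal)
      finally show ?thesis by (rule order_trans) simp
    next
      case False
      have "(residual SS a (pop m) S z)\<^sup>2 \<le> (na * 3 ^ m)\<^sup>2" by (rule abs_le_imp_square_le[OF pop_bound(2)[OF S]])
      then show ?thesis using False by (auto intro!: add_increasing ennreal_leI)
    qed
  qed
  also have "\<dots> = ennreal (real (card SS) - 1) * (\<Sum>S'\<in>SS - {S}. \<integral>\<^sup>+x. ennreal (?e S' x) \<partial>law f)
    + ennreal ((na * 3 ^ m)\<^sup>2) * ennreal (tail T)"
  proof -
    have m1: "(\<lambda>z. \<Sum>S'\<in>SS - {S}. ennreal (?e S' z)) \<in> borel_measurable (law f)"
      by (intro borel_measurable_sum em) auto
    have m2: "indicator {x. T \<le> supnorm UNIV x} \<in> borel_measurable (law f)" using tail_sets by simp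
    have "(\<integral>\<^sup>+z. ennreal (real (card SS) - 1) * (\<Sum>S'\<in>SS - {S}. ennreal (?e S' z))
       + ennreal ((na * 3 ^ m)\<^sup>2) * indicator {x. T \<le> supnorm UNIV x} z \<partial>law f) =
      (\<integral>\<^sup>+z. ennreal (real (card SS) - 1) * (\<Sum>S'\<in>SS - {S}. ennreal (?e S' z)) \<partial>law f)
       + (\<integral>\<^sup>+z. ennreal ((na * 3 ^ m)\<^sup>2) * indicator {x. T \<le> supnorm UNIV x} z \<partial>law f)"
      by (rule nn_integral_add; intro borel_measurable_times_ennreal borel_measurable_const m1 m2)
    also have "(\<integral>\<^sup>+z. ennreal (real (card SS) - 1) * (\<Sum>S'\<in>SS - {S}. ennreal (?e S' z)) \<partial>law f) =
        ennreal (real (card SS) - 1) * (\<integral>\<^sup>+z. (\<Sum>S'\<in>SS - {S}. ennreal (?e S' z)) \<partial>law f)"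
      by (rule nn_integral_cmult[OF m1])
    also have "(\<integral>\<^sup>+z. (\<Sum>S'\<in>SS - {S}. ennreal (?e S' z)) \<partial>law f) = (\<Sum>S'\<in>SS - {S}. \<integral>\<^sup>+x. ennreal (?e S' x) \<partial>law f)"
      by (rule nn_integral_sum) (rule em, auto)
    also have "(\<integral>\<^sup>+z. ennreal ((na * 3 ^ m)\<^sup>2) * indicator {x. T \<le> supnorm UNIV x} z \<partial>law f) = ennreal ((na * 3 ^ m)\<^sup>2) * ennreal (tail T)"
      unfolding nn_integral_tail[symmetric] by (rule nn_integral_cmult[OF m2])
    finally show ?thesis .
  qed
  also have "ennreal ((na * 3 ^ m)\<^sup>2) * ennreal (tail T) = ennreal ((na * 3 ^ m)\<^sup>2 * tail T)"
    by (simp add: ennreal_mult' tail_def)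
  finally show ?thesis .
qed

text \<open>The part of the mean squared error of one fitting step that is not inherited from the previous fit:
  truncation, kernel variance, kernel bias and the two normalisations.\<close>

definition noise :: "real \<Rightarrow> real \<Rightarrow> nat \<Rightarrow> nat \<Rightarrow> 'd set \<Rightarrow> real" where
  "noise h T m n S = 18 / (real (card SS))\<^sup>2 * ((2 ^ card S + C / c) * ((na * 3 ^ m)\<^sup>2 * tail T)
      + (9 * (na * 3 ^ m)\<^sup>2 * ((3 * T / h) ^ card S / n) + (Lam m)\<^sup>2 * h powr (2 * \<beta>) + 4 * (na * 3 ^ m)\<^sup>2 * (C / c)\<^sup>2 / n))
    + 96 / (real (card SS))\<^sup>2 * (na * 3 ^ m)\<^sup>2 * (C / n) + 9 * (na * 3 ^ m)\<^sup>2 / (real (card SS))\<^sup>2 * tail T"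

text \<open>The previous fit is a fixed function here. \<open>fit_step_error\<close> is integrated
  over the evaluation point and a fresh piece: Stone's inequality handles the inherited error, the
  covering of the cube handles kernel noise and empty balls, and points outside the cube are added
  separately.\<close>

lemma nn_integral_fit_step:
  fixes \<alpha> :: "'d set \<Rightarrow> ('d \<Rightarrow> real) \<Rightarrow> real" and K :: "nat set"
  assumes S: "S \<in> SS" and K: "finite K" "K \<noteq> {}" and h: "0 < h" "h \<le> 1" "h \<le> T"
    and \<alpha>: "\<And>S'. S' \<in> SS \<Longrightarrow> \<alpha> S' \<in> borel_measurable (leb S')"
  shows "(\<integral>\<^sup>+y. \<integral>\<^sup>+x. ennreal ((fit_step SS a r lam h T y K \<alpha> S (restrict x S) - pop (Suc m) S (restrict x S))\<^sup>2) \<partial>law f \<partial>PiM K (\<lambda>_. law f))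
    \<le> 2 * (\<integral>\<^sup>+x. ennreal ((\<alpha> S (restrict x S) - pop m S (restrict x S))\<^sup>2) \<partial>law f)
     + ennreal (18 / (real (card SS))\<^sup>2 * (2 ^ card S + C / c) * (real (card SS) - 1)) *
        (\<Sum>S'\<in>SS - {S}. \<integral>\<^sup>+x. ennreal ((\<alpha> S' (restrict x S') - pop m S' (restrict x S'))\<^sup>2) \<partial>law f)
     + ennreal (noise h T m (card K) S)"
proof -
  interpret Q: prob_space "PiM K (\<lambda>_. law f)" by (rule prob_PiM)
  interpret PS: pair_sigma_finite "PiM K (\<lambda>_. law f)" "law f" ..
  let ?P = "PiM K (\<lambda>_. law f)" and ?N = "real (card SS)"
  define b where "b = na * 3 ^ m"
  define q where "q = C / c"
  define g where "g = residual SS a (pop m) S"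
  define \<delta> where "\<delta> z = residual SS a \<alpha> S z * indicator {z. supnorm UNIV z \<le> T} z - g z" for z
  define \<epsilon> where "\<epsilon> z = g z - cmean S g (restrict z S)" for z
  define \<rho> where "\<rho> y = (\<Sum>i\<in>K. rb S (restrict (y i) S)) / card K" for y :: "nat \<Rightarrow> 'd \<Rightarrow> real"
  define X where "X y = (\<Sum>i\<in>K. wt S (restrict (y i) S) * (g (y i) - wmean S g)) / (\<Sum>i\<in>K. wt S (restrict (y i) S))" for y
  define ind where "ind = (indicator {x. supnorm S x \<le> T} :: ('d \<Rightarrow> real) \<Rightarrow> ennreal)"
  define e1 where "e1 x = (\<alpha> S (restrict x S) - pop m S (restrict x S))\<^sup>2" for x
  define c18 where "c18 = 18 / ?N\<^sup>2"
  have b0: "0 \<le> b" using na_nonneg by (simp add: b_def)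
  have q1: "1 \<le> q" using c c_C by (simp add: q_def)
  have N: "1 \<le> ?N" by (rule card_SS)
  have c18: "0 \<le> c18" by (simp add: c18_def)
  have k0: "0 < real (card K)" using K by (simp add: card_gt_0_iff)
  have gm: "g \<in> borel_measurable (leb UNIV)" unfolding g_def by (rule pop_residual_measurable)
  have gb: "\<bar>g z\<bar> \<le> b" for z unfolding g_def b_def by (rule pop_bound(2)[OF S])
  have \<delta>m: "\<delta> \<in> borel_measurable (leb UNIV)"
    unfolding \<delta>_def[abs_def]
    by (intro borel_measurable_diff borel_measurable_times residual_measurable \<alpha> gm borel_measurable_indicator supnorm_sets)
  have \<epsilon>m: "\<epsilon> \<in> borel_measurable (leb UNIV)"
    unfolding \<epsilon>_def[abs_def] by (intro borel_measurable_diff gm measurable_restrict_arg cmean_measurable S)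
  have Xm: "X \<in> borel_measurable ?P"
    unfolding X_def[abs_def]
    by (intro borel_measurable_divide borel_measurable_sum borel_measurable_times borel_measurable_diff borel_measurable_const
      measurable_compose[OF PiM_component_measurable gm] measurable_compose[OF PiM_component_measurable measurable_restrict_arg[OF wt_measurable[OF S]]])
  have \<rho>m: "\<rho> \<in> borel_measurable ?P"
    unfolding \<rho>_def[abs_def]
    by (intro borel_measurable_divide borel_measurable_sum borel_measurable_const
      measurable_compose[OF PiM_component_measurable measurable_restrict_arg[OF rb_measurable[OF S]]])
  have indm: "ind \<in> borel_measurable (law f)" unfolding ind_def using supnorm_sets by simp
  have e1m: "e1 \<in> borel_measurable (law f)"
    unfolding e1_def[abs_def]
    using measurable_restrict_arg[OF \<alpha>[OF S]] measurable_restrict_arg[OF pop_measurable[OF S, of m]] by simp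
  have compP: "(\<lambda>p. fst p j) \<in> ?P \<Otimes>\<^sub>M law f \<rightarrow>\<^sub>M leb UNIV" if "j \<in> K" for j
    by (rule measurable_compose[OF measurable_fst PiM_component_measurable[OF that]])
  have sndP: "snd \<in> ?P \<Otimes>\<^sub>M law f \<rightarrow>\<^sub>M leb UNIV"
    using measurable_snd[of ?P "law f"] by (simp cong: measurable_cong_sets)
  have sdP: "(\<lambda>p. supdist S (snd p) (fst p j)) \<in> borel_measurable (?P \<Otimes>\<^sub>M law f)" if "j \<in> K" for j
    by (intro borel_measurable_supdist measurable_leb_component[OF compP[OF that]] measurable_leb_component[OF sndP]) auto
  have WP: "(\<lambda>p. W S h K (snd p) (fst p) i) \<in> borel_measurable (?P \<Otimes>\<^sub>M law f)" if "i \<in> K" for i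
    by (rule measurable_W[OF sdP that])
  have cP: "(\<lambda>p. cnt S h K (snd p) (fst p)) \<in> borel_measurable (?P \<Otimes>\<^sub>M law f)"
    by (rule measurable_cnt) (rule sdP)

  \<comment> \<open>\<open>A2\<close> and \<open>A6\<close> carry the inherited error,
    \<open>A3\<close> the kernel noise, \<open>A4\<close> the empty balls and \<open>A5\<close> the
    bias. The indicator in \<open>A3\<close> and \<open>A4\<close> confines the covering argument to
    the cube.\<close>
  define A2 where "A2 p = (\<Sum>i\<in>K. ennreal (W S h K (snd p) (fst p) i) * ennreal ((\<delta> (fst p i))\<^sup>2))" for p
  define A3 where "A3 p = ind (snd p) * ennreal ((\<Sum>i\<in>K. W S h K (snd p) (fst p) i * \<epsilon> (fst p i))\<^sup>2)" for p
  define A4 where "A4 p = ind (snd p) * ennreal (1 / (1 + cnt S h K (snd p) (fst p)))" for p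
  define A5 where "A5 = (Lam m)\<^sup>2 * h powr (2 * \<beta>)"
  define A6 where "A6 y = (\<Sum>i\<in>K. ennreal (q / card K) * ennreal ((\<delta> (y i))\<^sup>2))" for y
  have A2m: "A2 \<in> borel_measurable (?P \<Otimes>\<^sub>M law f)"
    unfolding A2_def[abs_def]
    by (intro borel_measurable_sum borel_measurable_times_ennreal measurable_compose[OF _ measurable_ennreal] borel_measurable_power WP measurable_compose[OF compP \<delta>m])
  have A3m: "A3 \<in> borel_measurable (?P \<Otimes>\<^sub>M law f)"
    unfolding A3_def[abs_def]
    by (intro borel_measurable_times_ennreal measurable_compose[OF _ measurable_ennreal] borel_measurable_power borel_measurable_sum borel_measurable_times
        WP measurable_compose[OF compP \<epsilon>m] measurable_compose[OF measurable_snd indm])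
  have A4m: "A4 \<in> borel_measurable (?P \<Otimes>\<^sub>M law f)"
    unfolding A4_def[abs_def]
    by (intro borel_measurable_times_ennreal measurable_compose[OF _ measurable_ennreal] borel_measurable_divide borel_measurable_add borel_measurable_const
        cP measurable_compose[OF measurable_snd indm])
  have A6m: "A6 \<in> borel_measurable ?P"
    unfolding A6_def[abs_def]
    by (intro borel_measurable_sum borel_measurable_times_ennreal borel_measurable_const measurable_compose[OF _ measurable_ennreal] borel_measurable_power
      measurable_compose[OF PiM_component_measurable \<delta>m])
  \<comment> \<open>The last summand is for evaluation points outside the cube; being nonnegative it
    does no harm inside, so \<open>F\<close> is a bound everywhere.\<close>
  define F where "F p = 2 * ennreal (e1 (snd p)) + ennreal c18 * (A2 p + A3 p + ennreal (b\<^sup>2) * A4 p + ennreal A5 + A6 (fst p) + ennreal ((X (fst p))\<^sup>2))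
      + ennreal (96 / ?N\<^sup>2 * b\<^sup>2) * ennreal ((\<rho> (fst p) - 1)\<^sup>2) + ennreal (9 * b\<^sup>2 / ?N\<^sup>2) * indicator {x. T \<le> supnorm UNIV x} (snd p)" for p

  have pt: "ennreal ((fit_step SS a r lam h T y K \<alpha> S (restrict x S) - pop (Suc m) S (restrict x S))\<^sup>2) \<le> F (y, x)" for x y
  proof (cases "supnorm S x \<le> T")
    case True
    have "(fit_step SS a r lam h T y K \<alpha> S (restrict x S) - pop (Suc m) S (restrict x S))\<^sup>2 \<le>
      2 * e1 x + c18 * ((\<Sum>i\<in>K. W S h K x y i * (\<delta> (y i))\<^sup>2) + (\<Sum>i\<in>K. W S h K x y i * \<epsilon> (y i))\<^sup>2
         + (A5 + b\<^sup>2 * (1 / (1 + cnt S h K x y))) + q * ((\<Sum>i\<in>K. (\<delta> (y i))\<^sup>2) / card K) + (X y)\<^sup>2)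
      + 96 / ?N\<^sup>2 * b\<^sup>2 * (\<rho> y - 1)\<^sup>2"
      unfolding e1_def c18_def \<delta>_def \<epsilon>_def A5_def b_def q_def X_def \<rho>_def g_def
      by (rule fit_step_error[OF S K h(1,2) True])
    then have "ennreal ((fit_step SS a r lam h T y K \<alpha> S (restrict x S) - pop (Suc m) S (restrict x S))\<^sup>2) \<le>
      ennreal (2 * e1 x + c18 * ((\<Sum>i\<in>K. W S h K x y i * (\<delta> (y i))\<^sup>2) + (\<Sum>i\<in>K. W S h K x y i * \<epsilon> (y i))\<^sup>2
         + (A5 + b\<^sup>2 * (1 / (1 + cnt S h K x y))) + q * ((\<Sum>i\<in>K. (\<delta> (y i))\<^sup>2) / card K) + (X y)\<^sup>2)
      + 96 / ?N\<^sup>2 * b\<^sup>2 * (\<rho> y - 1)\<^sup>2)" by (rule ennreal_leI)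
    also have "\<dots> = 2 * ennreal (e1 x) + ennreal c18 * (ennreal (\<Sum>i\<in>K. W S h K x y i * (\<delta> (y i))\<^sup>2) + ennreal ((\<Sum>i\<in>K. W S h K x y i * \<epsilon> (y i))\<^sup>2)
         + (ennreal A5 + ennreal (b\<^sup>2) * ennreal (1 / (1 + cnt S h K x y))) + ennreal (q * ((\<Sum>i\<in>K. (\<delta> (y i))\<^sup>2) / card K)) + ennreal ((X y)\<^sup>2))
      + ennreal (96 / ?N\<^sup>2 * b\<^sup>2) * ennreal ((\<rho> y - 1)\<^sup>2)"
    proof -
      have plus: "ennreal (2 * u1 + c18 * (u2 + u3 + (u4 + b2 * u5) + u6 + u7) + c96 * u8) =
          2 * ennreal u1 + ennreal c18 * (ennreal u2 + ennreal u3 + (ennreal u4 + ennreal b2 * ennreal u5) + ennreal u6 + ennreal u7) + ennreal c96 * ennreal u8"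
        if "0 \<le> u1" "0 \<le> u2" "0 \<le> u3" "0 \<le> u4" "0 \<le> u5" "0 \<le> u6" "0 \<le> u7" "0 \<le> u8" "0 \<le> b2" "0 \<le> c96" for u1 u2 u3 u4 u5 u6 u7 u8 b2 c96 :: real
        using that c18 by (simp add: ennreal_plus ennreal_mult)
      show ?thesis
        by (rule plus) (use q1 cnt_nonneg[of S h K x y] in \<open>auto simp: e1_def A5_def W_nonneg intro!: sum_nonneg mult_nonneg_nonneg divide_nonneg_nonneg\<close>)
    qed
    also have "ennreal (\<Sum>i\<in>K. W S h K x y i * (\<delta> (y i))\<^sup>2) = A2 (y, x)"
      by (simp add: A2_def W_nonneg ennreal_mult flip: sum_ennreal)
    also have "ennreal (q * ((\<Sum>i\<in>K. (\<delta> (y i))\<^sup>2) / card K)) = A6 y"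
    proof -
      have "q * ((\<Sum>i\<in>K. (\<delta> (y i))\<^sup>2) / card K) = (\<Sum>i\<in>K. q / card K * (\<delta> (y i))\<^sup>2)"
        by (simp add: sum_distrib_left sum_divide_distrib)
      then have "ennreal (q * ((\<Sum>i\<in>K. (\<delta> (y i))\<^sup>2) / card K)) = (\<Sum>i\<in>K. ennreal (q / card K * (\<delta> (y i))\<^sup>2))"
        using q1 by (subst sum_ennreal) auto
      also have "\<dots> = A6 y" unfolding A6_def using q1 by (intro sum.cong refl ennreal_mult) auto
      finally show ?thesis .
    qed
    also have "ennreal ((\<Sum>i\<in>K. W S h K x y i * \<epsilon> (y i))\<^sup>2) = A3 (y, x)"
      using True by (simp add: A3_def ind_def)
    also have "ennreal (1 / (1 + cnt S h K x y)) = A4 (y, x)"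
      using True by (simp add: A4_def ind_def)
    also have "2 * ennreal (e1 x) + ennreal c18 * (A2 (y, x) + A3 (y, x) + (ennreal A5 + ennreal (b\<^sup>2) * A4 (y, x)) + A6 y + ennreal ((X y)\<^sup>2))
      + ennreal (96 / ?N\<^sup>2 * b\<^sup>2) * ennreal ((\<rho> y - 1)\<^sup>2) \<le> F (y, x)"
    proof -
      have "A2 (y, x) + A3 (y, x) + (ennreal A5 + ennreal (b\<^sup>2) * A4 (y, x)) + A6 y + ennreal ((X y)\<^sup>2) =
        A2 (y, x) + A3 (y, x) + ennreal (b\<^sup>2) * A4 (y, x) + ennreal A5 + A6 y + ennreal ((X y)\<^sup>2)"
        by (simp only: add_ac)
      then show ?thesis unfolding F_def fst_conv snd_conv by (simp only:) (rule add_increasing2, auto)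
    qed
    finally show ?thesis .
  next
    case False
    \<comment> \<open>Outside the cube the fit is 0, so the error is the population iterate
      itself.\<close>
    have "\<bar>pop (Suc m) S (restrict x S)\<bar> \<le> na * (3 ^ Suc m - 1) / ?N" by (rule pop_bound(1)[OF S restrict_subspace])
    also have "\<dots> \<le> 3 * b / ?N" using na_nonneg N unfolding b_def by (intro divide_right_mono) (auto simp: algebra_simps)
    finally have "(pop (Suc m) S (restrict x S))\<^sup>2 \<le> (3 * b / ?N)\<^sup>2" by (rule abs_le_imp_square_le)
    then have p: "(pop (Suc m) S (restrict x S))\<^sup>2 \<le> 9 * b\<^sup>2 / ?N\<^sup>2" by (simp add: power_divide power_mult_distrib)
    have "T \<le> supnorm UNIV x" using False supnorm_mono[of S UNIV x] by simp
    moreover have "fit_step SS a r lam h T y K \<alpha> S (restrict x S) = 0" using False by (simp add: fit_step_def Let_def)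
    ultimately show ?thesis using p by (auto simp: F_def intro!: add_increasing ennreal_leI simp del: pop.simps)
  qed

  have I_snd: "(\<integral>\<^sup>+p. u (snd p) \<partial>(?P \<Otimes>\<^sub>M law f)) = (\<integral>\<^sup>+x. u x \<partial>law f)" if "u \<in> borel_measurable (law f)" for u
    using that by (subst PS.nn_integral_snd[symmetric]) (auto simp: Q.emeasure_space_1)
  have I_fst: "(\<integral>\<^sup>+p. u (fst p) \<partial>(?P \<Otimes>\<^sub>M law f)) = (\<integral>\<^sup>+y. u y \<partial>?P)" if "u \<in> borel_measurable ?P" for u
    using that emeasure_space_1 by (subst nn_integral_fst[symmetric]) auto
  have Jm: "(\<lambda>x. \<integral>\<^sup>+y. ennreal (1 / (1 + cnt S h K x y)) \<partial>?P) \<in> borel_measurable (law f)"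
  proof (rule Q.borel_measurable_nn_integral)
    have "(\<lambda>p. ennreal (1 / (1 + cnt S h K (snd p) (fst p)))) \<in> borel_measurable (?P \<Otimes>\<^sub>M law f)" using cP by measurable
    from measurable_compose[OF measurable_pair_swap' this]
    show "(\<lambda>(x, y). ennreal (1 / (1 + cnt S h K x y))) \<in> borel_measurable (law f \<Otimes>\<^sub>M ?P)"
      by (simp add: split_beta')
  qed
  define cov where "cov = (3 * T / h) ^ card S / card K"
  have cov0: "0 \<le> cov" using h by (simp add: cov_def)
  have Jc: "(\<integral>\<^sup>+x. ind x * (\<integral>\<^sup>+y. ennreal (1 / (1 + cnt S h K x y)) \<partial>?P) \<partial>law f) \<le> ennreal cov"
    unfolding ind_def cov_def by (rule nn_integral_inverse_cnt_cube[OF K h(1,3)])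
  define Dl where "Dl = (\<integral>\<^sup>+z. ennreal ((\<delta> z)\<^sup>2) \<partial>law f)"
  have B2: "(\<integral>\<^sup>+p. A2 p \<partial>(?P \<Otimes>\<^sub>M law f)) \<le> 2 ^ card S * Dl"
  proof -
    have "(\<integral>\<^sup>+p. A2 p \<partial>(?P \<Otimes>\<^sub>M law f)) = (\<integral>\<^sup>+x. \<integral>\<^sup>+y. A2 (y, x) \<partial>?P \<partial>law f)"
      using PS.nn_integral_snd[OF A2m] by simp
    also have "\<dots> \<le> 2 ^ card S * Dl"
      unfolding A2_def Dl_def fst_conv snd_conv
      by (rule Stone_bound[OF K(1), of h "\<lambda>z. ennreal ((\<delta> z)\<^sup>2)"]) (use h \<delta>m in auto)
    finally show ?thesis .
  qed
  have B4: "(\<integral>\<^sup>+p. A4 p \<partial>(?P \<Otimes>\<^sub>M law f)) \<le> ennreal cov"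
  proof -
    have "(\<integral>\<^sup>+p. A4 p \<partial>(?P \<Otimes>\<^sub>M law f)) = (\<integral>\<^sup>+x. \<integral>\<^sup>+y. A4 (y, x) \<partial>?P \<partial>law f)"
      using PS.nn_integral_snd[OF A4m] by simp
    also have "\<dots> = (\<integral>\<^sup>+x. ind x * (\<integral>\<^sup>+y. ennreal (1 / (1 + cnt S h K x y)) \<partial>?P) \<partial>law f)"
    proof (rule nn_integral_cong)
      fix x
      show "(\<integral>\<^sup>+y. A4 (y, x) \<partial>?P) = ind x * (\<integral>\<^sup>+y. ennreal (1 / (1 + cnt S h K x y)) \<partial>?P)"
        unfolding A4_def ind_def by (cases "supnorm S x \<le> T") auto
    qed
    finally show ?thesis using Jc by simp
  qed
  have B3: "(\<integral>\<^sup>+p. A3 p \<partial>(?P \<Otimes>\<^sub>M law f)) \<le> ennreal (8 * b\<^sup>2) * ennreal cov"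
  proof -
    have "(\<integral>\<^sup>+p. A3 p \<partial>(?P \<Otimes>\<^sub>M law f)) = (\<integral>\<^sup>+x. \<integral>\<^sup>+y. A3 (y, x) \<partial>?P \<partial>law f)"
      using PS.nn_integral_snd[OF A3m] by simp
    also have "\<dots> \<le> (\<integral>\<^sup>+x. ennreal (8 * b\<^sup>2) * (ind x * (\<integral>\<^sup>+y. ennreal (1 / (1 + cnt S h K x y)) \<partial>?P)) \<partial>law f)"
    proof (rule nn_integral_mono)
      fix x
      show "(\<integral>\<^sup>+y. A3 (y, x) \<partial>?P) \<le> ennreal (8 * b\<^sup>2) * (ind x * (\<integral>\<^sup>+y. ennreal (1 / (1 + cnt S h K x y)) \<partial>?P))"
        using nn_integral_sum_W_centred[OF S K(1) gm gb, of h x]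
        unfolding A3_def ind_def \<epsilon>_def by (cases "supnorm S x \<le> T") auto
    qed
    also have "\<dots> = ennreal (8 * b\<^sup>2) * (\<integral>\<^sup>+x. ind x * (\<integral>\<^sup>+y. ennreal (1 / (1 + cnt S h K x y)) \<partial>?P) \<partial>law f)"
      by (intro nn_integral_cmult borel_measurable_times_ennreal indm Jm)
    also have "\<dots> \<le> ennreal (8 * b\<^sup>2) * ennreal cov" by (intro mult_left_mono Jc) auto
    finally show ?thesis .
  qed
  have B6: "(\<integral>\<^sup>+y. A6 y \<partial>?P) = ennreal q * Dl"
  proof -
    have "(\<integral>\<^sup>+y. A6 y \<partial>?P) = (\<Sum>i\<in>K. \<integral>\<^sup>+y. ennreal (q / card K) * ennreal ((\<delta> (y i))\<^sup>2) \<partial>?P)"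
      unfolding A6_def
      by (rule nn_integral_sum) (intro borel_measurable_times_ennreal borel_measurable_const measurable_compose[OF _ measurable_ennreal] borel_measurable_power
        measurable_compose[OF PiM_component_measurable \<delta>m])
    also have "\<dots> = (\<Sum>i\<in>K. ennreal (q / card K) * Dl)"
    proof (rule sum.cong[OF refl])
      fix i assume i: "i \<in> K"
      have "(\<integral>\<^sup>+y. ennreal (q / card K) * ennreal ((\<delta> (y i))\<^sup>2) \<partial>?P) = ennreal (q / card K) * (\<integral>\<^sup>+y. ennreal ((\<delta> (y i))\<^sup>2) \<partial>?P)"
        by (intro nn_integral_cmult measurable_compose[OF _ measurable_ennreal] borel_measurable_power measurable_compose[OF PiM_component_measurable[OF i] \<delta>m])
      also have "(\<integral>\<^sup>+y. ennreal ((\<delta> (y i))\<^sup>2) \<partial>?P) = Dl"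
        unfolding Dl_def by (rule nn_integral_PiM_component[OF prob_space_axioms K(1) i, of "\<lambda>z. ennreal ((\<delta> z)\<^sup>2)"]) (use \<delta>m in simp)
      finally show "(\<integral>\<^sup>+y. ennreal (q / card K) * ennreal ((\<delta> (y i))\<^sup>2) \<partial>?P) = ennreal (q / card K) * Dl" .
    qed
    also have "\<dots> = (ennreal (card K) * ennreal (q / card K)) * Dl"
      by (simp add: ennreal_of_nat_eq_real_of_nat mult.assoc)
    also have "ennreal (card K) * ennreal (q / card K) = ennreal q"
      using k0 q1 by (subst ennreal_mult[symmetric]) auto
    finally show ?thesis .
  qed
  have B7: "(\<integral>\<^sup>+y. ennreal ((X y)\<^sup>2) \<partial>?P) \<le> ennreal (4 * b\<^sup>2 * q\<^sup>2 / card K)"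
    unfolding X_def q_def by (rule nn_integral_wmean_error[OF S K gm gb])
  have B8: "(\<integral>\<^sup>+y. ennreal ((\<rho> y - 1)\<^sup>2) \<partial>?P) \<le> ennreal (C / card K)"
    unfolding \<rho>_def by (rule nn_integral_ratio_error[OF S K])

  have "(\<integral>\<^sup>+y. \<integral>\<^sup>+x. ennreal ((fit_step SS a r lam h T y K \<alpha> S (restrict x S) - pop (Suc m) S (restrict x S))\<^sup>2) \<partial>law f \<partial>?P)
      \<le> (\<integral>\<^sup>+y. \<integral>\<^sup>+x. F (y, x) \<partial>law f \<partial>?P)"
    by (intro nn_integral_mono pt)
  also have "\<dots> = (\<integral>\<^sup>+p. F p \<partial>(?P \<Otimes>\<^sub>M law f))"
  proof (rule nn_integral_fst)
    show "F \<in> borel_measurable (?P \<Otimes>\<^sub>M law f)"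
      unfolding F_def[abs_def]
      by (intro borel_measurable_add borel_measurable_times_ennreal borel_measurable_const A2m A3m A4m
          measurable_compose[OF measurable_fst A6m] measurable_compose[OF measurable_snd e1m, THEN measurable_compose, OF measurable_ennreal]
          measurable_compose[OF _ measurable_ennreal] borel_measurable_power borel_measurable_diff
          measurable_compose[OF measurable_fst Xm] measurable_compose[OF measurable_fst \<rho>m]
          measurable_compose[OF sndP borel_measurable_indicator[OF tail_sets]])
  qed
  also have "\<dots> = 2 * (\<integral>\<^sup>+x. ennreal (e1 x) \<partial>law f) + ennreal c18 * ((\<integral>\<^sup>+p. A2 p \<partial>(?P \<Otimes>\<^sub>M law f)) + (\<integral>\<^sup>+p. A3 p \<partial>(?P \<Otimes>\<^sub>M law f))
      + ennreal (b\<^sup>2) * (\<integral>\<^sup>+p. A4 p \<partial>(?P \<Otimes>\<^sub>M law f)) + ennreal A5 + (\<integral>\<^sup>+y. A6 y \<partial>?P) + (\<integral>\<^sup>+y. ennreal ((X y)\<^sup>2) \<partial>?P))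
      + ennreal (96 / ?N\<^sup>2 * b\<^sup>2) * (\<integral>\<^sup>+y. ennreal ((\<rho> y - 1)\<^sup>2) \<partial>?P) + ennreal (9 * b\<^sup>2 / ?N\<^sup>2) * ennreal (tail T)"
  proof -
    have m1: "(\<lambda>p. ennreal (e1 (snd p))) \<in> borel_measurable (?P \<Otimes>\<^sub>M law f)"
      by (intro measurable_compose[OF _ measurable_ennreal] measurable_compose[OF measurable_snd e1m])
    have m6: "(\<lambda>p. A6 (fst p)) \<in> borel_measurable (?P \<Otimes>\<^sub>M law f)" by (rule measurable_compose[OF measurable_fst A6m])
    have m7': "(\<lambda>y. ennreal ((X y)\<^sup>2)) \<in> borel_measurable ?P"
      by (intro measurable_compose[OF _ measurable_ennreal] borel_measurable_power Xm)
    have m8': "(\<lambda>y. ennreal ((\<rho> y - 1)\<^sup>2)) \<in> borel_measurable ?P"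
      by (intro measurable_compose[OF _ measurable_ennreal] borel_measurable_power borel_measurable_diff \<rho>m borel_measurable_const)
    have m9': "indicator {x. T \<le> supnorm UNIV x} \<in> borel_measurable (law f)" using tail_sets by simp
    note m7 = measurable_compose[OF measurable_fst m7'] and m8 = measurable_compose[OF measurable_fst m8']
      and m9 = measurable_compose[OF measurable_snd m9']
    have PP: "(\<integral>\<^sup>+p. ennreal A5 \<partial>(?P \<Otimes>\<^sub>M law f)) = ennreal A5"
      using I_snd[of "\<lambda>_. ennreal A5"] emeasure_space_1 by simp
    have i1: "(\<integral>\<^sup>+p. ennreal (e1 (snd p)) \<partial>(?P \<Otimes>\<^sub>M law f)) = (\<integral>\<^sup>+x. ennreal (e1 x) \<partial>law f)"
      by (rule I_snd[of "\<lambda>x. ennreal (e1 x)"]) (use e1m in simp)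
    have i9: "(\<integral>\<^sup>+p. indicator {x. T \<le> supnorm UNIV x} (snd p) \<partial>(?P \<Otimes>\<^sub>M law f)) = ennreal (tail T)"
      unfolding I_snd[OF m9'] by (rule nn_integral_tail)
    show ?thesis
      unfolding F_def
      apply (subst nn_integral_add, intro borel_measurable_add borel_measurable_times_ennreal borel_measurable_const m1 A2m A3m A4m m6 m7 m8, intro borel_measurable_times_ennreal borel_measurable_const m9)
      apply (subst nn_integral_add, intro borel_measurable_add borel_measurable_times_ennreal borel_measurable_const m1 A2m A3m A4m m6 m7, intro borel_measurable_times_ennreal borel_measurable_const m8)
      apply (subst nn_integral_add, intro borel_measurable_times_ennreal borel_measurable_const m1, intro borel_measurable_add borel_measurable_times_ennreal borel_measurable_const A2m A3m A4m m6 m7)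
      apply (subst nn_integral_cmult, rule m1)
      apply (subst nn_integral_cmult, intro borel_measurable_add borel_measurable_times_ennreal borel_measurable_const A2m A3m A4m m6 m7)
      apply (subst nn_integral_cmult, rule m8)
      apply (subst nn_integral_cmult, rule m9)
      apply (subst nn_integral_add, intro borel_measurable_add borel_measurable_times_ennreal borel_measurable_const A2m A3m A4m m6, rule m7)
      apply (subst nn_integral_add, intro borel_measurable_add borel_measurable_times_ennreal borel_measurable_const A2m A3m A4m, rule m6)
      apply (subst nn_integral_add, intro borel_measurable_add borel_measurable_times_ennreal borel_measurable_const A2m A3m A4m, rule borel_measurable_const)
      apply (subst nn_integral_add, intro borel_measurable_add A2m A3m, intro borel_measurable_times_ennreal borel_measurable_const A4m)
      apply (subst nn_integral_add, rule A2m, rule A3m)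
      apply (subst nn_integral_cmult, rule A4m)
      apply (simp only: i1 PP I_fst[OF A6m] I_fst[OF m7'] I_fst[OF m8'] i9)
      done
  qed
  also have "\<dots> \<le> 2 * (\<integral>\<^sup>+x. ennreal (e1 x) \<partial>law f) + ennreal c18 * (2 ^ card S * Dl + ennreal (8 * b\<^sup>2) * ennreal cov
      + ennreal (b\<^sup>2) * ennreal cov + ennreal A5 + ennreal q * Dl + ennreal (4 * b\<^sup>2 * q\<^sup>2 / card K))
      + ennreal (96 / ?N\<^sup>2 * b\<^sup>2) * ennreal (C / card K) + ennreal (9 * b\<^sup>2 / ?N\<^sup>2) * ennreal (tail T)"
    unfolding B6 by (intro add_mono mult_left_mono order_refl B2 B3 B4 B7 B8) auto
  also have "\<dots> = 2 * (\<integral>\<^sup>+x. ennreal (e1 x) \<partial>law f) + ennreal (c18 * (2 ^ card S + q)) * Dl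
     + ennreal (c18 * (9 * b\<^sup>2 * cov + A5 + 4 * b\<^sup>2 * q\<^sup>2 / card K) + 96 / ?N\<^sup>2 * b\<^sup>2 * (C / card K) + 9 * b\<^sup>2 / ?N\<^sup>2 * tail T)"
  proof -
    have A50: "0 \<le> A5" by (simp add: A5_def)
    have t0: "0 \<le> tail T" by (simp add: tail_def)
    have C0: "0 \<le> C / card K" using c_C by simp
    have p2: "ennreal (2 ^ card S) = 2 ^ card S" by (simp add: ennreal_power[symmetric])
    have "ennreal (c18 * (9 * b\<^sup>2 * cov + A5 + 4 * b\<^sup>2 * q\<^sup>2 / card K) + 96 / ?N\<^sup>2 * b\<^sup>2 * (C / card K) + 9 * b\<^sup>2 / ?N\<^sup>2 * tail T) =
       ennreal c18 * (ennreal (8 * b\<^sup>2) * ennreal cov + ennreal (b\<^sup>2) * ennreal cov + ennreal A5 + ennreal (4 * b\<^sup>2 * q\<^sup>2 / card K))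
        + ennreal (96 / ?N\<^sup>2 * b\<^sup>2) * ennreal (C / card K) + ennreal (9 * b\<^sup>2 / ?N\<^sup>2) * ennreal (tail T)"
    proof -
      have eq9: "9 * b\<^sup>2 * cov = 8 * b\<^sup>2 * cov + b\<^sup>2 * cov" by simp
      have plus: "ennreal (c1 * (b8 * cv + b2 * cv + u + v) + c2 * w + c3 * s) = ennreal c1 * (ennreal b8 * ennreal cv + ennreal b2 * ennreal cv + ennreal u + ennreal v)
          + ennreal c2 * ennreal w + ennreal c3 * ennreal s"
        if "0 \<le> c1" "0 \<le> b8" "0 \<le> b2" "0 \<le> cv" "0 \<le> u" "0 \<le> v" "0 \<le> c2" "0 \<le> w" "0 \<le> c3" "0 \<le> s" for c1 b8 b2 cv u v c2 w c3 s :: real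
        using that by (simp add: ennreal_plus ennreal_mult)
      show ?thesis unfolding eq9 by (rule plus) (use c18 cov0 A50 t0 C0 in auto)
    qed
    moreover have "ennreal (c18 * (2 ^ card S + q)) = ennreal c18 * (2 ^ card S + ennreal q)"
      using c18 q1 p2 by (simp add: ennreal_mult ennreal_plus)
    ultimately show ?thesis by (simp only:) (simp add: distrib_left distrib_right add_ac mult_ac)
  qed
  \<comment> \<open>The inherited error is resolved into the errors of the other blocks and a tail
    term; the latter is collected into \<open>noise\<close>.\<close>
  also have "\<dots> \<le> 2 * (\<integral>\<^sup>+x. ennreal (e1 x) \<partial>law f) + ennreal (c18 * (2 ^ card S + q)) *
      (ennreal (?N - 1) * (\<Sum>S'\<in>SS - {S}. \<integral>\<^sup>+x. ennreal ((\<alpha> S' (restrict x S') - pop m S' (restrict x S'))\<^sup>2) \<partial>law f) + ennreal (b\<^sup>2 * tail T))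
     + ennreal (c18 * (9 * b\<^sup>2 * cov + A5 + 4 * b\<^sup>2 * q\<^sup>2 / card K) + 96 / ?N\<^sup>2 * b\<^sup>2 * (C / card K) + 9 * b\<^sup>2 / ?N\<^sup>2 * tail T)"
    unfolding Dl_def \<delta>_def g_def b_def using nn_integral_residual_error[OF S \<alpha>, of T m]
    by (intro add_mono mult_left_mono order_refl) auto
  also have "\<dots> = 2 * (\<integral>\<^sup>+x. ennreal (e1 x) \<partial>law f) + ennreal (c18 * (2 ^ card S + q) * (?N - 1)) *
      (\<Sum>S'\<in>SS - {S}. \<integral>\<^sup>+x. ennreal ((\<alpha> S' (restrict x S') - pop m S' (restrict x S'))\<^sup>2) \<partial>law f) + ennreal (noise h T m (card K) S)"
  proof -
    have "ennreal (noise h T m (card K) S) = ennreal (c18 * (2 ^ card S + q)) * ennreal (b\<^sup>2 * tail T) +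
       ennreal (c18 * (9 * b\<^sup>2 * cov + A5 + 4 * b\<^sup>2 * q\<^sup>2 / card K) + 96 / ?N\<^sup>2 * b\<^sup>2 * (C / card K) + 9 * b\<^sup>2 / ?N\<^sup>2 * tail T)"
    proof -
      have nz: "noise h T m (card K) S = c18 * (2 ^ card S + q) * (b\<^sup>2 * tail T) +
       (c18 * (9 * b\<^sup>2 * cov + A5 + 4 * b\<^sup>2 * q\<^sup>2 / card K) + 96 / ?N\<^sup>2 * b\<^sup>2 * (C / card K) + 9 * b\<^sup>2 / ?N\<^sup>2 * tail T)"
      proof -
        have "c1 * (w * x + z) + t + u = c1 * w * x + (c1 * z + t + u)" for c1 w x z t u :: real
          by (simp add: algebra_simps)
        then show ?thesis unfolding noise_def c18_def q_def b_def cov_def A5_def .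
      qed
      have A50: "0 \<le> A5" by (simp add: A5_def)
      have t0: "0 \<le> tail T" by (simp add: tail_def)
      have C0: "0 \<le> C / card K" using c_C by simp
      have cq: "0 \<le> c18 * (2 ^ card S + q)" using c18 q1 by simp
      have "ennreal (noise h T m (card K) S) = ennreal (c18 * (2 ^ card S + q) * (b\<^sup>2 * tail T)) +
        ennreal (c18 * (9 * b\<^sup>2 * cov + A5 + 4 * b\<^sup>2 * q\<^sup>2 / card K) + 96 / ?N\<^sup>2 * b\<^sup>2 * (C / card K) + 9 * b\<^sup>2 / ?N\<^sup>2 * tail T)"
        unfolding nz
      proof (rule ennreal_plus)
        show "0 \<le> c18 * (2 ^ card S + q) * (b\<^sup>2 * tail T)" using cq t0 by simp
        have "0 \<le> 9 * b\<^sup>2 * cov + A5 + 4 * b\<^sup>2 * q\<^sup>2 / card K" using cov0 A50 by simp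
        moreover have "0 \<le> 96 / ?N\<^sup>2 * b\<^sup>2 * (C / card K)" by (intro mult_nonneg_nonneg C0) auto
        moreover have "0 \<le> 9 * b\<^sup>2 / ?N\<^sup>2 * tail T" by (intro mult_nonneg_nonneg t0) auto
        moreover have "0 \<le> c1 * u + v + w" if "0 \<le> u" "0 \<le> v" "0 \<le> w" "0 \<le> c1" for c1 u v w :: real
          using that by simp
        ultimately show "0 \<le> c18 * (9 * b\<^sup>2 * cov + A5 + 4 * b\<^sup>2 * q\<^sup>2 / card K) + 96 / ?N\<^sup>2 * b\<^sup>2 * (C / card K) + 9 * b\<^sup>2 / ?N\<^sup>2 * tail T"
          using c18 by blast
      qed
      then show ?thesis using cq t0 by (simp only: ennreal_mult mult_nonneg_nonneg zero_le_power2)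
    qed
    moreover have "ennreal (c18 * (2 ^ card S + q) * (?N - 1)) = ennreal (c18 * (2 ^ card S + q)) * ennreal (?N - 1)"
      using c18 q1 N by (intro ennreal_mult) auto
    ultimately show ?thesis by (simp only: distrib_left mult.assoc add.assoc)
  qed
  finally show ?thesis unfolding e1_def c18_def q_def .
qed

end

section \<open>Iterating the error bound\<close>

text \<open>As y \<ge> 5, 32 (A - 2 - 18 y) = 320 y - 64 is at least 307 y, so each of the three
  coefficients on the left only has to be at most 307 times \<open>X\<close>. Their growth in m is
  dominated because both 9 and 9 q are at most \<open>A\<close>.\<close>

lemma noise_arithmetic:
  fixes mx q L2 Mx y G1 G2 G3 A :: real and m d :: nat
  assumes "1 \<le> q" "0 \<le> mx" "q\<^sup>2 \<le> Mx" "L2 \<le> Mx" "8 ^ d \<le> Mx" "2 \<le> d" "y = q + 2 ^ d" "A = 28 * y"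
    and G: "0 \<le> G1" "0 \<le> G2" "0 \<le> G3" and L2: "0 \<le> L2"
  shows "mx * 9 ^ m * ((18 * y + 9) * G3 + (648 * 3 ^ d + 288 * q\<^sup>2 + 384 * q) * G1) + 288 * mx * L2 * 9 ^ m * q ^ Suc m * G2
    \<le> (A - (2 + 18 * y)) * (2 * A ^ m * (16 * mx * Mx) * (G1 + G2 + G3))"
proof -
  have "(4::real) \<le> 2 ^ d" using power_increasing[of 2 d "2::real"] assms(6) by simp
  then have y: "5 \<le> y" "q \<le> y" using assms by auto
  have "(8::real)\<^sup>2 \<le> 8 ^ d" using assms(6) by (intro power_increasing) auto
  then have Mx: "64 \<le> Mx" using assms(5) by simp
  have A9: "9 ^ m \<le> A ^ m" using y assms(8) by (intro power_mono) auto
  have "9 * q \<le> A" using y assms by simp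
  then have A9q: "9 ^ m * q ^ m \<le> A ^ m" using assms(1) by (subst power_mult_distrib[symmetric]) (intro power_mono, auto)
  have Am: "0 \<le> A ^ m" using y assms(8) by simp
  define X where "X = y * Mx * A ^ m"
  have yM: "0 \<le> y * Mx" using y Mx by simp
  have X0: "0 \<le> X" unfolding X_def using y Mx Am by simp
  have a: "9 ^ m * (18 * y + 9) \<le> 307 * X"
  proof -
    have "18 * y + 9 \<le> 307 * (y * 1)" using y by simp
    also have "\<dots> \<le> 307 * (y * Mx)" using y Mx by (intro mult_left_mono) auto
    finally have "9 ^ m * (18 * y + 9) \<le> A ^ m * (307 * (y * Mx))"
      using A9 Am y by (intro mult_mono) auto
    then show ?thesis by (simp add: X_def mult_ac)
  qed
  have b: "9 ^ m * (648 * 3 ^ d + 288 * q\<^sup>2 + 384 * q) \<le> 307 * X"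
  proof -
    have "(3::real) ^ d \<le> 8 ^ d" by (intro power_mono) auto
    then have 1: "648 * 3 ^ d \<le> 648 * Mx" using assms(5) by linarith
    have "q * 1 \<le> q * q" using assms(1) by (intro mult_left_mono) auto
    then have "q \<le> q\<^sup>2" by (simp add: power2_eq_square)
    \<comment> \<open>Here 648 + 288 + 384 = 1320, while 307 y is at least 1535.\<close>
    then have "648 * 3 ^ d + 288 * q\<^sup>2 + 384 * q \<le> 1320 * Mx" using 1 assms(3) by linarith
    also have "\<dots> \<le> (307 * y) * Mx" using y Mx by (intro mult_right_mono) auto
    finally have "9 ^ m * (648 * 3 ^ d + 288 * q\<^sup>2 + 384 * q) \<le> A ^ m * ((307 * y) * Mx)"
      using A9 Am assms(1) by (intro mult_mono) auto
    then show ?thesis by (simp add: X_def mult_ac)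
  qed
  have c: "288 * L2 * 9 ^ m * q ^ Suc m \<le> 307 * X"
  proof -
    have "(9 ^ m * q ^ m) * (q * L2) \<le> A ^ m * (y * Mx)"
      using A9q Am y assms by (intro mult_mono) auto
    moreover have "288 * L2 * 9 ^ m * q ^ Suc m = 288 * ((9 ^ m * q ^ m) * (q * L2))" by simp
    moreover have "X = A ^ m * (y * Mx)" by (simp add: X_def)
    ultimately show ?thesis using X0 by linarith
  qed
  have "mx * 9 ^ m * ((18 * y + 9) * G3 + (648 * 3 ^ d + 288 * q\<^sup>2 + 384 * q) * G1) + 288 * mx * L2 * 9 ^ m * q ^ Suc m * G2
      = mx * ((9 ^ m * (18 * y + 9)) * G3 + (9 ^ m * (648 * 3 ^ d + 288 * q\<^sup>2 + 384 * q)) * G1 + (288 * L2 * 9 ^ m * q ^ Suc m) * G2)"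
    by (simp add: algebra_simps)
  also have "\<dots> \<le> mx * ((307 * X) * G3 + (307 * X) * G1 + (307 * X) * G2)"
    using a b c G assms(2) by (intro mult_left_mono add_mono mult_right_mono)
  also have "\<dots> = (307 * y) * (mx * Mx * A ^ m * (G1 + G2 + G3))" by (simp add: X_def algebra_simps)
  also have "\<dots> \<le> (32 * (A - (2 + 18 * y))) * (mx * Mx * A ^ m * (G1 + G2 + G3))"
    using y assms(8) G assms(2) Mx Am by (intro mult_right_mono) auto
  also have "\<dots> = (A - (2 + 18 * y)) * (2 * A ^ m * (16 * mx * Mx) * (G1 + G2 + G3))"
  proof -
    have "(32 * u) * (mx * Mx * A ^ m * v) = u * (2 * A ^ m * (16 * mx * Mx) * v)" for u v by simp
    then show ?thesis .
  qed
  finally show ?thesis .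
qed

context missing_data
begin

text \<open>By hypothesis 1 / nk \<le> 4 M / n, and T / h \<ge> 1 lets every variance term be
  measured by the single quantity M T^d / (n h^d). Thus 648 = 18 * 9 * 4, 288 = 18 * 4 * 4 and 384 =
  96 * 4; the 288 in front of the bias is 18 * 16, the 16 being that of
  \<open>Lam_square_le\<close>. The factors 1 / \<open>card SS\<close>^2 are bounded by 1.\<close>

lemma noise_le:
  assumes T: "1 \<le> T" and h: "0 < h" "h \<le> 1" and n: "0 < n" and nk: "0 < nk" "real n \<le> 4 * real M * real nk"
    and S: "S \<in> SS"
  defines "q \<equiv> C / c" and "d \<equiv> CARD('d)"
  shows "noise h T m nk S \<le> max (na\<^sup>2) 1 * 9 ^ m * ((18 * (q + 2 ^ d) + 9) * tail T +
      (648 * 3 ^ d + 288 * q\<^sup>2 + 384 * q) * (M * T ^ d / (n * h ^ d)))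
      + 288 * max (na\<^sup>2) 1 * (L1 + L2 + L3)\<^sup>2 * 9 ^ m * q ^ Suc m * h powr (2 * \<beta>)"
proof -
  let ?N = "real (card SS)" and ?mx = "max (na\<^sup>2) 1"
  define G1 where "G1 = M * T ^ d / (n * h ^ d)"
  define b2 where "b2 = (na * 3 ^ m)\<^sup>2"
  have N: "1 \<le> ?N\<^sup>2" using power_mono[OF card_SS, of 2] by simp
  have q1: "1 \<le> q" using c c_C by (simp add: q_def)
  have Cq: "C \<le> q" using c c_C unfolding q_def by (simp add: pos_le_divide_eq mult_left_le)
  have b2: "0 \<le> b2" "b2 \<le> ?mx * 9 ^ m"
  proof -
    have "b2 = na\<^sup>2 * 9 ^ m" by (simp add: b2_def power_mult_distrib power2_eq_square flip: power_mult_distrib)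
    also have "\<dots> \<le> ?mx * 9 ^ m" by (intro mult_right_mono) auto
    finally show "b2 \<le> ?mx * 9 ^ m" .
  qed (simp add: b2_def)
  have Th: "1 \<le> T / h" using T h by simp
  have kM: "1 / nk \<le> 4 * (M / n)"
  proof -
    show ?thesis using n nk by (simp add: field_simps)
  qed
  have G1: "G1 = (M / n) * (T / h) ^ d" by (simp add: G1_def power_divide)
  have MG: "M / n \<le> G1"
    unfolding G1 using mult_left_mono[OF one_le_power[OF Th, of d], of "M / n"] by simp
  have k1: "1 / nk \<le> 4 * G1" using kM MG by linarith
  have card: "card S \<le> d" unfolding d_def by (rule card_mono) auto
  have cov: "(3 * T / h) ^ card S / nk \<le> 4 * 3 ^ d * G1"
  proof -
    have "(3 * T / h) ^ card S \<le> (3 * T / h) ^ d" using Th card by (intro power_increasing) auto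
    also have "\<dots> = 3 ^ d * (T / h) ^ d" by (simp add: power_mult_distrib power_divide)
    finally have "(3 * T / h) ^ card S * (1 / nk) \<le> (3 ^ d * (T / h) ^ d) * (4 * (M / n))"
      using kM Th by (intro mult_mono) auto
    then show ?thesis by (simp add: G1 mult_ac)
  qed
  have t0: "0 \<le> tail T" by (simp add: tail_def)
  have G10: "0 \<le> G1" using T h by (simp add: G1_def)
  have H0: "0 \<le> h powr (2 * \<beta>)" by simp
  have Lam: "(Lam m)\<^sup>2 \<le> 16 * ?mx * (L1 + L2 + L3)\<^sup>2 * 9 ^ m * q ^ Suc m"
    unfolding q_def by (rule Lam_square_le)
  define Z where "Z = (2 ^ card S + q) * (b2 * tail T) + (9 * b2 * ((3 * T / h) ^ card S / nk) + (Lam m)\<^sup>2 * h powr (2 * \<beta>) + 4 * b2 * q\<^sup>2 / nk)"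
  have Z0: "0 \<le> Z" unfolding Z_def using q1 b2 t0 Th T h
    by (intro add_nonneg_nonneg mult_nonneg_nonneg divide_nonneg_nonneg zero_le_power) (auto simp: Lam_nonneg)
  have nd: "u / ?N\<^sup>2 \<le> u" if "0 \<le> u" for u
  proof -
    have "u / ?N\<^sup>2 \<le> u / 1" by (rule divide_left_mono[OF N that]) (use N in linarith)
    then show ?thesis by simp
  qed
  have "noise h T m nk S = (18 * Z) / ?N\<^sup>2 + (96 * b2 * (C / nk)) / ?N\<^sup>2 + (9 * b2 * tail T) / ?N\<^sup>2"
    unfolding noise_def Z_def b2_def q_def by simp
  also have "\<dots> \<le> 18 * Z + 96 * b2 * (C / nk) + 9 * b2 * tail T"
    using Z0 b2 t0 c_C by (intro add_mono nd) auto
  also have "\<dots> \<le> (b2 * ((18 * (q + 2 ^ d) + 9) * tail T) + b2 * ((648 * 3 ^ d + 288 * q\<^sup>2 + 384 * q) * G1)) + 18 * ((Lam m)\<^sup>2 * h powr (2 * \<beta>))"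
  proof -
    have 1: "(2 ^ card S + q) * (b2 * tail T) \<le> (q + 2 ^ d) * (b2 * tail T)"
      using card b2 t0 by (intro mult_right_mono) (auto intro!: power_increasing)
    have 2: "9 * b2 * ((3 * T / h) ^ card S / nk) \<le> 9 * b2 * (4 * 3 ^ d * G1)"
      using b2 by (intro mult_left_mono cov) auto
    have 3: "4 * b2 * q\<^sup>2 / nk \<le> 4 * b2 * q\<^sup>2 * (4 * G1)"
      using mult_left_mono[OF k1, of "4 * b2 * q\<^sup>2"] b2 by simp
    have "C * (1 / nk) \<le> q * (4 * G1)" using Cq k1 c_C q1 by (intro mult_mono) auto
    then have 4: "96 * b2 * (C / nk) \<le> 96 * b2 * (q * (4 * G1))"
      using b2 by (intro mult_left_mono) auto
    have "18 * Z + 96 * b2 * (C / nk) + 9 * b2 * tail T \<le> 18 * ((q + 2 ^ d) * (b2 * tail T) + (9 * b2 * (4 * 3 ^ d * G1) + (Lam m)\<^sup>2 * h powr (2 * \<beta>) + 4 * b2 * q\<^sup>2 * (4 * G1)))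
       + 96 * b2 * (q * (4 * G1)) + 9 * b2 * tail T"
      unfolding Z_def
      by (rule add_mono[OF add_mono[OF mult_left_mono[OF add_mono[OF 1 add_mono[OF add_mono[OF 2 order_refl] 3]]] 4] order_refl]) simp
    also have "\<dots> = (b2 * ((18 * (q + 2 ^ d) + 9) * tail T) + b2 * ((648 * 3 ^ d + 288 * q\<^sup>2 + 384 * q) * G1)) + 18 * ((Lam m)\<^sup>2 * h powr (2 * \<beta>))"
      by (simp add: algebra_simps)
    finally show ?thesis .
  qed
  also have "\<dots> \<le> ((?mx * 9 ^ m) * ((18 * (q + 2 ^ d) + 9) * tail T) + (?mx * 9 ^ m) * ((648 * 3 ^ d + 288 * q\<^sup>2 + 384 * q) * G1))
      + 18 * ((16 * ?mx * (L1 + L2 + L3)\<^sup>2 * 9 ^ m * q ^ Suc m) * h powr (2 * \<beta>))"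
  proof -
    have U0: "0 \<le> (18 * (q + 2 ^ d) + 9) * tail T" using q1 t0 by simp
    have V0: "0 \<le> (648 * 3 ^ d + 288 * q\<^sup>2 + 384 * q) * G1" using q1 G10 by simp
    show ?thesis
      by (rule add_mono[OF add_mono[OF mult_right_mono[OF b2(2) U0] mult_right_mono[OF b2(2) V0]] mult_left_mono[OF mult_right_mono[OF Lam H0]]]) simp
  qed
  also have "\<dots> = ?mx * 9 ^ m * ((18 * (q + 2 ^ d) + 9) * tail T + (648 * 3 ^ d + 288 * q\<^sup>2 + 384 * q) * G1)
      + 288 * ?mx * (L1 + L2 + L3)\<^sup>2 * 9 ^ m * q ^ Suc m * h powr (2 * \<beta>)"
    by (simp add: distrib_left mult_ac)
  finally show ?thesis by (simp only: G1_def)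
qed

text \<open>Valued in \<open>ennreal\<close>, so that the recursion can run before any integrability
  of the fitted functions is known.\<close>

definition est_error ::
  "'w measure \<Rightarrow> (nat \<Rightarrow> 'w \<Rightarrow> 'd \<Rightarrow> real) \<Rightarrow> real \<Rightarrow> real \<Rightarrow> (nat \<Rightarrow> nat set) \<Rightarrow> nat \<Rightarrow> 'd set \<Rightarrow> ennreal" where
  "est_error P X h T J m S = (\<integral>\<^sup>+\<omega>. \<integral>\<^sup>+x. ennreal ((alpha_hat SS a r lam h T (\<lambda>i. X i \<omega>) J m S (restrict x S) - pop m S (restrict x S))\<^sup>2) \<partial>law f \<partial>P)"

lemma est_error_measurable:
  assumes X: "\<And>l i. l \<in> {1..m} \<Longrightarrow> i \<in> J l \<Longrightarrow> X i \<in> P \<rightarrow>\<^sub>M leb UNIV" and S: "S \<in> SS"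
  shows "(\<lambda>\<omega>. \<integral>\<^sup>+x. ennreal ((alpha_hat SS a r lam h T (\<lambda>i. X i \<omega>) J m S (restrict x S) - pop m S (restrict x S))\<^sup>2) \<partial>law f) \<in> borel_measurable P"
proof (rule borel_measurable_nn_integral)
  have snd: "snd \<in> P \<Otimes>\<^sub>M law f \<rightarrow>\<^sub>M leb UNIV"
    using measurable_snd[of P "law f"] by (simp cong: measurable_cong_sets)
  have u: "(\<lambda>p. restrict (snd p) S) \<in> P \<Otimes>\<^sub>M law f \<rightarrow>\<^sub>M leb S"
    by (rule measurable_leb_restrict[OF snd subset_UNIV])
  have "(\<lambda>p. alpha_hat SS a r lam h T (\<lambda>i. X i (fst p)) J m S (restrict (snd p) S)) \<in> borel_measurable (P \<Otimes>\<^sub>M law f)"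
    by (rule measurable_alpha_hat[OF _ S u]) (rule measurable_compose[OF measurable_fst X])
  moreover have "(\<lambda>p. pop m S (restrict (snd p) S)) \<in> borel_measurable (P \<Otimes>\<^sub>M law f)"
    by (rule measurable_compose[OF u pop_measurable[OF S]])
  ultimately show "(\<lambda>(\<omega>, x). ennreal ((alpha_hat SS a r lam h T (\<lambda>i. X i \<omega>) J m S (restrict x S) - pop m S (restrict x S))\<^sup>2)) \<in> borel_measurable (P \<Otimes>\<^sub>M law f)"
    unfolding split_beta' by (intro measurable_compose[OF _ measurable_ennreal] borel_measurable_power borel_measurable_diff)
qed

text \<open>The earlier pieces determine the previous fit and are independent of the new piece, so
  they are frozen and \<open>nn_integral_fit_step\<close> is applied to each realisation.\<close>

lemma est_error_Suc:
  assumes P: "prob_space P" and disj: "disjoint_family_on J {1..Suc m}"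
    and fin: "\<And>l. l \<in> {1..Suc m} \<Longrightarrow> finite (J l)" and ne: "J (Suc m) \<noteq> {}"
    and indep: "prob_space.indep_vars P (\<lambda>_. leb UNIV) X (\<Union>l\<in>{1..Suc m}. J l)"
    and dist: "\<And>l i. l \<in> {1..Suc m} \<Longrightarrow> i \<in> J l \<Longrightarrow> distr P (leb UNIV) (X i) = law f"
    and h: "0 < h" "h \<le> 1" "h \<le> T" and S: "S \<in> SS"
  shows "est_error P X h T J (Suc m) S \<le> 2 * est_error P X h T J m S
     + ennreal (18 / (real (card SS))\<^sup>2 * (2 ^ card S + C / c) * (real (card SS) - 1)) * (\<Sum>S'\<in>SS - {S}. est_error P X h T J m S')
     + ennreal (noise h T m (card (J (Suc m))) S)"
proof -
  interpret P: prob_space P by fact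
  define K where "K = J (Suc m)"
  define Past where "Past = (\<Union>l\<in>{1..m}. J l)"
  let ?I = "\<Union>l\<in>{1..Suc m}. J l"
  have Xm: "X i \<in> P \<rightarrow>\<^sub>M leb UNIV" if "i \<in> ?I" for i
    using indep that unfolding P.indep_vars_def by blast
  have KI: "K \<subseteq> ?I" unfolding K_def by (rule UN_upper) simp
  have PI: "Past \<subseteq> ?I" unfolding Past_def by (rule UN_mono) auto
  have "J l \<inter> J (Suc m) = {}" if "l \<in> {1..m}" for l
    by (rule disjoint_family_onD[OF disj]) (use that in auto)
  then have dis: "Past \<inter> K = {}"
    unfolding Past_def K_def by blast
  have finK: "finite K" unfolding K_def by (rule fin) simp
  define U where "U \<omega> = restrict (\<lambda>i. X i \<omega>) Past" for \<omega>
  define V where "V \<omega> = restrict (\<lambda>i. X i \<omega>) K" for \<omega>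
  have UV: "P.indep_var (PiM Past (\<lambda>_. leb UNIV)) U (PiM K (\<lambda>_. leb UNIV)) V"
    unfolding U_def[abs_def] V_def[abs_def] by (rule P.indep_var_restrict[OF indep dis PI KI])
  have distV: "distr P (PiM K (\<lambda>_. leb UNIV)) V = PiM K (\<lambda>_. law f)"
  proof -
    have "P.indep_vars (\<lambda>_. leb UNIV) X K" by (rule P.indep_vars_subset[OF indep KI])
    then have "distr P (PiM K (\<lambda>_. leb UNIV)) (\<lambda>\<omega>. \<lambda>i\<in>K. X i \<omega>) = PiM K (\<lambda>i. distr P (leb UNIV) (X i))"
      using ne KI Xm by (subst (asm) P.indep_vars_iff_distr_eq_PiM') (auto simp: K_def)
    also have "\<dots> = PiM K (\<lambda>_. law f)" using dist[of "Suc m"] by (intro PiM_cong) (auto simp: K_def)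
    finally show ?thesis by (simp add: V_def[abs_def])
  qed
  define \<Phi> where "\<Phi> u y = (\<integral>\<^sup>+x. ennreal ((fit_step SS a r lam h T y K (alpha_hat SS a r lam h T u J m) S (restrict x S) - pop (Suc m) S (restrict x S))\<^sup>2) \<partial>law f)" for u y
  let ?MU = "PiM Past (\<lambda>_. leb UNIV)" and ?MV = "PiM K (\<lambda>_. leb UNIV)"
  have \<Phi>m: "case_prod \<Phi> \<in> borel_measurable (?MU \<Otimes>\<^sub>M ?MV)"
    unfolding \<Phi>_def split_beta'
  proof (rule borel_measurable_nn_integral)
    let ?B = "(?MU \<Otimes>\<^sub>M ?MV) \<Otimes>\<^sub>M law f"
    have snd: "snd \<in> ?B \<rightarrow>\<^sub>M leb UNIV"
      using measurable_snd[of "?MU \<Otimes>\<^sub>M ?MV" "law f"] by (simp cong: measurable_cong_sets)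
    have u: "(\<lambda>p. restrict (snd p) S) \<in> ?B \<rightarrow>\<^sub>M leb S"
      by (rule measurable_leb_restrict[OF snd subset_UNIV])
    have xu: "(\<lambda>p. fst (fst p) i) \<in> ?B \<rightarrow>\<^sub>M leb UNIV" if "l \<in> {1..m}" "i \<in> J l" for l i
    proof -
      have "i \<in> Past" using that by (auto simp: Past_def)
      from measurable_compose[OF measurable_compose[OF measurable_fst measurable_fst] measurable_component_singleton[OF this]]
      show ?thesis .
    qed
    have xv: "(\<lambda>p. snd (fst p) i) \<in> ?B \<rightarrow>\<^sub>M leb UNIV" if "i \<in> K" for i
      using measurable_compose[OF measurable_compose[OF measurable_fst measurable_snd] measurable_component_singleton[OF that]] .
    have "(\<lambda>p. fit_step SS a r lam h T (\<lambda>i. snd (fst p) i) K (alpha_hat SS a r lam h T (\<lambda>i. fst (fst p) i) J m) S (restrict (snd p) S)) \<in> borel_measurable ?B"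
    proof (rule measurable_fit_step[where x="\<lambda>i p. snd (fst p) i" and \<alpha>="\<lambda>p. alpha_hat SS a r lam h T (fst (fst p)) J m", OF S _ u])
      show "(\<lambda>p. snd (fst p) i) \<in> ?B \<rightarrow>\<^sub>M leb UNIV" if "i \<in> K" for i by (rule xv[OF that])
      show "(\<lambda>p. alpha_hat SS a r lam h T (fst (fst p)) J m S' (u p)) \<in> borel_measurable ?B"
        if "S' \<in> SS" "u \<in> ?B \<rightarrow>\<^sub>M leb S'" for S' u
        using measurable_alpha_hat[of m J "\<lambda>i p. fst (fst p) i" ?B S' u h T] xu that by blast
    qed
    moreover have "(\<lambda>p. pop (Suc m) S (restrict (snd p) S)) \<in> borel_measurable ?B"
      by (rule measurable_compose[OF u pop_measurable[OF S]])
    ultimately have "(\<lambda>p. ennreal ((fit_step SS a r lam h T (snd (fst p)) K (alpha_hat SS a r lam h T (fst (fst p)) J m) S (restrict (snd p) S) - pop (Suc m) S (restrict (snd p) S))\<^sup>2)) \<in> borel_measurable ?B"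
      by (intro measurable_compose[OF _ measurable_ennreal] borel_measurable_power borel_measurable_diff)
    then show "(\<lambda>(p, x). ennreal ((fit_step SS a r lam h T (snd p) K (alpha_hat SS a r lam h T (fst p) J m) S (restrict x S) - pop (Suc m) S (restrict x S))\<^sup>2)) \<in> borel_measurable ?B"
      unfolding split_beta' .
  qed
  \<comment> \<open>Restricting the sample to the earlier pieces does not change the fit, which is
    therefore a function of \<open>U\<close> alone.\<close>
  have Ua: "alpha_hat SS a r lam h T (U \<omega>) J m = alpha_hat SS a r lam h T (\<lambda>i. X i \<omega>) J m" for \<omega>
    by (rule alpha_hat_cong) (auto simp: U_def Past_def)
  have Va: "fit_step SS a r lam h T (V \<omega>) K \<alpha> = fit_step SS a r lam h T (\<lambda>i. X i \<omega>) K \<alpha>" for \<omega> \<alpha>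
    by (rule fit_step_cong) (simp add: V_def)
  define E where "E \<omega> S' = (\<integral>\<^sup>+x. ennreal ((alpha_hat SS a r lam h T (\<lambda>i. X i \<omega>) J m S' (restrict x S') - pop m S' (restrict x S'))\<^sup>2) \<partial>law f)" for \<omega> S'
  have Em: "(\<lambda>\<omega>. E \<omega> S') \<in> borel_measurable P" if "S' \<in> SS" for S'
    unfolding E_def by (rule est_error_measurable[OF Xm that]) auto
  let ?k = "ennreal (18 / (real (card SS))\<^sup>2 * (2 ^ card S + C / c) * (real (card SS) - 1))"
  let ?nz = "ennreal (noise h T m (card K) S)"
  have "est_error P X h T J (Suc m) S = (\<integral>\<^sup>+\<omega>. \<Phi> (U \<omega>) (V \<omega>) \<partial>P)"
    unfolding est_error_def \<Phi>_def Ua Va alpha_hat_Suc K_def[symmetric] ..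
  also have "\<dots> = (\<integral>\<^sup>+\<omega>. \<integral>\<^sup>+\<omega>'. \<Phi> (U \<omega>) (V \<omega>') \<partial>P \<partial>P)"
    by (rule P.nn_integral_indep_var[OF UV \<Phi>m])
  also have "\<dots> \<le> (\<integral>\<^sup>+\<omega>. 2 * E \<omega> S + ?k * (\<Sum>S'\<in>SS - {S}. E \<omega> S') + ?nz \<partial>P)"
  proof (rule nn_integral_mono)
    fix \<omega> assume \<omega>: "\<omega> \<in> space P"
    have Um: "U \<in> P \<rightarrow>\<^sub>M ?MU" and Vm: "V \<in> P \<rightarrow>\<^sub>M ?MV" using UV unfolding P.indep_var_distribution_eq by auto
    have \<Phi>u: "\<Phi> (U \<omega>) \<in> borel_measurable ?MV"
      using measurable_compose[OF measurable_Pair1'[OF measurable_space[OF Um \<omega>]] \<Phi>m] by simp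
    have "(\<integral>\<^sup>+\<omega>'. \<Phi> (U \<omega>) (V \<omega>') \<partial>P) = (\<integral>\<^sup>+y. \<Phi> (U \<omega>) y \<partial>PiM K (\<lambda>_. law f))"
      unfolding distV[symmetric] using nn_integral_distr[OF Vm, of "\<Phi> (U \<omega>)"] \<Phi>u by simp
    also have "\<dots> \<le> 2 * E \<omega> S + ?k * (\<Sum>S'\<in>SS - {S}. E \<omega> S') + ?nz"
      unfolding \<Phi>_def E_def Ua
    proof (rule nn_integral_fit_step[OF S finK _ h])
      show "K \<noteq> {}" using ne by (simp add: K_def)
      show "alpha_hat SS a r lam h T (\<lambda>i. X i \<omega>) J m S' \<in> borel_measurable (leb S')" if "S' \<in> SS" for S'
        using measurable_alpha_hat[of m J "\<lambda>i _. X i \<omega>" "leb S'" S' "\<lambda>u. u" h T] that by simp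
    qed
    finally show "(\<integral>\<^sup>+\<omega>'. \<Phi> (U \<omega>) (V \<omega>') \<partial>P) \<le> 2 * E \<omega> S + ?k * (\<Sum>S'\<in>SS - {S}. E \<omega> S') + ?nz" .
  qed
  also have "\<dots> = 2 * (\<integral>\<^sup>+\<omega>. E \<omega> S \<partial>P) + ?k * (\<Sum>S'\<in>SS - {S}. \<integral>\<^sup>+\<omega>. E \<omega> S' \<partial>P) + ?nz"
  proof -
    have m1: "(\<lambda>\<omega>. \<Sum>S'\<in>SS - {S}. E \<omega> S') \<in> borel_measurable P" by (intro borel_measurable_sum Em) auto
    have "(\<integral>\<^sup>+\<omega>. (\<Sum>S'\<in>SS - {S}. E \<omega> S') \<partial>P) = (\<Sum>S'\<in>SS - {S}. \<integral>\<^sup>+\<omega>. E \<omega> S' \<partial>P)"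
      by (rule nn_integral_sum) (rule Em, auto)
    then show ?thesis
      using m1 Em[OF S] by (simp add: nn_integral_add nn_integral_cmult P.emeasure_space_1)
  qed
  finally show ?thesis unfolding est_error_def E_def K_def .
qed

text \<open>The inherited part is at most (2 + 18 y) times the old bound with y = C/c + 2^d, and
  \<open>noise_arithmetic\<close> places the new error in the remaining A - 2 - 18 y; the sum is
  \<open>A\<close> times the old bound. The start is exact, since the fit and the population iterate
  are both 0.\<close>

lemma est_error_le:
  fixes X :: "nat \<Rightarrow> 'w \<Rightarrow> 'd \<Rightarrow> real"
  assumes d2: "2 \<le> CARD('d)"
    and P: "prob_space P" and disj: "disjoint_family_on J {1..M}"
    and fin: "\<And>l. l \<in> {1..M} \<Longrightarrow> finite (J l)" and ne: "\<And>l. l \<in> {1..M} \<Longrightarrow> J l \<noteq> {}"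
    and size: "\<And>l. l \<in> {1..M} \<Longrightarrow> real n \<le> 4 * real M * real (card (J l))" and n: "0 < n"
    and indep: "prob_space.indep_vars P (\<lambda>_. leb UNIV) X (\<Union>l\<in>{1..M}. J l)"
    and dist: "\<And>l i. l \<in> {1..M} \<Longrightarrow> i \<in> J l \<Longrightarrow> distr P (leb UNIV) (X i) = law f"
    and h: "0 < h" "h \<le> 1" and T: "1 \<le> T" and S: "S \<in> SS" and "m \<le> M"
    and Mx: "(C / c)\<^sup>2 \<le> Mx" "(L1 + L2 + L3)\<^sup>2 \<le> Mx" "8 ^ CARD('d) \<le> Mx"
    and A: "A = 28 * (C / c + 2 ^ CARD('d))"
  shows "est_error P X h T J m S \<le> ennreal (2 * A ^ m * (16 * max (na\<^sup>2) 1 * Mx) *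
      (M * T ^ CARD('d) / (n * h ^ CARD('d)) + h powr (2 * \<beta>) + tail T))"
  using \<open>m \<le> M\<close> S
proof (induction m arbitrary: S)
  case 0
  show ?case unfolding est_error_def by simp
next
  case (Suc m)
  let ?d = "CARD('d)" and ?q = "C / c" and ?mx = "max (na\<^sup>2) 1"
  define y where "y = ?q + 2 ^ ?d"
  define G where "G = M * T ^ ?d / (n * h ^ ?d) + h powr (2 * \<beta>) + tail T"
  define D where "D = 2 * A ^ m * (16 * ?mx * Mx) * G"
  have q1: "1 \<le> ?q" using c c_C by simp
  have y0: "0 < y" using q1 by (simp add: y_def add_pos_pos)
  have A0: "0 < A" using y0 by (simp add: A y_def)
  have t0: "0 \<le> tail T" by (simp add: tail_def)
  have G0: "0 \<le> G" unfolding G_def using t0 T h by (intro add_nonneg_nonneg divide_nonneg_nonneg mult_nonneg_nonneg) auto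
  have Mx0: "0 \<le> Mx" by (rule order_trans[OF zero_le_power2 Mx(1)])
  have D0: "0 \<le> D" unfolding D_def using A0 G0 Mx0 by (intro mult_nonneg_nonneg) auto
  have N: "1 \<le> real (card SS)" by (rule card_SS)
  have IH: "est_error P X h T J m S' \<le> ennreal D" if "S' \<in> SS" for S'
    unfolding D_def G_def using Suc.IH[OF _ that] Suc.prems(1) by simp
  have sub: "{1..Suc m} \<subseteq> {1..M}" using Suc.prems(1) by auto
  have sm: "Suc m \<in> {1..M}" using Suc.prems(1) by auto
  have "est_error P X h T J (Suc m) S \<le> 2 * est_error P X h T J m S
     + ennreal (18 / (real (card SS))\<^sup>2 * (2 ^ card S + C / c) * (real (card SS) - 1)) * (\<Sum>S'\<in>SS - {S}. est_error P X h T J m S')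
     + ennreal (noise h T m (card (J (Suc m))) S)"
  proof (rule est_error_Suc[OF P _ _ _ _ _ h])
    show "disjoint_family_on J {1..Suc m}" using disj sub by (rule disjoint_family_on_mono[rotated])
    show "prob_space.indep_vars P (\<lambda>_. leb UNIV) X (\<Union>l\<in>{1..Suc m}. J l)"
      by (rule prob_space.indep_vars_subset[OF P indep UN_mono[OF sub order_refl]])
    show "finite (J l)" if "l \<in> {1..Suc m}" for l using fin that sub by blast
    show "distr P (leb UNIV) (X i) = law f" if "l \<in> {1..Suc m}" "i \<in> J l" for l i using dist that sub by blast
    show "J (Suc m) \<noteq> {}" by (rule ne[OF sm])
    show "h \<le> T" using h T by simp
  qed (rule Suc.prems(2))
  also have "\<dots> \<le> 2 * ennreal D + ennreal (18 / (real (card SS))\<^sup>2 * (2 ^ card S + C / c) * (real (card SS) - 1)) * (\<Sum>S'\<in>SS - {S}. ennreal D)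
     + ennreal (noise h T m (card (J (Suc m))) S)"
    using IH Suc.prems(2) by (intro add_mono mult_left_mono sum_mono order_refl) auto
  also have "\<dots> = ennreal (2 * D + 18 / (real (card SS))\<^sup>2 * (2 ^ card S + C / c) * (real (card SS) - 1) * ((real (card SS) - 1) * D))
      + ennreal (noise h T m (card (J (Suc m))) S)"
  proof -
    have "(\<Sum>S'\<in>SS - {S}. ennreal D) = ennreal ((real (card SS) - 1) * D)"
      using Suc.prems(2) N D0 by (simp add: ennreal_mult ennreal_of_nat_eq_real_of_nat of_nat_diff)
    moreover have "0 \<le> 18 / (real (card SS))\<^sup>2 * (2 ^ card S + C / c) * (real (card SS) - 1)"
      using N q1 by (intro mult_nonneg_nonneg) auto
    moreover have "ennreal (2 * D + u * v) = 2 * ennreal D + ennreal u * ennreal v" if "0 \<le> u" "0 \<le> v" for u v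
      using that D0 by (simp add: ennreal_plus ennreal_mult)
    moreover have "0 \<le> (real (card SS) - 1) * D" using N D0 by simp
    ultimately show ?thesis by presburger
  qed
  also have "\<dots> \<le> ennreal ((2 + 18 * y) * D) + ennreal ((A - (2 + 18 * y)) * D)"
  proof (intro add_mono ennreal_leI)
    \<comment> \<open>The number of other blocks enters twice, through the sum over them and through
      Cauchy-Schwarz; the squared step size compensates for both.\<close>
    have "18 / (real (card SS))\<^sup>2 * (2 ^ card S + C / c) * (real (card SS) - 1) * ((real (card SS) - 1) * D) =
        18 * (2 ^ card S + C / c) * D * ((real (card SS) - 1)\<^sup>2 / (real (card SS))\<^sup>2)"
      by (simp add: power2_eq_square)
    also have "\<dots> \<le> 18 * y * D * 1"
    proof (intro mult_mono)
      show "(2::real) ^ card S + C / c \<le> y" unfolding y_def by (auto intro!: power_increasing card_mono)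
      show "(real (card SS) - 1)\<^sup>2 / (real (card SS))\<^sup>2 \<le> 1" using N by (auto simp: divide_le_eq_1 intro!: power_mono)
    qed (use D0 y0 q1 in auto)
    finally show "2 * D + 18 / (real (card SS))\<^sup>2 * (2 ^ card S + C / c) * (real (card SS) - 1) * ((real (card SS) - 1) * D) \<le> (2 + 18 * y) * D"
      by (simp add: distrib_right)
    have "noise h T m (card (J (Suc m))) S \<le> ?mx * 9 ^ m * ((18 * y + 9) * tail T +
      (648 * 3 ^ ?d + 288 * ?q\<^sup>2 + 384 * ?q) * (M * T ^ ?d / (n * h ^ ?d)))
      + 288 * ?mx * (L1 + L2 + L3)\<^sup>2 * 9 ^ m * ?q ^ Suc m * h powr (2 * \<beta>)"
      unfolding y_def using ne[OF sm] fin[OF sm] by (intro noise_le T h n size sm Suc.prems) (auto simp: card_gt_0_iff)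
    also have "\<dots> \<le> (A - (2 + 18 * y)) * (2 * A ^ m * (16 * ?mx * Mx) * (M * T ^ ?d / (n * h ^ ?d) + h powr (2 * \<beta>) + tail T))"
      using T h t0 by (intro noise_arithmetic[OF q1 _ Mx d2 y_def]) (auto simp: A y_def)
    finally show "noise h T m (card (J (Suc m))) S \<le> (A - (2 + 18 * y)) * D" unfolding D_def G_def .
  qed
  also have "\<dots> = ennreal ((2 + 18 * y) * D + (A - (2 + 18 * y)) * D)"
  proof (rule ennreal_plus[symmetric])
    have "(4::real) \<le> 2 ^ ?d" using power_increasing[of 2 ?d "2::real"] d2 by simp
    then have "0 \<le> A - (2 + 18 * y)" using q1 by (simp add: A y_def)
    then show "0 \<le> (A - (2 + 18 * y)) * D" using D0 by simp
  qed (use D0 y0 in auto)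
  also have "(2 + 18 * y) * D + (A - (2 + 18 * y)) * D = 2 * A ^ Suc m * (16 * ?mx * Mx) * G"
    unfolding D_def by (simp add: algebra_simps)
  finally show ?case unfolding G_def .
qed

end

subsection \<open>Second moments of the estimator\<close>

lemma (in prob_space) nn_integral_indep_mult:
  assumes indep: "indep_var MU U MV V" and [measurable]: "F \<in> borel_measurable MU" "G \<in> borel_measurable MV"
  shows "(\<integral>\<^sup>+\<omega>. F (U \<omega>) * G (V \<omega>) \<partial>M) = (\<integral>\<^sup>+\<omega>. F (U \<omega>) \<partial>M) * (\<integral>\<^sup>+\<omega>. G (V \<omega>) \<partial>M)"
proof -
  have [measurable]: "U \<in> M \<rightarrow>\<^sub>M MU" "V \<in> M \<rightarrow>\<^sub>M MV"
    using indep unfolding indep_var_distribution_eq by auto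
  have "(\<integral>\<^sup>+\<omega>. F (U \<omega>) * G (V \<omega>) \<partial>M) = (\<integral>\<^sup>+\<omega>. \<integral>\<^sup>+\<omega>'. F (U \<omega>) * G (V \<omega>') \<partial>M \<partial>M)"
    by (rule nn_integral_indep_var[OF indep, of "\<lambda>u v. F u * G v"]) measurable
  also have "\<dots> = (\<integral>\<^sup>+\<omega>. F (U \<omega>) * (\<integral>\<^sup>+\<omega>. G (V \<omega>) \<partial>M) \<partial>M)"
    by (intro nn_integral_cong nn_integral_cmult) measurable
  also have "\<dots> = (\<integral>\<^sup>+\<omega>. F (U \<omega>) \<partial>M) * (\<integral>\<^sup>+\<omega>. G (V \<omega>) \<partial>M)"
    by (rule nn_integral_multc) measurable
  finally show ?thesis .
qed

lemma integrable_nonneg_bound: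
  fixes g :: "'a \<Rightarrow> real"
  assumes "integrable M h" "g \<in> borel_measurable M" "\<And>x. 0 \<le> g x" "\<And>x. g x \<le> h x"
  shows "integrable M g"
proof (rule Bochner_Integration.integrable_bound[OF assms(1,2)])
  have "norm (g x) \<le> norm (h x)" for x using assms(3,4)[of x] by simp
  then show "AE x in M. norm (g x) \<le> norm (h x)" by simp
qed

context missing_data
begin

definition obs :: "'d set \<Rightarrow> ('d \<Rightarrow> real) measure" where
  "obs S = density (leb S) (\<lambda>u. ennreal (rb S u * marginal f S u))"

text \<open>An incomplete observation is a tilted complete one, projected; means over it become
  means under \<open>law f\<close> with weight \<open>rb\<close>.\<close>

lemma obs_eq:
  assumes S: "S \<in> SS"
  shows "obs S = distr (density (law f) (\<lambda>x. ennreal (rb S (restrict x S)))) (leb S) (\<lambda>x. restrict x S)"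
proof (rule measure_eqI)
  fix A assume "A \<in> sets (obs S)"
  then have A[measurable]: "A \<in> sets (leb S)" by (simp add: obs_def)
  have "emeasure (obs S) A = (\<integral>\<^sup>+u. indicator A u \<partial>obs S)" using A by (simp add: obs_def)
  also have "\<dots> = (\<integral>\<^sup>+x. ennreal (rb S (restrict x S)) * indicator A (restrict x S) \<partial>law f)"
    unfolding obs_def by (rule nn_integral_obs[OF S]) measurable
  also have "\<dots> = (\<integral>\<^sup>+x. indicator A (restrict x S) \<partial>density (law f) (\<lambda>x. ennreal (rb S (restrict x S))))"
    using S by (subst nn_integral_density) auto
  also have "\<dots> = (\<integral>\<^sup>+u. indicator A u \<partial>distr (density (law f) (\<lambda>x. ennreal (rb S (restrict x S)))) (leb S) (\<lambda>x. restrict x S))"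
    by (subst nn_integral_distr) auto
  finally show "emeasure (obs S) A = emeasure (distr (density (law f) (\<lambda>x. ennreal (rb S (restrict x S)))) (leb S) (\<lambda>x. restrict x S)) A"
    using A by simp
qed (simp add: obs_def)

lemma integral_obs:
  assumes S: "S \<in> SS" and [measurable]: "\<phi> \<in> borel_measurable (leb S)"
  shows "integrable (obs S) \<phi> \<longleftrightarrow> integrable (law f) (\<lambda>x. rb S (restrict x S) * \<phi> (restrict x S))"
    and "integral\<^sup>L (obs S) \<phi> = expectation (\<lambda>x. rb S (restrict x S) * \<phi> (restrict x S) :: real)"
proof -
  let ?\<mu> = "density (law f) (\<lambda>x. ennreal (rb S (restrict x S)))"
  have m: "(\<lambda>x. restrict x S) \<in> ?\<mu> \<rightarrow>\<^sub>M leb S" by simp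
  have m2: "(\<lambda>x. \<phi> (restrict x S)) \<in> borel_measurable (law f)" and m3: "(\<lambda>x. rb S (restrict x S)) \<in> borel_measurable (law f)" using S by simp_all
  have ae: "AE x in law f. 0 \<le> rb S (restrict x S)" using rb_pos[OF S restrict_subspace] by (simp add: less_imp_le)
  show "integrable (obs S) \<phi> \<longleftrightarrow> integrable (law f) (\<lambda>x. rb S (restrict x S) * \<phi> (restrict x S))"
    unfolding obs_eq[OF S] integrable_distr_eq[OF m assms(2)] using integrable_density[OF m2 m3 ae] by simp
  show "integral\<^sup>L (obs S) \<phi> = expectation (\<lambda>x. rb S (restrict x S) * \<phi> (restrict x S))"
    unfolding obs_eq[OF S] integral_distr[OF m assms(2)] using integral_density[OF m2 m3 ae] by simp
qed

end

locale cross_fit = missing_data f a SS r lam k \<beta> L1 L2 L3 c C na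
  for f a :: "('d::finite \<Rightarrow> real) \<Rightarrow> real" and SS r lam k \<beta> L1 L2 L3 c C na +
  fixes n :: nat and ns :: "'d set \<Rightarrow> nat" and P :: "'w measure"
    and X :: "nat \<Rightarrow> 'w \<Rightarrow> 'd \<Rightarrow> real" and Y :: "'d set \<Rightarrow> nat \<Rightarrow> 'w \<Rightarrow> 'd \<Rightarrow> real"
  assumes model: "sample_model f r SS n ns P X Y" and n2: "2 \<le> n"
    and ns: "S \<in> SS \<Longrightarrow> 1 \<le> ns S \<and> \<bar>real n * lam S / real (ns S) - 1\<bar> \<le> 1 / real n"
begin

sublocale P: prob_space P using model by (simp add: sample_model_def)

abbreviation spaces :: "nat + 'd set \<times> nat \<Rightarrow> ('d \<Rightarrow> real) measure" where
  "spaces \<equiv> case_sum (\<lambda>_. leb UNIV) (\<lambda>(S, j). leb S)"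
abbreviation data :: "nat + 'd set \<times> nat \<Rightarrow> 'w \<Rightarrow> 'd \<Rightarrow> real" where
  "data \<equiv> case_sum X (\<lambda>(S, j). Y S j)"
abbreviation laws :: "nat + 'd set \<times> nat \<Rightarrow> ('d \<Rightarrow> real) measure" where
  "laws \<equiv> case_sum (\<lambda>_. law f) (\<lambda>(S, j). obs S)"
abbreviation Idx :: "(nat + 'd set \<times> nat) set" where "Idx \<equiv> {1..n} <+> (SIGMA S:SS. {1..ns S})"

lemma indep: "P.indep_vars spaces data Idx" using model by (simp add: sample_model_def)

lemma X_measurable [measurable]: "i \<in> {1..n} \<Longrightarrow> X i \<in> P \<rightarrow>\<^sub>M leb UNIV"
  using model by (auto simp: sample_model_def dest: distributed_measurable)

lemma Y_measurable [measurable]: "S \<in> SS \<Longrightarrow> j \<in> {1..ns S} \<Longrightarrow> Y S j \<in> P \<rightarrow>\<^sub>M leb S"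
  using model unfolding sample_model_def by (blast dest: distributed_measurable)

lemma X_distr: "i \<in> {1..n} \<Longrightarrow> distr P (leb UNIV) (X i) = law f"
  using model unfolding sample_model_def law_def by (blast dest: distributed_distr_eq_density)

lemma Y_distr: "S \<in> SS \<Longrightarrow> j \<in> {1..ns S} \<Longrightarrow> distr P (leb S) (Y S j) = obs S"
  using model unfolding sample_model_def obs_def by (blast dest: distributed_distr_eq_density)

lemma data_distr: "i \<in> Idx \<Longrightarrow> data i \<in> P \<rightarrow>\<^sub>M spaces i \<and> distr P (spaces i) (data i) = laws i"
  using X_distr Y_distr X_measurable Y_measurable by fastforce

text \<open>Complete and incomplete observations form one independent family indexed by a sum type,
  so that sums mixing both kinds of data are covered.\<close>

lemma expectation_sum_square_data:
  assumes K: "K \<subseteq> Idx" and \<psi>: "\<And>i. i \<in> K \<Longrightarrow> \<psi> i \<in> borel_measurable (spaces i)"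
    and sq: "\<And>i. i \<in> K \<Longrightarrow> integrable (laws i) (\<lambda>x. (\<psi> i x)\<^sup>2)" and mean: "\<And>i. i \<in> K \<Longrightarrow> integral\<^sup>L (laws i) (\<psi> i) = (0::real)"
  shows "integrable P (\<lambda>\<omega>. (\<Sum>i\<in>K. \<psi> i (data i \<omega>))\<^sup>2)"
    and "P.expectation (\<lambda>\<omega>. (\<Sum>i\<in>K. \<psi> i (data i \<omega>))\<^sup>2) = (\<Sum>i\<in>K. \<integral>x. (\<psi> i x)\<^sup>2 \<partial>laws i)"
proof -
  have fin: "finite K" by (rule finite_subset[OF K]) simp
  note d = data_distr[OF subsetD[OF K]]
  have int: "integrable P (\<lambda>\<omega>. (\<psi> i (data i \<omega>))\<^sup>2)" if "i \<in> K" for i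
    using integrable_distr_eq[of "data i" P "spaces i" "\<lambda>x. (\<psi> i x)\<^sup>2"] d[OF that] \<psi>[OF that] sq[OF that] by simp
  have eq: "P.expectation (\<lambda>\<omega>. g (data i \<omega>)) = integral\<^sup>L (laws i) g" if "i \<in> K" "g \<in> borel_measurable (spaces i)" for i and g :: "_ \<Rightarrow> real"
    using integral_distr[of "data i" P "spaces i" g] d[OF that(1)] that(2) by simp
  have m0: "P.expectation (\<lambda>\<omega>. \<psi> i (data i \<omega>)) = 0" if "i \<in> K" for i
    using eq[OF that \<psi>[OF that]] mean[OF that] by simp
  note main = P.expectation_sum_square_indep[where \<psi>=\<psi> and V=data and M'=spaces, OF fin P.indep_vars_subset[OF indep K] \<psi> int m0]
  show "integrable P (\<lambda>\<omega>. (\<Sum>i\<in>K. \<psi> i (data i \<omega>))\<^sup>2)" by (rule main(1))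
  show "P.expectation (\<lambda>\<omega>. (\<Sum>i\<in>K. \<psi> i (data i \<omega>))\<^sup>2) = (\<Sum>i\<in>K. \<integral>x. (\<psi> i x)\<^sup>2 \<partial>laws i)"
  proof -
    have "P.expectation (\<lambda>\<omega>. (\<Sum>i\<in>K. \<psi> i (data i \<omega>))\<^sup>2) = (\<Sum>i\<in>K. P.expectation (\<lambda>\<omega>. (\<psi> i (data i \<omega>))\<^sup>2))" by (rule main(2))
    also have "\<dots> = (\<Sum>i\<in>K. \<integral>x. (\<psi> i x)\<^sup>2 \<partial>laws i)"
    proof (rule sum.cong[OF refl])
      fix i assume "i \<in> K"
      then show "P.expectation (\<lambda>\<omega>. (\<psi> i (data i \<omega>))\<^sup>2) = (\<integral>x. (\<psi> i x)\<^sup>2 \<partial>laws i)"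
        using eq[of i "\<lambda>x. (\<psi> i x)\<^sup>2"] \<psi>[of i] by simp
    qed
    finally show ?thesis .
  qed
qed

lemma X_sum_square:
  assumes E: "E \<subseteq> {1..n}" and \<phi>: "\<phi> \<in> borel_measurable (leb UNIV)" "integrable (law f) (\<lambda>x. (\<phi> x)\<^sup>2)" "expectation \<phi> = 0"
  shows "(\<integral>\<^sup>+\<omega>. ennreal ((\<Sum>i\<in>E. \<phi> (X i \<omega>))\<^sup>2) \<partial>P) = ennreal (real (card E) * expectation (\<lambda>x. (\<phi> x)\<^sup>2))"
proof -
  have K: "Inl ` E \<subseteq> Idx" using E by auto
  have s: "(\<Sum>i\<in>Inl ` E. \<phi> (data i \<omega>)) = (\<Sum>i\<in>E. \<phi> (X i \<omega>))" for \<omega> by (simp add: sum.reindex)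
  have "integrable P (\<lambda>\<omega>. (\<Sum>i\<in>Inl ` E. \<phi> (data i \<omega>))\<^sup>2)"
    and "P.expectation (\<lambda>\<omega>. (\<Sum>i\<in>Inl ` E. \<phi> (data i \<omega>))\<^sup>2) = (\<Sum>i\<in>Inl ` E. \<integral>x. (\<phi> x)\<^sup>2 \<partial>laws i)"
    using \<phi> by (intro expectation_sum_square_data[OF K, of "\<lambda>_. \<phi>"]; auto)+
  then show ?thesis unfolding s by (subst nn_integral_eq_integral) (auto simp: sum.reindex)
qed

lemma Y_sum_square:
  assumes S: "S \<in> SS" and \<phi>[measurable]: "\<phi> \<in> borel_measurable (leb S)"
    and "integrable (law f) (\<lambda>x. rb S (restrict x S) * (\<phi> (restrict x S))\<^sup>2)" "expectation (\<lambda>x. rb S (restrict x S) * \<phi> (restrict x S)) = 0"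
  shows "(\<integral>\<^sup>+\<omega>. ennreal ((\<Sum>j\<in>{1..ns S}. \<phi> (Y S j \<omega>))\<^sup>2) \<partial>P) = ennreal (real (ns S) * expectation (\<lambda>x. rb S (restrict x S) * (\<phi> (restrict x S))\<^sup>2))"
proof -
  let ?K = "(\<lambda>j. Inr (S, j)) ` {1..ns S}"
  have K: "?K \<subseteq> Idx" using S by auto
  have s: "(\<Sum>i\<in>?K. \<phi> (data i \<omega>)) = (\<Sum>j\<in>{1..ns S}. \<phi> (Y S j \<omega>))" for \<omega> by (subst sum.reindex) (auto simp: inj_on_def)
  have sq: "integrable (obs S) (\<lambda>x. (\<phi> x)\<^sup>2)" "(\<integral>x. (\<phi> x)\<^sup>2 \<partial>obs S) = expectation (\<lambda>x. rb S (restrict x S) * (\<phi> (restrict x S))\<^sup>2)"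
    "integral\<^sup>L (obs S) \<phi> = 0"
    using integral_obs[OF S, of "\<lambda>x. (\<phi> x)\<^sup>2"] integral_obs[OF S \<phi>] assms by auto
  have "integrable P (\<lambda>\<omega>. (\<Sum>i\<in>?K. \<phi> (data i \<omega>))\<^sup>2)"
    and "P.expectation (\<lambda>\<omega>. (\<Sum>i\<in>?K. \<phi> (data i \<omega>))\<^sup>2) = (\<Sum>i\<in>?K. \<integral>x. (\<phi> x)\<^sup>2 \<partial>laws i)"
    using \<phi> sq by (intro expectation_sum_square_data[OF K, of "\<lambda>_. \<phi>"]; auto)+
  then show ?thesis unfolding s using sq(2) by (subst nn_integral_eq_integral) (auto simp: sum.reindex inj_on_def)
qed

lemma ns_bounds: assumes "S \<in> SS" shows "real n * lam S \<le> 3 / 2 * real (ns S)" "0 < real (ns S)"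
proof -
  show p: "0 < real (ns S)" using ns[OF assms] by simp
  \<comment> \<open>With n \<ge> 2 the relative deviation 1 / n of the sample sizes is at most one
    half, whence the factor 3/2.\<close>
  have "1 / real n \<le> 1 / 2" using n2 by simp
  then have "real n * lam S / real (ns S) \<le> 3 / 2" using ns[OF assms] by linarith
  then show "real n * lam S \<le> 3 / 2 * real (ns S)" using p by (simp add: field_simps)
qed

text \<open>The importance-weighted mean over the incomplete sample: dividing by the density ratio
  makes it unbiased for the mean of \<open>g\<close> under \<open>law f\<close>.\<close>

definition avg :: "'d set \<Rightarrow> (('d \<Rightarrow> real) \<Rightarrow> real) \<Rightarrow> (nat \<Rightarrow> 'd \<Rightarrow> real) \<Rightarrow> real" where
  "avg S g y = (\<Sum>j\<in>{1..ns S}. g (y j) / rb S (y j)) / real (ns S)"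

lemma measurable_avg:
  assumes S: "S \<in> SS" and y: "\<And>j. j \<in> {1..ns S} \<Longrightarrow> y j \<in> M \<rightarrow>\<^sub>M leb S"
    and g: "\<And>j. j \<in> {1..ns S} \<Longrightarrow> (\<lambda>\<omega>. g \<omega> (y j \<omega>)) \<in> borel_measurable M"
  shows "(\<lambda>\<omega>. avg S (g \<omega>) (\<lambda>j. y j \<omega>)) \<in> borel_measurable M"
  unfolding avg_def
  by (intro borel_measurable_divide borel_measurable_sum g measurable_compose[OF y rb_measurable[OF S]]) auto

lemma avg_centred: "S \<in> SS \<Longrightarrow> avg S g y - m = (\<Sum>j\<in>{1..ns S}. g (y j) / rb S (y j) - m) / real (ns S)"
  using ns_bounds(2)[of S] by (simp add: avg_def sum_subtractf field_simps)

text \<open>Under the law of an incomplete observation the centred summand g / rb - m has second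
  moment lam E(g^2 iv) - m^2; the negative part is dropped.\<close>

lemma avg_second_moment:
  assumes S: "S \<in> SS" and [measurable]: "g \<in> borel_measurable (leb S)" and g2: "integrable (law f) (\<lambda>x. (g (restrict x S))\<^sup>2)"
  shows "(\<integral>\<^sup>+\<omega>. ennreal ((avg S g (\<lambda>j. Y S j \<omega>) - expectation (\<lambda>x. g (restrict x S)))\<^sup>2) \<partial>P)
    \<le> ennreal (lam S / real (ns S) * expectation (\<lambda>x. (g (restrict x S))\<^sup>2 * iv S (restrict x S)))"
proof -
  note [measurable] = rb_measurable[OF S]
  define m where "m = expectation (\<lambda>x. g (restrict x S))"
  define \<phi> where "\<phi> u = g u / rb S u - m" for u
  have \<phi>m: "\<phi> \<in> borel_measurable (leb S)" unfolding \<phi>_def by measurable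
  have nz: "rb S (restrict x S) \<noteq> 0 \<and> lam S \<noteq> 0" for x using rb_pos[OF S restrict_subspace, of x] lam_pos[OF S] by auto
  have g1: "integrable (law f) (\<lambda>x. g (restrict x S))"
    by (rule integrable_of_square_integrable[OF _ g2]) measurable
  have e1: "rb S (restrict x S) * \<phi> (restrict x S) = g (restrict x S) - m * rb S (restrict x S)" for x
    using nz[of x] by (simp add: \<phi>_def field_simps)
  have e2: "rb S (restrict x S) * (\<phi> (restrict x S))\<^sup>2 = lam S * ((g (restrict x S))\<^sup>2 * iv S (restrict x S)) - 2 * m * g (restrict x S) + m\<^sup>2 * rb S (restrict x S)" for x
    using nz[of x] by (simp add: \<phi>_def iv_def field_simps power2_eq_square)
  note i = integrable_iv[OF S g2] g1 integrable_rb[OF S]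
  have i2: "integrable (law f) (\<lambda>x. rb S (restrict x S) * (\<phi> (restrict x S))\<^sup>2)" unfolding e2 using i by simp
  have m0: "expectation (\<lambda>x. rb S (restrict x S) * \<phi> (restrict x S)) = 0"
    unfolding e1 using i expectation_rb[OF S] by (simp add: m_def)
  have "expectation (\<lambda>x. rb S (restrict x S) * (\<phi> (restrict x S))\<^sup>2) = lam S * expectation (\<lambda>x. (g (restrict x S))\<^sup>2 * iv S (restrict x S)) - m\<^sup>2"
    unfolding e2 using i expectation_rb[OF S] by (simp add: m_def[symmetric] power2_eq_square)
  then have le: "expectation (\<lambda>x. rb S (restrict x S) * (\<phi> (restrict x S))\<^sup>2) \<le> lam S * expectation (\<lambda>x. (g (restrict x S))\<^sup>2 * iv S (restrict x S))" by simp
  note p = ns_bounds(2)[OF S]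
  have [measurable]: "\<And>j. j \<in> {1..ns S} \<Longrightarrow> (\<lambda>\<omega>. \<phi> (Y S j \<omega>)) \<in> borel_measurable P"
    using S \<phi>m by (intro measurable_compose[OF Y_measurable])
  have "(\<integral>\<^sup>+\<omega>. ennreal ((avg S g (\<lambda>j. Y S j \<omega>) - m)\<^sup>2) \<partial>P) = (\<integral>\<^sup>+\<omega>. ennreal (1 / (real (ns S))\<^sup>2) * ennreal ((\<Sum>j\<in>{1..ns S}. \<phi> (Y S j \<omega>))\<^sup>2) \<partial>P)"
    unfolding avg_centred[OF S] \<phi>_def[symmetric] by (simp add: power_divide ennreal_mult[symmetric])
  also have "\<dots> = ennreal (1 / (real (ns S))\<^sup>2) * ennreal (real (ns S) * expectation (\<lambda>x. rb S (restrict x S) * (\<phi> (restrict x S))\<^sup>2))"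
  proof -
    have mm: "(\<lambda>\<omega>. ennreal ((\<Sum>j\<in>{1..ns S}. \<phi> (Y S j \<omega>))\<^sup>2)) \<in> borel_measurable P" by measurable
    show ?thesis unfolding nn_integral_cmult[OF mm] Y_sum_square[OF S \<phi>m i2 m0] ..
  qed
  also have "\<dots> = ennreal (expectation (\<lambda>x. rb S (restrict x S) * (\<phi> (restrict x S))\<^sup>2) / real (ns S))"
    using p by (simp add: ennreal_mult'[symmetric] power2_eq_square)
  also have "\<dots> \<le> ennreal (lam S / real (ns S) * expectation (\<lambda>x. (g (restrict x S))\<^sup>2 * iv S (restrict x S)))"
    using le p by (intro ennreal_leI) (simp add: divide_right_mono)
  finally show ?thesis by (simp add: m_def)
qed

text \<open>The contribution of \<open>S\<close> and of the half with indices \<open>E\<close> to the difference between the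
  estimator with fit \<open>\<alpha>\<close> and the ideal estimator with fit \<open>p\<close>.\<close>

definition discrepancy :: "'d set \<Rightarrow> nat set \<Rightarrow> (('d \<Rightarrow> real) \<Rightarrow> real) \<Rightarrow> (('d \<Rightarrow> real) \<Rightarrow> real) \<Rightarrow>
    (nat \<Rightarrow> 'd \<Rightarrow> real) \<Rightarrow> (nat \<Rightarrow> 'd \<Rightarrow> real) \<Rightarrow> real" where
  "discrepancy S E p \<alpha> x y =
    (\<Sum>i\<in>E. rb S (restrict (x i) S) * avg S \<alpha> y - avg S p y - (\<alpha> (restrict (x i) S) - p (restrict (x i) S)))"

text \<open>Meant for m equal to the mean of \<alpha> - p with p centred. Then the summands are a
  centred sum over complete data, a product of two centred factors from independent samples, and a
  centred mean over incomplete data: no bias of the fit survives.\<close>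

lemma discrepancy_eq:
  fixes x y :: "nat \<Rightarrow> 'd \<Rightarrow> real"
  shows "discrepancy S E p \<alpha> x y =
    (\<Sum>i\<in>E. rb S (restrict (x i) S) * m - (\<alpha> (restrict (x i) S) - p (restrict (x i) S)))
    + (avg S \<alpha> y - m) * (\<Sum>i\<in>E. rb S (restrict (x i) S) - 1)
    + real (card E) * (avg S (\<lambda>u. \<alpha> u - p u) y - m)"
proof -
  have "avg S p y = avg S \<alpha> y - avg S (\<lambda>u. \<alpha> u - p u) y"
    by (simp add: avg_def diff_divide_distrib sum_subtractf)
  then have e: "avg S (\<lambda>u. \<alpha> u - p u) y = avg S \<alpha> y - avg S p y" by simp
  show ?thesis unfolding discrepancy_def e
    by (simp add: sum_subtractf sum.distrib algebra_simps sum_distrib_left sum_distrib_right)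
qed

lemma measurable_discrepancy:
  assumes S: "S \<in> SS" and x: "\<And>i. i \<in> E \<Longrightarrow> x i \<in> M \<rightarrow>\<^sub>M leb UNIV"
    and y: "\<And>j. j \<in> {1..ns S} \<Longrightarrow> y j \<in> M \<rightarrow>\<^sub>M leb S" and p: "p \<in> borel_measurable (leb S)"
    and \<alpha>: "\<And>u. u \<in> M \<rightarrow>\<^sub>M leb S \<Longrightarrow> (\<lambda>\<omega>. \<alpha> \<omega> (u \<omega>)) \<in> borel_measurable M"
  shows "(\<lambda>\<omega>. discrepancy S E p (\<alpha> \<omega>) (\<lambda>i. x i \<omega>) (\<lambda>j. y j \<omega>)) \<in> borel_measurable M"
proof -
  have u: "(\<lambda>\<omega>. restrict (x i \<omega>) S) \<in> M \<rightarrow>\<^sub>M leb S" if "i \<in> E" for i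
    by (rule measurable_leb_restrict[OF x[OF that] subset_UNIV])
  have "(\<lambda>\<omega>. avg S p (\<lambda>j. y j \<omega>)) \<in> borel_measurable M"
    by (rule measurable_avg[where g="\<lambda>_. p", OF S y measurable_compose[OF y p]])
  moreover have "(\<lambda>\<omega>. avg S (\<alpha> \<omega>) (\<lambda>j. y j \<omega>)) \<in> borel_measurable M"
    by (rule measurable_avg[where g=\<alpha>, OF S y \<alpha>[OF y]])
  ultimately show ?thesis unfolding discrepancy_def
    by (intro borel_measurable_sum borel_measurable_diff borel_measurable_times \<alpha>[OF u] measurable_compose[OF u p]
      measurable_compose[OF u rb_measurable[OF S]])
qed

text \<open>The hypothesis on \<open>n * l\<close> makes q l / N at most 3/2, so a mean over N
  incomplete observations counts like one over n complete ones. \<open>V\<close> comes without the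
  factor n, since it enters only through the product term.\<close>

lemma discrepancy_arithmetic:
  fixes q :: real
  assumes "0 \<le> q" "q \<le> real n" "0 \<le> V" "0 \<le> D" "0 < N" "0 < l" "real n * l \<le> 3 / 2 * N" "0 < lmin" "lmin \<le> l"
  shows "3 * (q * (2 * (1 + C) * D) + l / N * (2 * V + 2 * (D / (l * c))) * (q * C) + q\<^sup>2 * (l / N * (D / (l * c))))
    \<le> C / c * (1 + 1 / lmin) * (12 * real n * D + 9 * V)"
proof -
  define Q where "Q = C / c"
  have Q: "1 \<le> Q" "C \<le> Q" "1 / c \<le> Q" using c c_C by (auto simp: Q_def field_simps)
  have "q * l \<le> 3 / 2 * N" using assms mult_right_mono[of q "real n" l] by linarith
  then have ql: "q * l / N \<le> 3 / 2" using assms by (simp add: field_simps)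
  have ql0: "0 \<le> q * l / N" using assms by simp
  have il: "1 / l \<le> 1 / lmin" using assms by (simp add: frac_le)
  have n2': "2 \<le> real n" using n2 by simp
  define W where "W = D / l"
  have W0: "0 \<le> W" using assms by (simp add: W_def)
  have Wl: "W \<le> D * (1 / lmin)" using mult_left_mono[OF il assms(4)] by (simp add: W_def)
  have t1: "q * (2 * (1 + C) * D) \<le> real n * (4 * Q * D)"
  proof -
    have "2 * (1 + C) * D \<le> 4 * Q * D" using Q assms by (intro mult_right_mono) auto
    moreover have "0 \<le> 2 * (1 + C) * D" using assms c_C by simp
    ultimately show ?thesis using mult_mono[OF assms(2), of "2 * (1 + C) * D" "4 * Q * D"] by simp
  qed
  have t2: "l / N * (2 * V + 2 * (D / (l * c))) * (q * C) \<le> 3 * Q * V + 3 * Q * W"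
  proof -
    have "l / N * (2 * V + 2 * (D / (l * c))) * (q * C) = (q * l / N) * (2 * (C * V) + 2 * (Q * W))"
      using c assms by (simp add: Q_def W_def field_simps)
    also have "\<dots> \<le> 3 / 2 * (2 * (Q * V) + 2 * (Q * W))"
      using ql ql0 Q assms W0 c_C by (intro mult_mono add_mono) auto
    also have "\<dots> = 3 * Q * V + 3 * Q * W" by simp
    finally show ?thesis .
  qed
  have t3: "q\<^sup>2 * (l / N * (D / (l * c))) \<le> 3 / 2 * (real n * (Q * W))"
  proof -
    have "q\<^sup>2 * (l / N * (D / (l * c))) = (q * l / N) * (q * (1 / c * W))"
      using c assms by (simp add: W_def field_simps power2_eq_square)
    also have "\<dots> \<le> 3 / 2 * (real n * (Q * W))"
      using ql ql0 Q assms W0 c by (intro mult_mono) auto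
    finally show ?thesis .
  qed
  have t4: "2 * (Q * W) \<le> real n * (Q * W)" using n2' Q W0 by (intro mult_right_mono) auto
  have t5: "real n * (Q * W) \<le> real n * (Q * (D * (1 / lmin)))" using Q Wl by (intro mult_left_mono) auto
  have pos: "0 \<le> Q * V * (1 / lmin)" "0 \<le> real n * (Q * (D * (1 / lmin)))" using Q assms by auto
  have "C / c * (1 + 1 / lmin) * (12 * real n * D + 9 * V) = 12 * (real n * (Q * D)) + 12 * (real n * (Q * (D * (1 / lmin)))) + 9 * (Q * V) + 9 * (Q * V * (1 / lmin))"
    unfolding Q_def by (simp add: algebra_simps add_divide_distrib)
  moreover have "q * (2 * (1 + C) * D) \<le> 4 * (real n * (Q * D))" using t1 by (simp add: mult_ac)
  moreover have "l / N * (2 * V + 2 * (D / (l * c))) * (q * C) \<le> 3 * (Q * V) + 3 * (Q * W)" using t2 by (simp add: mult_ac)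
  moreover have "3 * (x1 + x2 + x3) \<le> z"
    if "z = 12 * y1 + 12 * y5 + 9 * y2 + 9 * y6" "x1 \<le> 4 * y1" "x2 \<le> 3 * y2 + 3 * y3" "x3 \<le> 3 / 2 * y4" "2 * y3 \<le> y4" "y4 \<le> y5" "0 \<le> y5" "0 \<le> y6"
    for x1 x2 x3 y1 y2 y3 y4 y5 y6 z :: real
    using that unfolding distrib_left by linarith
  ultimately show ?thesis using t3 t4 t5 pos by blast
qed

text \<open>The fit is a fixed function here, and each of the three terms of
  \<open>discrepancy_eq\<close> is treated by orthogonality of centred data. The first and third are
  of order n times the squared distance to \<open>p\<close>; in the product term the sizes of the
  two samples cancel, which leaves a bounded contribution even when the fit is exact.\<close>

lemma nn_integral_discrepancy:
  assumes S: "S \<in> SS" and E: "E \<subseteq> {1..n}" and p: "p \<in> H_space f S" and \<alpha>[measurable]: "\<alpha> \<in> borel_measurable (leb S)"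
    and V: "expectation (\<lambda>x. (p (restrict x S))\<^sup>2 * iv S (restrict x S)) \<le> V" and lmin: "0 < lmin" "lmin \<le> lam S"
  shows "(\<integral>\<^sup>+\<omega>. ennreal ((discrepancy S E p \<alpha> (\<lambda>i. X i \<omega>) (\<lambda>j. Y S j \<omega>))\<^sup>2) \<partial>P)
    \<le> ennreal (C / c * (1 + 1 / lmin) * (12 * real n)) * (\<integral>\<^sup>+x. ennreal ((\<alpha> (restrict x S) - p (restrict x S))\<^sup>2) \<partial>law f)
      + ennreal (C / c * (1 + 1 / lmin) * (9 * V))"
\<comment> \<open>An infinite distance makes the right-hand side infinite; in the other case square
  integrability becomes available.\<close>
proof (cases "(\<integral>\<^sup>+x. ennreal ((\<alpha> (restrict x S) - p (restrict x S))\<^sup>2) \<partial>law f) = \<infinity>")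
  case True
  have "0 < C / c * (1 + 1 / lmin) * (12 * real n)" using c c_C lmin n2 by (intro mult_pos_pos add_pos_pos divide_pos_pos) auto
  moreover have "ennreal z * \<infinity> = \<infinity>" if "0 < z" for z using that by (simp add: ennreal_mult_top)
  ultimately have "ennreal (C / c * (1 + 1 / lmin) * (12 * real n)) * \<infinity> = \<infinity>" by blast
  then show ?thesis unfolding True by simp
next
  case False
  note [measurable] = H_spaceD(1)[OF p] rb_measurable[OF S] X_measurable
  define \<delta> where "\<delta> u = \<alpha> u - p u" for u
  define D where "D = expectation (\<lambda>x. (\<delta> (restrict x S))\<^sup>2)"
  define m where "m = expectation (\<lambda>x. \<delta> (restrict x S))"
  have [measurable]: "\<delta> \<in> borel_measurable (leb S)" unfolding \<delta>_def by measurable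
  have d2: "integrable (law f) (\<lambda>x. (\<delta> (restrict x S))\<^sup>2)"
    using False by (intro integrableI_nonneg) (auto simp: \<delta>_def less_top)
  have d1: "integrable (law f) (\<lambda>x. \<delta> (restrict x S))" by (rule integrable_of_square_integrable[OF _ d2]) measurable
  have nnD: "(\<integral>\<^sup>+x. ennreal ((\<alpha> (restrict x S) - p (restrict x S))\<^sup>2) \<partial>law f) = ennreal D"
    unfolding D_def using nn_integral_eq_integral[OF d2] by (simp add: \<delta>_def)
  have D0: "0 \<le> D" unfolding D_def by (intro Bochner_Integration.integral_nonneg) simp
  have mD: "m\<^sup>2 \<le> D"
    using variance_positive[of "\<lambda>x. \<delta> (restrict x S)"] variance_eq[OF d1 d2] by (simp add: m_def D_def)
  have E\<alpha>: "expectation (\<lambda>x. \<alpha> (restrict x S)) = m"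
  proof -
    have "expectation (\<lambda>x. \<delta> (restrict x S) + p (restrict x S)) = m" using d1 H_spaceD[OF p] by (simp add: m_def)
    then show ?thesis by (simp add: \<delta>_def)
  qed
  have div: "expectation (\<lambda>x. (\<delta> (restrict x S))\<^sup>2 * iv S (restrict x S)) \<le> D / (lam S * c)"
  proof -
    have "expectation (\<lambda>x. (\<delta> (restrict x S))\<^sup>2 * iv S (restrict x S)) \<le> expectation (\<lambda>x. (\<delta> (restrict x S))\<^sup>2 * (1 / (lam S * c)))"
    proof (rule integral_mono[OF integrable_iv[OF S d2]])
      show "(\<delta> (restrict x S))\<^sup>2 * iv S (restrict x S) \<le> (\<delta> (restrict x S))\<^sup>2 * (1 / (lam S * c))" for x
        by (rule mult_left_mono[OF iv_bounds(2)[OF S restrict_subspace]]) simp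
    qed (use d2 in simp)
    then show ?thesis by (simp add: D_def)
  qed
  have \<alpha>le: "(\<alpha> (restrict x S))\<^sup>2 \<le> 2 * (p (restrict x S))\<^sup>2 + 2 * (\<delta> (restrict x S))\<^sup>2" for x
    using square_sum2_le[of "p (restrict x S)" "\<delta> (restrict x S)"] by (simp add: \<delta>_def)
  have a2: "integrable (law f) (\<lambda>x. (\<alpha> (restrict x S))\<^sup>2)"
    by (rule integrable_nonneg_bound[OF _ _ _ \<alpha>le]) (use d2 H_spaceD(2)[OF p] in \<open>simp_all\<close>)
  have aiv: "expectation (\<lambda>x. (\<alpha> (restrict x S))\<^sup>2 * iv S (restrict x S)) \<le> 2 * V + 2 * (D / (lam S * c))"
  proof -
    note i = integrable_iv[OF S H_spaceD(2)[OF p]] integrable_iv[OF S d2]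
    have "expectation (\<lambda>x. (\<alpha> (restrict x S))\<^sup>2 * iv S (restrict x S)) \<le> expectation (\<lambda>x. 2 * ((p (restrict x S))\<^sup>2 * iv S (restrict x S)) + 2 * ((\<delta> (restrict x S))\<^sup>2 * iv S (restrict x S)))"
    proof (rule integral_mono)
      show "(\<alpha> (restrict x S))\<^sup>2 * iv S (restrict x S) \<le> 2 * ((p (restrict x S))\<^sup>2 * iv S (restrict x S)) + 2 * ((\<delta> (restrict x S))\<^sup>2 * iv S (restrict x S))" for x
        using mult_right_mono[OF \<alpha>le[of x] less_imp_le[OF iv_bounds(1)[OF S restrict_subspace, of x]]] by (simp add: algebra_simps)
    qed (use i integrable_iv[OF S a2] in auto)
    also have "\<dots> \<le> 2 * V + 2 * (D / (lam S * c))" using i V div by simp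
    finally show ?thesis .
  qed
  have rb2: "(rb S (restrict x S))\<^sup>2 \<le> C * rb S (restrict x S)" "\<bar>rb S (restrict x S)\<bar> \<le> C" for x
    using rbar_bounds[OF S restrict_subspace, of x] rb_pos[OF S restrict_subspace, of x]
    by (auto simp: power2_eq_square intro: mult_right_mono)
  \<comment> \<open>Centred because \<open>rb\<close> has mean 1 and \<delta> has mean
    \<open>m\<close>.\<close>
  define \<phi> where "\<phi> x = rb S (restrict x S) * m - \<delta> (restrict x S)" for x
  have \<phi>m[measurable]: "\<phi> \<in> borel_measurable (leb UNIV)" unfolding \<phi>_def by measurable
  have \<phi>0: "expectation \<phi> = 0" unfolding \<phi>_def[abs_def] using d1 integrable_rb[OF S] expectation_rb[OF S] by (simp add: m_def)
  have \<phi>le: "(\<phi> x)\<^sup>2 \<le> 2 * (C * m\<^sup>2 * rb S (restrict x S) + (\<delta> (restrict x S))\<^sup>2)" for x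
    using square_sum2_le[of "rb S (restrict x S) * m" "- \<delta> (restrict x S)"] mult_right_mono[OF rb2(1)[of x], of "m\<^sup>2"]
    by (simp add: \<phi>_def power_mult_distrib algebra_simps)
  have \<phi>i: "integrable (law f) (\<lambda>x. 2 * (C * m\<^sup>2 * rb S (restrict x S) + (\<delta> (restrict x S))\<^sup>2))" using d2 integrable_rb[OF S] by simp
  have \<phi>2: "integrable (law f) (\<lambda>x. (\<phi> x)\<^sup>2)"
    by (rule integrable_nonneg_bound[OF \<phi>i _ _ \<phi>le]) simp_all
  have \<phi>D: "expectation (\<lambda>x. (\<phi> x)\<^sup>2) \<le> 2 * (1 + C) * D"
  proof -
    have "expectation (\<lambda>x. (\<phi> x)\<^sup>2) \<le> expectation (\<lambda>x. 2 * (C * m\<^sup>2 * rb S (restrict x S) + (\<delta> (restrict x S))\<^sup>2))"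
      by (rule integral_mono[OF \<phi>2 \<phi>i \<phi>le])
    also have "\<dots> = 2 * (C * m\<^sup>2 + D)" using d2 integrable_rb[OF S] expectation_rb[OF S] by (simp add: D_def)
    also have "\<dots> \<le> 2 * (C * D + D)" using mD c_C by (intro mult_left_mono add_right_mono) auto
    finally show ?thesis by (simp add: algebra_simps)
  qed
  let ?q = "real (card E)" and ?\<psi> = "\<lambda>x. rb S (restrict x S) - 1"
  have \<psi>m: "?\<psi> \<in> borel_measurable (leb UNIV)" by measurable
  have T1: "(\<integral>\<^sup>+\<omega>. ennreal ((\<Sum>i\<in>E. \<phi> (X i \<omega>))\<^sup>2) \<partial>P) \<le> ennreal (?q * (2 * (1 + C) * D))"
    unfolding X_sum_square[OF E \<phi>m \<phi>2 \<phi>0] by (intro ennreal_leI mult_left_mono \<phi>D) simp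
  have W: "(\<integral>\<^sup>+\<omega>. ennreal ((\<Sum>i\<in>E. ?\<psi> (X i \<omega>))\<^sup>2) \<partial>P) \<le> ennreal (?q * C)"
  proof -
    have "\<bar>?\<psi> x\<bar> \<le> C + 1" for x using rb2(2)[of x] by linarith
    then have "integrable (law f) (\<lambda>x. (?\<psi> x)\<^sup>2)"
      by (intro integrable_bounded[of _ "(C + 1)\<^sup>2"]) (auto intro!: abs_le_imp_square_le)
    moreover have "expectation ?\<psi> = 0" using integrable_rb[OF S] expectation_rb[OF S] prob_space by simp
    ultimately have "(\<integral>\<^sup>+\<omega>. ennreal ((\<Sum>i\<in>E. ?\<psi> (X i \<omega>))\<^sup>2) \<partial>P) = ennreal (?q * expectation (\<lambda>x. (?\<psi> x)\<^sup>2))"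
      by (intro X_sum_square[OF E]) auto
    then show ?thesis using rb_second_moment[OF S] by (auto intro!: ennreal_leI mult_left_mono)
  qed
  have avgm: "(\<lambda>y. avg S g (\<lambda>j. y (Inr (S, j)))) \<in> borel_measurable (PiM (Inr ` (SIGMA S:SS. {1..ns S})) spaces)"
    if [measurable]: "g \<in> borel_measurable (leb S)" for g
  proof -
    have "(\<lambda>y. y (Inr (S, j))) \<in> PiM (Inr ` (SIGMA S:SS. {1..ns S})) spaces \<rightarrow>\<^sub>M leb S" if "j \<in> {1..ns S}" for j
      using measurable_component_singleton[of "Inr (S, j)" "Inr ` (SIGMA S:SS. {1..ns S})" spaces] that S by auto
    then show ?thesis by (intro measurable_avg[where g="\<lambda>_. g", OF S] measurable_compose[OF _ that]) auto
  qed
  have avgY: "(\<lambda>\<omega>. avg S g (\<lambda>j. Y S j \<omega>)) \<in> borel_measurable P" if [measurable]: "g \<in> borel_measurable (leb S)" for g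
    by (rule measurable_avg[where g="\<lambda>_. g", OF S Y_measurable[OF S] measurable_compose[OF Y_measurable[OF S] that]])
  \<comment> \<open>The factors are functions of disjoint groups of the data, so the second moment
    of the product is the product of the second moments.\<close>
  have T2: "(\<integral>\<^sup>+\<omega>. ennreal (((avg S \<alpha> (\<lambda>j. Y S j \<omega>) - m) * (\<Sum>i\<in>E. ?\<psi> (X i \<omega>)))\<^sup>2) \<partial>P)
      \<le> ennreal (lam S / real (ns S) * (2 * V + 2 * (D / (lam S * c))) * (?q * C))"
  proof -
    let ?A = "Inl ` E" and ?B = "Inr ` (SIGMA S:SS. {1..ns S})"
    have iv: "P.indep_var (PiM ?A spaces) (\<lambda>\<omega>. restrict (\<lambda>i. data i \<omega>) ?A) (PiM ?B spaces) (\<lambda>\<omega>. restrict (\<lambda>i. data i \<omega>) ?B)"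
      by (rule P.indep_var_restrict[OF indep]) (use E in auto)
    have xm: "(\<lambda>x. ennreal ((\<Sum>i\<in>E. ?\<psi> (x (Inl i)))\<^sup>2)) \<in> borel_measurable (PiM ?A spaces)"
    proof -
      have "(\<lambda>x. x (Inl i)) \<in> PiM ?A spaces \<rightarrow>\<^sub>M leb UNIV" if "i \<in> E" for i
        using measurable_component_singleton[of "Inl i" ?A spaces] that by auto
      then have "(\<lambda>x. ?\<psi> (x (Inl i))) \<in> borel_measurable (PiM ?A spaces)" if "i \<in> E" for i
        using measurable_compose[OF _ \<psi>m] that by blast
      then have "(\<lambda>x. (\<Sum>i\<in>E. ?\<psi> (x (Inl i)))\<^sup>2) \<in> borel_measurable (PiM ?A spaces)"
        by (intro borel_measurable_power borel_measurable_sum) blast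
      then show ?thesis by (rule measurable_compose[OF _ measurable_ennreal])
    qed
    have ym: "(\<lambda>y. ennreal ((avg S \<alpha> (\<lambda>j. y (Inr (S, j))) - m)\<^sup>2)) \<in> borel_measurable (PiM ?B spaces)"
      using avgm[OF \<alpha>] by measurable
    have "(\<integral>\<^sup>+\<omega>. ennreal (((avg S \<alpha> (\<lambda>j. Y S j \<omega>) - m) * (\<Sum>i\<in>E. ?\<psi> (X i \<omega>)))\<^sup>2) \<partial>P) =
      (\<integral>\<^sup>+\<omega>. ennreal ((\<Sum>i\<in>E. ?\<psi> (X i \<omega>))\<^sup>2) * ennreal ((avg S \<alpha> (\<lambda>j. Y S j \<omega>) - m)\<^sup>2) \<partial>P)"
      by (simp add: power_mult_distrib ennreal_mult mult.commute)
    also have "\<dots> = (\<integral>\<^sup>+\<omega>. ennreal ((\<Sum>i\<in>E. ?\<psi> (X i \<omega>))\<^sup>2) \<partial>P) * (\<integral>\<^sup>+\<omega>. ennreal ((avg S \<alpha> (\<lambda>j. Y S j \<omega>) - m)\<^sup>2) \<partial>P)"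
      using P.nn_integral_indep_mult[OF iv xm ym] S by (simp add: avg_def)
    also have "\<dots> \<le> ennreal (?q * C) * ennreal (lam S / real (ns S) * (2 * V + 2 * (D / (lam S * c))))"
    proof (rule mult_mono[OF W])
      have "(\<integral>\<^sup>+\<omega>. ennreal ((avg S \<alpha> (\<lambda>j. Y S j \<omega>) - m)\<^sup>2) \<partial>P) \<le> ennreal (lam S / real (ns S) * expectation (\<lambda>x. (\<alpha> (restrict x S))\<^sup>2 * iv S (restrict x S)))"
        using avg_second_moment[OF S \<alpha> a2] unfolding E\<alpha> .
      also have "\<dots> \<le> ennreal (lam S / real (ns S) * (2 * V + 2 * (D / (lam S * c))))"
        using aiv lam_pos[OF S] by (intro ennreal_leI mult_left_mono) auto
      finally show "(\<integral>\<^sup>+\<omega>. ennreal ((avg S \<alpha> (\<lambda>j. Y S j \<omega>) - m)\<^sup>2) \<partial>P) \<le> ennreal (lam S / real (ns S) * (2 * V + 2 * (D / (lam S * c))))" .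
    qed auto
    also have "\<dots> = ennreal (lam S / real (ns S) * (2 * V + 2 * (D / (lam S * c))) * (?q * C))"
      using c_C by (simp add: ennreal_mult'[symmetric] mult_ac)
    finally show ?thesis .
  qed
  have T3: "(\<integral>\<^sup>+\<omega>. ennreal ((?q * (avg S \<delta> (\<lambda>j. Y S j \<omega>) - m))\<^sup>2) \<partial>P) \<le> ennreal (?q\<^sup>2 * (lam S / real (ns S) * (D / (lam S * c))))"
  proof -
    have "(\<integral>\<^sup>+\<omega>. ennreal ((?q * (avg S \<delta> (\<lambda>j. Y S j \<omega>) - m))\<^sup>2) \<partial>P) = ennreal (?q\<^sup>2) * (\<integral>\<^sup>+\<omega>. ennreal ((avg S \<delta> (\<lambda>j. Y S j \<omega>) - m)\<^sup>2) \<partial>P)"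
      using avgY[of \<delta>] by (simp add: power_mult_distrib ennreal_mult nn_integral_cmult)
    also have "\<dots> \<le> ennreal (?q\<^sup>2) * ennreal (lam S / real (ns S) * expectation (\<lambda>x. (\<delta> (restrict x S))\<^sup>2 * iv S (restrict x S)))"
      unfolding m_def by (rule mult_left_mono[OF avg_second_moment[OF S _ d2]]) simp_all
    also have "\<dots> = ennreal (?q\<^sup>2 * (lam S / real (ns S) * expectation (\<lambda>x. (\<delta> (restrict x S))\<^sup>2 * iv S (restrict x S))))"
      by (rule ennreal_mult'[symmetric]) simp
    also have "\<dots> \<le> ennreal (?q\<^sup>2 * (lam S / real (ns S) * (D / (lam S * c))))"
      using div lam_pos[OF S] by (intro ennreal_leI mult_left_mono) auto
    finally show ?thesis .
  qed
  have V0: "0 \<le> V"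
    by (rule order.trans[OF Bochner_Integration.integral_nonneg V])
      (use iv_bounds(1)[OF S restrict_subspace] in \<open>simp add: less_imp_le\<close>)
  define t1 where "t1 \<omega> = (\<Sum>i\<in>E. \<phi> (X i \<omega>))" for \<omega>
  define t2 where "t2 \<omega> = (avg S \<alpha> (\<lambda>j. Y S j \<omega>) - m) * (\<Sum>i\<in>E. ?\<psi> (X i \<omega>))" for \<omega>
  define t3 where "t3 \<omega> = ?q * (avg S \<delta> (\<lambda>j. Y S j \<omega>) - m)" for \<omega>
  have XE: "X i \<in> P \<rightarrow>\<^sub>M leb UNIV" if "i \<in> E" for i using E that by (intro X_measurable) auto
  have tm[measurable]: "t1 \<in> borel_measurable P" "t2 \<in> borel_measurable P" "t3 \<in> borel_measurable P"
    unfolding t1_def[abs_def] t2_def[abs_def] t3_def[abs_def]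
    by (intro borel_measurable_sum borel_measurable_times borel_measurable_diff[OF avgY] measurable_compose[OF XE \<phi>m]
      measurable_compose[OF XE \<psi>m] borel_measurable_const \<alpha> \<open>\<delta> \<in> borel_measurable (leb S)\<close>; assumption)+
  have eq: "discrepancy S E p \<alpha> (\<lambda>i. X i \<omega>) (\<lambda>j. Y S j \<omega>) = t1 \<omega> + t2 \<omega> + t3 \<omega>" for \<omega>
    unfolding discrepancy_eq[where m=m] t1_def t2_def t3_def \<phi>_def \<delta>_def ..
  have "(\<integral>\<^sup>+\<omega>. ennreal ((discrepancy S E p \<alpha> (\<lambda>i. X i \<omega>) (\<lambda>j. Y S j \<omega>))\<^sup>2) \<partial>P)
     \<le> (\<integral>\<^sup>+\<omega>. ennreal 3 * (ennreal ((t1 \<omega>)\<^sup>2) + ennreal ((t2 \<omega>)\<^sup>2) + ennreal ((t3 \<omega>)\<^sup>2)) \<partial>P)"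
    unfolding eq using square_sum3_le
    by (intro nn_integral_mono) (simp add: ennreal_plus[symmetric] ennreal_mult'[symmetric] ennreal_leI del: ennreal_plus ennreal_numeral)
  also have "\<dots> = ennreal 3 * ((\<integral>\<^sup>+\<omega>. ennreal ((t1 \<omega>)\<^sup>2) \<partial>P) + (\<integral>\<^sup>+\<omega>. ennreal ((t2 \<omega>)\<^sup>2) \<partial>P) + (\<integral>\<^sup>+\<omega>. ennreal ((t3 \<omega>)\<^sup>2) \<partial>P))"
    by (simp add: nn_integral_cmult nn_integral_add)
  also have "\<dots> \<le> ennreal 3 * (ennreal (?q * (2 * (1 + C) * D)) + ennreal (lam S / real (ns S) * (2 * V + 2 * (D / (lam S * c))) * (?q * C)) + ennreal (?q\<^sup>2 * (lam S / real (ns S) * (D / (lam S * c)))))"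
    using T1 T2 T3 unfolding t1_def t2_def t3_def by (intro mult_left_mono add_mono) auto
  also have "\<dots> = ennreal (3 * (?q * (2 * (1 + C) * D) + lam S / real (ns S) * (2 * V + 2 * (D / (lam S * c))) * (?q * C) + ?q\<^sup>2 * (lam S / real (ns S) * (D / (lam S * c)))))"
  proof -
    have "ennreal 3 * (ennreal u + ennreal v + ennreal w) = ennreal (3 * (u + v + w))" if "0 \<le> u" "0 \<le> v" "0 \<le> w" for u v w
      using that by (simp add: ennreal_mult)
    then show ?thesis using D0 V0 c c_C lam_pos[OF S] by simp
  qed
  also have "\<dots> \<le> ennreal (C / c * (1 + 1 / lmin) * (12 * real n * D + 9 * V))"
    using card_mono[OF _ E] ns_bounds[OF S] lam_pos[OF S] D0 V0 lmin by (intro ennreal_leI discrepancy_arithmetic) auto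
  also have "\<dots> = ennreal (C / c * (1 + 1 / lmin) * (12 * real n)) * ennreal D + ennreal (C / c * (1 + 1 / lmin) * (9 * V))"
  proof -
    have "0 \<le> C / c * (1 + 1 / lmin)" using c c_C lmin by simp
    moreover have "ennreal (Q * (12 * real n * D + 9 * V)) = ennreal (Q * (12 * real n)) * ennreal D + ennreal (Q * (9 * V))" if "0 \<le> Q" for Q
      using that D0 V0 by (simp add: ennreal_mult[symmetric] ennreal_plus[symmetric] algebra_simps del: ennreal_plus)
    ultimately show ?thesis by blast
  qed
  finally show ?thesis unfolding nnD .
qed

end

section \<open>Halves, pieces and the decomposition of the estimator\<close>

lemma nat_ceiling_half: "nat \<lceil>real n / 2\<rceil> = (n + 1) div 2"
proof (cases "even n")
  case True
  then obtain m where "n = 2 * m" by (elim evenE)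
  then show ?thesis by simp
next
  case False
  then obtain m where m: "n = 2 * m + 1" by (elim oddE)
  have "\<lceil>real n / 2\<rceil> = int m + 1" unfolding m by (rule ceiling_unique) (simp_all add: field_simps)
  then show ?thesis using m by simp
qed

lemma half_disjoint: "half n 1 \<inter> half n 2 = {}" by (auto simp: half_def)

lemma half_union: "half n 1 \<union> half n 2 = {1..n}"
  by (auto simp: half_def nat_ceiling_half)

lemma half_subset: "half n l \<subseteq> {1..n}"
  by (auto simp: half_def nat_ceiling_half)

lemma card_half: "n \<le> 2 * card (half n l) + 1"
  unfolding half_def nat_ceiling_half by (simp; presburger)

text \<open>Let \<mu> be the size of the piece. As sizes differ by at most one, the half has at most
  \<mu> + (M - 1) (\<mu> + 1) elements, and n is at most twice the half plus 1. An empty piece would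
  force n \<le> 2 M - 1; for \<mu> \<ge> 1 the bound on n is at most 4 M \<mu>.\<close>

lemma balanced_split_pieces:
  assumes I: "balanced_split n M I" and n: "2 * M \<le> n" and l: "l \<in> {1, 2}" and m: "m \<in> {1..M}"
  shows "finite (I l m)" "I l m \<noteq> {}" "n \<le> 4 * M * card (I l m)"
proof -
  have U: "(\<Union>m\<in>{1..M}. I l m) = half n l" and dis: "disjoint_family_on (I l) {1..M}"
    and bal: "\<And>m'. m' \<in> {1..M} \<Longrightarrow> card (I l m') \<le> card (I l m) + 1"
    using I l m unfolding balanced_split_def by blast+
  have fin: "finite (I l m')" if "m' \<in> {1..M}" for m'
    by (rule finite_subset[OF _ finite_subset[OF half_subset[of n l]]]) (use U that in auto)
  then show "finite (I l m)" using m by blast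
  have "card (half n l) = (\<Sum>m'\<in>{1..M}. card (I l m'))"
    unfolding U[symmetric] using dis fin by (subst card_UN_disjoint) (auto simp: disjoint_family_on_def)
  also have "\<dots> = card (I l m) + (\<Sum>m'\<in>{1..M} - {m}. card (I l m'))" using m by (simp add: sum.remove)
  also have "(\<Sum>m'\<in>{1..M} - {m}. card (I l m')) \<le> (\<Sum>m'\<in>{1..M} - {m}. card (I l m) + 1)"
    by (intro sum_mono bal) auto
  also have "\<dots> = (M - 1) * (card (I l m) + 1)" using m by simp
  finally have le: "card (half n l) \<le> card (I l m) + (M - 1) * (card (I l m) + 1)" by simp
  obtain M' where M': "M = Suc M'" using m by (cases M) auto
  have n1: "n \<le> 2 * card (half n l) + 1" by (rule card_half)
  have pos: "0 < card (I l m)"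
  proof (rule ccontr)
    assume "\<not> 0 < card (I l m)"
    then have "card (half n l) \<le> M'" using le M' by simp
    then show False using n1 n M' by simp
  qed
  then show "I l m \<noteq> {}" by auto
  define \<mu> where "\<mu> = card (I l m)"
  obtain \<mu>' where \<mu>': "\<mu> = Suc \<mu>'" using pos by (cases \<mu>) (auto simp: \<mu>_def)
  have "card (half n l) \<le> Suc \<mu>' + M' * (\<mu>' + 2)" using le M' \<mu>' by (simp add: \<mu>_def)
  then have "n \<le> 4 * Suc M' * Suc \<mu>'" using n1 by (simp add: algebra_simps)
  then show "n \<le> 4 * M * card (I l m)" using M' \<mu>' by (simp add: \<mu>_def)
qed

locale cross_fit_estimator = cross_fit f a SS r lam k \<beta> L1 L2 L3 c C na n ns P X Y
  for f a :: "('d::finite \<Rightarrow> real) \<Rightarrow> real" and SS r lam k \<beta> L1 L2 L3 c C na n ns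
    and P :: "'w measure" and X Y +
  fixes M :: nat and h T :: real and I :: "nat \<Rightarrow> nat \<Rightarrow> nat set"
  assumes d2: "2 \<le> CARD('d)" and M: "1 \<le> M" "2 * M \<le> n" and h: "0 < h" "h \<le> 1" and T: "1 \<le> T"
    and I: "balanced_split n M I"
begin

definition fit :: "(nat \<Rightarrow> 'd \<Rightarrow> real) \<Rightarrow> nat \<Rightarrow> 'd set \<Rightarrow> ('d \<Rightarrow> real) \<Rightarrow> real" where
  "fit x l = alpha_hat SS a r lam h T x (I l) M"

abbreviation theta :: "(nat \<Rightarrow> 'd \<Rightarrow> real) \<Rightarrow> ('d set \<Rightarrow> nat \<Rightarrow> 'd \<Rightarrow> real) \<Rightarrow> real" where
  "theta \<equiv> theta_hat SS a r lam n ns M h T I"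

text \<open>\<open>R S\<close> cancels between the estimated normalisation and \<open>r S\<close>.
  Adding and subtracting \<open>p\<close> then makes the discrepancies an exact difference; the
  identity holds for all functions and all data.\<close>

lemma theta_half_eq:
  fixes \<alpha> p :: "'d set \<Rightarrow> ('d \<Rightarrow> real) \<Rightarrow> real"
  assumes E: "finite E" "E \<noteq> {}"
  shows "real (card E) * ((\<Sum>i\<in>E. a (x i) - (\<Sum>S\<in>SS. \<alpha> S (restrict (x i) S))) / card E +
      (\<Sum>S\<in>SS. (\<Sum>j\<in>{1..ns S}. \<alpha> S (y S j) * r_hat r x E S / r S (y S j)) / ns S)) =
    (\<Sum>i\<in>E. centred p (x i) + expectation a) + real (card E) * (\<Sum>S\<in>SS. avg S (p S) (y S))
      + (\<Sum>S\<in>SS. discrepancy S E (p S) (\<alpha> S) x (y S))"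
proof -
  have q: "real (card E) \<noteq> 0" using E by simp
  have s: "real (card E) * ((\<Sum>j\<in>{1..ns S}. \<alpha> S (y S j) * r_hat r x E S / r S (y S j)) / ns S) =
    (\<Sum>i\<in>E. rb S (restrict (x i) S)) * avg S (\<alpha> S) (y S)" if S: "S \<in> SS" for S
  proof -
    have R0: "R S \<noteq> 0" using R_pos[OF S] by simp
    have rh: "r_hat r x E S = R S * ((\<Sum>i\<in>E. rb S (restrict (x i) S)) / card E)"
      unfolding r_hat_def r_eq[OF S] by (simp add: sum_distrib_left)
    have "(\<Sum>j\<in>{1..ns S}. \<alpha> S (y S j) * r_hat r x E S / r S (y S j)) =
      (\<Sum>j\<in>{1..ns S}. (\<alpha> S (y S j) / rb S (y S j)) * ((\<Sum>i\<in>E. rb S (restrict (x i) S)) / card E))"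
      unfolding rh r_eq[OF S] using R0 by (intro sum.cong refl) simp
    also have "\<dots> = (\<Sum>j\<in>{1..ns S}. \<alpha> S (y S j) / rb S (y S j)) * ((\<Sum>i\<in>E. rb S (restrict (x i) S)) / card E)"
      by (rule sum_distrib_right[symmetric])
    finally show ?thesis unfolding avg_def using q by simp
  qed
  have d: "discrepancy S E (p S) (\<alpha> S) x (y S) = (\<Sum>i\<in>E. rb S (restrict (x i) S)) * avg S (\<alpha> S) (y S)
      - real (card E) * avg S (p S) (y S) - (\<Sum>i\<in>E. \<alpha> S (restrict (x i) S)) + (\<Sum>i\<in>E. p S (restrict (x i) S))" for S
    unfolding discrepancy_def by (simp add: sum_subtractf sum_distrib_right)
  have c1: "(\<Sum>i\<in>E. centred p (x i) + expectation a) = (\<Sum>i\<in>E. a (x i)) - (\<Sum>S\<in>SS. \<Sum>i\<in>E. p S (restrict (x i) S))"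
    by (simp add: centred_def sum_subtractf sum.swap[of _ SS])
  have c2: "(\<Sum>i\<in>E. a (x i) - (\<Sum>S\<in>SS. \<alpha> S (restrict (x i) S))) = (\<Sum>i\<in>E. a (x i)) - (\<Sum>S\<in>SS. \<Sum>i\<in>E. \<alpha> S (restrict (x i) S))"
    by (simp add: sum_subtractf sum.swap[of _ SS])
  have "real (card E) * (\<Sum>S\<in>SS. (\<Sum>j\<in>{1..ns S}. \<alpha> S (y S j) * r_hat r x E S / r S (y S j)) / ns S) =
    (\<Sum>S\<in>SS. (\<Sum>i\<in>E. rb S (restrict (x i) S)) * avg S (\<alpha> S) (y S))"
    unfolding sum_distrib_left by (rule sum.cong[OF refl s])
  then show ?thesis unfolding distrib_left d c1 c2 using q
    by (simp add: sum_subtractf sum.distrib sum_distrib_left)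
qed

lemma half_nonempty: "half n l \<noteq> {}" "finite (half n l)"
  using card_half[of n l] n2 finite_subset[OF half_subset[of n l]] by auto

text \<open>n times the centred estimator that would use \<open>pop M\<close> in both halves and the
  true normalisation of \<open>r\<close>.\<close>

definition ideal_sum :: "(nat \<Rightarrow> 'd \<Rightarrow> real) \<Rightarrow> ('d set \<Rightarrow> nat \<Rightarrow> 'd \<Rightarrow> real) \<Rightarrow> real" where
  "ideal_sum x y = (\<Sum>i\<in>{1..n}. centred (pop M) (x i)) + real n * (\<Sum>S\<in>SS. avg S (pop M S) (y S))"

definition remainder :: "(nat \<Rightarrow> 'd \<Rightarrow> real) \<Rightarrow> ('d set \<Rightarrow> nat \<Rightarrow> 'd \<Rightarrow> real) \<Rightarrow> real" where
  "remainder x y = (\<Sum>l\<in>{1, 2}. \<Sum>S\<in>SS. discrepancy S (half n (3 - l)) (pop M S) (fit x l S) x (y S))"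

lemma theta_eq: "real n * (theta x y - expectation a) = ideal_sum x y + remainder x y"
proof -
  have t: "real (card (half n (3 - l))) * theta_half SS a r lam n ns M h T I x y l =
    (\<Sum>i\<in>half n (3 - l). centred (pop M) (x i) + expectation a) + real (card (half n (3 - l))) * (\<Sum>S\<in>SS. avg S (pop M S) (y S))
      + (\<Sum>S\<in>SS. discrepancy S (half n (3 - l)) (pop M S) (fit x l S) x (y S))" for l
    unfolding theta_half_def Let_def fit_def by (rule theta_half_eq[OF half_nonempty(2,1)])
  have s: "sum g {1..n} = sum g (half n 1) + sum g (half n 2)" for g :: "nat \<Rightarrow> real"
    unfolding half_union[symmetric] using half_disjoint half_nonempty(2) by (intro sum.union_disjoint) auto
  have cn: "real n = real (card (half n 1)) + real (card (half n 2))" using s[of "\<lambda>_. 1"] by simp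
  have "real n * (theta x y - expectation a) = real n * theta x y - real n * expectation a" by (simp add: right_diff_distrib)
  also have "real n * theta x y = real (card (half n 2)) * theta_half SS a r lam n ns M h T I x y 1
      + real (card (half n 1)) * theta_half SS a r lam n ns M h T I x y 2"
    using n2 by (simp add: theta_hat_def)
  also have "\<dots> - real n * expectation a = ideal_sum x y + remainder x y"
    using t[of 1] t[of 2] unfolding ideal_sum_def remainder_def s cn by (simp add: sum.distrib algebra_simps)
  finally show ?thesis .
qed

lemma variance_a: "variance a \<le> na\<^sup>2"
proof -
  have "integrable (law f) (\<lambda>x. (a x)\<^sup>2)"
    by (rule integrable_bounded[of _ "na\<^sup>2"]) (use a_bound abs_le_imp_square_le in auto)
  then have "variance a \<le> expectation (\<lambda>x. (a x)\<^sup>2)" using variance_eq[OF integrable_a] by simp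
  also have "\<dots> \<le> expectation (\<lambda>x. na\<^sup>2)"
    using \<open>integrable (law f) (\<lambda>x. (a x)\<^sup>2)\<close> a_bound abs_le_imp_square_le by (intro integral_mono) auto
  also have "\<dots> = na\<^sup>2" using prob_space by simp
  finally show ?thesis .
qed

lemma obj_pop_le_na: "obj (pop M) \<le> na\<^sup>2" using obj_pop_le[of M] variance_a by linarith

lemma obj_pop: "obj (pop M) = expectation (\<lambda>x. (centred (pop M) x)\<^sup>2) + (\<Sum>S\<in>SS. expectation (\<lambda>x. (pop M S (restrict x S))\<^sup>2 * iv S (restrict x S)))"
  by (rule obj_eq) (rule pop_H_space)

lemma pop_iv_nonneg: "S \<in> SS \<Longrightarrow> 0 \<le> expectation (\<lambda>x. (pop M S (restrict x S))\<^sup>2 * iv S (restrict x S))"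
  using iv_bounds(1)[OF _ restrict_subspace] by (intro Bochner_Integration.integral_nonneg) (simp add: less_imp_le)

text \<open>A penalty term is part of the objective, which never rises above its initial value, the
  variance of \<open>a\<close>.\<close>

lemma pop_iv_le: assumes S: "S \<in> SS" shows "expectation (\<lambda>x. (pop M S (restrict x S))\<^sup>2 * iv S (restrict x S)) \<le> na\<^sup>2"
proof -
  have "expectation (\<lambda>x. (pop M S (restrict x S))\<^sup>2 * iv S (restrict x S)) \<le> (\<Sum>S\<in>SS. expectation (\<lambda>x. (pop M S (restrict x S))\<^sup>2 * iv S (restrict x S)))"
    by (rule member_le_sum[OF S]) (auto intro: pop_iv_nonneg)
  also have "\<dots> \<le> obj (pop M)" unfolding obj_pop by simp
  finally show ?thesis using obj_pop_le_na by linarith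
qed

text \<open>The terms are independent and centred, and their second moments add up to n times the
  objective at \<open>pop M\<close>, except that each penalty term carries n lam / ns instead of 1.
  That ratio is within 1 / n of 1.\<close>

lemma expectation_ideal_square:
  shows "integrable P (\<lambda>\<omega>. (ideal_sum (\<lambda>i. X i \<omega>) (\<lambda>S j. Y S j \<omega>))\<^sup>2)"
    and "\<bar>P.expectation (\<lambda>\<omega>. (ideal_sum (\<lambda>i. X i \<omega>) (\<lambda>S j. Y S j \<omega>))\<^sup>2) / real n - obj (pop M)\<bar> \<le> obj (pop M) / real n"
proof -
  let ?g = "\<lambda>S u. real n / real (ns S) * (pop M S u / rb S u)"
  define \<psi> :: "nat + 'd set \<times> nat \<Rightarrow> ('d \<Rightarrow> real) \<Rightarrow> real" where "\<psi> = case_sum (\<lambda>_. centred (pop M)) (\<lambda>(S, j). ?g S)"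
  note H = pop_H_space[where m=M]
  have cs: "integrable (law f) (\<lambda>x. (centred (pop M) x)\<^sup>2)" "centred (pop M) \<in> borel_measurable (leb UNIV)"
    by (rule centred_square_integrable, rule pop_H_space, assumption)+
  have gm: "?g S \<in> borel_measurable (leb S)" if "S \<in> SS" for S
    using that by (intro borel_measurable_times borel_measurable_divide borel_measurable_const pop_measurable rb_measurable)
  have c0: "expectation (centred (pop M)) = 0"
    unfolding centred_def[abs_def] using integrable_a H_spaceD[OF H] prob_space by (simp add: Bochner_Integration.integral_sum)
  have g2: "integrable (obs S) (\<lambda>u. (?g S u)\<^sup>2)" "(\<integral>u. (?g S u)\<^sup>2 \<partial>obs S) = (real n)\<^sup>2 * lam S / (real (ns S))\<^sup>2 * expectation (\<lambda>x. (pop M S (restrict x S))\<^sup>2 * iv S (restrict x S))"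
    and g1: "integral\<^sup>L (obs S) (?g S) = 0" if S: "S \<in> SS" for S
  proof -
    have nz: "rb S (restrict x S) \<noteq> 0 \<and> lam S \<noteq> 0" for x using rb_pos[OF S restrict_subspace, of x] lam_pos[OF S] by auto
    have e: "rb S (restrict x S) * (?g S (restrict x S))\<^sup>2 = (real n)\<^sup>2 * lam S / (real (ns S))\<^sup>2 * ((pop M S (restrict x S))\<^sup>2 * iv S (restrict x S))" for x
      using nz[of x] by (simp add: iv_def power_divide power_mult_distrib power2_eq_square)
    have e1: "rb S (restrict x S) * ?g S (restrict x S) = real n / real (ns S) * pop M S (restrict x S)" for x
      using nz[of x] by simp
    have m2: "(\<lambda>u. (?g S u)\<^sup>2) \<in> borel_measurable (leb S)" by (intro borel_measurable_power gm S)
    have i: "integrable (law f) (\<lambda>x. (real n)\<^sup>2 * lam S / (real (ns S))\<^sup>2 * ((pop M S (restrict x S))\<^sup>2 * iv S (restrict x S)))"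
      by (intro integrable_mult_right integrable_iv[OF S] H_spaceD(2)[OF H[OF S]])
    show "integrable (obs S) (\<lambda>u. (?g S u)\<^sup>2)" unfolding integral_obs(1)[OF S m2] e by (rule i)
    show "(\<integral>u. (?g S u)\<^sup>2 \<partial>obs S) = (real n)\<^sup>2 * lam S / (real (ns S))\<^sup>2 * expectation (\<lambda>x. (pop M S (restrict x S))\<^sup>2 * iv S (restrict x S))"
      unfolding integral_obs(2)[OF S m2] e by (rule integral_mult_right_zero)
    show "integral\<^sup>L (obs S) (?g S) = 0"
      unfolding integral_obs(2)[OF S gm[OF S]] e1 using H_spaceD(4)[OF H[OF S]] by (simp only: integral_mult_right_zero mult_zero_right)
  qed
  have \<psi>m: "\<psi> i \<in> borel_measurable (spaces i)" if "i \<in> Idx" for i using that cs(2) gm by (auto simp: \<psi>_def)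
  have \<psi>i: "integrable (laws i) (\<lambda>x. (\<psi> i x)\<^sup>2)" if "i \<in> Idx" for i using that cs(1) g2(1) by (auto simp: \<psi>_def)
  have \<psi>0: "integral\<^sup>L (laws i) (\<psi> i) = 0" if "i \<in> Idx" for i using that c0 g1 by (auto simp: \<psi>_def)
  note main = expectation_sum_square_data[OF order.refl \<psi>m \<psi>i \<psi>0]
  have o: "(\<Sum>i\<in>Idx. \<psi> i (data i \<omega>)) = ideal_sum (\<lambda>i. X i \<omega>) (\<lambda>S j. Y S j \<omega>)" for \<omega>
  proof -
    have "(\<Sum>i\<in>Idx. \<psi> i (data i \<omega>)) = (\<Sum>i\<in>{1..n}. centred (pop M) (X i \<omega>)) + (\<Sum>S\<in>SS. \<Sum>j\<in>{1..ns S}. ?g S (Y S j \<omega>))"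
      by (subst sum.Plus) (auto simp: \<psi>_def sum.Sigma split_beta')
    also have "(\<Sum>S\<in>SS. \<Sum>j\<in>{1..ns S}. ?g S (Y S j \<omega>)) = real n * (\<Sum>S\<in>SS. avg S (pop M S) (\<lambda>j. Y S j \<omega>))"
      by (simp add: avg_def sum_distrib_left sum_divide_distrib mult.commute)
    finally show ?thesis by (simp add: ideal_sum_def)
  qed
  show "integrable P (\<lambda>\<omega>. (ideal_sum (\<lambda>i. X i \<omega>) (\<lambda>S j. Y S j \<omega>))\<^sup>2)" using main(1) unfolding o .
  have nn: "0 < real n" using n2 by simp
  let ?v = "\<lambda>S. expectation (\<lambda>x. (pop M S (restrict x S))\<^sup>2 * iv S (restrict x S))"
  have "P.expectation (\<lambda>\<omega>. (ideal_sum (\<lambda>i. X i \<omega>) (\<lambda>S j. Y S j \<omega>))\<^sup>2) = (\<Sum>i\<in>Idx. \<integral>x. (\<psi> i x)\<^sup>2 \<partial>laws i)"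
    using main(2) unfolding o .
  also have "\<dots> = real n * expectation (\<lambda>x. (centred (pop M) x)\<^sup>2) + (\<Sum>S\<in>SS. \<Sum>j\<in>{1..ns S}. \<integral>u. (?g S u)\<^sup>2 \<partial>obs S)"
  proof -
    have pl: "(\<Sum>i\<in>Idx. F i) = (\<Sum>i\<in>{1..n}. F (Inl i)) + (\<Sum>i\<in>(SIGMA S:SS. {1..ns S}). F (Inr i))" for F :: "_ \<Rightarrow> real"
      by (subst sum.Plus) (auto simp: comp_def)
    have "(\<Sum>i\<in>{1..n}. \<integral>x. (\<psi> (Inl i) x)\<^sup>2 \<partial>laws (Inl i)) = real n * expectation (\<lambda>x. (centred (pop M) x)\<^sup>2)"
      by (simp add: \<psi>_def)
    moreover have "(\<Sum>i\<in>(SIGMA S:SS. {1..ns S}). \<integral>x. (\<psi> (Inr i) x)\<^sup>2 \<partial>laws (Inr i)) = (\<Sum>S\<in>SS. \<Sum>j\<in>{1..ns S}. \<integral>u. (?g S u)\<^sup>2 \<partial>obs S)"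
      by (simp add: \<psi>_def sum.Sigma split_beta' del: sum_constant)
    ultimately show ?thesis unfolding pl by (simp only:)
  qed
  also have "(\<Sum>S\<in>SS. \<Sum>j\<in>{1..ns S}. \<integral>u. (?g S u)\<^sup>2 \<partial>obs S) = (\<Sum>S\<in>SS. real n * (real n * lam S / real (ns S) * ?v S))"
  proof (rule sum.cong[OF refl])
    fix S assume S: "S \<in> SS"
    show "(\<Sum>j\<in>{1..ns S}. \<integral>u. (?g S u)\<^sup>2 \<partial>obs S) = real n * (real n * lam S / real (ns S) * ?v S)"
      unfolding g2(2)[OF S] using ns_bounds(2)[OF S] by (simp add: power2_eq_square)
  qed
  also have "\<dots> = real n * (\<Sum>S\<in>SS. real n * lam S / real (ns S) * ?v S)" by (rule sum_distrib_left[symmetric])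
  finally have "P.expectation (\<lambda>\<omega>. (ideal_sum (\<lambda>i. X i \<omega>) (\<lambda>S j. Y S j \<omega>))\<^sup>2) / real n - obj (pop M)
      = (\<Sum>S\<in>SS. real n * lam S / real (ns S) * ?v S) - (\<Sum>S\<in>SS. ?v S)"
    unfolding obj_pop using nn by (simp add: field_simps)
  also have "\<dots> = (\<Sum>S\<in>SS. (real n * lam S / real (ns S) - 1) * ?v S)" by (simp only: left_diff_distrib sum_subtractf mult_1)
  finally have eq: "P.expectation (\<lambda>\<omega>. (ideal_sum (\<lambda>i. X i \<omega>) (\<lambda>S j. Y S j \<omega>))\<^sup>2) / real n - obj (pop M)
      = (\<Sum>S\<in>SS. (real n * lam S / real (ns S) - 1) * ?v S)" .
  have "\<bar>\<Sum>S\<in>SS. (real n * lam S / real (ns S) - 1) * ?v S\<bar> \<le> (\<Sum>S\<in>SS. 1 / real n * ?v S)"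
  proof (rule order.trans[OF sum_abs sum_mono])
    fix S assume S: "S \<in> SS"
    show "\<bar>(real n * lam S / real (ns S) - 1) * ?v S\<bar> \<le> 1 / real n * ?v S"
      unfolding abs_mult abs_of_nonneg[OF pop_iv_nonneg[OF S]] using ns[OF S] by (intro mult_right_mono pop_iv_nonneg[OF S]) simp
  qed
  also have "\<dots> = 1 / real n * (\<Sum>S\<in>SS. ?v S)" by (rule sum_distrib_left[symmetric])
  also have "\<dots> \<le> 1 / real n * obj (pop M)" unfolding obj_pop by (intro mult_left_mono) auto
  finally show "\<bar>P.expectation (\<lambda>\<omega>. (ideal_sum (\<lambda>i. X i \<omega>) (\<lambda>S j. Y S j \<omega>))\<^sup>2) / real n - obj (pop M)\<bar> \<le> obj (pop M) / real n"
    unfolding eq by simp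
qed

text \<open>The joint family is dependently typed over a sum index; grouping into singletons and
  reading off their only coordinate changes the index type.\<close>

lemma indep_X: assumes "E \<subseteq> {1..n}" shows "P.indep_vars (\<lambda>_. leb UNIV) X E"
proof -
  have "P.indep_vars (\<lambda>i. PiM {Inl i} spaces) (\<lambda>i \<omega>. restrict (\<lambda>j. data j \<omega>) {Inl i}) E"
    by (rule P.indep_vars_restrict[OF indep]) (use assms in \<open>auto simp: disjoint_family_on_def\<close>)
  then have "P.indep_vars (\<lambda>_. leb UNIV) (\<lambda>i \<omega>. restrict (\<lambda>j. data j \<omega>) {Inl i} (Inl i)) E"
  proof (rule P.indep_vars_compose2)
    show "(\<lambda>x. x (Inl i)) \<in> PiM {Inl i} spaces \<rightarrow>\<^sub>M leb UNIV" for i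
      using measurable_component_singleton[of "Inl i" "{Inl i}" spaces] by simp
  qed
  then show ?thesis by simp
qed

lemma pieces: assumes "l \<in> {1, 2}" shows "(\<Union>m\<in>{1..M}. I l m) = half n l" "disjoint_family_on (I l) {1..M}"
  using I assms by (auto simp: balanced_split_def)

lemma fit_cong: "l \<in> {1, 2} \<Longrightarrow> (\<And>i. i \<in> half n l \<Longrightarrow> x i = x' i) \<Longrightarrow> fit x l = fit x' l"
  unfolding fit_def pieces(1)[symmetric] by (rule alpha_hat_cong) blast

lemma measurable_fit:
  assumes "l \<in> {1, 2}" "\<And>i. i \<in> half n l \<Longrightarrow> x i \<in> N \<rightarrow>\<^sub>M leb UNIV" "S \<in> SS" "u \<in> N \<rightarrow>\<^sub>M leb S"
  shows "(\<lambda>\<omega>. fit (\<lambda>i. x i \<omega>) l S (u \<omega>)) \<in> borel_measurable N"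
  unfolding fit_def by (rule measurable_alpha_hat[OF _ assms(3,4)]) (rule assms(2), use pieces(1)[OF assms(1)] in blast)

text \<open>The fit depends on half \<open>l\<close> alone, and the discrepancy reads only the other
  half and the incomplete samples; freezing the fit reduces the claim to a fixed function.\<close>

lemma nn_integral_fit_discrepancy:
  assumes l: "l \<in> {1, 2}" and S: "S \<in> SS" and lmin: "0 < lmin" "lmin \<le> lam S"
  shows "(\<integral>\<^sup>+\<omega>. ennreal ((discrepancy S (half n (3 - l)) (pop M S) (fit (\<lambda>i. X i \<omega>) l S) (\<lambda>i. X i \<omega>) (\<lambda>j. Y S j \<omega>))\<^sup>2) \<partial>P)
    \<le> ennreal (C / c * (1 + 1 / lmin) * (12 * real n)) * est_error P X h T (I l) M S + ennreal (C / c * (1 + 1 / lmin) * (9 * na\<^sup>2))"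
proof -
  let ?E = "half n (3 - l)"
  define A where "A = (Inl ` half n l :: (nat + 'd set \<times> nat) set)"
  define B where "B = Inl ` ?E \<union> Inr ` (SIGMA S:SS. {1..ns S})"
  have AI: "A \<subseteq> Idx" and BI: "B \<subseteq> Idx" using half_subset[of n] by (auto simp: A_def B_def)
  have "half n l \<inter> ?E = {}" using l half_disjoint[of n] by auto
  then have dis: "A \<inter> B = {}" unfolding A_def B_def by blast
  define U where "U \<omega> = restrict (\<lambda>i. data i \<omega>) A" for \<omega>
  define V where "V \<omega> = restrict (\<lambda>i. data i \<omega>) B" for \<omega>
  have UV: "P.indep_var (PiM A spaces) U (PiM B spaces) V"
    unfolding U_def[abs_def] V_def[abs_def] by (rule P.indep_var_restrict[OF indep dis AI BI])
  define \<Phi> where "\<Phi> u v = ennreal ((discrepancy S ?E (pop M S) (fit (\<lambda>i. u (Inl i)) l S) (\<lambda>i. v (Inl i)) (\<lambda>j. v (Inr (S, j))))\<^sup>2)"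
    for u v :: "nat + 'd set \<times> nat \<Rightarrow> 'd \<Rightarrow> real"
  have \<Phi>m: "case_prod \<Phi> \<in> borel_measurable (PiM A spaces \<Otimes>\<^sub>M PiM B spaces)"
  proof -
    let ?B = "PiM A spaces \<Otimes>\<^sub>M PiM B spaces"
    have xu: "(\<lambda>p. fst p (Inl i)) \<in> ?B \<rightarrow>\<^sub>M leb UNIV" if "i \<in> half n l" for i
      using measurable_compose[OF measurable_fst measurable_component_singleton[of "Inl i" A spaces]] that by (auto simp: A_def)
    have xv: "(\<lambda>p. snd p (Inl i)) \<in> ?B \<rightarrow>\<^sub>M leb UNIV" if "i \<in> ?E" for i
      using measurable_compose[OF measurable_snd measurable_component_singleton[of "Inl i" B spaces]] that by (auto simp: B_def)
    have yv: "(\<lambda>p. snd p (Inr (S, j))) \<in> ?B \<rightarrow>\<^sub>M leb S" if "j \<in> {1..ns S}" for j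
      using measurable_compose[OF measurable_snd measurable_component_singleton[of "Inr (S, j)" B spaces]] that S by (auto simp: B_def)
    have "(\<lambda>p. discrepancy S ?E (pop M S) (fit (\<lambda>i. fst p (Inl i)) l S) (\<lambda>i. snd p (Inl i)) (\<lambda>j. snd p (Inr (S, j)))) \<in> borel_measurable ?B"
      by (rule measurable_discrepancy[where x="\<lambda>i p. snd p (Inl i)" and y="\<lambda>j p. snd p (Inr (S, j))" and \<alpha>="\<lambda>p. fit (\<lambda>i. fst p (Inl i)) l S",
          OF S xv yv pop_measurable[OF S] measurable_fit[where x="\<lambda>i p. fst p (Inl i)", OF l xu S]])
    then show ?thesis unfolding \<Phi>_def[abs_def] split_beta' by (intro measurable_compose[OF _ measurable_ennreal] borel_measurable_power)
  qed
  have Ua: "fit (\<lambda>i. U \<omega> (Inl i)) l = fit (\<lambda>i. X i \<omega>) l" for \<omega>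
    by (rule fit_cong[OF l]) (simp add: U_def A_def)
  have Va: "discrepancy S ?E (pop M S) \<alpha> (\<lambda>i. V \<omega> (Inl i)) (\<lambda>j. V \<omega> (Inr (S, j))) = discrepancy S ?E (pop M S) \<alpha> (\<lambda>i. X i \<omega>) (\<lambda>j. Y S j \<omega>)" for \<omega> \<alpha>
    unfolding discrepancy_def avg_def using S by (simp add: V_def B_def)
  let ?k = "ennreal (C / c * (1 + 1 / lmin) * (12 * real n))"
  let ?e = "\<lambda>\<omega>. \<integral>\<^sup>+x. ennreal ((alpha_hat SS a r lam h T (\<lambda>i. X i \<omega>) (I l) M S (restrict x S) - pop M S (restrict x S))\<^sup>2) \<partial>law f"
  have Xm: "X i \<in> P \<rightarrow>\<^sub>M leb UNIV" if "m \<in> {1..M}" "i \<in> I l m" for m i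
    using pieces(1)[OF l] half_subset[of n l] that by (intro X_measurable) blast
  have "(\<integral>\<^sup>+\<omega>. ennreal ((discrepancy S ?E (pop M S) (fit (\<lambda>i. X i \<omega>) l S) (\<lambda>i. X i \<omega>) (\<lambda>j. Y S j \<omega>))\<^sup>2) \<partial>P) = (\<integral>\<^sup>+\<omega>. \<Phi> (U \<omega>) (V \<omega>) \<partial>P)"
    unfolding \<Phi>_def Ua Va ..
  also have "\<dots> = (\<integral>\<^sup>+\<omega>. \<integral>\<^sup>+\<omega>'. \<Phi> (U \<omega>) (V \<omega>') \<partial>P \<partial>P)"
    by (rule P.nn_integral_indep_var[OF UV \<Phi>m])
  also have "\<dots> \<le> (\<integral>\<^sup>+\<omega>. ?k * ?e \<omega> + ennreal (C / c * (1 + 1 / lmin) * (9 * na\<^sup>2)) \<partial>P)"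
  proof (rule nn_integral_mono)
    fix \<omega> assume \<omega>: "\<omega> \<in> space P"
    have "fit (\<lambda>i. X i \<omega>) l S \<in> borel_measurable (leb S)"
      using measurable_fit[where x="\<lambda>i _. X i \<omega>" and u="\<lambda>u. u" and N="leb S", OF l _ S] by simp
    then show "(\<integral>\<^sup>+\<omega>'. \<Phi> (U \<omega>) (V \<omega>') \<partial>P) \<le> ?k * ?e \<omega> + ennreal (C / c * (1 + 1 / lmin) * (9 * na\<^sup>2))"
      unfolding \<Phi>_def Ua Va unfolding fit_def
      by (rule nn_integral_discrepancy[OF S half_subset pop_H_space[OF S] _ pop_iv_le[OF S] lmin])
  qed
  also have "\<dots> = ?k * est_error P X h T (I l) M S + ennreal (C / c * (1 + 1 / lmin) * (9 * na\<^sup>2))"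
  proof -
    have em: "?e \<in> borel_measurable P" by (rule est_error_measurable[OF Xm S])
    show ?thesis unfolding est_error_def using em by (simp add: nn_integral_add nn_integral_cmult P.emeasure_space_1)
  qed
  finally show ?thesis .
qed

definition rate :: real where
  "rate = M * T ^ CARD('d) / (n * h ^ CARD('d)) + h powr (2 * \<beta>) + tail T"

text \<open>The first summand alone is at least 1 / n, since M \<ge> 1 and h \<le> T. Terms of order
  1 / n can therefore be charged to \<open>rate\<close>.\<close>

lemma rate_ge: assumes "h \<le> T" shows "1 / real n \<le> rate"
proof -
  have "h ^ CARD('d) \<le> T ^ CARD('d)" using assms h by (intro power_mono) auto
  then have "h ^ CARD('d) \<le> real M * T ^ CARD('d)"
    using mult_mono[of 1 "real M" "h ^ CARD('d)" "T ^ CARD('d)"] M h by simp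
  moreover have "0 < real n * h ^ CARD('d)" using n2 h by simp
  ultimately have "h ^ CARD('d) / (real n * h ^ CARD('d)) \<le> real M * T ^ CARD('d) / (real n * h ^ CARD('d))"
    by (intro divide_right_mono) auto
  moreover have "0 \<le> tail T" by (simp add: tail_def)
  moreover have "0 \<le> h powr (2 * \<beta>)" by simp
  moreover have "h ^ CARD('d) / (real n * h ^ CARD('d)) = 1 / real n" using h by simp
  ultimately show ?thesis unfolding rate_def by linarith
qed

text \<open>There are 2 \<open>card SS\<close> discrepancies. This number enters once through
  Cauchy-Schwarz and once through the number of summands, hence 4 \<open>card SS\<close>^2.\<close>

lemma nn_integral_remainder:
  assumes lmin: "0 < lmin" "\<And>S. S \<in> SS \<Longrightarrow> lmin \<le> lam S"
    and err: "\<And>l S. l \<in> {1, 2} \<Longrightarrow> S \<in> SS \<Longrightarrow> est_error P X h T (I l) M S \<le> ennreal e" and e: "0 \<le> e"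
  shows "(\<integral>\<^sup>+\<omega>. ennreal ((remainder (\<lambda>i. X i \<omega>) (\<lambda>S j. Y S j \<omega>))\<^sup>2) \<partial>P)
    \<le> ennreal (4 * (real (card SS))\<^sup>2 * (C / c * (1 + 1 / lmin)) * (12 * real n * e + 9 * na\<^sup>2))"
    and "(\<lambda>\<omega>. remainder (\<lambda>i. X i \<omega>) (\<lambda>S j. Y S j \<omega>)) \<in> borel_measurable P"
proof -
  define d where "d l S \<omega> = discrepancy S (half n (3 - l)) (pop M S) (fit (\<lambda>i. X i \<omega>) l S) (\<lambda>i. X i \<omega>) (\<lambda>j. Y S j \<omega>)" for l S \<omega>
  define Q where "Q = C / c * (1 + 1 / lmin)"
  have Q0: "0 \<le> Q" using c c_C lmin by (simp add: Q_def)
  have X: "X i \<in> P \<rightarrow>\<^sub>M leb UNIV" if "i \<in> half n l" for i l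
    using half_subset[of n l] that by (intro X_measurable) blast
  have dm: "d l S \<in> borel_measurable P" if l: "l \<in> {1, 2}" and S: "S \<in> SS" for l S
    unfolding d_def[abs_def]
    by (rule measurable_discrepancy[OF S X Y_measurable[OF S] pop_measurable[OF S] measurable_fit[OF l X S]])
  have R: "remainder (\<lambda>i. X i \<omega>) (\<lambda>S j. Y S j \<omega>) = (\<Sum>p\<in>{1, 2} \<times> SS. d (fst p) (snd p) \<omega>)" for \<omega>
    unfolding remainder_def d_def sum.cartesian_product split_beta' ..
  show "(\<lambda>\<omega>. remainder (\<lambda>i. X i \<omega>) (\<lambda>S j. Y S j \<omega>)) \<in> borel_measurable P"
    unfolding R by (intro borel_measurable_sum dm) auto
  have cd: "real (card ({1, 2 :: nat} \<times> SS)) = 2 * real (card SS)" by (simp add: card_cartesian_product)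
  have dm2: "(\<lambda>\<omega>. ennreal ((d (fst p) (snd p) \<omega>)\<^sup>2)) \<in> borel_measurable P" if "p \<in> {1, 2} \<times> SS" for p
    using that by (intro measurable_compose[OF _ measurable_ennreal] borel_measurable_power dm) auto
  have dle: "(\<integral>\<^sup>+\<omega>. ennreal ((d (fst p) (snd p) \<omega>)\<^sup>2) \<partial>P) \<le> ennreal (Q * (12 * real n * e + 9 * na\<^sup>2))" if "p \<in> {1, 2} \<times> SS" for p
  proof -
    have p: "fst p \<in> {1, 2}" "snd p \<in> SS" using that by auto
    have "(\<integral>\<^sup>+\<omega>. ennreal ((d (fst p) (snd p) \<omega>)\<^sup>2) \<partial>P) \<le> ennreal (Q * (12 * real n)) * est_error P X h T (I (fst p)) M (snd p) + ennreal (Q * (9 * na\<^sup>2))"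
      unfolding d_def Q_def by (rule nn_integral_fit_discrepancy[OF p lmin(1) lmin(2)[OF p(2)]])
    also have "\<dots> \<le> ennreal (Q * (12 * real n)) * ennreal e + ennreal (Q * (9 * na\<^sup>2))"
      by (intro add_right_mono mult_left_mono err p) simp
    also have "\<dots> = ennreal (Q * (12 * real n * e + 9 * na\<^sup>2))"
      using Q0 e by (simp add: ennreal_mult[symmetric] ennreal_plus[symmetric] algebra_simps del: ennreal_plus)
    finally show ?thesis .
  qed
  have "(\<integral>\<^sup>+\<omega>. ennreal ((remainder (\<lambda>i. X i \<omega>) (\<lambda>S j. Y S j \<omega>))\<^sup>2) \<partial>P)
      \<le> (\<integral>\<^sup>+\<omega>. ennreal (2 * real (card SS)) * (\<Sum>p\<in>{1, 2} \<times> SS. ennreal ((d (fst p) (snd p) \<omega>)\<^sup>2)) \<partial>P)"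
  proof (rule nn_integral_mono)
    fix \<omega>
    have "(\<Sum>p\<in>{1, 2} \<times> SS. d (fst p) (snd p) \<omega>)\<^sup>2 \<le> (\<Sum>p\<in>{1, 2} \<times> SS. (d (fst p) (snd p) \<omega>)\<^sup>2) * real (card ({1, 2 :: nat} \<times> SS))"
      by (rule sum_squared_le_sum_of_squares)
    then have "ennreal ((remainder (\<lambda>i. X i \<omega>) (\<lambda>S j. Y S j \<omega>))\<^sup>2) \<le> ennreal (2 * real (card SS) * (\<Sum>p\<in>{1, 2} \<times> SS. (d (fst p) (snd p) \<omega>)\<^sup>2))"
      unfolding R cd by (intro ennreal_leI) (simp add: mult.commute)
    then show "ennreal ((remainder (\<lambda>i. X i \<omega>) (\<lambda>S j. Y S j \<omega>))\<^sup>2) \<le> ennreal (2 * real (card SS)) * (\<Sum>p\<in>{1, 2} \<times> SS. ennreal ((d (fst p) (snd p) \<omega>)\<^sup>2))"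
      by (subst sum_ennreal) (simp_all add: ennreal_mult')
  qed
  also have "\<dots> = ennreal (2 * real (card SS)) * (\<Sum>p\<in>{1, 2} \<times> SS. \<integral>\<^sup>+\<omega>. ennreal ((d (fst p) (snd p) \<omega>)\<^sup>2) \<partial>P)"
  proof -
    have m: "(\<lambda>\<omega>. \<Sum>p\<in>{1, 2} \<times> SS. ennreal ((d (fst p) (snd p) \<omega>)\<^sup>2)) \<in> borel_measurable P"
      by (intro borel_measurable_sum dm2)
    have s: "(\<integral>\<^sup>+\<omega>. (\<Sum>p\<in>{1, 2} \<times> SS. ennreal ((d (fst p) (snd p) \<omega>)\<^sup>2)) \<partial>P) = (\<Sum>p\<in>{1, 2} \<times> SS. \<integral>\<^sup>+\<omega>. ennreal ((d (fst p) (snd p) \<omega>)\<^sup>2) \<partial>P)"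
      by (rule nn_integral_sum) (rule dm2)
    show ?thesis unfolding nn_integral_cmult[OF m] s ..
  qed
  also have "\<dots> \<le> ennreal (2 * real (card SS)) * (\<Sum>p\<in>{1, 2 :: nat} \<times> SS. ennreal (Q * (12 * real n * e + 9 * na\<^sup>2)))"
    by (intro mult_left_mono sum_mono dle) auto
  also have "\<dots> = ennreal (4 * (real (card SS))\<^sup>2 * Q * (12 * real n * e + 9 * na\<^sup>2))"
  proof -
    define z where "z = Q * (12 * real n * e + 9 * na\<^sup>2)"
    have z: "0 \<le> z" using Q0 e by (simp add: z_def)
    have "(\<Sum>p\<in>{1, 2 :: nat} \<times> SS. ennreal z) = ennreal (2 * real (card SS) * z)"
      using z by (subst sum_ennreal) (simp_all only: sum_constant cd)
    then have "ennreal (2 * real (card SS)) * (\<Sum>p\<in>{1, 2 :: nat} \<times> SS. ennreal z) = ennreal (2 * real (card SS)) * ennreal (2 * real (card SS) * z)" by simp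
    also have "\<dots> = ennreal (2 * real (card SS) * (2 * real (card SS) * z))" by (rule ennreal_mult'[symmetric]) simp
    finally show ?thesis by (simp add: z_def power2_eq_square mult_ac)
  qed
  finally show "(\<integral>\<^sup>+\<omega>. ennreal ((remainder (\<lambda>i. X i \<omega>) (\<lambda>S j. Y S j \<omega>))\<^sup>2) \<partial>P)
    \<le> ennreal (4 * (real (card SS))\<^sup>2 * (C / c * (1 + 1 / lmin)) * (12 * real n * e + 9 * na\<^sup>2))" unfolding Q_def .
qed

text \<open>Young's inequality with weight \<open>t\<close> for the mixed term.\<close>

lemma mse_near_objective:
  assumes lmin: "0 < lmin" "\<And>S. S \<in> SS \<Longrightarrow> lmin \<le> lam S"
    and err: "\<And>l S. l \<in> {1, 2} \<Longrightarrow> S \<in> SS \<Longrightarrow> est_error P X h T (I l) M S \<le> ennreal e" and e: "0 \<le> e" and t: "0 < t"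
  shows "\<bar>real n * mse f SS a r lam n ns M h T I P X Y - obj (pop M)\<bar>
    \<le> na\<^sup>2 / n + t * (3 / 2 * na\<^sup>2) + (1 + 1 / t) * (4 * (real (card SS))\<^sup>2 * (C / c * (1 + 1 / lmin)) * (12 * e + 9 * na\<^sup>2 / n))"
proof -
  define O' where "O' \<omega> = ideal_sum (\<lambda>i. X i \<omega>) (\<lambda>S j. Y S j \<omega>)" for \<omega>
  define W where "W \<omega> = remainder (\<lambda>i. X i \<omega>) (\<lambda>S j. Y S j \<omega>)" for \<omega>
  define Q where "Q = 4 * (real (card SS))\<^sup>2 * (C / c * (1 + 1 / lmin))"
  have nn: "0 < real n" and nn2: "2 \<le> real n" using n2 by auto
  have Q0: "0 \<le> Q" using c c_C lmin by (simp add: Q_def)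
  have O2: "integrable P (\<lambda>\<omega>. (O' \<omega>)\<^sup>2)" and EO: "\<bar>P.expectation (\<lambda>\<omega>. (O' \<omega>)\<^sup>2) / real n - obj (pop M)\<bar> \<le> obj (pop M) / real n"
    using expectation_ideal_square unfolding O'_def by auto
  have Wm: "W \<in> borel_measurable P" unfolding W_def[abs_def] by (rule nn_integral_remainder(2)[OF lmin err e])
  have W2le: "(\<integral>\<^sup>+\<omega>. ennreal ((W \<omega>)\<^sup>2) \<partial>P) \<le> ennreal (Q * (12 * real n * e + 9 * na\<^sup>2))"
    unfolding W_def Q_def by (rule nn_integral_remainder(1)[OF lmin err e])
  have W2: "integrable P (\<lambda>\<omega>. (W \<omega>)\<^sup>2)"
    using Wm le_less_trans[OF W2le ennreal_less_top] by (intro integrableI_nonneg) auto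
  have EW: "P.expectation (\<lambda>\<omega>. (W \<omega>)\<^sup>2) \<le> Q * (12 * real n * e + 9 * na\<^sup>2)"
    using W2le Q0 e by (subst (asm) nn_integral_eq_integral[OF W2]) auto
  have Om: "O' \<in> borel_measurable P"
  proof -
    have "(\<lambda>\<omega>. \<Sum>i\<in>{1..n}. centred (pop M) (X i \<omega>)) \<in> borel_measurable P"
      by (intro borel_measurable_sum measurable_compose[OF X_measurable centred_square_integrable(2)] pop_H_space)
    moreover have "(\<lambda>\<omega>. \<Sum>S\<in>SS. avg S (pop M S) (\<lambda>j. Y S j \<omega>)) \<in> borel_measurable P"
      by (intro borel_measurable_sum measurable_avg[where g="\<lambda>_. pop M S" for S] Y_measurable measurable_compose[OF Y_measurable pop_measurable])
    ultimately show ?thesis unfolding O'_def[abs_def] ideal_sum_def by simp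
  qed
  have OW: "integrable P (\<lambda>\<omega>. O' \<omega> * W \<omega>)" by (rule integrable_mult_of_square_integrable[OF Om Wm O2 W2])
  have mse: "(real n)\<^sup>2 * mse f SS a r lam n ns M h T I P X Y = P.expectation (\<lambda>\<omega>. (O' \<omega> + W \<omega>)\<^sup>2)"
    unfolding mse_def O'_def W_def theta_eq[symmetric] power_mult_distrib by (rule integral_mult_right_zero[symmetric])
  have sq: "P.expectation (\<lambda>\<omega>. (O' \<omega> + W \<omega>)\<^sup>2) = P.expectation (\<lambda>\<omega>. (O' \<omega>)\<^sup>2) + P.expectation (\<lambda>\<omega>. (W \<omega>)\<^sup>2) + 2 * P.expectation (\<lambda>\<omega>. O' \<omega> * W \<omega>)"
    unfolding power2_sum using O2 W2 OW by (simp add: mult.assoc)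
  have young: "2 * \<bar>O' \<omega> * W \<omega>\<bar> \<le> t * (O' \<omega>)\<^sup>2 + 1 / t * (W \<omega>)\<^sup>2" for \<omega>
  proof -
    have "0 \<le> (sqrt t * \<bar>O' \<omega>\<bar> - \<bar>W \<omega>\<bar> / sqrt t)\<^sup>2" by simp
    also have "\<dots> = t * (O' \<omega>)\<^sup>2 + 1 / t * (W \<omega>)\<^sup>2 - 2 * \<bar>O' \<omega> * W \<omega>\<bar>"
      using t by (simp add: power2_diff power_mult_distrib power_divide abs_mult)
    finally show ?thesis by simp
  qed
  have mixed: "\<bar>2 * P.expectation (\<lambda>\<omega>. O' \<omega> * W \<omega>)\<bar> \<le> t * P.expectation (\<lambda>\<omega>. (O' \<omega>)\<^sup>2) + 1 / t * P.expectation (\<lambda>\<omega>. (W \<omega>)\<^sup>2)"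
  proof -
    have "\<bar>2 * P.expectation (\<lambda>\<omega>. O' \<omega> * W \<omega>)\<bar> \<le> 2 * P.expectation (\<lambda>\<omega>. \<bar>O' \<omega> * W \<omega>\<bar>)"
    proof -
      have "\<bar>2 * u\<bar> \<le> 2 * v" if "\<bar>u\<bar> \<le> v" for u v :: real using that by simp
      then show ?thesis using integral_abs_bound[of P "\<lambda>\<omega>. O' \<omega> * W \<omega>"] by blast
    qed
    also have "\<dots> = P.expectation (\<lambda>\<omega>. 2 * \<bar>O' \<omega> * W \<omega>\<bar>)" by simp
    also have "\<dots> \<le> P.expectation (\<lambda>\<omega>. t * (O' \<omega>)\<^sup>2 + 1 / t * (W \<omega>)\<^sup>2)"
    proof (rule integral_mono[OF _ _ young])
      show "integrable P (\<lambda>\<omega>. 2 * \<bar>O' \<omega> * W \<omega>\<bar>)" using OW by simp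
      show "integrable P (\<lambda>\<omega>. t * (O' \<omega>)\<^sup>2 + 1 / t * (W \<omega>)\<^sup>2)" using O2 W2 by simp
    qed
    also have "\<dots> = t * P.expectation (\<lambda>\<omega>. (O' \<omega>)\<^sup>2) + 1 / t * P.expectation (\<lambda>\<omega>. (W \<omega>)\<^sup>2)" using O2 W2 by simp
    finally show ?thesis .
  qed
  define eo where "eo = P.expectation (\<lambda>\<omega>. (O' \<omega>)\<^sup>2)"
  define ew where "ew = P.expectation (\<lambda>\<omega>. (W \<omega>)\<^sup>2)"
  define eow where "eow = 2 * P.expectation (\<lambda>\<omega>. O' \<omega> * W \<omega>)"
  have ew0: "0 \<le> ew" unfolding ew_def by (intro Bochner_Integration.integral_nonneg) simp
  have obj: "0 \<le> obj (pop M)" "obj (pop M) \<le> na\<^sup>2" using obj_nonneg[of "pop M"] pop_H_space obj_pop_le_na by auto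
  have on: "obj (pop M) / n \<le> na\<^sup>2 / n" using obj(2) nn by (simp add: divide_right_mono)
  \<comment> \<open>With n \<ge> 2 the correction to the second moment of the ideal sum is at most
    half of \<open>na^2\<close>, which explains the factor 3/2 in the claim.\<close>
  have on2: "obj (pop M) / n \<le> na\<^sup>2 / 2" using obj nn2 by (intro frac_le) auto
  have a1: "\<bar>eo / n - obj (pop M)\<bar> \<le> na\<^sup>2 / n" using EO on unfolding eo_def by linarith
  have a2: "eo / n \<le> 3 / 2 * na\<^sup>2" using EO on2 obj unfolding eo_def by linarith
  have a3: "ew / n \<le> Q * (12 * e + 9 * na\<^sup>2 / n)"
    using EW nn unfolding ew_def by (simp add: field_simps)
  have a4: "\<bar>eow / n\<bar> \<le> t * (eo / n) + 1 / t * (ew / n)"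
  proof -
    have "\<bar>eow / n\<bar> = \<bar>eow\<bar> / n" by simp
    also have "\<dots> \<le> (t * eo + 1 / t * ew) / n" using mixed nn unfolding eow_def eo_def ew_def by (intro divide_right_mono) auto
    finally show ?thesis by (simp add: add_divide_distrib)
  qed
  have "real n * mse f SS a r lam n ns M h T I P X Y = (real n)\<^sup>2 * mse f SS a r lam n ns M h T I P X Y / n"
    using nn by (simp add: power2_eq_square)
  also have "\<dots> = eo / n + ew / n + eow / n"
    unfolding mse sq eo_def ew_def eow_def by (simp add: add_divide_distrib)
  finally have split: "real n * mse f SS a r lam n ns M h T I P X Y = eo / n + ew / n + eow / n" .
  have "\<bar>real n * mse f SS a r lam n ns M h T I P X Y - obj (pop M)\<bar> \<le> na\<^sup>2 / n + ew / n + (t * (eo / n) + 1 / t * (ew / n))"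
  proof -
    have "\<bar>x + y + z - v\<bar> \<le> u + y + w" if "\<bar>x - v\<bar> \<le> u" "\<bar>z\<bar> \<le> w" "0 \<le> y" for x y z u v w :: real
      using that by linarith
    from this[OF a1 a4, of "ew / n"] show ?thesis
      unfolding split using ew0 nn by simp
  qed
  also have "\<dots> \<le> na\<^sup>2 / n + Q * (12 * e + 9 * na\<^sup>2 / n) + (t * (3 / 2 * na\<^sup>2) + 1 / t * (Q * (12 * e + 9 * na\<^sup>2 / n)))"
    using a2 a3 t by (intro add_mono mult_left_mono order.refl) auto
  also have "\<dots> = na\<^sup>2 / n + t * (3 / 2 * na\<^sup>2) + (1 + 1 / t) * (Q * (12 * e + 9 * na\<^sup>2 / n))"
    unfolding distrib_right[of 1 "1 / t"] mult_1 by (simp only: add_ac)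
  finally show ?thesis unfolding Q_def .
qed

end

section \<open>Final constants and the two claims\<close>

text \<open>Here s is the square root of the rate, v = \<open>na^2\<close>, w = 1 / n, and the Young
  weight is 20 s: the remainder, of order s^2, is divided by it and becomes of order s like the
  rest. In units of K s, with s \<le> 7/4 from s^2 \<le> 3, the left side is at most 97 * 7/4 +
  97/20 + 2, which is below 200.\<close>

lemma rate_arithmetic:
  fixes v w s B Q A :: real
  assumes v: "0 \<le> v" "1024 * v \<le> B" and Q: "1 \<le> Q" and A: "1 \<le> A" and s: "0 < s" "s\<^sup>2 \<le> 3" and w: "0 \<le> w" "w \<le> s\<^sup>2"
  shows "v * w + 20 * s * (3 / 2 * v) + (1 + 1 / (20 * s)) * (4 * Q * (12 * (2 * A * B * s\<^sup>2) + 9 * (v * w))) \<le> 200 * Q * B * A * s"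
proof -
  define K where "K = Q * B * A"
  have B0: "0 \<le> B" using v by linarith
  have QB: "B \<le> Q * B" using mult_right_mono[OF Q B0] by simp
  have QBK: "Q * B \<le> K" unfolding K_def using mult_left_mono[OF A, of "Q * B"] Q B0 by simp
  have K: "0 \<le> K" using QB QBK B0 by linarith
  have "Q * (1024 * v) \<le> Q * B" using mult_left_mono[OF v(2), of Q] Q by simp
  moreover have "Q * (1024 * v) = 1024 * (Q * v)" by simp
  ultimately have Qv: "1024 * (Q * v) \<le> K" using QBK by linarith
  have vQ: "v \<le> Q * v" using mult_right_mono[OF Q v(1)] by simp
  have Qv0: "0 \<le> Q * v" using v vQ by linarith
  have Qvw: "1024 * (Q * v * w) \<le> K * s\<^sup>2"
    using mult_mono[OF Qv w(2)] K w Qv0 by simp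
  have vw: "1024 * (v * w) \<le> K * s\<^sup>2"
    using mult_right_mono[OF vQ w(1)] Qvw by linarith
  have Ks: "0 \<le> K * s\<^sup>2" "0 \<le> K * s" using K s by auto
  have e: "4 * Q * (12 * (2 * A * B * s\<^sup>2) + 9 * (v * w)) \<le> 97 * (K * s\<^sup>2)"
  proof -
    have "4 * Q * (12 * (2 * A * B * s\<^sup>2) + 9 * (v * w)) = 96 * (K * s\<^sup>2) + 36 * (Q * v * w)"
      unfolding K_def by (simp add: algebra_simps)
    then show ?thesis using Qvw Ks by linarith
  qed
  have "(1 + 1 / (20 * s)) * (4 * Q * (12 * (2 * A * B * s\<^sup>2) + 9 * (v * w))) \<le> (1 + 1 / (20 * s)) * (97 * (K * s\<^sup>2))"
    using s by (intro mult_left_mono e) auto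
  also have "\<dots> = 97 * (K * s\<^sup>2) + 97 / 20 * (K * s)"
    using s by (simp add: field_simps power2_eq_square)
  finally have f: "(1 + 1 / (20 * s)) * (4 * Q * (12 * (2 * A * B * s\<^sup>2) + 9 * (v * w))) \<le> 97 * (K * s\<^sup>2) + 97 / 20 * (K * s)" .
  have vs: "20 * s * (3 / 2 * v) \<le> K * s"
  proof -
    have "30 * v \<le> K" using Qv vQ v by linarith
    from mult_right_mono[OF this, of s] s show ?thesis by (simp add: mult_ac)
  qed
  have "s \<le> 7 / 4"
  proof (rule power2_le_imp_le)
    show "s\<^sup>2 \<le> (7 / 4)\<^sup>2" using s(2) by (simp add: power2_eq_square)
  qed simp
  then have "K * s * s \<le> K * s * (7 / 4)" using Ks by (intro mult_left_mono) auto
  then have ss: "K * s\<^sup>2 \<le> 7 / 4 * (K * s)" by (simp add: power2_eq_square mult_ac)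
  have "200 * Q * B * A * s = 200 * (K * s)" unfolding K_def by (simp add: mult_ac)
  then show ?thesis using f vs vw ss Ks by linarith
qed

text \<open>Combines the fit error of both halves with Young's inequality. The bound is two-sided
  because the asymptotic claim needs the lower side as well.\<close>

lemma (in cross_fit_estimator) mse_bound:
  assumes lmin: "0 < lmin" "\<And>S. S \<in> SS \<Longrightarrow> lmin \<le> lam S"
    and Mx: "(C / c)\<^sup>2 \<le> Mx" "(L1 + L2 + L3)\<^sup>2 \<le> Mx" "8 ^ CARD('d) \<le> Mx"
    and A: "A = 28 * (C / c + 2 ^ CARD('d))" and B: "B = 16 * max (na\<^sup>2) 1 * Mx"
    and D: "D = 200 * (real (card SS))\<^sup>2 * (C / c) * (1 + 1 / lmin) * B"
    and rate3: "rate \<le> 3"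
  shows "\<bar>real n * mse f SS a r lam n ns M h T I P X Y - obj (pop M)\<bar> \<le> A ^ M * D * sqrt rate"
proof -
  have q1: "1 \<le> C / c" using c c_C by simp
  have "(0::real) \<le> 2 ^ CARD('d)" by simp
  then have A1: "1 \<le> A" using q1 unfolding A distrib_left by linarith
  have hT: "h \<le> T" using h T by linarith
  have n0: "0 < 1 / real n" using n2 by simp
  have r0: "0 < rate" using rate_ge[OF hT] n0 by linarith
  \<comment> \<open>As d \<ge> 2, the entry 8^d of the maximum is at least 64, and 16 * 64 = 1024 is
    the ratio that \<open>rate_arithmetic\<close> asks for.\<close>
  have "(8::real) ^ 2 \<le> 8 ^ CARD('d)" by (rule power_increasing[OF d2]) simp
  then have Mx64: "64 \<le> Mx" using Mx(3) by simp
  have B0: "1024 * max (na\<^sup>2) 1 \<le> B"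
    using mult_left_mono[OF Mx64, of "16 * max (na\<^sup>2) 1"] unfolding B by simp
  have na: "1024 * na\<^sup>2 \<le> B" and B1: "0 \<le> B" using B0 by auto
  define e where "e = 2 * A ^ M * B * rate"
  have e0: "0 \<le> e" unfolding e_def using A1 B1 r0 by simp
  have err: "est_error P X h T (I l) M S \<le> ennreal e" if l: "l \<in> {1, 2}" and S: "S \<in> SS" for l S
    unfolding e_def B rate_def
  proof (rule est_error_le[OF d2 P.prob_space_axioms pieces(2)[OF l] _ _ _ _ _ _ h T S order.refl Mx A])
    fix m assume m: "m \<in> {1..M}"
    note p = balanced_split_pieces[OF I M(2) l m]
    show "finite (I l m)" "I l m \<noteq> {}" using p by auto
    show "real n \<le> 4 * real M * real (card (I l m))" using p(3) by (metis of_nat_le_iff of_nat_mult of_nat_numeral)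
    fix i assume "i \<in> I l m"
    then have "i \<in> half n l" using pieces(1)[OF l] m by blast
    then show "distr P (leb UNIV) (X i) = law f" using half_subset[of n l] by (intro X_distr) blast
  next
    show "0 < n" using n2 by simp
    show "P.indep_vars (\<lambda>_. leb UNIV) X (\<Union>l'\<in>{1..M}. I l l')" unfolding pieces(1)[OF l] by (rule indep_X[OF half_subset])
  qed
  define s where "s = sqrt rate"
  have s: "0 < s" "s\<^sup>2 = rate" using r0 by (auto simp: s_def)
  define Q where "Q = (real (card SS))\<^sup>2 * (C / c) * (1 + 1 / lmin)"
  have "1 \<le> (real (card SS))\<^sup>2" using card_SS power_mono[of 1 "real (card SS)" 2] by simp
  then have "1 * 1 \<le> (real (card SS))\<^sup>2 * (C / c)" using q1 by (intro mult_mono) auto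
  then have "1 \<le> (real (card SS))\<^sup>2 * (C / c)" by simp
  then have "1 * 1 \<le> (real (card SS))\<^sup>2 * (C / c) * (1 + 1 / lmin)"
    by (rule mult_mono) (use lmin(1) c c_C in simp_all)
  then have Q1: "1 \<le> Q" unfolding Q_def by simp
  have "\<bar>real n * mse f SS a r lam n ns M h T I P X Y - obj (pop M)\<bar>
    \<le> na\<^sup>2 / n + 20 * s * (3 / 2 * na\<^sup>2) + (1 + 1 / (20 * s)) * (4 * (real (card SS))\<^sup>2 * (C / c * (1 + 1 / lmin)) * (12 * e + 9 * na\<^sup>2 / n))"
    by (rule mse_near_objective[OF lmin err e0]) (use s in simp_all)
  also have "\<dots> = na\<^sup>2 * (1 / n) + 20 * s * (3 / 2 * na\<^sup>2) + (1 + 1 / (20 * s)) * (4 * Q * (12 * (2 * A ^ M * B * s\<^sup>2) + 9 * (na\<^sup>2 * (1 / n))))"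
    unfolding e_def s(2) Q_def by (simp add: mult.assoc)
  also have "\<dots> \<le> 200 * Q * B * A ^ M * s"
    using na Q1 A1 s rate3 n0 rate_ge[OF hT] by (intro rate_arithmetic) auto
  also have "\<dots> = A ^ M * D * sqrt rate" unfolding D Q_def s_def by (simp add: mult_ac)
  finally show ?thesis .
qed

theorem theorem15:
  fixes f a :: "('d::finite \<Rightarrow> real) \<Rightarrow> real"
    and SS :: "'d set set"
    and r \<alpha>s :: "'d set \<Rightarrow> ('d \<Rightarrow> real) \<Rightarrow> real"
    and lam :: "'d set \<Rightarrow> real"
    and k :: "'d set \<Rightarrow> ('d \<Rightarrow> real) \<Rightarrow> ('d \<Rightarrow> real) measure"
    and \<beta>1 \<beta>2 \<beta>3 \<beta>min L1 L2 L3 c C norm_a lmax lmin \<kappa> A B D :: real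
  assumes "CARD('d) \<ge> 2"
    and "is_prob_density f"
    and "SS \<noteq> {}" and "UNIV \<notin> SS"
    and "\<And>S. S \<in> SS \<Longrightarrow> r S \<in> borel_measurable (leb S)"
    and "\<And>S u. S \<in> SS \<Longrightarrow> u \<in> subspace_of S \<Longrightarrow> 0 < r S u"
    and "\<And>S. S \<in> SS \<Longrightarrow> 0 < lam S"
    and "a \<in> borel_measurable (leb UNIV)"
    and "0 < \<beta>1" "\<beta>1 \<le> 1" "0 < \<beta>2" "\<beta>2 \<le> 1" "0 < \<beta>3" "\<beta>3 \<le> 1"
    and "0 < L1" "0 < L2" "0 < L3"
    and "\<beta>min = Min {\<beta>1, \<beta>2, \<beta>3}"
    and "bounded (range a)" and "norm_a = (SUP x. \<bar>a x\<bar>)"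
    and "0 < c" "c \<le> C"
    and "\<And>S u. S \<in> SS \<Longrightarrow> u \<in> subspace_of S \<Longrightarrow> c \<le> rbar f r S u \<and> rbar f r S u \<le> C"
    and A1: "\<And>x x'. supdist UNIV x x' \<le> 1 \<Longrightarrow> \<bar>a x - a x'\<bar> \<le> L1 * supdist UNIV x x' powr \<beta>1"
    and "\<And>S. S \<in> SS \<Longrightarrow> cond_distribution f S (k S)"
    and A2: "\<And>S u u'. S \<in> SS \<Longrightarrow> u \<in> subspace_of S \<Longrightarrow> u' \<in> subspace_of S \<Longrightarrow>
               supdist S u u' \<le> 1 \<Longrightarrow> tv_dist (k S u) (k S u') \<le> L2 * supdist S u u' powr \<beta>2"
    and A3: "\<And>S u u'. S \<in> SS \<Longrightarrow> u \<in> subspace_of S \<Longrightarrow> u' \<in> subspace_of S \<Longrightarrow>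
               supdist S u u' \<le> 1 \<Longrightarrow>
               \<bar>rbar f r S u - rbar f r S u'\<bar> \<le> L3 * supdist S u u' powr \<beta>3"
    and "lmax = Max (lam ` SS)" and "lmin = Min (lam ` SS)"
    and "\<kappa> = card SS * (1 + C * lmax)"
    and "A = 28 * (C / c + 2 ^ CARD('d))"
    and "B = 16 * max (norm_a\<^sup>2) 1 * Max {(C / c)\<^sup>2, (L1 + L2 + L3)\<^sup>2, 8 ^ CARD('d)}"
    and "D = 200 * (card SS)\<^sup>2 * (C / c) * (1 + 1 / lmin) * B"
    and "is_arg_min (objective f a r SS lam) (\<lambda>\<alpha>. \<alpha> \<in> H_prod f SS) \<alpha>s"
  shows
    "(\<forall>(n::nat) (ns :: 'd set \<Rightarrow> nat) (M::nat) (h::real) (T::real) I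
        (P :: 'w measure) (X :: nat \<Rightarrow> 'w \<Rightarrow> 'd \<Rightarrow> real) (Y :: 'd set \<Rightarrow> nat \<Rightarrow> 'w \<Rightarrow> 'd \<Rightarrow> real).
        1 \<le> M \<and> 2 * M \<le> n \<and> 1 \<le> T \<and>
        T * (M / n) powr (1 / CARD('d)) \<le> h \<and> h \<le> 1 \<and>
        (\<forall>S\<in>SS. 1 \<le> ns S \<and> \<bar>n * lam S / ns S - 1\<bar> \<le> 1 / n) \<and>
        balanced_split n M I \<and>
        sample_model f r SS n ns P X Y
        \<longrightarrow> n * mse f SS a r lam n ns M h T I P X Y - objective f a r SS lam \<alpha>s
            \<le> A ^ M * D * sqrt (M * T ^ CARD('d) / (n * h ^ CARD('d)) + h powr (2 * \<beta>min)
                                 + measure (law f) {x. T \<le> supnorm UNIV x})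
              + 4 * \<kappa> * prob_space.variance (law f) a * exp (- real M / \<kappa>))
     \<and>
     (\<forall>(ns :: nat \<Rightarrow> 'd set \<Rightarrow> nat) (M :: nat \<Rightarrow> nat) (h :: nat \<Rightarrow> real) (T :: nat \<Rightarrow> real) I
        (P :: nat \<Rightarrow> 'w measure) (X :: nat \<Rightarrow> nat \<Rightarrow> 'w \<Rightarrow> 'd \<Rightarrow> real)
        (Y :: nat \<Rightarrow> 'd set \<Rightarrow> nat \<Rightarrow> 'w \<Rightarrow> 'd \<Rightarrow> real).
        (\<forall>\<^sub>F n in sequentially.
           0 < h n \<and>
           (\<forall>S\<in>SS. 1 \<le> ns n S \<and> \<bar>n * lam S / ns n S - 1\<bar> \<le> 1 / n) \<and>
           balanced_split n (M n) (I n) \<and>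
           sample_model f r SS n (ns n) (P n) (X n) (Y n)) \<and>
        (\<lambda>n. A ^ (2 * M n) *
              (M n * T n ^ CARD('d) / (n * h n ^ CARD('d)) + h n powr (2 * \<beta>min)
               + measure (law f) {x. T n \<le> supnorm UNIV x})) \<longlonglongrightarrow> 0 \<and>
        filterlim T at_top sequentially \<and> filterlim M at_top sequentially
        \<longrightarrow> (\<lambda>n. mse f SS a r lam n (ns n) (M n) (h n) (T n) (I n) (P n) (X n) (Y n)
                  - objective f a r SS lam \<alpha>s / n) \<in> o(\<lambda>n. 1 / n))"
proof -
  let ?Mx = "Max {(C / c)\<^sup>2, (L1 + L2 + L3)\<^sup>2, 8 ^ CARD('d)}"
  have \<beta>: "\<beta>min \<le> \<beta>1" "\<beta>min \<le> \<beta>2" "\<beta>min \<le> \<beta>3" "0 < \<beta>min" "\<beta>min \<le> 1"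
    using assms(9-14) unfolding assms(18) by auto
  have sd0: "0 \<le> supdist S u v" for S :: "'d set" and u v by (rule supdist_nonneg)
  \<comment> \<open>At distances up to 1 a smaller exponent gives a larger power, so all three
    conditions hold with the smallest exponent.\<close>
  have mono: "y \<le> L * supdist S u v powr \<beta>min" if "supdist S u v \<le> 1" "y \<le> L * supdist S u v powr b" "\<beta>min \<le> b" "0 < L"
    for y L b and S :: "'d set" and u v
  proof -
    have "supdist S u v powr b \<le> supdist S u v powr \<beta>min"
      using that(1,3) sd0[of S u v] by (intro powr_mono') auto
    then show ?thesis using that(2,4) mult_left_mono[of "supdist S u v powr b" "supdist S u v powr \<beta>min" L] by linarith
  qed
  have na: "\<bar>a x\<bar> \<le> norm_a" for x
  proof -
    have "bdd_above (range (\<lambda>x. \<bar>a x\<bar>))"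
      using assms(19) unfolding bounded_iff by (auto intro: bdd_aboveI)
    then show ?thesis unfolding assms(20) by (rule cSUP_upper[OF UNIV_I])
  qed
  interpret missing_data f a SS r lam k \<beta>min L1 L2 L3 c C norm_a
  proof
    show "\<bar>a x - a x'\<bar> \<le> L1 * supdist UNIV x x' powr \<beta>min" if "supdist UNIV x x' \<le> 1" for x x'
      by (rule mono[OF that A1[OF that] \<beta>(1) \<open>0 < L1\<close>])
    show "tv_dist (k S u) (k S u') \<le> L2 * supdist S u u' powr \<beta>min"
      if "S \<in> SS" "u \<in> subspace_of S" "u' \<in> subspace_of S" "supdist S u u' \<le> 1" for S u u'
      by (rule mono[OF that(4) A2[OF that] \<beta>(2) \<open>0 < L2\<close>])
    show "\<bar>rbar f r S u - rbar f r S u'\<bar> \<le> L3 * supdist S u u' powr \<beta>min"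
      if "S \<in> SS" "u \<in> subspace_of S" "u' \<in> subspace_of S" "supdist S u u' \<le> 1" for S u u'
      by (rule mono[OF that(4) A3[OF that] \<beta>(3) \<open>0 < L3\<close>])
  qed (use assms na \<beta> in blast)+
  have lmax: "lam S \<le> lmax" and lmin: "lmin \<le> lam S" if "S \<in> SS" for S
    using that unfolding assms(28,29) by auto
  have lmin0: "0 < lmin" unfolding assms(29) using SS lam_pos by (subst Min_gr_iff) auto
  obtain S0 where S0: "S0 \<in> SS" using SS by auto
  have "0 \<le> C * lmax" using c_C lam_pos[OF S0] lmax[OF S0] by (intro mult_nonneg_nonneg) linarith+
  then have "1 * 1 \<le> real (card SS) * (1 + C * lmax)" using card_SS by (intro mult_mono) auto
  then have \<kappa>1: "1 \<le> \<kappa>" unfolding assms(30) by simp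
  have q1: "1 \<le> C / c" using c c_C by simp
  have "(0::real) \<le> 2 ^ CARD('d)" by simp
  then have A1: "2 \<le> A" unfolding assms(31) distrib_left using q1 by linarith
  have Mx: "(C / c)\<^sup>2 \<le> ?Mx" "(L1 + L2 + L3)\<^sup>2 \<le> ?Mx" "8 ^ CARD('d) \<le> ?Mx" by (auto intro!: Max_ge)
  have \<alpha>s: "\<alpha>s S \<in> H_space f S" if "S \<in> SS" for S
    using assms(34) that unfolding is_arg_min_def H_prod_def by (auto dest: PiE_mem)
  have gap: "obj (pop m) - obj \<alpha>s \<le> variance a * exp (- real m / \<kappa>)" for m
    by (rule obj_pop_gap[OF \<alpha>s lmax assms(30)])
  \<comment> \<open>The minimisation ranges over families that are \<open>undefined\<close> off
    \<open>SS\<close>, so \<open>pop m\<close> is restricted first; the objective reads only the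
    blocks in \<open>SS\<close>.\<close>
  have gap0: "obj \<alpha>s \<le> obj (pop m)" for m
  proof -
    have "restrict (pop m) SS \<in> H_prod f SS" unfolding H_prod_def using pop_H_space by auto
    then have "obj \<alpha>s \<le> obj (restrict (pop m) SS)" using assms(34) unfolding is_arg_min_def by (meson not_le)
    also have "obj (restrict (pop m) SS) = obj (pop m)" unfolding objective_def by simp
    finally show ?thesis .
  qed
  have var0: "0 \<le> variance a" by (rule variance_positive)
  define \<Gamma> where "\<Gamma> n M h T = real M * T ^ CARD('d) / (real n * h ^ CARD('d)) + h powr (2 * \<beta>min) + measure (law f) {x. T \<le> supnorm UNIV x}"
    for n M :: nat and h T :: real
  have bound: "\<bar>real n * mse f SS a r lam n ns M h T I P X Y - obj (pop M)\<bar> \<le> A ^ M * D * sqrt (\<Gamma> n M h T)"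
    if "1 \<le> M" "2 * M \<le> n" "0 < h" "h \<le> 1" "1 \<le> T" "\<forall>S\<in>SS. 1 \<le> ns S \<and> \<bar>n * lam S / ns S - 1\<bar> \<le> 1 / n"
      "balanced_split n M I" "sample_model f r SS n ns P X Y" "\<Gamma> n M h T \<le> 3"
    for n M ns h T I and P :: "'w measure" and X Y
  proof -
    interpret cross_fit_estimator f a SS r lam k \<beta>min L1 L2 L3 c C norm_a n ns P X Y M h T I
      by unfold_locales (use that assms(1) in auto)
    have r: "rate = \<Gamma> n M h T" by (simp add: rate_def \<Gamma>_def tail_def)
    show ?thesis unfolding r[symmetric]
      by (rule mse_bound[OF lmin0 lmin Mx assms(31,32)]) (use that(9) in \<open>simp_all add: assms(33) r\<close>)
  qed
  have tail1: "measure (law f) {x. T \<le> supnorm UNIV x} \<le> 1" for T by (rule prob_le_1)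
  show ?thesis
  proof (intro conjI allI impI; elim conjE)
    fix n M :: nat and h T :: real and I ns and P :: "'w measure" and X Y
    assume M: "1 \<le> M" "2 * M \<le> n" and T: "1 \<le> T" and hT: "T * (real M / real n) powr (1 / CARD('d)) \<le> h" and h: "h \<le> 1"
      and ns: "\<forall>S\<in>SS. 1 \<le> ns S \<and> \<bar>n * lam S / ns S - 1\<bar> \<le> 1 / n"
      and I: "balanced_split n M I" and model: "sample_model f r SS n ns P X Y"
    have Mn: "0 < real M / real n" using M by simp
    have "0 < T * (real M / real n) powr (1 / CARD('d))"
    proof (rule mult_pos_pos)
      show "0 < T" using T by linarith
      show "0 < (real M / real n) powr (1 / CARD('d))" using M by simp
    qed
    then have h0: "0 < h" using hT by linarith
    \<comment> \<open>Raising the lower bound on \<open>h\<close> to the power d shows that the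
      first summand of the rate is at most 1; so are the other two, whence the hypothesis that the
      rate is at most 3.\<close>
    have "(T * (real M / real n) powr (1 / CARD('d))) ^ CARD('d) \<le> h ^ CARD('d)"
      using hT T by (intro power_mono) auto
    also have "(T * (real M / real n) powr (1 / CARD('d))) ^ CARD('d) = T ^ CARD('d) * (real M / real n)"
    proof -
      have "(x powr (1 / real d)) ^ d = x" if "0 < x" "0 < d" for x :: real and d :: nat
        using powr_realpow[of "x powr (1 / real d)" d] that by (simp add: powr_powr)
      from this[OF Mn, of "CARD('d)"] show ?thesis by (simp add: power_mult_distrib)
    qed
    finally have "real M * T ^ CARD('d) / (real n * h ^ CARD('d)) \<le> 1"
      using h0 M by (simp add: field_simps)
    moreover have "h powr (2 * \<beta>min) \<le> 1" using h h0 \<beta> by (intro powr_le1) auto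
    ultimately have \<Gamma>3: "\<Gamma> n M h T \<le> 3" using tail1[of T] unfolding \<Gamma>_def by linarith
    have "real n * mse f SS a r lam n ns M h T I P X Y - obj (pop M) \<le> A ^ M * D * sqrt (\<Gamma> n M h T)"
      using bound[OF M h0 h T ns I model \<Gamma>3] by linarith
    \<comment> \<open>Since \<kappa> \<ge> 1, the contraction bound lies below the stated term with
      its factor 4 \<kappa>.\<close>
    moreover have "variance a * exp (- real M / \<kappa>) \<le> 4 * \<kappa> * variance a * exp (- real M / \<kappa>)"
      using mult_right_mono[of 1 "4 * \<kappa>" "variance a"] \<kappa>1 var0 by (intro mult_right_mono) auto
    ultimately show "real n * mse f SS a r lam n ns M h T I P X Y - obj \<alpha>s
        \<le> A ^ M * D * sqrt (real M * T ^ CARD('d) / (real n * h ^ CARD('d)) + h powr (2 * \<beta>min) + measure (law f) {x. T \<le> supnorm UNIV x})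
          + 4 * \<kappa> * variance a * exp (- real M / \<kappa>)"
      using gap[of M] unfolding \<Gamma>_def by linarith
  next
    fix ns :: "nat \<Rightarrow> 'd set \<Rightarrow> nat" and M :: "nat \<Rightarrow> nat" and h T :: "nat \<Rightarrow> real" and I
      and P :: "nat \<Rightarrow> 'w measure" and X Y
    assume ev: "\<forall>\<^sub>F n in sequentially. 0 < h n \<and>
           (\<forall>S\<in>SS. 1 \<le> ns n S \<and> \<bar>n * lam S / ns n S - 1\<bar> \<le> 1 / n) \<and>
           balanced_split n (M n) (I n) \<and> sample_model f r SS n (ns n) (P n) (X n) (Y n)"
      and lim: "(\<lambda>n. A ^ (2 * M n) * (M n * T n ^ CARD('d) / (n * h n ^ CARD('d)) + h n powr (2 * \<beta>min)
               + measure (law f) {x. T n \<le> supnorm UNIV x})) \<longlonglongrightarrow> 0"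
      and Tlim: "filterlim T at_top sequentially" and Mlim: "filterlim M at_top sequentially"
    \<comment> \<open>The factor \<open>A ^ (2 * M n)\<close> is the square of the one in the
      finite-sample bound, so D times the square root of \<open>G n\<close> is exactly its
      right-hand side.\<close>
    define G where "G n = A ^ (2 * M n) * \<Gamma> n (M n) (h n) (T n)" for n
    have G: "G \<longlonglongrightarrow> 0" using lim unfolding G_def[abs_def] \<Gamma>_def .
    let ?mse = "\<lambda>n. mse f SS a r lam n (ns n) (M n) (h n) (T n) (I n) (P n) (X n) (Y n)"
    have "\<forall>\<^sub>F n in sequentially. G n < 1" using G by (rule order_tendstoD) simp
    moreover have "\<forall>\<^sub>F n in sequentially. 1 \<le> T n" using Tlim by (simp add: filterlim_at_top)
    moreover have "\<forall>\<^sub>F n in sequentially. 1 \<le> M n" using Mlim by (simp add: filterlim_at_top)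
    moreover have "\<forall>\<^sub>F n::nat in sequentially. 1 \<le> n" by (rule eventually_ge_at_top)
    ultimately have "\<forall>\<^sub>F n in sequentially. norm (real n * ?mse n - obj \<alpha>s) \<le> D * sqrt (G n) + variance a * exp (- real (M n) / \<kappa>)"
      using ev
    proof eventually_elim
      case (elim n)
      have h0: "0 < h n" and T1: "1 \<le> T n" and M1: "1 \<le> M n" and n1: "1 \<le> n" using elim by auto
      \<comment> \<open>As A \<ge> 2 and M n \<ge> 1, smallness of \<open>G\<close> makes the rate
        less than 1/2. Its summands then yield h n \<le> 1 and 2 M n < n, which are the size
        conditions of \<open>bound\<close>.\<close>
      have "A ^ 1 \<le> A ^ (2 * M n)" using A1 M1 by (intro power_increasing) auto
      then have AM: "2 \<le> A ^ (2 * M n)" using A1 by simp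
      define z where "z = real (M n) * T n ^ CARD('d) / (real n * h n ^ CARD('d))"
      have z0: "0 \<le> z" unfolding z_def using T1 h0 by (intro divide_nonneg_nonneg mult_nonneg_nonneg) auto
      have parts: "z \<le> \<Gamma> n (M n) (h n) (T n)" "h n powr (2 * \<beta>min) \<le> \<Gamma> n (M n) (h n) (T n)"
        using z0 measure_nonneg[of "law f" "{x. T n \<le> supnorm UNIV x}"] powr_ge_zero[of "h n" "2 * \<beta>min"]
        unfolding \<Gamma>_def z_def[symmetric] by linarith+
      have \<Gamma>0: "0 \<le> \<Gamma> n (M n) (h n) (T n)" using z0 parts by linarith
      have "2 * \<Gamma> n (M n) (h n) (T n) \<le> G n" unfolding G_def using AM \<Gamma>0 by (intro mult_right_mono)
      then have \<Gamma>half: "2 * \<Gamma> n (M n) (h n) (T n) < 1" using elim(1) by linarith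
      have h1: "h n \<le> 1"
      proof (rule ccontr)
        assume "\<not> h n \<le> 1"
        then have "1 \<le> h n powr (2 * \<beta>min)" using \<beta> by (intro ge_one_powr_ge_zero) auto
        then show False using parts \<Gamma>half by linarith
      qed
      have "h n ^ CARD('d) \<le> 1" using h0 h1 by (intro power_le_one) auto
      moreover have "1 \<le> T n ^ CARD('d)" using T1 by (rule one_le_power)
      ultimately have "real (M n) * 1 / (real n * 1) \<le> z"
        unfolding z_def using h0 n1 by (intro frac_le mult_left_mono) auto
      then have "2 * (real (M n) / real n) < 1" using parts \<Gamma>half by simp
      then have "2 * real (M n) < real n" using n1 by (simp add: field_simps)
      then have Mn: "2 * M n \<le> n" by linarith
      have "\<bar>real n * ?mse n - obj (pop (M n))\<bar> \<le> A ^ M n * D * sqrt (\<Gamma> n (M n) (h n) (T n))"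
        by (rule bound[OF M1 Mn h0 h1 T1]) (use elim \<Gamma>half \<Gamma>0 in auto)
      also have "\<dots> = D * sqrt (G n)"
      proof -
        have "sqrt (A ^ (2 * M n)) = A ^ M n" unfolding power_even_eq by (rule real_sqrt_unique[OF refl]) (use A1 in simp)
        then show ?thesis unfolding G_def real_sqrt_mult by simp
      qed
      finally show ?case using gap[of "M n"] gap0[of "M n"] by simp
    qed
    moreover have "(\<lambda>n. D * sqrt (G n) + variance a * exp (- real (M n) / \<kappa>)) \<longlonglongrightarrow> D * sqrt 0 + variance a * 0"
    proof (intro tendsto_intros G)
      have "filterlim (\<lambda>n. real (M n)) at_top sequentially"
        by (rule filterlim_compose[OF filterlim_real_sequentially Mlim])
      then have "filterlim (\<lambda>n. 1 / \<kappa> * real (M n)) at_top sequentially"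
        using \<kappa>1 by (intro filterlim_tendsto_pos_mult_at_top[OF tendsto_const]) auto
      from filterlim_compose[OF filterlim_uminus_at_bot_at_top this]
      have "filterlim (\<lambda>n. - real (M n) / \<kappa>) at_bot sequentially" by simp
      then show "(\<lambda>n. exp (- real (M n) / \<kappa>)) \<longlonglongrightarrow> 0" by (rule filterlim_compose[OF exp_at_bot])
    qed
    ultimately have lim0: "(\<lambda>n. real n * ?mse n - obj \<alpha>s) \<longlonglongrightarrow> 0"
      unfolding real_sqrt_zero mult_zero_right add_0_right by (rule Lim_null_comparison)
    show "(\<lambda>n. ?mse n - obj \<alpha>s / real n) \<in> o(\<lambda>n. 1 / real n)"
    proof (rule smalloI_tendsto)
      show "\<forall>\<^sub>F n in sequentially. 1 / real n \<noteq> 0" using eventually_gt_at_top[of "0::nat"] by eventually_elim simp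
      show "(\<lambda>n. (?mse n - obj \<alpha>s / real n) / (1 / real n)) \<longlonglongrightarrow> 0"
      proof (rule Lim_transform_eventually[OF lim0])
        show "\<forall>\<^sub>F n in sequentially. real n * ?mse n - obj \<alpha>s = (?mse n - obj \<alpha>s / real n) / (1 / real n)"
          using eventually_gt_at_top[of "0::nat"] by eventually_elim (simp add: divide_simps mult.commute)
      qed
    qed
  qed
qed

end
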